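(* Let $k$ be a field of characteristic zero, $R = k[x_1,\ldots,x_n]$ with its standard grading, and $\mathscr{D} = \mathscr{D}(R,k)$ the ring of $k$-linear differential operators on $R$. Let $E = H^n_{(x_1,\ldots,x_n)}(R)$. Let $M$ be a finitely generated graded left $\mathscr{D}$-module. For all $i$ such that $H^{n-i}_{dR}(M)$ is a finite-dimensional $k$-space, $$H^{n-i}_{dR}(M)^{\vee}\cong \mathrm{Ext}^i_{\mathscr{D}}(M,E)$$ as $k$-spaces, where ${}^\vee$ denotes the $k$-space dual.
   Context: $\mathscr{D} = R\langle\partial_1,\ldots,\partial_n\rangle$ with $\partial_i = \partial/\partial x_i$; $\mathscr{D}$-modules are left modules. All gradings are $\mathbb{Z}$-gradings, with $\deg x_i = 1$ and $\deg c=0$ for $c\in k$. A graded $\mathscr{D}$-module is a left $\mathscr{D}$-module $M$ whose underlying $R$-module is graded, $M=\bigoplus_{l\in\mathbb{Z}}M_l$, with $\partial_i(M_l)\subseteq M_{l-1}$ for all $l$ and all $1\le i\le n$. "Finitely generated" means finitely generated over $\mathscr{D}$. $E$ has $k$-basis the inverse monomials $x_1^{i_1}\cdots x_n^{i_n}$ with all $i_j\le -1$. Multiplication by $x_j$ raises the exponent $i_j$ by one (giving $0$ if the exponent becomes $0$), and $\partial_j$ acts by formal differentiation. $\mathrm{Ext}^i_{\mathscr{D}}$ is the usual (ungraded) Ext over the ring $\mathscr{D}$. The de Rham complex $M\otimes\Omega_R^\bullet$ of a $\mathscr{D}$-module $M$ has $M\otimes\Omega_R^i=\bigoplus_{1\le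 j_1<\cdots<j_i\le n} M\,dx_{j_1}\wedge\cdots\wedge dx_{j_i}$ for $0\le i\le n$, with $k$-linear differential $d^i(m\,dx_{j_1}\wedge\cdots\wedge dx_{j_i})=\sum_{s=1}^n\partial_s(m)\,dx_s\wedge dx_{j_1}\wedge\cdots\wedge dx_{j_i}$; $H^i_{dR}(M)$ is its $i$-th cohomology (zero for indices outside $0,\ldots,n$). *)

theory Defs
  imports
    "HOL-Algebra.Algebraic_Closure_Type"
    "HOL-Algebra.Generated_Rings"
    "HOL-Library.Poly_Mapping"
    "HOL-Library.FuncSet"
begin

section \<open>Left modules over a not necessarily commutative ring\<close>

text \<open>
  The locale \<^verbatim>\<open>module\<close> of HOL-Algebra requires a commutative ring of scalars, so the same axioms
  are stated here over an arbitrary ring. The record type is reused; its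
  multiplication and unit fields play no role for modules.
\<close>

locale left_module = R?: ring R + M?: abelian_group M
  for R :: "('r, 'y) ring_scheme" (structure) and M :: "('r, 'm, 'x) module_scheme" (structure) +
  assumes smult_closed [simp, intro]:
      "\<lbrakk> a \<in> carrier R; x \<in> carrier M \<rbrakk> \<Longrightarrow> a \<odot>\<^bsub>M\<^esub> x \<in> carrier M"
    and smult_l_distr:
      "\<lbrakk> a \<in> carrier R; b \<in> carrier R; x \<in> carrier M \<rbrakk> \<Longrightarrow>
        (a \<oplus> b) \<odot>\<^bsub>M\<^esub> x = a \<odot>\<^bsub>M\<^esub> x \<oplus>\<^bsub>M\<^esub> b \<odot>\<^bsub>M\<^esub> x"
    and smult_r_distr:
      "\<lbrakk> a \<in> carrier R; x \<in> carrier M; y \<in> carrier M \<rbrakk> \<Longrightarrow>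
        a \<odot>\<^bsub>M\<^esub> (x \<oplus>\<^bsub>M\<^esub> y) = a \<odot>\<^bsub>M\<^esub> x \<oplus>\<^bsub>M\<^esub> a \<odot>\<^bsub>M\<^esub> y"
    and smult_assoc1:
      "\<lbrakk> a \<in> carrier R; b \<in> carrier R; x \<in> carrier M \<rbrakk> \<Longrightarrow>
        (a \<otimes> b) \<odot>\<^bsub>M\<^esub> x = a \<odot>\<^bsub>M\<^esub> (b \<odot>\<^bsub>M\<^esub> x)"
    and smult_one [simp]: "x \<in> carrier M \<Longrightarrow> \<one> \<odot>\<^bsub>M\<^esub> x = x"

definition fin_gen :: "('r, 'y) ring_scheme \<Rightarrow> ('r, 'm) module \<Rightarrow> bool" where
  "fin_gen R M \<longleftrightarrow> (\<exists>S. finite S \<and> S \<subseteq> carrier M \<and>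
     (\<forall>m \<in> carrier M. \<exists>c \<in> S \<rightarrow> carrier R. m = (\<Oplus>\<^bsub>M\<^esub>s\<in>S. c s \<odot>\<^bsub>M\<^esub> s)))"

definition lin_hom ::
  "('r, 'y) ring_scheme \<Rightarrow> ('r, 'm) module \<Rightarrow> ('r, 'n) module \<Rightarrow> ('m \<Rightarrow> 'n) set" where
  "lin_hom R M N = {f \<in> carrier M \<rightarrow>\<^sub>E carrier N.
     (\<forall>x \<in> carrier M. \<forall>y \<in> carrier M. f (x \<oplus>\<^bsub>M\<^esub> y) = f x \<oplus>\<^bsub>N\<^esub> f y) \<and>
     (\<forall>r \<in> carrier R. \<forall>x \<in> carrier M. f (r \<odot>\<^bsub>M\<^esub> x) = r \<odot>\<^bsub>N\<^esub> f x)}"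

definition quot_module :: "('r, 'm) module \<Rightarrow> 'm set \<Rightarrow> ('r, 'm set) module" where
  "quot_module M B = \<lparr> carrier = a_rcosets\<^bsub>M\<^esub> B, monoid.mult = \<lambda>_ _. undefined, one = undefined,
     zero = B, add = set_add M, module.smult = \<lambda>r C. (\<Union>x \<in> C. B +>\<^bsub>M\<^esub> (r \<odot>\<^bsub>M\<^esub> x)) \<rparr>"

text \<open>
  For an algebra \<open>A\<close> over the field \<open>'k\<close> with (central) structure map \<open>s :: 'k \<Rightarrow> 'a\<close>, the
  \<open>'k\<close>-space of \<open>A\<close>-linear maps from \<open>M\<close> to \<open>N\<close>.
\<close>

definition hom_space ::
  "('a, 'y) ring_scheme \<Rightarrow> ('k \<Rightarrow> 'a) \<Rightarrow> ('a, 'm) module \<Rightarrow> ('a, 'n) module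
    \<Rightarrow> ('k, 'm \<Rightarrow> 'n) module" where
  "hom_space A s M N = \<lparr> carrier = lin_hom A M N, monoid.mult = \<lambda>_ _. undefined, one = undefined,
     zero = (\<lambda>x \<in> carrier M. \<zero>\<^bsub>N\<^esub>),
     add = \<lambda>f g. (\<lambda>x \<in> carrier M. f x \<oplus>\<^bsub>N\<^esub> g x),
     module.smult = \<lambda>c f. (\<lambda>x \<in> carrier M. s c \<odot>\<^bsub>N\<^esub> f x) \<rparr>"


section \<open>Vector spaces over a field type\<close>

abbreviation base_field :: "'k::field ring" where
  "base_field \<equiv> ring_of_type_algebra"

definition base_field_space :: "('k::field, 'k) module" where
  "base_field_space = \<lparr> carrier = UNIV, monoid.mult = (*), one = 1, zero = 0, add = (+), module.smult = (*) \<rparr>"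

definition dual_space :: "('k::field, 'v) module \<Rightarrow> ('k, 'v \<Rightarrow> 'k) module" where
  "dual_space V = hom_space base_field id V base_field_space"

definition finite_dimensional :: "('k::field, 'v) module \<Rightarrow> bool" where
  "finite_dimensional V \<longleftrightarrow> fin_gen base_field V"

definition space_iso :: "('k::field, 'v) module \<Rightarrow> ('k, 'w) module \<Rightarrow> bool" where
  "space_iso V W \<longleftrightarrow> (\<exists>f \<in> lin_hom base_field V W. bij_betw f (carrier V) (carrier W))"


section \<open>Projective resolutions and Ext\<close>

text \<open>
  Projectivity is the lifting property. HOL cannot quantify over types inside a
  definition; the test modules \<open>A\<close> range over the type \<^typ>\<open>'p \<Rightarrow> 'a\<close>, which contains the free
  module on the carrier of \<open>P\<close> (finitely supported functions), and \<open>B\<close> over the type of \<open>P\<close>.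
  Lifting the identity of \<open>P\<close> along the canonical surjection from that free module makes \<open>P\<close> a
  direct summand of it, so the lifting property for test modules of all types follows.
\<close>

definition projective_module :: "('a, 'y) ring_scheme \<Rightarrow> ('a, 'p) module \<Rightarrow> bool" where
  "projective_module R P \<longleftrightarrow> left_module R P \<and>
     (\<forall>(A :: ('a, 'p \<Rightarrow> 'a) module) (B :: ('a, 'p) module) g f.
        left_module R A \<longrightarrow> left_module R B \<longrightarrow>
        g \<in> lin_hom R A B \<longrightarrow> g ` carrier A = carrier B \<longrightarrow> f \<in> lin_hom R P B \<longrightarrow>
        (\<exists>h \<in> lin_hom R P A. \<forall>x \<in> carrier P. g (h x) = f x))"

definition projective_resolution ::
  "('a, 'y) ring_scheme \<Rightarrow> (nat \<Rightarrow> ('a, 'p) module) \<Rightarrow> (nat \<Rightarrow> 'p \<Rightarrow> 'p) \<Rightarrow> ('p \<Rightarrow> 'm)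
    \<Rightarrow> ('a, 'm) module \<Rightarrow> bool" where
  "projective_resolution R P \<delta> \<epsilon> M \<longleftrightarrow>
     (\<forall>i. projective_module R (P i)) \<and>
     (\<forall>i. \<delta> i \<in> lin_hom R (P (Suc i)) (P i)) \<and>
     \<epsilon> \<in> lin_hom R (P 0) M \<and>
     \<epsilon> ` carrier (P 0) = carrier M \<and>
     \<delta> 0 ` carrier (P 1) = {x \<in> carrier (P 0). \<epsilon> x = \<zero>\<^bsub>M\<^esub>} \<and>
     (\<forall>i. \<delta> (Suc i) ` carrier (P (Suc (Suc i))) =
          {x \<in> carrier (P (Suc i)). \<delta> i x = \<zero>\<^bsub>P i\<^esub>})"

text \<open>
  The \<open>i\<close>-th cohomology of the complex of \<open>A\<close>-linear maps \<open>P\<^sub>i \<rightarrow> N\<close>; when \<open>P\<close> (with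
  differential \<open>\<delta>\<close>) is a projective resolution of \<open>M\<close> this is the \<open>i\<close>-th Ext of \<open>M\<close> and \<open>N\<close>
  over \<open>A\<close>, as a \<open>'k\<close>-space.
\<close>

definition ext_cocycles where
  "ext_cocycles A P \<delta> N i =
     {f \<in> lin_hom A (P i) N. \<forall>x \<in> carrier (P (Suc i)). f (\<delta> i x) = \<zero>\<^bsub>N\<^esub>}"

definition ext_coboundaries where
  "ext_coboundaries A P \<delta> N i =
     (case i of 0 \<Rightarrow> {\<lambda>x \<in> carrier (P 0). \<zero>\<^bsub>N\<^esub>}
      | Suc j \<Rightarrow> (\<lambda>f. compose (carrier (P (Suc j))) f (\<delta> j)) ` lin_hom A (P j) N)"

definition ext_space ::
  "('a, 'y) ring_scheme \<Rightarrow> ('k \<Rightarrow> 'a) \<Rightarrow> (nat \<Rightarrow> ('a, 'p) module) \<Rightarrow> (nat \<Rightarrow> 'p \<Rightarrow> 'p)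
    \<Rightarrow> ('a, 'e) module \<Rightarrow> nat \<Rightarrow> ('k, ('p \<Rightarrow> 'e) set) module" where
  "ext_space A s P \<delta> N i =
     quot_module ((hom_space A s (P i) N)\<lparr>carrier := ext_cocycles A P \<delta> N i\<rparr>)
       (ext_coboundaries A P \<delta> N i)"


section \<open>Polynomials and differential operators\<close>

text \<open>
  A monomial is a finitely supported exponent vector \<^typ>\<open>nat \<Rightarrow>\<^sub>0 nat\<close>; the multiplication on
  \<^typ>\<open>(nat \<Rightarrow>\<^sub>0 nat) \<Rightarrow>\<^sub>0 'k\<close> is the convolution product. The ring \<open>k[x\<^sub>1, \<dots>, x\<^sub>n]\<close> is cut out
  by allowing only the variables with index in \<open>{1..n}\<close>.
\<close>

type_synonym 'k mpoly = "(nat \<Rightarrow>\<^sub>0 nat) \<Rightarrow>\<^sub>0 'k"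
type_synonym 'k diff_op = "'k mpoly \<Rightarrow> 'k mpoly"

definition polys :: "nat \<Rightarrow> 'k::field_char_0 mpoly set" where
  "polys n = {f. \<forall>m \<in> Poly_Mapping.keys f. Poly_Mapping.keys m \<subseteq> {1..n}}"

definition homog_polys :: "nat \<Rightarrow> nat \<Rightarrow> 'k::field_char_0 mpoly set" where
  "homog_polys n d =
     {f \<in> polys n. \<forall>m \<in> Poly_Mapping.keys f. (\<Sum>j = 1..n. Poly_Mapping.lookup m j) = d}"

definition const_poly :: "'k::field_char_0 \<Rightarrow> 'k mpoly" where
  "const_poly c = Poly_Mapping.single 0 c"

definition var_poly :: "nat \<Rightarrow> 'k::field_char_0 mpoly" where
  "var_poly j = Poly_Mapping.single (Poly_Mapping.single j 1) 1"

definition partial_deriv :: "nat \<Rightarrow> 'k::field_char_0 mpoly \<Rightarrow> 'k mpoly" where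
  "partial_deriv j f = (\<Sum>m \<in> Poly_Mapping.keys f.
     Poly_Mapping.single (m - Poly_Mapping.single j 1)
       (of_nat (Poly_Mapping.lookup m j) * Poly_Mapping.lookup f m))"

definition endo_ring :: "nat \<Rightarrow> 'k::field_char_0 diff_op ring" where
  "endo_ring n = \<lparr>
     carrier = {d \<in> polys n \<rightarrow>\<^sub>E polys n.
       (\<forall>f \<in> polys n. \<forall>g \<in> polys n. d (f + g) = d f + d g) \<and>
       (\<forall>c. \<forall>f \<in> polys n. d (const_poly c * f) = const_poly c * d f)},
     monoid.mult = compose (polys n), one = (\<lambda>f \<in> polys n. f),
     zero = (\<lambda>f \<in> polys n. 0), add = \<lambda>d e. (\<lambda>f \<in> polys n. d f + e f) \<rparr>"

definition mult_op :: "nat \<Rightarrow> 'k::field_char_0 mpoly \<Rightarrow> 'k diff_op" where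
  "mult_op n f = (\<lambda>g \<in> polys n. f * g)"

definition partial_op :: "nat \<Rightarrow> nat \<Rightarrow> 'k::field_char_0 diff_op" where
  "partial_op n j = (\<lambda>g \<in> polys n. partial_deriv j g)"

definition diff_op_ring :: "nat \<Rightarrow> 'k::field_char_0 diff_op ring" where
  "diff_op_ring n = (endo_ring n)\<lparr>carrier :=
     generate_ring (endo_ring n) (mult_op n ` polys n \<union> partial_op n ` {1..n})\<rparr>"

definition scalar_op :: "nat \<Rightarrow> 'k::field_char_0 \<Rightarrow> 'k diff_op" where
  "scalar_op n c = mult_op n (const_poly c)"


subsection \<open>The differential operators form a ring\<close>

lemma lookup_partial_deriv:
  "Poly_Mapping.lookup (partial_deriv j f) m =
     of_nat (Poly_Mapping.lookup m j + 1) * Poly_Mapping.lookup f (m + Poly_Mapping.single j 1)"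
proof -
  let ?e = "Poly_Mapping.single j (1::nat)"
  have "Poly_Mapping.lookup (partial_deriv j f) m =
      (\<Sum>p \<in> Poly_Mapping.keys f. if p = m + ?e
         then of_nat (Poly_Mapping.lookup m j + 1) * Poly_Mapping.lookup f (m + ?e) else 0)"
    unfolding partial_deriv_def lookup_sum
  proof (rule sum.cong[OF refl])
    fix p assume p: "p \<in> Poly_Mapping.keys f"
    show "Poly_Mapping.lookup (Poly_Mapping.single (p - ?e)
       (of_nat (Poly_Mapping.lookup p j) * Poly_Mapping.lookup f p)) m =
       (if p = m + ?e
         then of_nat (Poly_Mapping.lookup m j + 1) * Poly_Mapping.lookup f (m + ?e) else 0)"
    proof (cases "p = m + ?e")
      case True
      then show ?thesis by (simp add: lookup_single lookup_add)
    next
      case False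
      have "Poly_Mapping.lookup p j = 0" if "p - ?e = m"
      proof (rule ccontr)
        assume "Poly_Mapping.lookup p j \<noteq> 0"
        then have "p = m + ?e"
          by (intro poly_mapping_eqI)
             (auto simp: that[symmetric] lookup_minus lookup_add lookup_single when_def)
        then show False using False by simp
      qed
      then show ?thesis using False by (auto simp: lookup_single when_def)
    qed
  qed
  also have "\<dots> = of_nat (Poly_Mapping.lookup m j + 1) * Poly_Mapping.lookup f (m + ?e)"
    by (auto simp: not_in_keys_iff_lookup_eq_zero)
  finally show ?thesis .
qed

lemma polys_iff_lookup:
  "f \<in> polys n \<longleftrightarrow> (\<forall>m. \<not> Poly_Mapping.keys m \<subseteq> {1..n} \<longrightarrow> Poly_Mapping.lookup f m = 0)"
  unfolding polys_def by (auto simp: in_keys_iff)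

lemma zero_in_polys [simp]: "0 \<in> polys n"
  by (simp add: polys_def)

lemma add_in_polys [simp]: "f \<in> polys n \<Longrightarrow> g \<in> polys n \<Longrightarrow> f + g \<in> polys n"
  by (simp add: polys_iff_lookup lookup_add)

lemma uminus_in_polys [simp]: "f \<in> polys n \<Longrightarrow> - f \<in> polys n"
  by (simp add: polys_iff_lookup)

lemma mult_in_polys [simp]: "f \<in> polys n \<Longrightarrow> g \<in> polys n \<Longrightarrow> f * g \<in> polys n"
proof -
  assume a: "f \<in> polys n" "g \<in> polys n"
  have "Poly_Mapping.keys m \<subseteq> {1..n}" if "m \<in> Poly_Mapping.keys (f * g)" for m
  proof -
    have "m \<in> {p + q |p q. p \<in> Poly_Mapping.keys f \<and> q \<in> Poly_Mapping.keys g}"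
      using keys_mult[of f g] that by (rule subsetD)
    then obtain p q where "m = p + q" "p \<in> Poly_Mapping.keys f" "q \<in> Poly_Mapping.keys g"
      by blast
    then show ?thesis using a keys_add[of p q] unfolding polys_def by blast
  qed
  then show ?thesis by (simp add: polys_def)
qed

lemma const_in_polys [simp]: "const_poly c \<in> polys n"
  by (auto simp: polys_def const_poly_def)

lemma var_in_polys [simp]: "j \<in> {1..n} \<Longrightarrow> var_poly j \<in> polys n"
  by (auto simp: polys_def var_poly_def)

lemma partial_deriv_in_polys [simp]: "f \<in> polys n \<Longrightarrow> partial_deriv j f \<in> polys n"
  unfolding polys_iff_lookup
proof (intro allI impI)
  fix m :: "nat \<Rightarrow>\<^sub>0 nat"
  assume f: "\<forall>m. \<not> Poly_Mapping.keys m \<subseteq> {1..n} \<longrightarrow> Poly_Mapping.lookup f m = 0"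
    and m: "\<not> Poly_Mapping.keys m \<subseteq> {1..n}"
  have "Poly_Mapping.keys m \<subseteq> Poly_Mapping.keys (m + Poly_Mapping.single j 1)"
    by (auto simp: in_keys_iff lookup_add)
  then have "\<not> Poly_Mapping.keys (m + Poly_Mapping.single j 1) \<subseteq> {1..n}"
    using m by blast
  then show "Poly_Mapping.lookup (partial_deriv j f) m = 0"
    using f by (simp add: lookup_partial_deriv)
qed

lemma lookup_const_mult:
  fixes f :: "'a::monoid_add \<Rightarrow>\<^sub>0 'k::semiring_1"
  shows "Poly_Mapping.lookup (Poly_Mapping.single 0 c * f) m = c * Poly_Mapping.lookup f m"
  by (simp add: mult_map_scale_conv_mult[symmetric] map.rep_eq when_def)

lemma partial_deriv_add: "partial_deriv j (f + g) = partial_deriv j f + partial_deriv j g"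
  by (rule poly_mapping_eqI) (simp add: lookup_partial_deriv lookup_add algebra_simps)

lemma partial_deriv_const_mult: "partial_deriv j (const_poly c * f) = const_poly c * partial_deriv j f"
  by (rule poly_mapping_eqI) (simp add: lookup_partial_deriv const_poly_def lookup_const_mult mult.left_commute)

lemma mult_op_in_endo: "f \<in> polys n \<Longrightarrow> mult_op n f \<in> carrier (endo_ring n)"
  by (auto simp: mult_op_def endo_ring_def distrib_left mult.left_commute)

lemma partial_op_in_endo: "partial_op n j \<in> carrier (endo_ring n)"
  by (auto simp: partial_op_def endo_ring_def partial_deriv_add partial_deriv_const_mult)

lemma ring_endo_ring: "ring (endo_ring n :: 'k::field_char_0 diff_op ring)"
proof -
  let ?A = "endo_ring n :: 'k diff_op ring"
  let ?C = "carrier ?A"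
  have in_polys: "d f \<in> polys n" if "d \<in> ?C" "f \<in> polys n" for d f
    using that by (auto simp: endo_ring_def)
  have ext: "d = e" if "d \<in> ?C" "e \<in> ?C" "\<And>f. f \<in> polys n \<Longrightarrow> d f = e f" for d e
    using that by (intro extensionalityI[of _ "polys n"]) (auto simp: endo_ring_def PiE_def)
  have add: "d (f + g) = d f + d g" if "d \<in> ?C" "f \<in> polys n" "g \<in> polys n" for d f g
    using that by (auto simp: endo_ring_def)
  have add_app: "(d \<oplus>\<^bsub>?A\<^esub> e) f = d f + e f" if "f \<in> polys n" for d e f
    using that by (simp add: endo_ring_def)
  have mult_app: "(d \<otimes>\<^bsub>?A\<^esub> e) f = d (e f)" if "f \<in> polys n" for d e f
    using that by (simp add: endo_ring_def compose_def)
  have zero_app: "\<zero>\<^bsub>?A\<^esub> f = 0" "\<one>\<^bsub>?A\<^esub> f = f" if "f \<in> polys n" for f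
    using that by (simp_all add: endo_ring_def)
  have add_cl: "d \<oplus>\<^bsub>?A\<^esub> e \<in> ?C" if "d \<in> ?C" "e \<in> ?C" for d e
    using that by (auto simp: endo_ring_def distrib_left PiE_iff add.assoc add.left_commute)
  have mult_cl: "d \<otimes>\<^bsub>?A\<^esub> e \<in> ?C" if "d \<in> ?C" "e \<in> ?C" for d e
    using that by (auto simp: endo_ring_def compose_def PiE_iff Pi_iff)
  have zero_cl: "\<zero>\<^bsub>?A\<^esub> \<in> ?C" "\<one>\<^bsub>?A\<^esub> \<in> ?C"
    by (auto simp: endo_ring_def)
  show ?thesis
  proof (intro ringI abelian_groupI monoidI)
    fix d assume d: "d \<in> ?C"
    let ?m = "\<lambda>f \<in> polys n. - d f"
    have m: "?m \<in> ?C" using d by (auto simp: endo_ring_def PiE_iff)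
    have "?m \<oplus>\<^bsub>?A\<^esub> d = \<zero>\<^bsub>?A\<^esub>"
      by (rule ext) (use d m in \<open>auto simp: add_cl zero_cl add_app zero_app\<close>)
    then show "\<exists>y \<in> ?C. y \<oplus>\<^bsub>?A\<^esub> d = \<zero>\<^bsub>?A\<^esub>" using m by blast
  qed (auto intro!: ext simp: add_cl mult_cl zero_cl add_app mult_app zero_app in_polys add algebra_simps)
qed

lemma diff_op_gens_in_endo:
  "mult_op n ` polys n \<union> partial_op n ` {1..n} \<subseteq> carrier (endo_ring n)"
  using mult_op_in_endo partial_op_in_endo by blast

lemma ring_diff_op_ring: "ring (diff_op_ring n)"
  unfolding diff_op_ring_def
  by (rule ring.generate_ring_is_ring[OF ring_endo_ring diff_op_gens_in_endo])


section \<open>Graded modules over the ring of differential operators\<close>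

definition graded_diff_module ::
  "nat \<Rightarrow> ('k::field_char_0 diff_op, 'm) module \<Rightarrow> (int \<Rightarrow> 'm set) \<Rightarrow> bool" where
  "graded_diff_module n M G \<longleftrightarrow> left_module (diff_op_ring n) M \<and>
     (\<forall>l. additive_subgroup (G l) M) \<and>
     (\<forall>m \<in> carrier M. \<exists>!c. (\<forall>l. c l \<in> G l) \<and> finite {l. c l \<noteq> \<zero>\<^bsub>M\<^esub>} \<and>
        m = (\<Oplus>\<^bsub>M\<^esub>l\<in>{l. c l \<noteq> \<zero>\<^bsub>M\<^esub>}. c l)) \<and>
     (\<forall>d l. \<forall>f \<in> homog_polys n d. \<forall>m \<in> G l. mult_op n f \<odot>\<^bsub>M\<^esub> m \<in> G (l + int d)) \<and>
     (\<forall>l. \<forall>j \<in> {1..n}. \<forall>m \<in> G l. partial_op n j \<odot>\<^bsub>M\<^esub> m \<in> G (l - 1))"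


section \<open>De Rham cohomology\<close>

text \<open>
  A form is the family of its coefficients: \<open>w J\<close> is the coefficient of
  \<open>dx\<^bsub>j1\<^esub> \<and> \<dots> \<and> dx\<^bsub>ji\<^esub>\<close>, where \<open>j1 < \<dots> < ji\<close> are the elements of \<open>J\<close>. For \<open>i\<close> outside
  \<open>{0..n}\<close> there are no index sets, and the space of forms is zero.
\<close>

definition form_indices :: "nat \<Rightarrow> int \<Rightarrow> nat set set" where
  "form_indices n i = {J. J \<subseteq> {1..n} \<and> int (card J) = i}"

definition de_rham_forms ::
  "nat \<Rightarrow> ('k::field_char_0 diff_op, 'm) module \<Rightarrow> int \<Rightarrow> ('k, nat set \<Rightarrow> 'm) module" where
  "de_rham_forms n M i = \<lparr> carrier = form_indices n i \<rightarrow>\<^sub>E carrier M,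
     monoid.mult = \<lambda>_ _. undefined, one = undefined,
     zero = (\<lambda>J \<in> form_indices n i. \<zero>\<^bsub>M\<^esub>),
     add = \<lambda>w v. (\<lambda>J \<in> form_indices n i. w J \<oplus>\<^bsub>M\<^esub> v J),
     module.smult = \<lambda>c w. (\<lambda>J \<in> form_indices n i. scalar_op n c \<odot>\<^bsub>M\<^esub> w J) \<rparr>"

text \<open>
  The coefficient of the differential at \<open>K\<close> collects the terms \<open>dx\<^sub>s \<and> dx\<^sub>J\<close> with
  \<open>K = insert s J\<close>; sorting \<open>dx\<^sub>s\<close> into place contributes one sign for each \<open>j \<in> J\<close> with \<open>j < s\<close>.
\<close>

definition de_rham_diff ::
  "nat \<Rightarrow> ('k::field_char_0 diff_op, 'm) module \<Rightarrow> int \<Rightarrow> (nat set \<Rightarrow> 'm) \<Rightarrow> (nat set \<Rightarrow> 'm)" where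
  "de_rham_diff n M i w = (\<lambda>K \<in> form_indices n (i + 1).
     \<Oplus>\<^bsub>M\<^esub>s\<in>K. scalar_op n ((- 1) ^ card {j \<in> K. j < s}) \<odot>\<^bsub>M\<^esub> (partial_op n s \<odot>\<^bsub>M\<^esub> w (K - {s})))"

definition de_rham_cohomology ::
  "nat \<Rightarrow> ('k::field_char_0 diff_op, 'm) module \<Rightarrow> int \<Rightarrow> ('k, (nat set \<Rightarrow> 'm) set) module" where
  "de_rham_cohomology n M i =
     quot_module ((de_rham_forms n M i)\<lparr>carrier :=
         {w \<in> carrier (de_rham_forms n M i).
            de_rham_diff n M i w = \<zero>\<^bsub>de_rham_forms n M (i + 1)\<^esub>}\<rparr>)
       (de_rham_diff n M (i - 1) ` carrier (de_rham_forms n M (i - 1)))"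


section \<open>The module of inverse polynomials\<close>

text \<open>
  The top local cohomology of the polynomial ring at the homogeneous maximal ideal, through its
  basis of inverse monomials.
\<close>

type_synonym 'k laurent = "(nat \<Rightarrow>\<^sub>0 int) \<Rightarrow>\<^sub>0 'k"

definition inverse_exponents :: "nat \<Rightarrow> (nat \<Rightarrow>\<^sub>0 int) set" where
  "inverse_exponents n =
     {a. Poly_Mapping.keys a \<subseteq> {1..n} \<and> (\<forall>j \<in> {1..n}. Poly_Mapping.lookup a j \<le> - 1)}"

definition is_inverse_poly_module ::
  "nat \<Rightarrow> ('k::field_char_0 diff_op, 'k laurent) module \<Rightarrow> bool" where
  "is_inverse_poly_module n E \<longleftrightarrow> left_module (diff_op_ring n) E \<and>
     carrier E = {e. Poly_Mapping.keys e \<subseteq> inverse_exponents n} \<and>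
     \<zero>\<^bsub>E\<^esub> = 0 \<and> (\<forall>e e'. e \<oplus>\<^bsub>E\<^esub> e' = e + e') \<and>
     (\<forall>a \<in> inverse_exponents n. \<forall>b.
        (\<forall>c. scalar_op n c \<odot>\<^bsub>E\<^esub> Poly_Mapping.single a b = Poly_Mapping.single a (c * b)) \<and>
        (\<forall>j \<in> {1..n}.
           mult_op n (var_poly j) \<odot>\<^bsub>E\<^esub> Poly_Mapping.single a b =
             (if Poly_Mapping.lookup a j = - 1 then 0
              else Poly_Mapping.single (a + Poly_Mapping.single j 1) b) \<and>
           partial_op n j \<odot>\<^bsub>E\<^esub> Poly_Mapping.single a b =
             Poly_Mapping.single (a - Poly_Mapping.single j 1)
               (of_int (Poly_Mapping.lookup a j) * b)))"

text \<open>
  These conditions determine the action on the carrier, because the ring is generated by the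
  scalars, the variables and the partial derivatives; existence is proved below.
\<close>

definition inverse_poly_module ::
  "nat \<Rightarrow> ('k::field_char_0 diff_op, 'k laurent) module" where
  "inverse_poly_module n = (SOME E. is_inverse_poly_module n E)"


subsection \<open>Existence of the module of inverse polynomials\<close>

text \<open>
  Every differential operator extends to Laurent polynomials, uniquely because the coefficients of
  the values on monomials depend polynomially on the exponents. Laurent monomials that are not
  inverse monomials span a stable subspace, and the action is the one on the quotient.
\<close>

lemma poly_mapping_sum_singles:
  "(\<Sum>a \<in> Poly_Mapping.keys f. Poly_Mapping.single a (Poly_Mapping.lookup f a)) = f"
  by (rule poly_mapping_eqI)
     (auto simp: lookup_sum lookup_single when_def not_in_keys_iff_lookup_eq_zero)

lemma additive_eqI:
  fixes F G :: "('a \<Rightarrow>\<^sub>0 'b::ab_group_add) \<Rightarrow> 'c::ab_group_add"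
  assumes "\<And>f g. F (f + g) = F f + F g" "\<And>f g. G (f + g) = G f + G g"
    and "\<And>a. a \<in> Poly_Mapping.keys f \<Longrightarrow>
      F (Poly_Mapping.single a (Poly_Mapping.lookup f a)) = G (Poly_Mapping.single a (Poly_Mapping.lookup f a))"
  shows "F f = G f"
proof -
  have sum: "H (\<Sum>a \<in> A. h a) = (\<Sum>a \<in> A. H (h a))"
    if "\<And>f g. H (f + g) = H f + H g" "finite A"
    for H :: "('a \<Rightarrow>\<^sub>0 'b) \<Rightarrow> 'c" and h and A :: "'a set"
  proof -
    have "H 0 = 0" using that(1)[of 0 0] by simp
    with that(2) show ?thesis by (induction A) (simp_all add: that(1))
  qed
  let ?s = "\<Sum>a \<in> Poly_Mapping.keys f. Poly_Mapping.single a (Poly_Mapping.lookup f a)"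
  have "F ?s = G ?s"
    by (simp add: sum[OF assms(1)] sum[OF assms(2)] assms(3))
  then show ?thesis by (simp only: poly_mapping_sum_singles)
qed

lemma lookup_single_mult:
  fixes g :: "'a::ab_group_add \<Rightarrow>\<^sub>0 'k::semiring_1"
  shows "Poly_Mapping.lookup (Poly_Mapping.single a c * g) b = c * Poly_Mapping.lookup g (b - a)"
proof -
  have "(\<Sum>q. Poly_Mapping.lookup g q when b = l + q) = Poly_Mapping.lookup g (b - l)" for l
  proof -
    have "(Poly_Mapping.lookup g q when b = l + q) = (Poly_Mapping.lookup g q when q = b - l)" for q
      by (auto simp: when_def algebra_simps)
    then show ?thesis by simp
  qed
  then show ?thesis by (simp add: lookup_mult lookup_single when_mult)
qed

definition int_exp :: "(nat \<Rightarrow>\<^sub>0 nat) \<Rightarrow> (nat \<Rightarrow>\<^sub>0 int)" where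
  "int_exp m = Poly_Mapping.map int m"

lemma lookup_int_exp [simp]: "Poly_Mapping.lookup (int_exp m) j = int (Poly_Mapping.lookup m j)"
  by (simp add: int_exp_def map.rep_eq when_def)

lemma int_exp_add: "int_exp (p + q) = int_exp p + int_exp q"
  by (rule poly_mapping_eqI) (simp add: lookup_add)

definition laurent_of_poly :: "'k::field_char_0 mpoly \<Rightarrow> 'k laurent" where
  "laurent_of_poly f =
     (\<Sum>m \<in> Poly_Mapping.keys f. Poly_Mapping.single (int_exp m) (Poly_Mapping.lookup f m))"

lemma sum_keys_superset:
  fixes h :: "'a \<Rightarrow> 'b::zero \<Rightarrow> 'c::comm_monoid_add"
  assumes "\<And>a. h a 0 = 0" "finite A" "Poly_Mapping.keys f \<subseteq> A"
  shows "(\<Sum>a \<in> Poly_Mapping.keys f. h a (Poly_Mapping.lookup f a)) =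
    (\<Sum>a \<in> A. h a (Poly_Mapping.lookup f a))"
  by (rule sum.mono_neutral_left) (use assms in \<open>auto simp: in_keys_iff\<close>)

lemma sum_keys_add:
  fixes h :: "'a \<Rightarrow> 'b::ab_group_add \<Rightarrow> 'c::ab_group_add"
  assumes "\<And>a b c. h a (b + c) = h a b + h a c"
  shows "(\<Sum>a \<in> Poly_Mapping.keys (f + g). h a (Poly_Mapping.lookup (f + g) a)) =
    (\<Sum>a \<in> Poly_Mapping.keys f. h a (Poly_Mapping.lookup f a)) +
    (\<Sum>a \<in> Poly_Mapping.keys g. h a (Poly_Mapping.lookup g a))"
proof -
  let ?A = "Poly_Mapping.keys f \<union> Poly_Mapping.keys g"
  have 0: "h a 0 = 0" for a using assms[of a 0 0] by simp
  have "(\<Sum>a \<in> Poly_Mapping.keys u. h a (Poly_Mapping.lookup u a)) =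
      (\<Sum>a \<in> ?A. h a (Poly_Mapping.lookup u a))" if "Poly_Mapping.keys u \<subseteq> ?A" for u
    using that by (intro sum_keys_superset 0) auto
  note this[of "f + g", OF keys_add] this[of f] this[of g]
  then show ?thesis by (simp only: lookup_add assms sum.distrib) simp
qed

lemma laurent_of_poly_add:
  "laurent_of_poly (f + g) = laurent_of_poly f + laurent_of_poly g"
  unfolding laurent_of_poly_def
  by (rule sum_keys_add[where h = "\<lambda>m. Poly_Mapping.single (int_exp m)"]) (simp add: single_add)

lemma laurent_of_poly_zero [simp]: "laurent_of_poly 0 = 0"
  by (simp add: laurent_of_poly_def)

lemma laurent_of_poly_single [simp]:
  "laurent_of_poly (Poly_Mapping.single m c) = Poly_Mapping.single (int_exp m) c"
  by (cases "c = 0") (simp_all add: laurent_of_poly_def)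

lemma laurent_of_poly_mult:
  "laurent_of_poly (f * g) = laurent_of_poly f * laurent_of_poly g"
proof (rule additive_eqI[of "\<lambda>f. laurent_of_poly (f * g)" "\<lambda>f. laurent_of_poly f * laurent_of_poly g"])
  fix a
  show "laurent_of_poly (Poly_Mapping.single a c * g) =
      laurent_of_poly (Poly_Mapping.single a c) * laurent_of_poly g" for c
    by (rule additive_eqI[of "\<lambda>g. laurent_of_poly (Poly_Mapping.single a c * g)"
          "\<lambda>g. laurent_of_poly (Poly_Mapping.single a c) * laurent_of_poly g"])
       (simp_all add: laurent_of_poly_add distrib_left mult_single int_exp_add)
qed (simp_all add: laurent_of_poly_add distrib_right)

definition laurent_deriv :: "nat \<Rightarrow> 'k::field_char_0 laurent \<Rightarrow> 'k laurent" where
  "laurent_deriv j f = (\<Sum>a \<in> Poly_Mapping.keys f.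
     Poly_Mapping.single (a - Poly_Mapping.single j 1)
       (of_int (Poly_Mapping.lookup a j) * Poly_Mapping.lookup f a))"

lemma laurent_deriv_add: "laurent_deriv j (f + g) = laurent_deriv j f + laurent_deriv j g"
  unfolding laurent_deriv_def
  by (rule sum_keys_add[where h = "\<lambda>a c. Poly_Mapping.single (a - Poly_Mapping.single j 1)
        (of_int (Poly_Mapping.lookup a j) * c)"])
     (simp add: single_add distrib_left)

lemma laurent_deriv_single [simp]:
  "laurent_deriv j (Poly_Mapping.single a c) =
     Poly_Mapping.single (a - Poly_Mapping.single j 1) (of_int (Poly_Mapping.lookup a j) * c)"
  by (cases "c = 0") (simp_all add: laurent_deriv_def)

lemma partial_deriv_single [simp]:
  "partial_deriv j (Poly_Mapping.single a c) =
     Poly_Mapping.single (a - Poly_Mapping.single j 1) (of_nat (Poly_Mapping.lookup a j) * c)"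
  by (cases "c = 0") (simp_all add: partial_deriv_def)

lemma lookup_laurent_deriv:
  "Poly_Mapping.lookup (laurent_deriv j f) b =
     of_int (Poly_Mapping.lookup b j + 1) * Poly_Mapping.lookup f (b + Poly_Mapping.single j 1)"
proof (rule additive_eqI[of "\<lambda>f. Poly_Mapping.lookup (laurent_deriv j f) b"
      "\<lambda>f. of_int (Poly_Mapping.lookup b j + 1) * Poly_Mapping.lookup f (b + Poly_Mapping.single j 1)"])
  fix a
  have "a - Poly_Mapping.single j 1 = b \<longleftrightarrow> a = b + Poly_Mapping.single j 1"
    by (auto simp: algebra_simps)
  then show "Poly_Mapping.lookup (laurent_deriv j (Poly_Mapping.single a c)) b =
      of_int (Poly_Mapping.lookup b j + 1) *
      Poly_Mapping.lookup (Poly_Mapping.single a c) (b + Poly_Mapping.single j 1)" for c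
    by (auto simp: lookup_single when_def lookup_add)
qed (simp_all add: laurent_deriv_add lookup_add algebra_simps)

lemma laurent_of_poly_partial_deriv:
  "laurent_of_poly (partial_deriv j f) = laurent_deriv j (laurent_of_poly f)"
proof (rule additive_eqI[of "\<lambda>f. laurent_of_poly (partial_deriv j f)"
      "\<lambda>f. laurent_deriv j (laurent_of_poly f)"])
  fix m
  have "int_exp (m - Poly_Mapping.single j 1) = int_exp m - Poly_Mapping.single j 1"
    if "Poly_Mapping.lookup m j \<noteq> 0"
    using that by (intro poly_mapping_eqI) (auto simp: lookup_minus lookup_single when_def)
  then show "laurent_of_poly (partial_deriv j (Poly_Mapping.single m c)) =
      laurent_deriv j (laurent_of_poly (Poly_Mapping.single m c))" for c
    by (cases "Poly_Mapping.lookup m j = 0") simp_all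
qed (simp_all add: laurent_of_poly_add partial_deriv_add laurent_deriv_add)

inductive laurent_ext :: "nat \<Rightarrow> 'k::field_char_0 diff_op \<Rightarrow> ('k laurent \<Rightarrow> 'k laurent) \<Rightarrow> bool"
  for n where
    one: "laurent_ext n \<one>\<^bsub>endo_ring n\<^esub> (\<lambda>g. g)"
  | mult: "f \<in> polys n \<Longrightarrow> laurent_ext n (mult_op n f) (\<lambda>g. laurent_of_poly f * g)"
  | partial: "j \<in> {1..n} \<Longrightarrow> laurent_ext n (partial_op n j) (laurent_deriv j)"
  | uminus: "laurent_ext n d \<phi> \<Longrightarrow> laurent_ext n (\<ominus>\<^bsub>endo_ring n\<^esub> d) (\<lambda>g. - \<phi> g)"
  | add: "laurent_ext n d \<phi> \<Longrightarrow> laurent_ext n e \<psi> \<Longrightarrow>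
      laurent_ext n (d \<oplus>\<^bsub>endo_ring n\<^esub> e) (\<lambda>g. \<phi> g + \<psi> g)"
  | comp: "laurent_ext n d \<phi> \<Longrightarrow> laurent_ext n e \<psi> \<Longrightarrow>
      laurent_ext n (d \<otimes>\<^bsub>endo_ring n\<^esub> e) (\<lambda>g. \<phi> (\<psi> g))"

lemma laurent_ext_exists:
  assumes "d \<in> carrier (diff_op_ring n)"
  shows "\<exists>\<phi>. laurent_ext n d \<phi>"
proof -
  have "d \<in> generate_ring (endo_ring n) (mult_op n ` polys n \<union> partial_op n ` {1..n})"
    using assms by (simp add: diff_op_ring_def)
  then show ?thesis
    by induction (blast intro: laurent_ext.intros)+
qed

lemma laurent_ext_endo:
  assumes "laurent_ext n d \<phi>"
  shows "d \<in> carrier (endo_ring n)"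
proof -
  interpret ring "endo_ring n :: 'a diff_op ring" by (rule ring_endo_ring)
  show ?thesis
    using assms by induction (auto simp: mult_op_in_endo partial_op_in_endo)
qed

lemma laurent_ext_linear:
  assumes "laurent_ext n d \<phi>"
  shows "\<phi> (f + g) = \<phi> f + \<phi> g"
    and "\<phi> (Poly_Mapping.single 0 c * f) = Poly_Mapping.single 0 c * \<phi> f"
proof -
  have "(\<forall>f g. \<phi> (f + g) = \<phi> f + \<phi> g) \<and>
      (\<forall>c f. \<phi> (Poly_Mapping.single 0 c * f) = Poly_Mapping.single 0 c * \<phi> f)"
    using assms
  proof induction
    case (partial j)
    have "laurent_deriv j (Poly_Mapping.single 0 c * f) = Poly_Mapping.single 0 c * laurent_deriv j f"
      for c and f :: "'a laurent"
      by (rule poly_mapping_eqI) (simp add: lookup_laurent_deriv lookup_const_mult mult.left_commute)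
    then show ?case by (simp add: laurent_deriv_add)
  qed (simp_all add: distrib_left mult.left_commute)
  then show "\<phi> (f + g) = \<phi> f + \<phi> g"
    "\<phi> (Poly_Mapping.single 0 c * f) = Poly_Mapping.single 0 c * \<phi> f" by blast+
qed

lemma laurent_ext_of_poly:
  assumes "laurent_ext n d \<phi>" "f \<in> polys n"
  shows "\<phi> (laurent_of_poly f) = laurent_of_poly (d f)"
  using assms
proof (induction arbitrary: f)
  case one
  then show ?case by (simp add: endo_ring_def)
next
  case (mult h)
  then show ?case by (simp add: mult_op_def laurent_of_poly_mult)
next
  case (partial j)
  then show ?case by (simp add: partial_op_def laurent_of_poly_partial_deriv)
next
  case (uminus d \<phi>)
  interpret ring "endo_ring n :: 'a diff_op ring" by (rule ring_endo_ring)
  have "d \<in> carrier (endo_ring n)" using uminus laurent_ext_endo by blast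
  then have "(\<ominus>\<^bsub>endo_ring n\<^esub> d \<oplus>\<^bsub>endo_ring n\<^esub> d) f = \<zero>\<^bsub>endo_ring n\<^esub> f"
    by (simp add: l_neg)
  then have "(\<ominus>\<^bsub>endo_ring n\<^esub> d) f + d f = 0"
    using uminus.prems by (simp add: endo_ring_def)
  then have "laurent_of_poly ((\<ominus>\<^bsub>endo_ring n\<^esub> d) f) + laurent_of_poly (d f) = 0"
    by (metis laurent_of_poly_add laurent_of_poly_single single_zero)
  then show ?case using uminus by (simp add: eq_neg_iff_add_eq_0 add.commute neg_eq_iff_add_eq_0)
next
  case (add d \<phi> e \<psi>)
  then show ?case by (simp add: endo_ring_def laurent_of_poly_add)
next
  case (comp d \<phi> e \<psi>)
  have "e f \<in> polys n" using laurent_ext_endo[OF comp(2)] comp.prems by (auto simp: endo_ring_def)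
  with comp show ?case by (simp add: endo_ring_def compose_def)
qed

lemma lookup_laurent_of_poly_mult:
  "Poly_Mapping.lookup (laurent_of_poly f * g) b =
    (\<Sum>m \<in> Poly_Mapping.keys f. Poly_Mapping.lookup f m * Poly_Mapping.lookup g (b - int_exp m))"
  by (simp add: laurent_of_poly_def sum_distrib_right lookup_sum lookup_single_mult)

lemma laurent_ext_stable:
  assumes "laurent_ext n d \<phi>" "\<forall>b \<in> inverse_exponents n. Poly_Mapping.lookup g b = 0"
  shows "\<forall>b \<in> inverse_exponents n. Poly_Mapping.lookup (\<phi> g) b = 0"
  using assms
proof (induction arbitrary: g)
  case (mult f)
  have "b - int_exp m \<in> inverse_exponents n"
    if "b \<in> inverse_exponents n" "m \<in> Poly_Mapping.keys f" for b m
  proof -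
    have m: "Poly_Mapping.keys m \<subseteq> {1..n}" using mult that by (auto simp: polys_def)
    have b: "Poly_Mapping.keys b \<subseteq> {1..n}" "\<And>j. j \<in> {1..n} \<Longrightarrow> Poly_Mapping.lookup b j \<le> - 1"
      using that by (auto simp: inverse_exponents_def)
    have "j \<in> {1..n}" if "j \<in> Poly_Mapping.keys (b - int_exp m)" for j
    proof (rule ccontr)
      assume "j \<notin> {1..n}"
      then have "Poly_Mapping.lookup b j = 0" "Poly_Mapping.lookup m j = 0"
        using m b by (meson in_keys_iff subsetD)+
      then show False using that by (simp add: in_keys_iff lookup_minus)
    qed
    moreover have "Poly_Mapping.lookup (b - int_exp m) j \<le> - 1" if "j \<in> {1..n}" for j
      using b(2)[OF that] by (simp add: lookup_minus)
    ultimately show ?thesis by (auto simp: inverse_exponents_def)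
  qed
  then show ?case
    using mult.prems by (simp add: lookup_laurent_of_poly_mult)
next
  case (partial j)
  show ?case
  proof
    fix b assume b: "b \<in> inverse_exponents n"
    show "Poly_Mapping.lookup (laurent_deriv j g) b = 0"
    proof (cases "Poly_Mapping.lookup b j = - 1")
      case True
      then show ?thesis by (simp add: lookup_laurent_deriv)
    next
      case False
      have b': "Poly_Mapping.keys b \<subseteq> {1..n}" "\<And>j. j \<in> {1..n} \<Longrightarrow> Poly_Mapping.lookup b j \<le> - 1"
        using b by (auto simp: inverse_exponents_def)
      have "Poly_Mapping.keys (b + Poly_Mapping.single j 1) \<subseteq> {1..n}"
        using keys_add[of b "Poly_Mapping.single j 1"] b'(1) partial by auto
      moreover have "Poly_Mapping.lookup (b + Poly_Mapping.single j 1) i \<le> - 1" if "i \<in> {1..n}" for i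
        using b'(2)[OF that] False by (auto simp: lookup_add lookup_single when_def)
      ultimately have "b + Poly_Mapping.single j 1 \<in> inverse_exponents n"
        by (auto simp: inverse_exponents_def)
      then show ?thesis using partial.prems by (simp add: lookup_laurent_deriv)
    qed
  qed
qed (simp_all add: lookup_add)

inductive poly_fun :: "((nat \<Rightarrow>\<^sub>0 int) \<Rightarrow> 'k::field_char_0) \<Rightarrow> bool" where
    const: "poly_fun (\<lambda>_. c)"
  | coord: "poly_fun (\<lambda>a. of_int (Poly_Mapping.lookup a j))"
  | add: "poly_fun p \<Longrightarrow> poly_fun q \<Longrightarrow> poly_fun (\<lambda>a. p a + q a)"
  | mult: "poly_fun p \<Longrightarrow> poly_fun q \<Longrightarrow> poly_fun (\<lambda>a. p a * q a)"

lemma poly_fun_uminus: "poly_fun p \<Longrightarrow> poly_fun (\<lambda>a. - p a)"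
  using poly_fun.mult[OF poly_fun.const[of "- 1"]] by simp

lemma poly_fun_diff: "poly_fun p \<Longrightarrow> poly_fun q \<Longrightarrow> poly_fun (\<lambda>a. p a - q a)"
  using poly_fun.add[OF _ poly_fun_uminus] by simp

lemma poly_fun_sum:
  "finite A \<Longrightarrow> (\<And>x. x \<in> A \<Longrightarrow> poly_fun (p x)) \<Longrightarrow> poly_fun (\<lambda>a. \<Sum>x \<in> A. p x a)"
  by (induction A rule: finite_induct) (simp_all add: poly_fun.const poly_fun.add)

lemma poly_fun_restrict:
  assumes "poly_fun p"
  shows "\<exists>q. \<forall>t. p (Poly_Mapping.update j t a) = Polynomial.poly q (of_int t)"
  using assms
proof induction
  case (const c)
  have "\<forall>t::int. c = Polynomial.poly [:c:] (of_int t)" by simp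
  then show ?case by blast
next
  case (coord i)
  show ?case
  proof (cases "i = j")
    case True
    then have "\<forall>t. of_int (Poly_Mapping.lookup (Poly_Mapping.update j t a) i) =
        Polynomial.poly [:0, 1:] (of_int t :: 'a)"
      by (simp add: lookup_update)
    then show ?thesis by blast
  next
    case False
    then have "\<forall>t. of_int (Poly_Mapping.lookup (Poly_Mapping.update j t a) i) =
        Polynomial.poly [:of_int (Poly_Mapping.lookup a i):] (of_int t :: 'a)"
      by (simp add: lookup_update)
    then show ?thesis by blast
  qed
next
  case (add p q)
  then show ?case by (metis poly_add)
next
  case (mult p q)
  then show ?case by (metis poly_mult)
qed

lemma poly_fun_vanish:
  assumes "poly_fun p" "finite S"
    and "\<And>a. Poly_Mapping.keys a \<subseteq> {1..n} \<Longrightarrow> (\<And>j. 0 \<le> Poly_Mapping.lookup a j) \<Longrightarrow> p a = 0"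
    and "Poly_Mapping.keys a \<subseteq> {1..n}" "\<And>j. j \<notin> S \<Longrightarrow> 0 \<le> Poly_Mapping.lookup a j"
  shows "p a = 0"
  using assms(2,4,5)
proof (induction S arbitrary: a)
  case empty
  then show ?case using assms(3) by blast
next
  case (insert j S)
  show ?case
  proof (cases "j \<in> {1..n}")
    case False
    then have "Poly_Mapping.lookup a j = 0"
      using insert.prems by (meson in_keys_iff subsetD)
    then show ?thesis using insert by (metis insertE order_refl)
  next
    case j: True
    obtain q where q: "\<And>t. p (Poly_Mapping.update j t a) = Polynomial.poly q (of_int t)"
      using poly_fun_restrict[OF assms(1)] by metis
    have "Polynomial.poly q (of_nat t) = 0" for t
    proof -
      have "p (Poly_Mapping.update j (int t) a) = 0"
      proof (rule insert.IH)
        show "Poly_Mapping.keys (Poly_Mapping.update j (int t) a) \<subseteq> {1..n}"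
          using insert.prems(1) j by (auto simp: in_keys_iff lookup_update split: if_splits)
        show "0 \<le> Poly_Mapping.lookup (Poly_Mapping.update j (int t) a) i" if "i \<notin> S" for i
          using insert.prems(2)[of i] that by (auto simp: lookup_update)
      qed
      then show ?thesis using q[of "int t"] by simp
    qed
    then have "range of_nat \<subseteq> {x. Polynomial.poly q x = 0}" by auto
    moreover have "infinite (range (of_nat :: nat \<Rightarrow> 'a))"
      using inj_of_nat by (rule range_inj_infinite)
    ultimately have "q = 0" using poly_roots_finite[of q] finite_subset by blast
    moreover have "Poly_Mapping.update j (Poly_Mapping.lookup a j) a = a"
      by (rule poly_mapping_eqI) (simp add: lookup_update)
    ultimately show ?thesis using q[of "Poly_Mapping.lookup a j"] by simp
  qed
qed

definition poly_family :: "((nat \<Rightarrow>\<^sub>0 int) \<Rightarrow> 'k::field_char_0 laurent) \<Rightarrow> bool" where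
  "poly_family T \<longleftrightarrow> (\<forall>b. poly_fun (\<lambda>a. Poly_Mapping.lookup (T a) (a + b)))"

lemma laurent_ext_poly_family:
  assumes "laurent_ext n d \<phi>" "poly_family T"
  shows "poly_family (\<lambda>a. \<phi> (T a))"
  using assms
proof (induction arbitrary: T)
  case (mult f)
  have "poly_fun (\<lambda>a. \<Sum>m \<in> Poly_Mapping.keys f.
      Poly_Mapping.lookup f m * Poly_Mapping.lookup (T a) (a + (b - int_exp m)))" for b
    using mult by (intro poly_fun_sum poly_fun.mult poly_fun.const) (auto simp: poly_family_def)
  then show ?case by (simp add: poly_family_def lookup_laurent_of_poly_mult add_diff_eq)
next
  case (partial j)
  have "poly_fun (\<lambda>a. (of_int (Poly_Mapping.lookup a j) + of_int (Poly_Mapping.lookup b j + 1)) *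
      Poly_Mapping.lookup (T a) (a + (b + Poly_Mapping.single j 1)))" for b
    using partial by (intro poly_fun.intros) (auto simp: poly_family_def)
  then show ?case
    by (simp add: poly_family_def lookup_laurent_deriv lookup_add add.assoc)
qed (auto simp: poly_family_def lookup_add intro: poly_fun.add poly_fun_uminus)

lemma laurent_ext_unique:
  assumes \<phi>: "laurent_ext n d \<phi>" and \<psi>: "laurent_ext n d \<psi>"
    and g: "\<And>a. a \<in> Poly_Mapping.keys g \<Longrightarrow> Poly_Mapping.keys a \<subseteq> {1..n}"
  shows "\<phi> g = \<psi> g"
proof (rule additive_eqI[of \<phi> \<psi>, OF laurent_ext_linear(1)[OF \<phi>] laurent_ext_linear(1)[OF \<psi>]])
  fix a assume "a \<in> Poly_Mapping.keys g"
  then have a: "Poly_Mapping.keys a \<subseteq> {1..n}" using g by blast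
  let ?T = "\<lambda>a. \<phi> (Poly_Mapping.single a 1) - \<psi> (Poly_Mapping.single a 1)"
  have "poly_family (\<lambda>a. Poly_Mapping.single a (1::'a))"
  proof -
    have "Poly_Mapping.lookup (Poly_Mapping.single a (1::'a)) (a + b) = (if b = 0 then 1 else 0)"
      for a b :: "nat \<Rightarrow>\<^sub>0 int" by (auto simp: lookup_single when_def)
    then show ?thesis by (simp add: poly_family_def poly_fun.const)
  qed
  then have T: "poly_family ?T"
    using laurent_ext_poly_family[OF \<phi>] laurent_ext_poly_family[OF \<psi>]
    by (auto simp: poly_family_def lookup_minus intro: poly_fun_diff)
  have T0: "?T b = 0" if b: "Poly_Mapping.keys b \<subseteq> {1..n}" "\<And>j. 0 \<le> Poly_Mapping.lookup b j" for b
  proof -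
    let ?m = "Poly_Mapping.map nat b"
    have m: "int_exp ?m = b"
      by (rule poly_mapping_eqI) (use b in \<open>auto simp: map.rep_eq when_def\<close>)
    have "Poly_Mapping.keys ?m \<subseteq> {1..n}"
      using b by (auto simp: in_keys_iff map.rep_eq when_def split: if_splits)
    then have "Poly_Mapping.single ?m (1::'a) \<in> polys n" by (simp add: polys_def)
    then have "\<phi> (laurent_of_poly (Poly_Mapping.single ?m 1)) =
        \<psi> (laurent_of_poly (Poly_Mapping.single ?m 1))"
      by (simp only: laurent_ext_of_poly[OF \<phi>] laurent_ext_of_poly[OF \<psi>])
    then show ?thesis by (simp add: m)
  qed
  have "?T a = 0"
  proof (rule poly_mapping_eqI)
    fix c
    have "Poly_Mapping.lookup (?T a) (a + (c - a)) = 0"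
    proof (rule poly_fun_vanish[of "\<lambda>b. Poly_Mapping.lookup (?T b) (b + (c - a))" "Poly_Mapping.keys a" n])
      show "poly_fun (\<lambda>b. Poly_Mapping.lookup (?T b) (b + (c - a)))"
        using T by (auto simp: poly_family_def)
    qed (use a T0 in \<open>auto simp: in_keys_iff\<close>)
    then show "Poly_Mapping.lookup (?T a) c = Poly_Mapping.lookup 0 c" by simp
  qed
  moreover have "Poly_Mapping.single a c = Poly_Mapping.single 0 c * Poly_Mapping.single a 1" for c :: 'a
    by (simp add: mult_single)
  ultimately show "\<phi> (Poly_Mapping.single a (Poly_Mapping.lookup g a)) =
      \<psi> (Poly_Mapping.single a (Poly_Mapping.lookup g a))"
    by (metis \<phi> \<psi> eq_iff_diff_eq_0 laurent_ext_linear(2))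
qed

definition inverse_part :: "nat \<Rightarrow> 'k::field_char_0 laurent \<Rightarrow> 'k laurent" where
  "inverse_part n g = (\<Sum>a \<in> Poly_Mapping.keys g \<inter> inverse_exponents n.
     Poly_Mapping.single a (Poly_Mapping.lookup g a))"

lemma lookup_inverse_part:
  "Poly_Mapping.lookup (inverse_part n g) b =
    (if b \<in> inverse_exponents n then Poly_Mapping.lookup g b else 0)"
  by (auto simp: inverse_part_def lookup_sum lookup_single when_def not_in_keys_iff_lookup_eq_zero
      simp flip: if_distrib)

lemma inverse_part_add: "inverse_part n (f + g) = inverse_part n f + inverse_part n g"
  by (rule poly_mapping_eqI) (simp add: lookup_inverse_part lookup_add)

lemma keys_inverse_part: "Poly_Mapping.keys (inverse_part n g) \<subseteq> inverse_exponents n"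
  by (auto simp: in_keys_iff lookup_inverse_part split: if_splits)

lemma inverse_part_id: "Poly_Mapping.keys g \<subseteq> inverse_exponents n \<Longrightarrow> inverse_part n g = g"
  by (rule poly_mapping_eqI) (auto simp: lookup_inverse_part not_in_keys_iff_lookup_eq_zero)

definition inverse_action ::
  "nat \<Rightarrow> 'k::field_char_0 diff_op \<Rightarrow> 'k laurent \<Rightarrow> 'k laurent" where
  "inverse_action n d e = inverse_part n ((SOME \<phi>. laurent_ext n d \<phi>) e)"

lemma inverse_action_eq:
  assumes "laurent_ext n d \<phi>" "Poly_Mapping.keys e \<subseteq> inverse_exponents n"
  shows "inverse_action n d e = inverse_part n (\<phi> e)"
proof -
  have "laurent_ext n d (SOME \<phi>. laurent_ext n d \<phi>)" using assms(1) by (rule someI[of "laurent_ext n d"])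
  then have "(SOME \<phi>. laurent_ext n d \<phi>) e = \<phi> e"
    by (rule laurent_ext_unique) (use assms in \<open>auto simp: inverse_exponents_def\<close>)
  then show ?thesis by (simp add: inverse_action_def)
qed

lemma inverse_part_ext:
  assumes "laurent_ext n d \<phi>"
  shows "inverse_part n (\<phi> (inverse_part n g)) = inverse_part n (\<phi> g)"
proof -
  have "\<forall>b \<in> inverse_exponents n. Poly_Mapping.lookup (\<phi> (g - inverse_part n g)) b = 0"
    by (rule laurent_ext_stable[OF assms]) (simp add: lookup_minus lookup_inverse_part)
  then have "inverse_part n (\<phi> (g - inverse_part n g)) = 0"
    by (intro poly_mapping_eqI) (simp add: lookup_inverse_part)
  moreover have "\<phi> g = \<phi> (inverse_part n g) + \<phi> (g - inverse_part n g)"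
    using laurent_ext_linear(1)[OF assms, of "inverse_part n g" "g - inverse_part n g"] by simp
  ultimately show ?thesis by (simp add: inverse_part_add)
qed

lemma is_inverse_poly_module_exists:
  "\<exists>E :: ('k::field_char_0 diff_op, 'k laurent) module. is_inverse_poly_module n E"
proof -
  let ?D = "diff_op_ring n :: 'k diff_op ring"
  let ?A = "endo_ring n :: 'k diff_op ring"
  define C where "C = {e :: 'k laurent. Poly_Mapping.keys e \<subseteq> inverse_exponents n}"
  define E :: "('k diff_op, 'k laurent) module" where
    "E = \<lparr> carrier = C, monoid.mult = \<lambda>_ _. undefined, one = undefined,
       zero = 0, add = (+), module.smult = inverse_action n \<rparr>"
  have E [simp]: "carrier E = C" "\<zero>\<^bsub>E\<^esub> = 0" "add E = (+)" "module.smult E = inverse_action n"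
    by (simp_all add: E_def)
  have D [simp]: "add ?D = add ?A" "monoid.mult ?D = monoid.mult ?A" "one ?D = one ?A"
    by (simp_all add: diff_op_ring_def)
  have act_closed: "inverse_action n d e \<in> C" for d :: "'k diff_op" and e
    using keys_inverse_part by (auto simp: C_def inverse_action_def)
  have add_closed: "e + e' \<in> C" if "e \<in> C" "e' \<in> C" for e e'
    using that keys_add[of e e'] unfolding C_def by blast
  have act: "inverse_action n d e = inverse_part n (\<phi> e)" if "laurent_ext n d \<phi>" "e \<in> C" for d \<phi> e
    using that inverse_action_eq by (auto simp: C_def)
  have single: "Poly_Mapping.single a b \<in> C" if "a \<in> inverse_exponents n" for a b
    using that by (simp add: C_def)
  have "abelian_group E"
  proof (rule abelian_groupI)
    fix e assume "e \<in> carrier E"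
    then have "- e \<in> carrier E" "- e \<oplus>\<^bsub>E\<^esub> e = \<zero>\<^bsub>E\<^esub>" by (simp_all add: C_def)
    then show "\<exists>y \<in> carrier E. y \<oplus>\<^bsub>E\<^esub> e = \<zero>\<^bsub>E\<^esub>" by blast
  qed (auto simp: add_closed add_ac, simp add: C_def)
  moreover have "left_module_axioms ?D E"
  proof
    fix d e :: "'k diff_op" and x y :: "'k laurent"
    assume x: "x \<in> carrier E"
    show "d \<odot>\<^bsub>E\<^esub> x \<in> carrier E" by (simp add: act_closed)
    show "\<one>\<^bsub>?D\<^esub> \<odot>\<^bsub>E\<^esub> x = x"
      using x act[OF laurent_ext.one] by (simp add: inverse_part_id C_def)
    assume d: "d \<in> carrier ?D"
    then obtain \<phi> where \<phi>: "laurent_ext n d \<phi>" using laurent_ext_exists by blast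
    show "d \<odot>\<^bsub>E\<^esub> (x \<oplus>\<^bsub>E\<^esub> y) = d \<odot>\<^bsub>E\<^esub> x \<oplus>\<^bsub>E\<^esub> d \<odot>\<^bsub>E\<^esub> y" if "y \<in> carrier E"
      using x that by (simp add: act[OF \<phi>] add_closed laurent_ext_linear(1)[OF \<phi>] inverse_part_add)
    assume e: "e \<in> carrier ?D"
    then obtain \<psi> where \<psi>: "laurent_ext n e \<psi>" using laurent_ext_exists by blast
    show "(d \<oplus>\<^bsub>?D\<^esub> e) \<odot>\<^bsub>E\<^esub> x = d \<odot>\<^bsub>E\<^esub> x \<oplus>\<^bsub>E\<^esub> e \<odot>\<^bsub>E\<^esub> x"
      using x by (simp add: act[OF \<phi>] act[OF \<psi>] act[OF laurent_ext.add[OF \<phi> \<psi>]] inverse_part_add)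
    show "(d \<otimes>\<^bsub>?D\<^esub> e) \<odot>\<^bsub>E\<^esub> x = d \<odot>\<^bsub>E\<^esub> (e \<odot>\<^bsub>E\<^esub> x)"
    proof -
      have "inverse_action n e x \<in> C" by (rule act_closed)
      then have "inverse_action n d (inverse_action n e x) = inverse_part n (\<phi> (inverse_action n e x))"
        by (rule act[OF \<phi>])
      also have "\<dots> = inverse_part n (\<phi> (\<psi> x))"
        using x by (simp add: act[OF \<psi>] inverse_part_ext[OF \<phi>])
      finally show ?thesis using x by (simp add: act[OF laurent_ext.comp[OF \<phi> \<psi>]])
    qed
  qed
  ultimately have "left_module ?D E"
    by (simp add: left_module_def ring_diff_op_ring)
  moreover
  { fix a assume a: "a \<in> inverse_exponents n"
    have s: "Poly_Mapping.single a b \<in> C" for b :: 'k using a by (rule single)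
    have "inverse_action n (scalar_op n c) (Poly_Mapping.single a b) = Poly_Mapping.single a (c * b)" for c b :: 'k
    proof -
      have e: "int_exp 0 = 0" by (rule poly_mapping_eqI) simp
      show ?thesis
        using act[OF laurent_ext.mult[OF const_in_polys[of c]] s] s[of "c * b"]
        by (simp add: scalar_op_def const_poly_def mult_single e inverse_part_id C_def)
    qed
    moreover have "inverse_action n (mult_op n (var_poly j)) (Poly_Mapping.single a b) =
        (if Poly_Mapping.lookup a j = - 1 then 0 else Poly_Mapping.single (a + Poly_Mapping.single j 1) b)"
      if j: "j \<in> {1..n}" for j and b :: 'k
    proof -
      have e: "int_exp (Poly_Mapping.single j 1) = Poly_Mapping.single j 1"
        by (rule poly_mapping_eqI) (simp add: lookup_single when_def)
      have 1: "inverse_action n (mult_op n (var_poly j)) (Poly_Mapping.single a b) =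
          inverse_part n (Poly_Mapping.single (a + Poly_Mapping.single j 1) b)"
        using act[OF laurent_ext.mult[OF var_in_polys[OF j]] s] e
        by (simp add: var_poly_def mult_single add.commute)
      have "a + Poly_Mapping.single j 1 \<in> inverse_exponents n \<longleftrightarrow> Poly_Mapping.lookup a j \<noteq> - 1"
      proof
        assume "a + Poly_Mapping.single j 1 \<in> inverse_exponents n"
        then have "Poly_Mapping.lookup (a + Poly_Mapping.single j 1) j \<le> - 1"
          using j unfolding inverse_exponents_def by blast
        then show "Poly_Mapping.lookup a j \<noteq> - 1" by (simp add: lookup_add)
      next
        assume "Poly_Mapping.lookup a j \<noteq> - 1"
        then have "Poly_Mapping.lookup (a + Poly_Mapping.single j 1) i \<le> - 1" if "i \<in> {1..n}" for i
          using a that by (force simp: inverse_exponents_def lookup_add lookup_single when_def)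
        moreover have "Poly_Mapping.keys (a + Poly_Mapping.single j 1) \<subseteq> {1..n}"
          using keys_add[of a "Poly_Mapping.single j 1"] a j by (auto simp: inverse_exponents_def)
        ultimately show "a + Poly_Mapping.single j 1 \<in> inverse_exponents n"
          by (auto simp: inverse_exponents_def)
      qed
      then show ?thesis
        unfolding 1 by (intro poly_mapping_eqI) (auto simp: lookup_inverse_part lookup_single when_def)
    qed
    moreover have "inverse_action n (partial_op n j) (Poly_Mapping.single a b) =
        Poly_Mapping.single (a - Poly_Mapping.single j 1) (of_int (Poly_Mapping.lookup a j) * b)"
      if j: "j \<in> {1..n}" for j and b :: 'k
    proof -
      have "Poly_Mapping.lookup (a - Poly_Mapping.single j 1) i \<le> - 1" if "i \<in> {1..n}" for i
        using a that by (force simp: inverse_exponents_def lookup_minus lookup_single when_def)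
      moreover have "i \<in> {1..n}" if "i \<in> Poly_Mapping.keys (a - Poly_Mapping.single j 1)" for i
      proof (rule ccontr)
        assume i: "i \<notin> {1..n}"
        then have "Poly_Mapping.lookup a i = 0"
          using a unfolding inverse_exponents_def by (metis (mono_tags) in_keys_iff mem_Collect_eq subsetD)
        moreover have "i \<noteq> j" using i j by blast
        ultimately show False
          using that by (simp add: in_keys_iff lookup_minus lookup_single)
      qed
      ultimately have "a - Poly_Mapping.single j 1 \<in> inverse_exponents n"
        by (auto simp: inverse_exponents_def)
      then show ?thesis
        using act[OF laurent_ext.partial[OF j] s] by (simp add: inverse_part_id)
    qed
    ultimately have "(\<forall>c. inverse_action n (scalar_op n c) (Poly_Mapping.single a b) = Poly_Mapping.single a (c * b)) \<and>
       (\<forall>j \<in> {1..n}. inverse_action n (mult_op n (var_poly j)) (Poly_Mapping.single a b) =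
          (if Poly_Mapping.lookup a j = - 1 then 0 else Poly_Mapping.single (a + Poly_Mapping.single j 1) b) \<and>
          inverse_action n (partial_op n j) (Poly_Mapping.single a b) =
          Poly_Mapping.single (a - Poly_Mapping.single j 1) (of_int (Poly_Mapping.lookup a j) * b))"
      for b :: 'k by blast }
  ultimately have "is_inverse_poly_module n E"
    unfolding is_inverse_poly_module_def E C_def[symmetric] by blast
  then show ?thesis by blast
qed

lemma inverse_poly_module: "is_inverse_poly_module n (inverse_poly_module n)"
  unfolding inverse_poly_module_def by (rule someI_ex) (rule is_inverse_poly_module_exists)

end

theory Submission
  imports Defs
begin

text \<open>
  Let \<open>Q\<close> be a resolution of \<open>M\<close> by finitely generated free modules with homogeneous generators and
  homogeneous maps. The de Rham complex of a free module is acyclic below degree \<open>n\<close>, so the double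
  complex of the de Rham complexes of the \<open>Q\<^sub>a\<close> identifies \<open>H\<^bsup>n-i\<^esup>\<close> of \<open>M\<close> with the homology of
  \<open>Q\<^sub>i / (\<partial>\<^sub>1 Q\<^sub>i + \<dots> + \<partial>\<^sub>n Q\<^sub>i)\<close>. Taking the coefficient at \<open>(x\<^sub>1 \<dots> x\<^sub>n)\<^sup>-\<^sup>1\<close> (the residue) embeds
  \<open>Hom(Q\<^sub>i, E)\<close> into the dual of this quotient; its image consists of the functionals that vanish in
  large degrees. Ext is therefore computed by the dual complex, except for this degree condition.
  A functional may be truncated without changing its restriction to a subspace of bounded degree,
  and if the cohomology of \<open>M\<close> is finite-dimensional, then it is represented by cycles of bounded
  degree, so that every functional on it comes from Ext.
\<close>

text \<open>The dual of the quotient is too large for one reason: an element of \<open>E\<close> is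
  a finite sum of inverse monomials. A functional \<mu> prescribes the coefficients \<mu>(x^p v) of
  a homomorphism, and for each \<open>v\<close> only finitely many of them may be nonzero. The
  grading turns this into a bound on degrees. The given projective resolution carries no grading, so
  Ext has to be moved to a graded free resolution, and that one exists because submodules of free
  modules are finitely generated. All terms of this resolution must lie in one type, so elements of
  free modules are stored as normal ordered symbols, polynomials in x, \<xi> and a marker for the
  generator. On symbols the derivatives by \<xi> are available, and they contract the de Rham
  complex up to an Euler operator. The constant to be inverted is n - i + N, where i is the degree
  of the form and N a degree in \<xi>; in characteristic zero it is nonzero for all N as long as i <
  n, and this is why cohomology survives in degree n only.\<close>

abbreviation "lookup \<equiv> Poly_Mapping.lookup"
abbreviation "single \<equiv> Poly_Mapping.single"
abbreviation "keys \<equiv> Poly_Mapping.keys"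

declare One_nat_def [simp del]

section \<open>Formal derivatives and multiplication by variables\<close>

lemma poly_mapping_add_induct [consumes 1, case_names zero single add]:
  fixes v :: "'a \<Rightarrow>\<^sub>0 'b::comm_monoid_add"
  assumes "keys v \<subseteq> A" "P 0" "\<And>m c. m \<in> A \<Longrightarrow> P (single m c)"
    and "\<And>u w. keys u \<subseteq> A \<Longrightarrow> keys w \<subseteq> A \<Longrightarrow> P u \<Longrightarrow> P w \<Longrightarrow> P (u + w)"
  shows "P v"
proof -
  have "P (\<Sum>a\<in>B. single a (lookup v a)) \<and> keys (\<Sum>a\<in>B. single a (lookup v a)) \<subseteq> A"
    if "finite B" "B \<subseteq> A" for B
    using that
  proof (induction B rule: finite_induct)
    case (insert x F)
    have "keys (single x (lookup v x) + (\<Sum>a\<in>F. single a (lookup v a))) \<subseteq> A"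
      using insert keys_add[of "single x (lookup v x)" "\<Sum>a\<in>F. single a (lookup v a)"]
      by (auto split: if_splits)
    then show ?case using insert by (auto intro!: assms(3,4) split: if_splits)
  qed (simp add: assms)
  from this[of "keys v"] show ?thesis using assms(1) by (simp add: poly_mapping_sum_singles)
qed

lemma partial_deriv_mult:
  "partial_deriv j (f * g) = partial_deriv j f * g + f * partial_deriv j g"
proof (rule additive_eqI[of "\<lambda>f. partial_deriv j (f * g)" "\<lambda>f. partial_deriv j f * g + f * partial_deriv j g"])
  fix a
  show "partial_deriv j (single a c * g) = partial_deriv j (single a c) * g + single a c * partial_deriv j g" for c
  proof (rule additive_eqI[of "\<lambda>g. partial_deriv j (single a c * g)"
        "\<lambda>g. partial_deriv j (single a c) * g + single a c * partial_deriv j g"])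
    fix b
    \<comment> \<open>Subtraction of exponents is truncated, so the two rearrangements need a
      positive exponent; when that exponent is 0, the coefficient of the term is 0 as well.\<close>
    have 1: "a + b - single j 1 = a - single j 1 + b" if "lookup a j \<noteq> 0"
      using that by (intro poly_mapping_eqI) (auto simp: lookup_minus lookup_add lookup_single when_def)
    have 2: "a + b - single j 1 = a + (b - single j 1)" if "lookup b j \<noteq> 0"
      using that by (intro poly_mapping_eqI) (auto simp: lookup_minus lookup_add lookup_single when_def)
    show "partial_deriv j (single a c * single b d) =
      partial_deriv j (single a c) * single b d + single a c * partial_deriv j (single b d)" for d
    proof (cases "lookup a j = 0"; cases "lookup b j = 0")
      assume "lookup a j \<noteq> 0" "lookup b j \<noteq> 0"
      then have "a - single j 1 + b = a + b - single j 1" "a + (b - single j 1) = a + b - single j 1"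
        using 1 2 by simp_all
      then show ?thesis by (simp add: mult_single lookup_add single_add distrib_left distrib_right mult_ac add.commute[of b])
    qed (simp_all add: mult_single lookup_add 1 2 mult_ac add.commute[of b "a - single j 1"])
  qed (simp_all add: partial_deriv_add algebra_simps)
qed (simp_all add: partial_deriv_add algebra_simps)

lemma partial_deriv_commute: "partial_deriv i (partial_deriv j f) = partial_deriv j (partial_deriv i f)"
proof (rule poly_mapping_eqI)
  fix m
  have "m + single i 1 + single j 1 = m + single j (1::nat) + single i 1" by (simp add: add_ac)
  then show "lookup (partial_deriv i (partial_deriv j f)) m = lookup (partial_deriv j (partial_deriv i f)) m"
    by (cases "i = j") (simp_all add: lookup_partial_deriv lookup_add lookup_single when_def mult.left_commute)
qed

lemma partial_deriv_var: "partial_deriv i (var_poly j) = (if i = j then 1 else 0)"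
  by (simp add: var_poly_def lookup_single when_def flip: single_one)

lemma partial_deriv_zero [simp]: "partial_deriv j 0 = 0"
  by (simp add: partial_deriv_def)

lemma const_poly_add: "const_poly (c + d) = const_poly c + const_poly d"
  by (simp add: const_poly_def single_add)

lemma const_poly_mult: "const_poly (c * d) = const_poly c * const_poly d"
  by (simp add: const_poly_def mult_single)

lemma const_poly_0 [simp]: "const_poly 0 = 0"
  by (simp add: const_poly_def)

lemma const_poly_1 [simp]: "const_poly 1 = 1"
  by (simp add: const_poly_def)

lemma lookup_const_poly_mult [simp]: "lookup (const_poly c * f) m = c * lookup f m"
  by (simp add: const_poly_def lookup_const_mult)

lemma const_poly_mult_single [simp]: "const_poly c * single m d = single m (c * d)"
  by (simp add: const_poly_def mult_single)

lemma var_poly_mult_single [simp]: "var_poly j * single m c = single (m + single j 1) c"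
  by (simp add: var_poly_def mult_single add.commute)

lemma lookup_var_poly_mult:
  "lookup (var_poly j * f) m = (if lookup m j = 0 then 0 else lookup f (m - single j 1))"
proof (rule additive_eqI[of "\<lambda>f. lookup (var_poly j * f) m" 
      "\<lambda>f. (if lookup m j = 0 then 0 else lookup f (m - single j 1))"])
  fix a
  have "a + single j 1 = m \<longleftrightarrow> lookup m j \<noteq> 0 \<and> a = m - single j 1"
    by (auto simp: poly_mapping_eq_iff fun_eq_iff lookup_add lookup_minus lookup_single when_def)
  then show "lookup (var_poly j * single a c) m = (if lookup m j = 0 then 0 else lookup (single a c) (m - single j 1))" for c
    by (auto simp: lookup_single when_def)
qed (simp_all add: distrib_left lookup_add)

section \<open>The symbol calculus for differential operators\<close>

text \<open>
  The operator \<open>x\<^sup>a \<partial>\<^sup>b\<close> is represented by the monomial \<open>x\<^sup>a \<xi>\<^sup>b\<close>, where \<open>x\<^sub>j\<close> is the variable with index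
  \<open>j\<close> and \<open>\<xi>\<^sub>j\<close> the one with index \<open>n + j\<close>. The exponent of the variable with index \<open>2 * n + 1\<close> is the
  number of a generator, so that the free module with \<open>r\<close> generators embeds into the polynomials.
  Left multiplication by \<open>\<partial>\<^sub>j\<close> becomes \<open>\<xi>\<^sub>j + \<partial>/\<partial>x\<^sub>j\<close>.
\<close>

definition xpart :: "nat \<Rightarrow> (nat \<Rightarrow>\<^sub>0 nat) \<Rightarrow> (nat \<Rightarrow>\<^sub>0 nat)" where
  "xpart n m = (\<Sum>j = 1..n. single j (lookup m j))"

text \<open>The exponents of \<xi> are moved down to the indices of the x variables, so that they
  can serve as exponents of an iterated derivative.\<close>

definition dpart :: "nat \<Rightarrow> (nat \<Rightarrow>\<^sub>0 nat) \<Rightarrow> (nat \<Rightarrow>\<^sub>0 nat)" where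
  "dpart n m = (\<Sum>j = 1..n. single j (lookup m (n + j)))"

definition gen_index :: "nat \<Rightarrow> (nat \<Rightarrow>\<^sub>0 nat) \<Rightarrow> nat" where
  "gen_index n m = lookup m (2 * n + 1)"

definition symbol_exps :: "nat \<Rightarrow> nat \<Rightarrow> (nat \<Rightarrow>\<^sub>0 nat) set" where
  "symbol_exps n r = {m. keys m \<subseteq> {1..2 * n + 1} \<and> gen_index n m < r}"

definition symbols :: "nat \<Rightarrow> nat \<Rightarrow> 'k::field_char_0 mpoly set" where
  "symbols n r = {v. keys v \<subseteq> symbol_exps n r}"

definition gen_symbol :: "nat \<Rightarrow> nat \<Rightarrow> 'k::field_char_0 mpoly" where
  "gen_symbol n s = single (single (2 * n + 1) s) 1"

definition sym_deriv :: "nat \<Rightarrow> nat \<Rightarrow> 'k::field_char_0 mpoly \<Rightarrow> 'k mpoly" where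
  "sym_deriv n j v = var_poly (n + j) * v + partial_deriv j v"

definition exp_fact :: "nat \<Rightarrow> (nat \<Rightarrow>\<^sub>0 nat) \<Rightarrow> 'k::field_char_0" where
  "exp_fact n m = (\<Prod>j = 1..n. fact (lookup m j))"

text \<open>The iterated derivative \<open>\<partial>^b\<close>: the coefficient at m is (m + b)! /
  m! times the one at m + b. The closed formula chooses no order of the variables, and the division
  is possible in characteristic zero.\<close>

lift_definition iter_deriv :: "nat \<Rightarrow> (nat \<Rightarrow>\<^sub>0 nat) \<Rightarrow> 'k::field_char_0 mpoly \<Rightarrow> 'k mpoly" is
  "\<lambda>n b f m. exp_fact n (m + b) / exp_fact n m * f (m + b)"
proof -
  fix n :: nat and b and f :: "(nat \<Rightarrow>\<^sub>0 nat) \<Rightarrow> 'k"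
  assume "finite {m. f m \<noteq> 0}"
  then have "finite ((\<lambda>m. m + b) -` {m. f m \<noteq> 0})" by (rule finite_vimageI) (simp add: inj_def)
  then show "finite {m. exp_fact n (m + b) / exp_fact n m * f (m + b) \<noteq> 0}"
    by (rule rev_finite_subset) auto
qed

lemma lookup_xpart: "lookup (xpart n m) i = (if i \<in> {1..n} then lookup m i else 0)"
  by (simp add: xpart_def lookup_sum lookup_single when_def)

lemma lookup_dpart: "lookup (dpart n m) i = (if i \<in> {1..n} then lookup m (n + i) else 0)"
  by (simp add: dpart_def lookup_sum lookup_single when_def)

lemma xpart_add: "xpart n (m + m') = xpart n m + xpart n m'"
  and dpart_add: "dpart n (m + m') = dpart n m + dpart n m'"
  and gen_index_add: "gen_index n (m + m') = gen_index n m + gen_index n m'"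
  by (auto intro!: poly_mapping_eqI simp: lookup_xpart lookup_dpart lookup_add gen_index_def)

lemma xpart_diff: "xpart n (m - m') = xpart n m - xpart n m'"
  and dpart_diff: "dpart n (m - m') = dpart n m - dpart n m'"
  and gen_index_diff: "gen_index n (m - m') = gen_index n m - gen_index n m'"
  by (auto intro!: poly_mapping_eqI simp: lookup_xpart lookup_dpart lookup_minus gen_index_def)

lemma parts_single:
  assumes "j \<in> {1..n}"
  shows "xpart n (single j c) = single j c" "xpart n (single (n + j) c) = 0" 
    "dpart n (single j c) = 0" "dpart n (single (n + j) c) = single j c"
    "gen_index n (single j c) = 0" "gen_index n (single (n + j) c) = 0"
  using assms by (auto intro!: poly_mapping_eqI simp: lookup_xpart lookup_dpart lookup_single when_def gen_index_def)

lemma parts_gen: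
  "xpart n (single (2 * n + 1) c) = 0" "dpart n (single (2 * n + 1) c) = 0" "gen_index n (single (2 * n + 1) c) = c"
  by (auto intro!: poly_mapping_eqI simp: lookup_xpart lookup_dpart lookup_single when_def gen_index_def)

lemma symbol_exps_eqI:
  assumes "m \<in> symbol_exps n r" "m' \<in> symbol_exps n r'" "xpart n m = xpart n m'" "dpart n m = dpart n m'" 
    "gen_index n m = gen_index n m'"
  shows "m = m'"
proof (rule poly_mapping_eqI)
  fix i
  consider "i \<in> {1..n}" | j where "j \<in> {1..n}" "i = n + j" | "i = 2 * n + 1" | "i \<notin> {1..2*n+1}"
  proof -
    have "i - n \<in> {1..n}" "i = n + (i - n)" if "n < i" "i \<le> 2 * n"
      using that by auto
    moreover have "i \<in> {1..n} \<or> (n < i \<and> i \<le> 2 * n) \<or> i = 2 * n + 1 \<or> i \<notin> {1..2*n+1}"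
      by (simp add: not_le) linarith
    ultimately show thesis using that by blast
  qed
  then show "lookup m i = lookup m' i"
  proof cases
    case 1 then show ?thesis using arg_cong[OF assms(3), of "\<lambda>p. lookup p i"] by (simp add: lookup_xpart)
  next
    case 2 then show ?thesis using arg_cong[OF assms(4), of "\<lambda>p. lookup p j"] by (simp add: lookup_dpart)
  next
    case 3 then show ?thesis using assms(5) by (simp add: gen_index_def)
  next
    case 4 
    then have "i \<notin> keys m" "i \<notin> keys m'" using assms(1,2) unfolding symbol_exps_def by blast+
    then show ?thesis by (simp add: in_keys_iff)
  qed
qed

lemma exp_fact_nz [simp]: "exp_fact n m \<noteq> 0"
  by (simp add: exp_fact_def)

lemma exp_fact_Suc:
  assumes "j \<in> {1..n}"
  shows "exp_fact n (m + single j 1) = of_nat (lookup m j + 1) * exp_fact n m"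
proof -
  have 1: "(\<Prod>i \<in> {1..n} - {j}. fact (lookup (m + single j 1) i)) = (\<Prod>i \<in> {1..n} - {j}. fact (lookup m i) :: 'a)"
    by (rule prod.cong) (auto simp: lookup_add lookup_single when_def)
  have "exp_fact n (m + single j 1) = fact (lookup m j + 1) * (\<Prod>i \<in> {1..n} - {j}. fact (lookup m i) :: 'a)"
    unfolding exp_fact_def using assms
    by (subst prod.remove[of _ j], simp, assumption) (simp only: 1, simp add: lookup_add)
  also have "fact (lookup m j + 1) = of_nat (lookup m j + 1) * (fact (lookup m j) :: 'a)"
    by (simp add: fact_Suc flip: Suc_eq_plus1)
  also have "\<dots> * (\<Prod>i \<in> {1..n} - {j}. fact (lookup m i)) = of_nat (lookup m j + 1) * (\<Prod>i \<in> {1..n}. fact (lookup m i))"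
    by (simp only: mult.assoc prod.remove[OF finite_atLeastAtMost assms])
  finally show ?thesis by (simp add: exp_fact_def)
qed

lemma iter_deriv_0 [simp]: "iter_deriv n 0 f = f"
  by (rule poly_mapping_eqI) (simp add: iter_deriv.rep_eq)

lemma partial_iter_deriv:
  assumes "j \<in> {1..n}"
  shows "partial_deriv j (iter_deriv n b f) = iter_deriv n (b + single j 1) f"
proof (rule poly_mapping_eqI)
  fix m
  have "of_nat (lookup m j + 1) * (exp_fact n (m + single j 1 + b) / (of_nat (lookup m j + 1) * exp_fact n m)) =
    (exp_fact n (m + single j 1 + b) / exp_fact n m :: 'a)"
    using of_nat_neq_0[of "lookup m j", where 'a = 'a] by (simp add: add.commute)
  then show "lookup (partial_deriv j (iter_deriv n b f)) m = lookup (iter_deriv n (b + single j 1) f) m"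
    by (simp add: lookup_partial_deriv iter_deriv.rep_eq exp_fact_Suc[OF assms, of m] add.assoc
        add.commute[of b] del: of_nat_add of_nat_Suc flip: mult.assoc)
qed

text \<open>Component \<open>s\<close> of a symbol as an operator on polynomials in normal order:
  every monomial \<open>x^a \<xi>^b\<close> marked with the generator \<open>s\<close> first applies
  \<open>\<partial>^b\<close> and then multiplies by \<open>x^a\<close>.\<close>

definition sym_op :: "nat \<Rightarrow> 'k::field_char_0 mpoly \<Rightarrow> nat \<Rightarrow> 'k mpoly \<Rightarrow> 'k mpoly" where
  "sym_op n v s f = (\<Sum>m \<in> keys v. if gen_index n m = s
     then single (xpart n m) (lookup v m) * iter_deriv n (dpart n m) f else 0)"

lemma sym_op_add: "sym_op n (v + w) s f = sym_op n v s f + sym_op n w s f"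
  unfolding sym_op_def
  by (rule sum_keys_add[where h = "\<lambda>m c. if gen_index n m = s
     then single (xpart n m) c * iter_deriv n (dpart n m) f else 0"]) (simp add: single_add algebra_simps)

lemma sym_op_zero [simp]: "sym_op n 0 s f = 0"
  by (simp add: sym_op_def)

lemma sym_op_single: "sym_op n (single m c) s f = (if gen_index n m = s
     then single (xpart n m) c * iter_deriv n (dpart n m) f else 0)"
  by (cases "c = 0") (simp_all add: sym_op_def)

lemma sym_op_uminus: "sym_op n (- v) s f = - sym_op n v s f"
  using sym_op_add[of n v "- v" s f] by (simp add: eq_neg_iff_add_eq_0 add.commute)

lemma sym_op_const: "sym_op n (const_poly c * v) s f = const_poly c * sym_op n v s f"
  by (rule additive_eqI[of "\<lambda>v. sym_op n (const_poly c * v) s f" "\<lambda>v. const_poly c * sym_op n v s f"])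
     (simp_all add: sym_op_add sym_op_single distrib_left flip: mult.assoc)

lemma sym_op_var:
  assumes "j \<in> {1..n}"
  shows "sym_op n (var_poly j * v) s f = var_poly j * sym_op n v s f"
  by (rule additive_eqI[of "\<lambda>v. sym_op n (var_poly j * v) s f" "\<lambda>v. var_poly j * sym_op n v s f"])
     (use assms in \<open>simp_all add: sym_op_add sym_op_single distrib_left xpart_add dpart_add gen_index_add parts_single
        flip: mult.assoc\<close>)

text \<open>Leibniz rule in normal order: composing \<open>\<partial>_j\<close> with
  \<open>x^a \<partial>^b\<close> gives \<open>x^a \<partial>^b \<partial>_j\<close> plus
  \<open>(\<partial>_j x^a) \<partial>^b\<close>, and these are the two terms of
  \<open>sym_deriv\<close>.\<close>

lemma sym_op_deriv:
  assumes "j \<in> {1..n}"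
  shows "sym_op n (sym_deriv n j v) s f = partial_deriv j (sym_op n v s f)"
proof (rule additive_eqI[of "\<lambda>v. sym_op n (sym_deriv n j v) s f" "\<lambda>v. partial_deriv j (sym_op n v s f)"])
  show "sym_op n (sym_deriv n j (single m c)) s f = partial_deriv j (sym_op n (single m c) s f)" for m c
    using assms
    by (simp add: sym_deriv_def sym_op_add sym_op_single partial_deriv_mult partial_iter_deriv lookup_xpart
        xpart_add dpart_add gen_index_add xpart_diff dpart_diff gen_index_diff parts_single)
qed (simp_all add: sym_deriv_def sym_op_add partial_deriv_add algebra_simps)

lemma sym_op_gen: "sym_op n (gen_symbol n s) t f = (if s = t then f else 0)"
  by (simp add: gen_symbol_def sym_op_single parts_gen)

section \<open>Linear maps between left modules\<close>

context left_module
begin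

lemma smult_zero_r [simp]: "a \<in> carrier R \<Longrightarrow> a \<odot>\<^bsub>M\<^esub> \<zero>\<^bsub>M\<^esub> = \<zero>\<^bsub>M\<^esub>"
  using smult_r_distr[of a "\<zero>\<^bsub>M\<^esub>" "\<zero>\<^bsub>M\<^esub>"] M.add.l_cancel_one'[of "a \<odot>\<^bsub>M\<^esub> \<zero>\<^bsub>M\<^esub>" "a \<odot>\<^bsub>M\<^esub> \<zero>\<^bsub>M\<^esub>"] by simp

lemma smult_zero_l [simp]: "x \<in> carrier M \<Longrightarrow> \<zero> \<odot>\<^bsub>M\<^esub> x = \<zero>\<^bsub>M\<^esub>"
  using smult_l_distr[of "\<zero>" "\<zero>" x] M.add.l_cancel_one'[of "\<zero> \<odot>\<^bsub>M\<^esub> x" "\<zero> \<odot>\<^bsub>M\<^esub> x"] by simp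

lemma smult_minus_r: "a \<in> carrier R \<Longrightarrow> x \<in> carrier M \<Longrightarrow> a \<odot>\<^bsub>M\<^esub> (\<ominus>\<^bsub>M\<^esub> x) = \<ominus>\<^bsub>M\<^esub> (a \<odot>\<^bsub>M\<^esub> x)"
  using smult_r_distr[of a "\<ominus>\<^bsub>M\<^esub> x" x] by (simp add: M.minus_equality M.l_neg)

lemma smult_minus_one: "x \<in> carrier M \<Longrightarrow> (\<ominus> \<one>) \<odot>\<^bsub>M\<^esub> x = \<ominus>\<^bsub>M\<^esub> x"
  using smult_l_distr[of "\<ominus> \<one>" \<one> x] by (simp add: M.minus_equality R.l_neg)

lemma smult_finsum:
  assumes "a \<in> carrier R" "finite A" "f \<in> A \<rightarrow> carrier M"
  shows "a \<odot>\<^bsub>M\<^esub> (\<Oplus>\<^bsub>M\<^esub>i\<in>A. f i) = (\<Oplus>\<^bsub>M\<^esub>i\<in>A. a \<odot>\<^bsub>M\<^esub> f i)"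
  using assms(2,3,1) by (induction A rule: finite_induct) (simp_all add: smult_r_distr Pi_iff)

lemma finsum_closed_sub:
  assumes "K \<subseteq> carrier M" "\<zero>\<^bsub>M\<^esub> \<in> K" "\<And>x y. x \<in> K \<Longrightarrow> y \<in> K \<Longrightarrow> x \<oplus>\<^bsub>M\<^esub> y \<in> K"
    and "finite A" "f \<in> A \<rightarrow> K"
  shows "(\<Oplus>\<^bsub>M\<^esub>i\<in>A. f i) \<in> K"
  using assms(4,5)
proof (induction A rule: finite_induct)
  case (insert x F)
  then have "f \<in> F \<rightarrow> carrier M" "f x \<in> carrier M" using assms(1) by auto
  then show ?case using insert assms(3) by (simp add: Pi_iff)
qed (simp add: assms(2))

end

lemma lin_hom_closed: "f \<in> lin_hom R A B \<Longrightarrow> x \<in> carrier A \<Longrightarrow> f x \<in> carrier B"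
  by (auto simp: lin_hom_def)

lemma lin_hom_add:
  "f \<in> lin_hom R A B \<Longrightarrow> x \<in> carrier A \<Longrightarrow> y \<in> carrier A \<Longrightarrow> f (x \<oplus>\<^bsub>A\<^esub> y) = f x \<oplus>\<^bsub>B\<^esub> f y"
  by (auto simp: lin_hom_def)

lemma lin_hom_smult:
  "f \<in> lin_hom R A B \<Longrightarrow> r \<in> carrier R \<Longrightarrow> x \<in> carrier A \<Longrightarrow> f (r \<odot>\<^bsub>A\<^esub> x) = r \<odot>\<^bsub>B\<^esub> f x"
  by (auto simp: lin_hom_def)

lemma lin_hom_zero:
  assumes "left_module R A" "left_module R B" "f \<in> lin_hom R A B"
  shows "f \<zero>\<^bsub>A\<^esub> = \<zero>\<^bsub>B\<^esub>"
proof -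
  interpret A: left_module R A by fact
  interpret B: left_module R B by fact
  show ?thesis
    using lin_hom_smult[OF assms(3), of "\<zero>\<^bsub>R\<^esub>" "\<zero>\<^bsub>A\<^esub>"] lin_hom_closed[OF assms(3)] by simp
qed

lemma lin_hom_uminus:
  assumes "left_module R A" "left_module R B" "f \<in> lin_hom R A B" "x \<in> carrier A"
  shows "f (\<ominus>\<^bsub>A\<^esub> x) = \<ominus>\<^bsub>B\<^esub> f x"
proof -
  interpret A: left_module R A by fact
  interpret B: left_module R B by fact
  show ?thesis
    using lin_hom_smult[OF assms(3), of "\<ominus>\<^bsub>R\<^esub> \<one>\<^bsub>R\<^esub>" x] lin_hom_closed[OF assms(3)] assms(4)
    by (simp add: A.smult_minus_one B.smult_minus_one)
qed

lemma lin_hom_minus: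
  assumes "left_module R A" "left_module R B" "f \<in> lin_hom R A B" "x \<in> carrier A" "y \<in> carrier A"
  shows "f (x \<ominus>\<^bsub>A\<^esub> y) = f x \<ominus>\<^bsub>B\<^esub> f y"
proof -
  interpret A: left_module R A by fact
  interpret B: left_module R B by fact
  show ?thesis
    using assms(4,5) by (simp add: a_minus_def lin_hom_add[OF assms(3)] lin_hom_uminus[OF assms(1-3)])
qed

lemma lin_hom_finsum:
  assumes "left_module R A" "left_module R B" "f \<in> lin_hom R A B" "finite I" "h \<in> I \<rightarrow> carrier A"
  shows "f (\<Oplus>\<^bsub>A\<^esub>i\<in>I. h i) = (\<Oplus>\<^bsub>B\<^esub>i\<in>I. f (h i))"
proof -
  interpret A: left_module R A by fact
  interpret B: left_module R B by fact
  show ?thesis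
    using assms(4,5)
  proof (induction I rule: finite_induct)
    case empty
    then show ?case by (simp add: lin_hom_zero[OF assms(1-3)])
  next
    case (insert x F)
    have h: "h x \<in> carrier A" "h \<in> F \<rightarrow> carrier A" using insert by auto
    then have "f (h x) \<in> carrier B" "(\<lambda>i. f (h i)) \<in> F \<rightarrow> carrier B"
      using lin_hom_closed[OF assms(3)] by auto
    then show ?case
      using insert.hyps insert.IH[OF h(2)] h by (simp add: lin_hom_add[OF assms(3)])
  qed
qed

lemma lin_hom_compose:
  assumes "left_module R A" "f \<in> lin_hom R A B" "g \<in> lin_hom R B C"
  shows "compose (carrier A) g f \<in> lin_hom R A C"
proof -
  interpret A: left_module R A by fact
  show ?thesis
    using lin_hom_closed[OF assms(2)] lin_hom_closed[OF assms(3)] lin_hom_add[OF assms(2)] lin_hom_add[OF assms(3)]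
      lin_hom_smult[OF assms(2)] lin_hom_smult[OF assms(3)]
    by (simp add: lin_hom_def[of R A C] compose_def)
qed

lemma lin_hom_restrict:
  assumes "\<And>x. x \<in> carrier A \<Longrightarrow> f x \<in> carrier B"
    and "\<And>x y. x \<in> carrier A \<Longrightarrow> y \<in> carrier A \<Longrightarrow> f (x \<oplus>\<^bsub>A\<^esub> y) = f x \<oplus>\<^bsub>B\<^esub> f y"
    and "\<And>r x. r \<in> carrier R \<Longrightarrow> x \<in> carrier A \<Longrightarrow> f (r \<odot>\<^bsub>A\<^esub> x) = r \<odot>\<^bsub>B\<^esub> f x"
    and "left_module R A"
  shows "restrict f (carrier A) \<in> lin_hom R A B"
proof -
  interpret A: left_module R A by fact
  show ?thesis using assms by (auto simp: lin_hom_def)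
qed

lemma lin_hom_eqI:
  assumes "f \<in> lin_hom R A B" "g \<in> lin_hom R A B" "\<And>x. x \<in> carrier A \<Longrightarrow> f x = g x"
  shows "f = g"
  using assms by (intro extensionalityI[of _ "carrier A"]) (auto simp: lin_hom_def PiE_def)

section \<open>Generators of the ring of differential operators\<close>

lemma diff_op_ring_sel:
  "add (diff_op_ring n) = add (endo_ring n)" "monoid.mult (diff_op_ring n) = monoid.mult (endo_ring n)"
  "one (diff_op_ring n) = one (endo_ring n)" "zero (diff_op_ring n) = zero (endo_ring n)"
  by (simp_all add: diff_op_ring_def)

lemma diff_op_in_endo: "d \<in> carrier (diff_op_ring n) \<Longrightarrow> d \<in> carrier (endo_ring n)"
  using ring.generate_ring_in_carrier[OF ring_endo_ring diff_op_gens_in_endo]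
  by (auto simp: diff_op_ring_def)

lemma diff_op_polys:
  "d \<in> carrier (diff_op_ring n) \<Longrightarrow> f \<in> polys n \<Longrightarrow> d f \<in> polys n"
  by (drule diff_op_in_endo) (auto simp: endo_ring_def)

lemma diff_op_additive:
  "d \<in> carrier (diff_op_ring n) \<Longrightarrow> f \<in> polys n \<Longrightarrow> g \<in> polys n \<Longrightarrow> d (f + g) = d f + d g"
  by (drule diff_op_in_endo) (auto simp: endo_ring_def)

lemma diff_op_add_app: "f \<in> polys n \<Longrightarrow> (d \<oplus>\<^bsub>diff_op_ring n\<^esub> e) f = d f + e f"
  and diff_op_mult_app: "f \<in> polys n \<Longrightarrow> (d \<otimes>\<^bsub>diff_op_ring n\<^esub> e) f = d (e f)"
  and diff_op_zero_app: "f \<in> polys n \<Longrightarrow> \<zero>\<^bsub>diff_op_ring n\<^esub> f = 0"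
  and diff_op_one_app: "f \<in> polys n \<Longrightarrow> \<one>\<^bsub>diff_op_ring n\<^esub> f = f"
  by (simp_all add: diff_op_ring_sel endo_ring_def compose_def)

lemma diff_op_eqI:
  "d \<in> carrier (diff_op_ring n) \<Longrightarrow> e \<in> carrier (diff_op_ring n) \<Longrightarrow> (\<And>f. f \<in> polys n \<Longrightarrow> d f = e f) \<Longrightarrow> d = e"
  by (drule diff_op_in_endo)+
     (intro extensionalityI[of _ "polys n"], auto simp: endo_ring_def PiE_def)

lemma mult_op_in_diff_op [simp]: "f \<in> polys n \<Longrightarrow> mult_op n f \<in> carrier (diff_op_ring n)"
  by (auto simp: diff_op_ring_def intro: generate_ring.incl)

lemma partial_op_in_diff_op [simp]: "j \<in> {1..n} \<Longrightarrow> partial_op n j \<in> carrier (diff_op_ring n)"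
  by (auto simp: diff_op_ring_def intro: generate_ring.incl)

lemma scalar_op_in_diff_op [simp]: "scalar_op n c \<in> carrier (diff_op_ring n)"
  by (simp add: scalar_op_def)

lemma scalar_op_app: "f \<in> polys n \<Longrightarrow> scalar_op n c f = const_poly c * f"
  by (simp add: scalar_op_def mult_op_def)

lemma mult_op_mult:
  "f \<in> polys n \<Longrightarrow> g \<in> polys n \<Longrightarrow> mult_op n (f * g) = mult_op n f \<otimes>\<^bsub>diff_op_ring n\<^esub> mult_op n g"
  and mult_op_add:
  "f \<in> polys n \<Longrightarrow> g \<in> polys n \<Longrightarrow> mult_op n (f + g) = mult_op n f \<oplus>\<^bsub>diff_op_ring n\<^esub> mult_op n g"
  by (auto simp: mult_op_def diff_op_ring_sel endo_ring_def compose_def mult.assoc distrib_right intro!: restrict_ext)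

lemma scalar_op_one: "scalar_op n 1 = \<one>\<^bsub>diff_op_ring n\<^esub>"
  and scalar_op_zero: "scalar_op n 0 = \<zero>\<^bsub>diff_op_ring n\<^esub>"
  by (auto simp: scalar_op_def mult_op_def diff_op_ring_sel endo_ring_def intro!: restrict_ext)

lemma scalar_op_mult: "scalar_op n (a * b) = scalar_op n a \<otimes>\<^bsub>diff_op_ring n\<^esub> scalar_op n b"
  and scalar_op_add: "scalar_op n (a + b) = scalar_op n a \<oplus>\<^bsub>diff_op_ring n\<^esub> scalar_op n b"
  by (simp_all only: scalar_op_def const_poly_mult const_poly_add mult_op_mult mult_op_add const_in_polys)

lemma scalar_op_commute:
  fixes d :: "'k::field_char_0 diff_op"
  assumes "d \<in> carrier (diff_op_ring n)"
  shows "scalar_op n c \<otimes>\<^bsub>diff_op_ring n\<^esub> d = d \<otimes>\<^bsub>diff_op_ring n\<^esub> scalar_op n c"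
proof -
  interpret ring "diff_op_ring n :: 'k diff_op ring" by (rule ring_diff_op_ring)
  have "d (const_poly c * f) = const_poly c * d f" if "f \<in> polys n" for f
    using diff_op_in_endo[OF assms] that by (auto simp: endo_ring_def)
  then show ?thesis
    using assms m_closed[of "scalar_op n c" d] m_closed[of d "scalar_op n c"]
    by (intro diff_op_eqI[of _ n]) (simp_all add: diff_op_mult_app scalar_op_app diff_op_polys)
qed

lemma uminus_diff_op:
  fixes d :: "'k::field_char_0 diff_op"
  assumes "d \<in> carrier (diff_op_ring n)"
  shows "\<ominus>\<^bsub>diff_op_ring n\<^esub> d = scalar_op n (- 1) \<otimes>\<^bsub>diff_op_ring n\<^esub> d"
proof -
  interpret ring "diff_op_ring n :: 'k diff_op ring" by (rule ring_diff_op_ring)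
  have "(scalar_op n (- 1) :: 'k diff_op) \<oplus>\<^bsub>diff_op_ring n\<^esub> \<one>\<^bsub>diff_op_ring n\<^esub> = \<zero>\<^bsub>diff_op_ring n\<^esub>"
    using scalar_op_add[of n "-1" 1, symmetric] by (simp only: scalar_op_one scalar_op_zero add.left_inverse)
  then have "(scalar_op n (- 1) :: 'k diff_op) = \<ominus>\<^bsub>diff_op_ring n\<^esub> \<one>\<^bsub>diff_op_ring n\<^esub>"
    by (rule minus_equality[symmetric]) simp_all
  then show ?thesis using assms l_minus[of "\<one>\<^bsub>diff_op_ring n\<^esub>" d] by simp
qed

lemma endo_uminus:
  fixes d :: "'k::field_char_0 diff_op"
  assumes "d \<in> carrier (diff_op_ring n)"
  shows "\<ominus>\<^bsub>endo_ring n\<^esub> d = \<ominus>\<^bsub>diff_op_ring n\<^esub> d"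
proof -
  interpret E: ring "endo_ring n :: 'k diff_op ring" by (rule ring_endo_ring)
  interpret ring "diff_op_ring n :: 'k diff_op ring" by (rule ring_diff_op_ring)
  show ?thesis
    using assms l_neg[of d] a_inv_closed[of d]
    by (intro E.minus_equality) (simp_all only: diff_op_in_endo diff_op_ring_sel)
qed

text \<open>The ring is generated by multiplications with arbitrary polynomials and by derivatives.
  Multiplications are reduced to scalars and variables by induction on the degree of a monomial, and
  additive inverses are products with the scalar -1.\<close>

lemma diff_op_induct [consumes 1, case_names scalar var partial add mult]:
  fixes d :: "'k::field_char_0 diff_op"
  assumes "d \<in> carrier (diff_op_ring n)"
    and scalar: "\<And>c. P (scalar_op n c)"
    and var: "\<And>j. j \<in> {1..n} \<Longrightarrow> P (mult_op n (var_poly j))"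
    and partial: "\<And>j. j \<in> {1..n} \<Longrightarrow> P (partial_op n j)"
    and add: "\<And>d e. d \<in> carrier (diff_op_ring n) \<Longrightarrow> e \<in> carrier (diff_op_ring n) \<Longrightarrow> P d \<Longrightarrow> P e
      \<Longrightarrow> P (d \<oplus>\<^bsub>diff_op_ring n\<^esub> e)"
    and mult: "\<And>d e. d \<in> carrier (diff_op_ring n) \<Longrightarrow> e \<in> carrier (diff_op_ring n) \<Longrightarrow> P d \<Longrightarrow> P e
      \<Longrightarrow> P (d \<otimes>\<^bsub>diff_op_ring n\<^esub> e)"
  shows "P d"
proof -
  let ?D = "diff_op_ring n :: 'k diff_op ring"
  interpret ring ?D by (rule ring_diff_op_ring)
  have mono: "P (mult_op n (single m c))" if "keys m \<subseteq> {1..n}" "(\<Sum>j = 1..n. lookup m j) = k" for m c k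
    using that
  proof (induction k arbitrary: m)
    case 0
    have "m = 0"
    proof (rule poly_mapping_eqI)
      have "lookup m i = 0" if "i \<in> {1..n}" for i
        using 0(2) that by simp
      moreover have "lookup m i = 0" if "i \<notin> {1..n}" for i
        using 0(1) that by (meson in_keys_iff subsetD)
      ultimately show "lookup m i = lookup 0 i" for i by simp blast
    qed
    then show ?case using scalar[of c] by (simp add: scalar_op_def const_poly_def)
  next
    case (Suc k)
    have "\<exists>j \<in> {1..n}. lookup m j \<noteq> 0"
    proof (rule ccontr)
      assume "\<not> (\<exists>j \<in> {1..n}. lookup m j \<noteq> 0)"
      then have "(\<Sum>j = 1..n. lookup m j) = 0" by (intro sum.neutral) blast
      then show False using Suc.prems(2) by simp
    qed
    then obtain j where j: "j \<in> {1..n}" "lookup m j \<noteq> 0" by blast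
    let ?m = "m - single j 1"
    have m: "m = ?m + single j 1"
      using j by (intro poly_mapping_eqI) (auto simp: lookup_add lookup_minus lookup_single when_def)
    have k: "keys ?m \<subseteq> {1..n}"
      using Suc.prems(1) by (auto simp: in_keys_iff lookup_minus subset_iff)
    have "lookup m i = lookup ?m i + lookup (single j 1) i" for i
      using arg_cong[OF m, of "\<lambda>p. lookup p i"] by (simp only: lookup_add)
    then have "(\<Sum>i = 1..n. lookup m i) = (\<Sum>i = 1..n. lookup ?m i + lookup (single j 1) i)"
      by (rule sum.cong[OF refl])
    also have "\<dots> = (\<Sum>i = 1..n. lookup ?m i) + 1"
      using j by (simp add: sum.distrib lookup_single when_def)
    finally have "P (mult_op n (single ?m c))"
      using Suc.prems(2) by (intro Suc.IH[OF k]) linarith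
    moreover have "single ?m c \<in> polys n" using k by (simp add: polys_def)
    moreover have "single m c = var_poly j * single ?m c" by (simp only: var_poly_mult_single m[symmetric])
    ultimately show ?case using j var by (simp only: mult_op_mult var_in_polys) (rule mult; simp)
  qed
  have poly: "P (mult_op n f)" if "f \<in> polys n" for f
  proof -
    have p: "g \<in> polys n \<longleftrightarrow> keys g \<subseteq> {m. keys m \<subseteq> {1..n}}" for g :: "'k mpoly"
      by (auto simp: polys_def)
    from that[unfolded p] show ?thesis
    proof (induction rule: poly_mapping_add_induct)
      case zero
      then show ?case using scalar[of 0] by (simp add: scalar_op_def)
    next
      case (single m c)
      then show ?case using mono by blast
    next
      case (add u w)
      then have "u \<in> polys n" "w \<in> polys n" by (auto simp: p)
      then show ?case using add assms(5)[of "mult_op n u" "mult_op n w"]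
        by (simp only: mult_op_add) simp
    qed
  qed
  have "d \<in> generate_ring (endo_ring n) (mult_op n ` polys n \<union> partial_op n ` {1..n})"
    using assms(1) by (simp add: diff_op_ring_def)
  then have "d \<in> carrier ?D \<and> P d"
  proof induction
    case one
    then show ?case using scalar[of 1] one_closed by (simp only: scalar_op_one diff_op_ring_sel simp_thms)
  next
    case (incl h)
    then show ?case using poly partial by auto
  next
    case (a_inv h)
    then have "P (scalar_op n (- 1) \<otimes>\<^bsub>?D\<^esub> h)" by (intro mult scalar) auto
    then show ?case using a_inv a_inv_closed[of h] by (simp add: endo_uminus uminus_diff_op)
  next
    case (eng_add h1 h2)
    then show ?case using add[of h1 h2] a_closed[of h1 h2] by (simp only: diff_op_ring_sel simp_thms)
  next
    case (eng_mult h1 h2)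
    then show ?case using mult[of h1 h2] m_closed[of h1 h2] by (simp only: diff_op_ring_sel simp_thms)
  qed
  then show ?thesis by simp
qed

section \<open>Free modules of symbols\<close>

lemma symbols_zero [simp]: "0 \<in> symbols n r"
  by (simp add: symbols_def)

lemma symbols_add [simp]: "v \<in> symbols n r \<Longrightarrow> w \<in> symbols n r \<Longrightarrow> v + w \<in> symbols n r"
  using keys_add[of v w] unfolding symbols_def by blast

lemma symbols_iff_lookup: "v \<in> symbols n r \<longleftrightarrow> (\<forall>m. m \<notin> symbol_exps n r \<longrightarrow> lookup v m = 0)"
  unfolding symbols_def by (auto simp: in_keys_iff)

lemma symbols_uminus [simp]: "v \<in> symbols n r \<Longrightarrow> - v \<in> symbols n r"
  by (simp add: symbols_iff_lookup)

lemma symbols_diff [simp]: "v \<in> symbols n r \<Longrightarrow> w \<in> symbols n r \<Longrightarrow> v - w \<in> symbols n r"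
  by (simp add: symbols_iff_lookup lookup_minus)

lemma symbols_const [simp]: "v \<in> symbols n r \<Longrightarrow> const_poly c * v \<in> symbols n r"
  by (simp add: symbols_iff_lookup)

lemma symbols_sum: "(\<And>x. x \<in> A \<Longrightarrow> f x \<in> symbols n r) \<Longrightarrow> (\<Sum>x\<in>A. f x) \<in> symbols n r"
  by (induction A rule: infinite_finite_induct) auto

lemma symbols_single: "m \<in> symbol_exps n r \<Longrightarrow> single m c \<in> symbols n r"
  by (simp add: symbols_def)

lemma symbol_exps_add_single:
  assumes "m \<in> symbol_exps n r" "i \<in> {1..2 * n}"
  shows "m + single i k \<in> symbol_exps n r"
proof -
  have "keys (m + single i k) \<subseteq> {1..2 * n + 1}"
    using keys_add[of m "single i k"] assms by (auto simp: symbol_exps_def split: if_splits)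
  moreover have "gen_index n (m + single i k) = gen_index n m"
    using assms(2) by (simp add: gen_index_def lookup_add lookup_single when_def)
  ultimately show ?thesis using assms by (simp add: symbol_exps_def)
qed

lemma symbol_exps_diff_single:
  assumes "m \<in> symbol_exps n r" "i \<in> {1..2 * n}"
  shows "m - single i k \<in> symbol_exps n r"
proof -
  have "keys (m - single i k) \<subseteq> keys m" by (auto simp: in_keys_iff lookup_minus)
  moreover have "gen_index n (m - single i k) = gen_index n m"
    using assms(2) by (simp add: gen_index_def lookup_minus lookup_single when_def)
  ultimately show ?thesis using assms by (auto simp: symbol_exps_def)
qed

lemma symbol_exps_cancel_single:
  assumes "m + single i k \<in> symbol_exps n r" "i \<in> {1..2 * n}"
  shows "m \<in> symbol_exps n r"
  using symbol_exps_diff_single[OF assms, of k] by simp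

lemma symbols_var_mult:
  assumes "i \<in> {1..2 * n}" "v \<in> symbols n r"
  shows "var_poly i * v \<in> symbols n r"
  unfolding symbols_iff_lookup
proof (intro allI impI)
  fix m assume m: "m \<notin> symbol_exps n r"
  show "lookup (var_poly i * v) m = 0"
  proof (cases "lookup m i = 0")
    case False
    then have "m - single i 1 + single i 1 = m"
      by (intro poly_mapping_eqI) (auto simp: lookup_add lookup_minus lookup_single when_def)
    then have "m - single i 1 \<notin> symbol_exps n r"
      using m symbol_exps_add_single[OF _ assms(1), of "m - single i 1" r 1] by auto
    then show ?thesis using assms(2) by (simp add: lookup_var_poly_mult symbols_iff_lookup)
  qed (simp add: lookup_var_poly_mult)
qed

lemma symbols_partial_deriv:
  assumes "i \<in> {1..2 * n}" "v \<in> symbols n r"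
  shows "partial_deriv i v \<in> symbols n r"
  using assms symbol_exps_cancel_single[OF _ assms(1), of _ 1 r]
  by (auto simp: symbols_iff_lookup lookup_partial_deriv)

lemma symbols_var [simp]: "j \<in> {1..n} \<Longrightarrow> v \<in> symbols n r \<Longrightarrow> var_poly j * v \<in> symbols n r"
  by (rule symbols_var_mult) auto

lemma symbols_sym_deriv [simp]:
  assumes "j \<in> {1..n}" "v \<in> symbols n r"
  shows "sym_deriv n j v \<in> symbols n r"
proof -
  have "n + j \<in> {1..2 * n}" "j \<in> {1..2 * n}" using assms(1) by auto
  then show ?thesis
    using assms(2) by (simp add: sym_deriv_def symbols_var_mult symbols_partial_deriv)
qed

lemma gen_symbol_in_symbols [simp]: "s < r \<Longrightarrow> gen_symbol n s \<in> symbols n r"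
  by (auto simp: gen_symbol_def symbols_def symbol_exps_def parts_gen split: if_splits)

lemma sym_deriv_add: "sym_deriv n j (v + w) = sym_deriv n j v + sym_deriv n j w"
  by (simp add: sym_deriv_def partial_deriv_add algebra_simps)

lemma sym_deriv_const: "sym_deriv n j (const_poly c * v) = const_poly c * sym_deriv n j v"
  by (simp add: sym_deriv_def partial_deriv_const_mult distrib_left mult.left_commute)

section \<open>Induction over the monomials of a symbol\<close>

definition total_deg :: "nat \<Rightarrow> (nat \<Rightarrow>\<^sub>0 nat) \<Rightarrow> nat" where
  "total_deg n m = (\<Sum>i = 1..2 * n. lookup m i)"

lemma total_deg_add: "total_deg n (m + m') = total_deg n m + total_deg n m'"
  by (simp add: total_deg_def lookup_add sum.distrib)

lemma total_deg_single: "i \<in> {1..2 * n} \<Longrightarrow> total_deg n (single i k) = k"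
  by (simp add: total_deg_def lookup_single when_def)

lemma single_diff_add:
  "lookup m i \<noteq> 0 \<Longrightarrow> m - single i 1 + single i (1::nat) = m"
  by (intro poly_mapping_eqI) (auto simp: lookup_add lookup_minus lookup_single when_def)

text \<open>Every monomial is reached from a generator by multiplications with variables and
  derivatives, up to monomials of smaller total degree.\<close>

lemma symbol_mono_induct [consumes 1, case_names gen var deriv]:
  assumes "m \<in> symbol_exps n r"
    and gen: "\<And>s. s < r \<Longrightarrow> P (single (2 * n + 1) s)"
    and var: "\<And>m j. m \<in> symbol_exps n r \<Longrightarrow> j \<in> {1..n} \<Longrightarrow> P m \<Longrightarrow> P (m + single j 1)"
    and deriv: "\<And>m j. m \<in> symbol_exps n r \<Longrightarrow> j \<in> {1..n} \<Longrightarrow> P m \<Longrightarrow>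
      (lookup m j \<noteq> 0 \<Longrightarrow> P (m - single j 1)) \<Longrightarrow> P (m + single (n + j) 1)"
  shows "P m"
  using assms(1)
proof (induction "total_deg n m" arbitrary: m rule: less_induct)
  case less
  show ?case
  proof (cases "total_deg n m = 0")
    case True
    have "m = single (2 * n + 1) (gen_index n m)"
    proof (rule poly_mapping_eqI)
      fix i
      have "lookup m i = 0" if "i \<in> {1..2 * n}" using True that by (simp add: total_deg_def)
      moreover have "lookup m i = 0" if "i \<notin> {1..2 * n + 1}"
        using less.prems that unfolding symbol_exps_def by (metis (mono_tags, lifting) in_keys_iff mem_Collect_eq subsetD)
      moreover have "i \<in> {1..2 * n} \<or> i = 2 * n + 1 \<or> i \<notin> {1..2 * n + 1}" by auto
      ultimately show "lookup m i = lookup (single (2 * n + 1) (gen_index n m)) i"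
        by (auto simp: lookup_single when_def gen_index_def)
    qed
    moreover have "gen_index n m < r" using less.prems by (simp add: symbol_exps_def)
    ultimately show ?thesis using gen by metis
  next
    case False
    then obtain i where i: "i \<in> {1..2 * n}" "lookup m i \<noteq> 0"
      unfolding total_deg_def by (meson sum.neutral)
    let ?m = "m - single i 1"
    have m: "?m + single i 1 = m" using i by (rule_tac single_diff_add)
    have mem: "?m \<in> symbol_exps n r" using less.prems i(1) by (rule symbol_exps_diff_single)
    have deg: "total_deg n m = total_deg n ?m + 1"
      using arg_cong[OF m, of "total_deg n"] i(1) by (simp only: total_deg_add total_deg_single)
    have IH: "P ?m" using less.hyps[OF _ mem] deg by simp
    show ?thesis
    proof (cases "i \<le> n")
      case True
      then have "P (?m + single i 1)" using i mem IH by (intro var) auto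
      then show ?thesis by (simp only: m)
    next
      case False
      then have j: "i - n \<in> {1..n}" "n + (i - n) = i" using i(1) by auto
      have "P (?m - single (i - n) 1)" if l: "lookup ?m (i - n) \<noteq> 0"
      proof (rule less.hyps)
        have "i - n \<in> {1..2 * n}" using j(1) by auto
        then show "?m - single (i - n) 1 \<in> symbol_exps n r" "total_deg n (?m - single (i - n) 1) < total_deg n m"
          using symbol_exps_diff_single[OF mem] arg_cong[OF single_diff_add[OF l], of "total_deg n"] deg
          by (simp_all add: total_deg_add total_deg_single)
      qed
      then have "P (?m + single (n + (i - n)) 1)" using mem j(1) IH by (intro deriv) auto
      then show ?thesis by (simp only: m j(2))
    qed
  qed
qed

text \<open>The module operations reach every symbol from the generators: \<open>\<xi>_j\<close>
  times a monomial m is \<open>sym_deriv n j\<close> of m minus a multiple of m / x_j, which has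
  smaller total degree.\<close>

lemma symbols_induct [consumes 1, case_names add zero const gen var deriv]:
  fixes v :: "'k::field_char_0 mpoly"
  assumes "v \<in> symbols n r"
    and add: "\<And>v w. v \<in> symbols n r \<Longrightarrow> w \<in> symbols n r \<Longrightarrow> P v \<Longrightarrow> P w \<Longrightarrow> P (v + w)"
    and zero: "P 0"
    and const: "\<And>c v. v \<in> symbols n r \<Longrightarrow> P v \<Longrightarrow> P (const_poly c * v)"
    and gen: "\<And>s. s < r \<Longrightarrow> P (gen_symbol n s)"
    and var: "\<And>j v. j \<in> {1..n} \<Longrightarrow> v \<in> symbols n r \<Longrightarrow> P v \<Longrightarrow> P (var_poly j * v)"
    and deriv: "\<And>j v. j \<in> {1..n} \<Longrightarrow> v \<in> symbols n r \<Longrightarrow> P v \<Longrightarrow> P (sym_deriv n j v)"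
  shows "P v"
proof -
  have one: "P (single m 1)" if "m \<in> symbol_exps n r" for m
    using that
  proof (induction rule: symbol_mono_induct)
    case (gen s)
    then show ?case using assms(5)[of s] by (simp add: gen_symbol_def)
  next
    case (var m j)
    then show ?case using assms(6)[of j "single m 1"] by (simp add: symbols_single)
  next
    case (deriv m j)
    have s: "single m (1::'k) \<in> symbols n r" using deriv(1) by (rule symbols_single)
    have 1: "P (sym_deriv n j (single m 1))" using assms(7)[OF deriv(2) s] deriv(3) by blast
    have e: "sym_deriv n j (single m 1) = single (m + single (n + j) 1) (1::'k) +
        single (m - single j 1) (of_nat (lookup m j))" by (simp add: sym_deriv_def)
    show ?case
    proof (cases "lookup m j = 0")
      case True
      then show ?thesis using 1 e by simp
    next
      case False
      have j: "j \<in> {1..2 * n}" using deriv(2) by auto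
      let ?u = "single (m - single j 1) (1::'k)"
      have u: "?u \<in> symbols n r" "P ?u"
        using symbol_exps_diff_single[OF deriv(1) j] deriv(4)[OF False] by (auto intro: symbols_single)
      have "P (sym_deriv n j (single m 1) + const_poly (- of_nat (lookup m j)) * ?u)"
        using u s deriv(2) 1 by (intro add const symbols_const symbols_sym_deriv) auto
      moreover have "sym_deriv n j (single m 1) + const_poly (- of_nat (lookup m j)) * ?u =
          single (m + single (n + j) 1) (1::'k)"
        unfolding e by (simp add: add.assoc flip: single_add)
      ultimately show ?thesis by simp
    qed
  qed
  have s: "P (single m c)" "single m c \<in> symbols n r" if "m \<in> symbol_exps n r" for m c
    using const[OF _ one[OF that], of c] that by (simp_all add: symbols_single)
  have v: "keys v \<subseteq> symbol_exps n r" using assms(1) by (simp add: symbols_def)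
  show ?thesis
    using v
  proof (induction rule: poly_mapping_add_induct)
    case zero
    then show ?case by (rule assms(3))
  next
    case (single m c)
    then show ?case by (rule s)
  next
    case (add u w)
    then show ?case by (intro assms(2)) (auto simp: symbols_def)
  qed
qed

section \<open>Faithfulness of the action of symbols on polynomials\<close>

lemma exp_fact_0 [simp]: "exp_fact n 0 = 1"
  by (simp add: exp_fact_def)

lemma keys_dpart: "keys (dpart n m) \<subseteq> {1..n}"
  using lookup_dpart[of n m] by (auto simp: in_keys_iff split: if_splits)

lemma sum_sym_op_lookup:
  "lookup (sym_op n v s f) p = (\<Sum>m \<in> keys v. if gen_index n m = s
     then lookup (single (xpart n m) (lookup v m) * iter_deriv n (dpart n m) f) p else 0)"
  by (auto simp: sym_op_def lookup_sum intro!: sum.cong)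

text \<open>A nonzero symbol does not vanish on \<open>x\<^sup>b\<close> when \<open>b\<close> is the exponent of \<open>\<xi>\<close> in a term whose
  degree in \<open>\<xi>\<close> is minimal.\<close>

lemma sym_op_faithful:
  fixes v :: "'k::field_char_0 mpoly"
  assumes "v \<in> symbols n r" "\<And>s f. f \<in> polys n \<Longrightarrow> sym_op n v s f = 0"
  shows "v = 0"
proof (rule ccontr)
  assume "v \<noteq> 0"
  define w where "w m = (\<Sum>j = 1..n. lookup m j)" for m :: "nat \<Rightarrow>\<^sub>0 nat"
  obtain m0 where "m0 \<in> keys v" using \<open>v \<noteq> 0\<close> by (metis keys_eq_empty equals0I)
  then obtain m where m: "m \<in> keys v" "\<And>m'. m' \<in> keys v \<Longrightarrow> w (dpart n m) \<le> w (dpart n m')"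
    using ex_has_least_nat[of "\<lambda>m. m \<in> keys v" m0 "\<lambda>m. w (dpart n m)"] by blast
  define b where "b = dpart n m"
  define f where "f = single b (1::'k)"
  have bk: "keys b \<subseteq> {1..n}" unfolding b_def by (rule keys_dpart)
  then have f: "f \<in> polys n" by (simp add: f_def polys_def)
  have exps: "m' \<in> symbol_exps n r" if "m' \<in> keys v" for m'
    using assms(1) that by (auto simp: symbols_def)
  \<comment> \<open>A derivative of \<open>x^b\<close> with exponent c is nonzero only if c is at
    most \<open>b\<close> in every coordinate. No exponent c in \<open>v\<close> has smaller degree
    than \<open>b\<close>, so c must be equal to \<open>b\<close>.\<close>
  have it: "iter_deriv n (dpart n m') f = (if dpart n m' = b then single 0 (exp_fact n b) else 0)"
    if m': "m' \<in> keys v" for m'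
  proof (rule poly_mapping_eqI)
    fix p
    have p0: "p = 0" if p: "b = p + dpart n m'"
    proof (rule poly_mapping_eqI)
      fix i
      have "w b = w p + w (dpart n m')" unfolding p w_def by (simp add: lookup_add sum.distrib)
      then have "w p = 0" using m(2)[OF m'] by (simp add: b_def)
      then have "lookup p i = 0" if "i \<in> {1..n}" using that by (simp add: w_def)
      moreover have "lookup p i = 0" if "i \<notin> {1..n}"
      proof -
        have "i \<notin> keys b" using bk that by blast
        then show ?thesis by (simp add: p in_keys_iff lookup_add)
      qed
      ultimately show "lookup p i = lookup 0 i" by simp blast
    qed
    show "lookup (iter_deriv n (dpart n m') f) p =
        lookup (if dpart n m' = b then single 0 (exp_fact n b) else 0) p"
    proof (cases "b = p + dpart n m'")
      case True
      then show ?thesis using p0 by (simp add: iter_deriv.rep_eq f_def)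
    next
      case False
      then have "\<not> (dpart n m' = b \<and> p = 0)" by auto
      then show ?thesis using False by (auto simp: iter_deriv.rep_eq f_def lookup_single when_def)
    qed
  qed
  \<comment> \<open>The surviving terms share the \<xi>-exponent \<open>b\<close> and the generator,
    hence differ in their x-part; the coefficient at \<open>xpart n m\<close> sees the term of
    \<open>m\<close> alone.\<close>
  have "lookup (sym_op n v (gen_index n m) f) (xpart n m) =
      (\<Sum>m' \<in> keys v. if m' = m then lookup v m * exp_fact n b else 0)"
    unfolding sum_sym_op_lookup
  proof (rule sum.cong[OF refl])
    fix m' assume m': "m' \<in> keys v"
    have "m' = m" if "gen_index n m' = gen_index n m" "dpart n m' = b" "xpart n m' = xpart n m"
      using symbol_exps_eqI[OF exps[OF m'] exps[OF m(1)]] that by (simp add: b_def)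
    then show "(if gen_index n m' = gen_index n m then lookup (single (xpart n m') (lookup v m') *
        iter_deriv n (dpart n m') f) (xpart n m) else 0) =
      (if m' = m then lookup v m * exp_fact n b else 0)"
      using it[OF m'] b_def by (auto simp: mult_single lookup_single when_def)
  qed
  also have "\<dots> = lookup v m * exp_fact n b" using m(1) by simp
  finally show False using assms(2)[OF f] m(1) by (simp add: in_keys_iff)
qed

lemma symbols_eqI:
  assumes "v \<in> symbols n r" "w \<in> symbols n r" "\<And>s f. f \<in> polys n \<Longrightarrow> sym_op n v s f = sym_op n w s f"
  shows "v = w"
proof -
  have "sym_op n (v - w) s f = 0" if "f \<in> polys n" for s f
    using sym_op_add[of n v "- w" s f] assms(3)[OF that] by (simp add: sym_op_uminus)
  then show ?thesis using sym_op_faithful[of "v - w" n r] assms(1,2) by simp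
qed

section \<open>The module structure on symbols\<close>

definition sym_diff_op :: "nat \<Rightarrow> 'k::field_char_0 mpoly \<Rightarrow> nat \<Rightarrow> 'k diff_op" where
  "sym_diff_op n v s = (\<lambda>f \<in> polys n. sym_op n v s f)"

lemma sym_diff_op_add:
  "sym_diff_op n (v + w) s = sym_diff_op n v s \<oplus>\<^bsub>diff_op_ring n\<^esub> sym_diff_op n w s"
  by (auto simp: sym_diff_op_def diff_op_ring_sel endo_ring_def sym_op_add intro!: restrict_ext)

lemma sym_diff_op_in:
  fixes v :: "'k::field_char_0 mpoly"
  assumes "v \<in> symbols n r"
  shows "sym_diff_op n v s \<in> carrier (diff_op_ring n)"
proof -
  let ?D = "diff_op_ring n :: 'k diff_op ring"
  interpret ring ?D by (rule ring_diff_op_ring)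
  have eq: "d = sym_diff_op n u s" if "d \<in> carrier ?D" "\<And>f. f \<in> polys n \<Longrightarrow> sym_op n u s f = d f" for d u
    using diff_op_in_endo[OF that(1)] that(2)
    by (intro extensionalityI[of _ "polys n"]) (auto simp: sym_diff_op_def endo_ring_def PiE_def)
  have app: "sym_op n u s f = sym_diff_op n u s f" if "f \<in> polys n" for u f
    using that by (simp add: sym_diff_op_def)
  show ?thesis
    using assms
  proof (induction rule: symbols_induct)
    case (add v w)
    then show ?case by (simp add: sym_diff_op_add)
  next
    case zero
    have "\<zero>\<^bsub>?D\<^esub> = sym_diff_op n 0 s" by (rule eq) (simp_all add: diff_op_zero_app)
    then show ?case using zero_closed by metis
  next
    case (const c v)
    have "scalar_op n c \<otimes>\<^bsub>?D\<^esub> sym_diff_op n v s = sym_diff_op n (const_poly c * v) s"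
      using const.IH diff_op_polys[OF const.IH]
      by (intro eq) (auto simp: diff_op_mult_app scalar_op_app sym_op_const app)
    then show ?case using const.IH m_closed by (metis scalar_op_in_diff_op)
  next
    case (gen t)
    have "(if t = s then \<one>\<^bsub>?D\<^esub> else \<zero>\<^bsub>?D\<^esub>) = sym_diff_op n (gen_symbol n t) s"
      by (rule eq) (auto simp: sym_op_gen diff_op_zero_app diff_op_one_app)
    then show ?case using zero_closed one_closed by metis
  next
    case (var j v)
    have "mult_op n (var_poly j) \<otimes>\<^bsub>?D\<^esub> sym_diff_op n v s = sym_diff_op n (var_poly j * v) s"
      using var.hyps var.IH diff_op_polys[OF var.IH] m_closed[OF mult_op_in_diff_op[OF var_in_polys[OF var.hyps(1)]] var.IH]
      by (intro eq) (auto simp: diff_op_mult_app mult_op_def sym_op_var app)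
    then show ?case using var.IH var.hyps m_closed by (metis mult_op_in_diff_op var_in_polys)
  next
    case (deriv j v)
    have "partial_op n j \<otimes>\<^bsub>?D\<^esub> sym_diff_op n v s = sym_diff_op n (sym_deriv n j v) s"
      using deriv.hyps deriv.IH diff_op_polys[OF deriv.IH] m_closed[OF partial_op_in_diff_op[OF deriv.hyps(1)] deriv.IH]
      by (intro eq) (auto simp: diff_op_mult_app partial_op_def sym_op_deriv app)
    then show ?case using deriv.IH deriv.hyps m_closed by (metis partial_op_in_diff_op)
  qed
qed

lemma sym_op_polys: "v \<in> symbols n r \<Longrightarrow> f \<in> polys n \<Longrightarrow> sym_op n v s f \<in> polys n"
  using diff_op_polys[OF sym_diff_op_in[of v n r s]] by (simp add: sym_diff_op_def)

text \<open>The action is transported along the faithful representation \<open>sym_op\<close>: the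
  components of \<open>v'\<close> are those of \<open>v\<close> followed by \<open>d\<close>.
  Existence is checked on the generators of the ring; uniqueness is \<open>symbols_eqI\<close>, and
  through it the module axioms are inherited from the composition of operators.\<close>

definition is_sym_action :: "nat \<Rightarrow> nat \<Rightarrow> 'k::field_char_0 diff_op \<Rightarrow> 'k mpoly \<Rightarrow> 'k mpoly \<Rightarrow> bool" where
  "is_sym_action n r d v v' \<longleftrightarrow>
     v' \<in> symbols n r \<and> (\<forall>s. \<forall>f \<in> polys n. sym_op n v' s f = d (sym_op n v s f))"

definition sym_action :: "nat \<Rightarrow> nat \<Rightarrow> 'k::field_char_0 diff_op \<Rightarrow> 'k mpoly \<Rightarrow> 'k mpoly" where
  "sym_action n r d v = (THE v'. is_sym_action n r d v v')"

lemma sym_action_eq: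
  assumes "is_sym_action n r d v v'"
  shows "sym_action n r d v = v'"
  unfolding sym_action_def
proof (rule the_equality)
  show "is_sym_action n r d v v'" by fact
  show "w = v'" if "is_sym_action n r d v w" for w
    using that assms by (intro symbols_eqI[of w n r v']) (auto simp: is_sym_action_def)
qed

lemma is_sym_action_exists:
  fixes d :: "'k::field_char_0 diff_op"
  assumes "d \<in> carrier (diff_op_ring n)" "v \<in> symbols n r"
  shows "\<exists>v'. is_sym_action n r d v v'"
  using assms
proof (induction arbitrary: v rule: diff_op_induct)
  case (scalar c)
  then have "is_sym_action n r (scalar_op n c) v (const_poly c * v)"
    by (auto simp: is_sym_action_def sym_op_const scalar_op_app sym_op_polys)
  then show ?case by blast
next
  case (var j)
  then have "is_sym_action n r (mult_op n (var_poly j)) v (var_poly j * v)"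
    by (auto simp: is_sym_action_def sym_op_var mult_op_def sym_op_polys)
  then show ?case by blast
next
  case (partial j)
  then have "is_sym_action n r (partial_op n j) v (sym_deriv n j v)"
    by (auto simp: is_sym_action_def sym_op_deriv partial_op_def sym_op_polys)
  then show ?case by blast
next
  case (add d e)
  then obtain v1 v2 where "is_sym_action n r d v v1" "is_sym_action n r e v v2" by blast
  then have "is_sym_action n r (d \<oplus>\<^bsub>diff_op_ring n\<^esub> e) v (v1 + v2)"
    using add.prems by (auto simp: is_sym_action_def sym_op_add diff_op_add_app sym_op_polys)
  then show ?case by blast
next
  case (mult d e)
  then obtain v1 where v1: "is_sym_action n r e v v1" by blast
  then have "v1 \<in> symbols n r" by (simp add: is_sym_action_def)
  then obtain v2 where "is_sym_action n r d v1 v2" using mult.IH(1) by blast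
  then have "is_sym_action n r (d \<otimes>\<^bsub>diff_op_ring n\<^esub> e) v v2"
    using v1 mult.prems by (auto simp: is_sym_action_def diff_op_mult_app sym_op_polys)
  then show ?case by blast
qed

lemma sym_action_closed [simp]:
  "d \<in> carrier (diff_op_ring n) \<Longrightarrow> v \<in> symbols n r \<Longrightarrow> sym_action n r d v \<in> symbols n r"
  using is_sym_action_exists sym_action_eq by (metis is_sym_action_def)

lemma sym_op_action:
  "d \<in> carrier (diff_op_ring n) \<Longrightarrow> v \<in> symbols n r \<Longrightarrow> f \<in> polys n \<Longrightarrow>
    sym_op n (sym_action n r d v) s f = d (sym_op n v s f)"
  using is_sym_action_exists sym_action_eq by (metis is_sym_action_def)

lemma sym_action_gens:
  assumes "v \<in> symbols n r"
  shows "sym_action n r (scalar_op n c) v = const_poly c * v"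
    and "j \<in> {1..n} \<Longrightarrow> sym_action n r (mult_op n (var_poly j)) v = var_poly j * v"
    and "j \<in> {1..n} \<Longrightarrow> sym_action n r (partial_op n j) v = sym_deriv n j v"
  using assms
  by (auto intro!: sym_action_eq simp: is_sym_action_def sym_op_const scalar_op_app sym_op_polys
      sym_op_var mult_op_def sym_op_deriv partial_op_def)

definition free_module :: "nat \<Rightarrow> nat \<Rightarrow> ('k::field_char_0 diff_op, 'k mpoly) module" where
  "free_module n r = \<lparr> carrier = symbols n r, monoid.mult = \<lambda>_ _. undefined, one = undefined,
     zero = 0, add = (+), module.smult = sym_action n r \<rparr>"

lemma free_module_sel [simp]:
  "carrier (free_module n r) = symbols n r" "\<zero>\<^bsub>free_module n r\<^esub> = 0"
  "add (free_module n r) = (+)" "module.smult (free_module n r) = sym_action n r"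
  by (simp_all add: free_module_def)

lemma left_module_free_module:
  "left_module (diff_op_ring n :: 'k::field_char_0 diff_op ring) (free_module n r)"
proof -
  let ?D = "diff_op_ring n :: 'k diff_op ring"
  interpret D: ring ?D by (rule ring_diff_op_ring)
  have "abelian_group (free_module n r :: ('k diff_op, 'k mpoly) module)"
  proof (rule abelian_groupI)
    fix v :: "'k mpoly" assume "v \<in> carrier (free_module n r)"
    then have "- v \<in> carrier (free_module n r)" "- v \<oplus>\<^bsub>free_module n r\<^esub> v = \<zero>\<^bsub>free_module n r\<^esub>" by simp_all
    then show "\<exists>y\<in>carrier (free_module n r). y \<oplus>\<^bsub>free_module n r\<^esub> v = \<zero>\<^bsub>free_module n r\<^esub>" by blast
  qed (auto simp: add_ac)
  moreover have "left_module_axioms ?D (free_module n r)"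
  proof
    fix d e :: "'k diff_op" and x y :: "'k mpoly"
    assume x: "x \<in> carrier (free_module n r)"
    show "\<one>\<^bsub>?D\<^esub> \<odot>\<^bsub>free_module n r\<^esub> x = x"
      using x by (simp add: sym_action_gens flip: scalar_op_one)
    assume d: "d \<in> carrier ?D"
    show "d \<odot>\<^bsub>free_module n r\<^esub> x \<in> carrier (free_module n r)" using x d by simp
    show "d \<odot>\<^bsub>free_module n r\<^esub> (x \<oplus>\<^bsub>free_module n r\<^esub> y) =
        d \<odot>\<^bsub>free_module n r\<^esub> x \<oplus>\<^bsub>free_module n r\<^esub> d \<odot>\<^bsub>free_module n r\<^esub> y" if "y \<in> carrier (free_module n r)"
      using x d that
      by (auto intro!: sym_action_eq simp: is_sym_action_def sym_op_action sym_op_add sym_op_polys diff_op_additive)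
    assume e: "e \<in> carrier ?D"
    show "(d \<oplus>\<^bsub>?D\<^esub> e) \<odot>\<^bsub>free_module n r\<^esub> x = d \<odot>\<^bsub>free_module n r\<^esub> x \<oplus>\<^bsub>free_module n r\<^esub> e \<odot>\<^bsub>free_module n r\<^esub> x"
      using x d e
      by (auto intro!: sym_action_eq simp: is_sym_action_def sym_op_action sym_op_add sym_op_polys diff_op_add_app)
    show "(d \<otimes>\<^bsub>?D\<^esub> e) \<odot>\<^bsub>free_module n r\<^esub> x = d \<odot>\<^bsub>free_module n r\<^esub> (e \<odot>\<^bsub>free_module n r\<^esub> x)"
      using x d e
      by (auto intro!: sym_action_eq simp: is_sym_action_def sym_op_action sym_op_polys diff_op_mult_app)
  qed
  ultimately show ?thesis by (simp add: left_module_def ring_diff_op_ring)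
qed

lemma free_module_lin_hom_eq:
  fixes f g :: "'k::field_char_0 mpoly \<Rightarrow> 'x"
  assumes N: "left_module (diff_op_ring n) N" and f: "f \<in> lin_hom (diff_op_ring n) (free_module n r) N"
    and g: "g \<in> lin_hom (diff_op_ring n) (free_module n r) N"
    and gen: "\<And>s. s < r \<Longrightarrow> f (gen_symbol n s) = g (gen_symbol n s)"
    and v: "v \<in> symbols n r"
  shows "f v = g v"
  using v
proof (induction rule: symbols_induct)
  case (add v w)
  then show ?case using lin_hom_add[OF f, of v w] lin_hom_add[OF g, of v w] by simp
next
  case zero
  then show ?case
    using lin_hom_zero[OF left_module_free_module N f] lin_hom_zero[OF left_module_free_module N g] by simp
next
  case (const c v)
  then show ?case
    using lin_hom_smult[OF f, of "scalar_op n c" v] lin_hom_smult[OF g, of "scalar_op n c" v]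
    by (simp add: sym_action_gens)
next
  case (gen s)
  then show ?case by (rule assms(4))
next
  case (var j v)
  then show ?case
    using lin_hom_smult[OF f, of "mult_op n (var_poly j)" v] lin_hom_smult[OF g, of "mult_op n (var_poly j)" v]
    by (simp add: sym_action_gens)
next
  case (deriv j v)
  then show ?case
    using lin_hom_smult[OF f, of "partial_op n j" v] lin_hom_smult[OF g, of "partial_op n j" v]
    by (simp add: sym_action_gens)
qed

text \<open>The operators \<open>sym_diff_op n v s\<close> are the coordinates of \<open>v\<close>
  with respect to the generators, so this is the linear map that takes the values \<open>g s\<close>
  on them.\<close>

definition free_map ::
  "nat \<Rightarrow> nat \<Rightarrow> ('k::field_char_0 diff_op, 'x) module \<Rightarrow> (nat \<Rightarrow> 'x) \<Rightarrow> 'k mpoly \<Rightarrow> 'x" where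
  "free_map n r N g = (\<lambda>v \<in> symbols n r. \<Oplus>\<^bsub>N\<^esub>s\<in>{..<r}. sym_diff_op n v s \<odot>\<^bsub>N\<^esub> g s)"

lemma
  fixes N :: "('k::field_char_0 diff_op, 'x) module"
  assumes N: "left_module (diff_op_ring n) N" and g: "\<And>s. s < r \<Longrightarrow> g s \<in> carrier N"
  shows free_map_lin_hom: "free_map n r N g \<in> lin_hom (diff_op_ring n) (free_module n r) N"
    and free_map_gen: "s < r \<Longrightarrow> free_map n r N g (gen_symbol n s) = g s"
proof -
  let ?D = "diff_op_ring n :: 'k diff_op ring"
  interpret N: left_module ?D N by fact
  have cl: "sym_diff_op n v s \<odot>\<^bsub>N\<^esub> g s \<in> carrier N" if "v \<in> symbols n r" "s < r" for v s
    using that g sym_diff_op_in by (intro N.smult_closed) auto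
  have act: "sym_diff_op n (sym_action n r d v) s = d \<otimes>\<^bsub>?D\<^esub> sym_diff_op n v s"
    if "d \<in> carrier ?D" "v \<in> symbols n r" for d v s
    using that sym_diff_op_in[OF that(2)] sym_diff_op_in[OF sym_action_closed[OF that]]
    by (intro diff_op_eqI[of _ n]) (auto simp: diff_op_mult_app sym_op_action sym_diff_op_def)
  show "free_map n r N g \<in> lin_hom ?D (free_module n r) N"
    unfolding free_map_def free_module_sel(1)[symmetric]
  proof (rule lin_hom_restrict[OF _ _ _ left_module_free_module])
    fix v w :: "'k mpoly" and d assume v: "v \<in> carrier (free_module n r)"
    then have cv: "(\<lambda>s. sym_diff_op n v s \<odot>\<^bsub>N\<^esub> g s) \<in> {..<r} \<rightarrow> carrier N" using cl by auto
    then show "(\<Oplus>\<^bsub>N\<^esub>s\<in>{..<r}. sym_diff_op n v s \<odot>\<^bsub>N\<^esub> g s) \<in> carrier N" by (rule N.finsum_closed)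
    { assume w: "w \<in> carrier (free_module n r)"
      then have cw: "(\<lambda>s. sym_diff_op n w s \<odot>\<^bsub>N\<^esub> g s) \<in> {..<r} \<rightarrow> carrier N" using cl by auto
      have "(\<Oplus>\<^bsub>N\<^esub>s\<in>{..<r}. sym_diff_op n (v + w) s \<odot>\<^bsub>N\<^esub> g s) =
          (\<Oplus>\<^bsub>N\<^esub>s\<in>{..<r}. (sym_diff_op n v s \<odot>\<^bsub>N\<^esub> g s) \<oplus>\<^bsub>N\<^esub> (sym_diff_op n w s \<odot>\<^bsub>N\<^esub> g s))"
        using v w sym_diff_op_in g cv cw
        by (intro N.finsum_cong') (auto simp: sym_diff_op_add Pi_iff intro!: N.smult_l_distr)
      also have "\<dots> = (\<Oplus>\<^bsub>N\<^esub>s\<in>{..<r}. sym_diff_op n v s \<odot>\<^bsub>N\<^esub> g s) \<oplus>\<^bsub>N\<^esub> (\<Oplus>\<^bsub>N\<^esub>s\<in>{..<r}. sym_diff_op n w s \<odot>\<^bsub>N\<^esub> g s)"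
        using cv cw by (rule N.finsum_addf)
      finally show "(\<Oplus>\<^bsub>N\<^esub>s\<in>{..<r}. sym_diff_op n (v \<oplus>\<^bsub>free_module n r\<^esub> w) s \<odot>\<^bsub>N\<^esub> g s) =
        (\<Oplus>\<^bsub>N\<^esub>s\<in>{..<r}. sym_diff_op n v s \<odot>\<^bsub>N\<^esub> g s) \<oplus>\<^bsub>N\<^esub> (\<Oplus>\<^bsub>N\<^esub>s\<in>{..<r}. sym_diff_op n w s \<odot>\<^bsub>N\<^esub> g s)"
        by simp }
    { assume d: "d \<in> carrier ?D"
      have "(\<Oplus>\<^bsub>N\<^esub>s\<in>{..<r}. sym_diff_op n (sym_action n r d v) s \<odot>\<^bsub>N\<^esub> g s) =
          (\<Oplus>\<^bsub>N\<^esub>s\<in>{..<r}. d \<odot>\<^bsub>N\<^esub> (sym_diff_op n v s \<odot>\<^bsub>N\<^esub> g s))"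
        using v d sym_diff_op_in g cv
        by (intro N.finsum_cong') (auto simp: act Pi_iff intro!: N.smult_assoc1)
      also have "\<dots> = d \<odot>\<^bsub>N\<^esub> (\<Oplus>\<^bsub>N\<^esub>s\<in>{..<r}. sym_diff_op n v s \<odot>\<^bsub>N\<^esub> g s)"
        using d cv by (simp add: N.smult_finsum)
      finally show "(\<Oplus>\<^bsub>N\<^esub>s\<in>{..<r}. sym_diff_op n (d \<odot>\<^bsub>free_module n r\<^esub> v) s \<odot>\<^bsub>N\<^esub> g s) =
        d \<odot>\<^bsub>N\<^esub> (\<Oplus>\<^bsub>N\<^esub>s\<in>{..<r}. sym_diff_op n v s \<odot>\<^bsub>N\<^esub> g s)" by simp }
  qed
  assume s: "s < r"
  have d: "sym_diff_op n (gen_symbol n s) t = (if t = s then \<one>\<^bsub>?D\<^esub> else \<zero>\<^bsub>?D\<^esub>)" for t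
  proof (rule diff_op_eqI)
    show "sym_diff_op n (gen_symbol n s) t \<in> carrier ?D" using s by (intro sym_diff_op_in[of _ n r]) simp
  qed (auto simp: diff_op_one_app diff_op_zero_app sym_op_gen sym_diff_op_def)
  have "free_map n r N g (gen_symbol n s) = (\<Oplus>\<^bsub>N\<^esub>t\<in>{..<r}. if s = t then g t else \<zero>\<^bsub>N\<^esub>)"
    unfolding free_map_def using s g by (auto simp: d intro!: N.finsum_cong')
  also have "\<dots> = g s" using s g by (intro N.add.finprod_singleton) auto
  finally show "free_map n r N g (gen_symbol n s) = g s" .
qed

section \<open>Submodules, images and kernels\<close>

definition submodule_set :: "('a, 'y) ring_scheme \<Rightarrow> ('a, 'm) module \<Rightarrow> 'm set \<Rightarrow> bool" where
  "submodule_set R N K \<longleftrightarrow> K \<subseteq> carrier N \<and> \<zero>\<^bsub>N\<^esub> \<in> K \<and> (\<forall>x\<in>K. \<forall>y\<in>K. x \<oplus>\<^bsub>N\<^esub> y \<in> K) \<and>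
     (\<forall>a\<in>carrier R. \<forall>x\<in>K. a \<odot>\<^bsub>N\<^esub> x \<in> K)"

lemma submodule_set_image:
  assumes "left_module R A" "left_module R B" "f \<in> lin_hom R A B"
  shows "submodule_set R B (f ` carrier A)"
proof -
  interpret A: left_module R A by fact
  interpret B: left_module R B by fact
  show ?thesis
    unfolding submodule_set_def
  proof (intro conjI ballI)
    show "f ` carrier A \<subseteq> carrier B" using lin_hom_closed[OF assms(3)] by blast
    show "\<zero>\<^bsub>B\<^esub> \<in> f ` carrier A" using lin_hom_zero[OF assms] A.zero_closed by (metis imageI)
    show "x \<oplus>\<^bsub>B\<^esub> y \<in> f ` carrier A" if "x \<in> f ` carrier A" "y \<in> f ` carrier A" for x y
    proof -
      obtain a b where "a \<in> carrier A" "b \<in> carrier A" "x = f a" "y = f b" using \<open>x \<in> f ` carrier A\<close> \<open>y \<in> f ` carrier A\<close> by blast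
      then show ?thesis using lin_hom_add[OF assms(3), of a b] A.a_closed by (metis imageI)
    qed
    show "r \<odot>\<^bsub>B\<^esub> x \<in> f ` carrier A" if "r \<in> carrier R" "x \<in> f ` carrier A" for r x
    proof -
      obtain a where "a \<in> carrier A" "x = f a" using \<open>x \<in> f ` carrier A\<close> by blast
      then show ?thesis using lin_hom_smult[OF assms(3) \<open>r \<in> carrier R\<close>, of a] A.smult_closed \<open>r \<in> carrier R\<close> by (metis imageI)
    qed
  qed
qed

lemma submodule_set_kernel:
  assumes "left_module R A" "left_module R B" "f \<in> lin_hom R A B"
  shows "submodule_set R A {x \<in> carrier A. f x = \<zero>\<^bsub>B\<^esub>}"
proof -
  interpret A: left_module R A by fact
  interpret B: left_module R B by fact
  show ?thesis
    by (auto simp: submodule_set_def lin_hom_zero[OF assms] lin_hom_add[OF assms(3)] lin_hom_smult[OF assms(3)])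
qed

lemma free_map_image_subset:
  fixes N :: "('k::field_char_0 diff_op, 'x) module"
  assumes N: "left_module (diff_op_ring n) N" and K: "submodule_set (diff_op_ring n) N K"
    and g: "\<And>s. s < r \<Longrightarrow> g s \<in> K"
  shows "free_map n r N g ` symbols n r \<subseteq> K"
proof -
  interpret N: left_module "diff_op_ring n :: 'k diff_op ring" N by fact
  have "(\<Oplus>\<^bsub>N\<^esub>s\<in>{..<r}. sym_diff_op n v s \<odot>\<^bsub>N\<^esub> g s) \<in> K" if "v \<in> symbols n r" for v
    using K g that sym_diff_op_in[OF that]
    by (intro N.finsum_closed_sub) (auto simp: submodule_set_def Pi_iff)
  then show ?thesis by (auto simp: free_map_def)
qed

section \<open>Acyclicity of the de Rham complex of a free module\<close>

lemma const_poly_uminus: "const_poly (- c) = - const_poly c"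
  by (simp add: const_poly_def single_uminus)

lemma const_poly_minus_one_power: "const_poly ((- 1) ^ k) = (- 1) ^ k"
  by (induction k) (simp_all add: const_poly_uminus)

lemma sym_deriv_sign: "sym_deriv n s ((- 1) ^ k * v) = (- 1) ^ k * sym_deriv n s v"
  using sym_deriv_const[of n s "(- 1) ^ k" v] by (simp add: const_poly_minus_one_power)

lemma partial_deriv_sign: "partial_deriv s ((- 1) ^ k * v) = (- 1) ^ k * partial_deriv s v"
  using partial_deriv_const_mult[of s "(- 1) ^ k" v] by (simp add: const_poly_minus_one_power)

lemma sym_deriv_zero [simp]: "sym_deriv n s 0 = 0"
  by (simp add: sym_deriv_def)

lemma sym_deriv_sum: "sym_deriv n s (\<Sum>x\<in>A. f x) = (\<Sum>x\<in>A. sym_deriv n s (f x))"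
  by (induction A rule: infinite_finite_induct) (simp_all add: sym_deriv_add)

lemma partial_deriv_sum: "partial_deriv s (\<Sum>x\<in>A. f x) = (\<Sum>x\<in>A. partial_deriv s (f x))"
  by (induction A rule: infinite_finite_induct) (simp_all add: partial_deriv_add)

lemma sym_deriv_commute:
  assumes "s \<in> {1..n}" "t \<in> {1..n}"
  shows "sym_deriv n s (sym_deriv n t v) = sym_deriv n t (sym_deriv n s v)"
  using assms
  by (simp add: sym_deriv_def partial_deriv_add partial_deriv_mult partial_deriv_var distrib_left
      partial_deriv_commute[of s t] add_ac mult.left_commute)

text \<open>Canonical commutation relation: on normal ordered symbols the derivative by
  \<open>\<xi>_t\<close> is the commutator with x_t. The case \<open>s = t\<close> is the source of
  the scalar term in the homotopy formula.\<close>

lemma xi_deriv_sym_deriv: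
  assumes "s \<in> {1..n}" "t \<in> {1..n}"
  shows "partial_deriv (n + t) (sym_deriv n s v) =
    sym_deriv n s (partial_deriv (n + t) v) + (if s = t then v else 0)"
  using assms
  by (simp add: sym_deriv_def partial_deriv_add partial_deriv_mult partial_deriv_var distrib_left
      partial_deriv_commute[of s "n + t"] add_ac)

lemma card_less_insert:
  assumes "finite J" "t \<notin> J"
  shows "card {j \<in> insert t J. j < (s::nat)} = card {j \<in> J. j < s} + (if t < s then 1 else 0)"
proof (cases "t < s")
  case True
  then have "{j \<in> insert t J. j < s} = insert t {j \<in> J. j < s}" by auto
  then show ?thesis using True assms by simp
next
  case False
  then have "{j \<in> insert t J. j < s} = {j \<in> J. j < s}" by auto
  then show ?thesis using False by simp
qed

text \<open>The de Rham differential of a free module, taken on all index sets at once and 0 outside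
  the subsets of \<open>{1..n}\<close>, so that no form degree has to be carried through the sign
  computations.\<close>

definition koszul_d :: "nat \<Rightarrow> (nat set \<Rightarrow> 'k::field_char_0 mpoly) \<Rightarrow> nat set \<Rightarrow> 'k mpoly" where
  "koszul_d n w K = (if K \<subseteq> {1..n} then
     \<Sum>s\<in>K. (- 1) ^ card {j \<in> K. j < s} * sym_deriv n s (w (K - {s})) else 0)"

text \<open>Contraction of a form in which the removal of dx_s differentiates the coefficient by
  \<open>\<xi>_s\<close>; this is the candidate for a contracting homotopy.\<close>

definition koszul_h :: "nat \<Rightarrow> (nat set \<Rightarrow> 'k::field_char_0 mpoly) \<Rightarrow> nat set \<Rightarrow> 'k mpoly" where
  "koszul_h n w J = (if J \<subseteq> {1..n} then
     \<Sum>s\<in>{1..n} - J. (- 1) ^ card {j \<in> J. j < s} * partial_deriv (n + s) (w (insert s J)) else 0)"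

lemma koszul_d_add: "koszul_d n (\<lambda>J. w J + v J) K = koszul_d n w K + koszul_d n v K"
  by (simp add: koszul_d_def sym_deriv_add distrib_left sum.distrib)

lemma koszul_d_const: "koszul_d n (\<lambda>J. const_poly c * w J) K = const_poly c * koszul_d n w K"
  by (simp add: koszul_d_def sym_deriv_const sum_distrib_left mult.left_commute)

lemma mpoly_eq_uminus_zero: "(x :: 'k::field_char_0 mpoly) = - x \<Longrightarrow> x = 0"
proof (rule poly_mapping_eqI)
  fix m assume "x = - x"
  then have "lookup x m = - lookup x m" by (metis lookup_uminus)
  then have "2 * lookup x m = 0" by (simp only: mult_2) simp
  then show "lookup x m = lookup 0 m" by simp
qed

lemma koszul_d_koszul_d: "koszul_d n (koszul_d n w) K = (0 :: 'k::field_char_0 mpoly)"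
proof (cases "K \<subseteq> {1..n}")
  case True
  then have fin: "finite K" by (rule finite_subset) simp
  \<comment> \<open>With the diagonal set to 0 both indices range over all of \<open>K\<close>.
    Exchanging \<open>s\<close> and \<open>t\<close> changes the sign, so the double sum equals its
    own negative.\<close>
  define F where "F s t = (if s = t then 0 else (- 1) ^ card {j \<in> K. j < s} * ((- 1) ^ card {j \<in> K - {s}. j < t} *
     sym_deriv n s (sym_deriv n t (w (K - {s} - {t})))))" for s t
  have anti: "F s t = - F t s" if st: "s \<in> K" "t \<in> K" for s t
  proof (cases "s = t")
    case False
    have "card {j \<in> K. j < t} = card {j \<in> K - {s}. j < t} + (if s < t then 1 else 0)"
      using card_less_insert[of "K - {s}" s t] fin st by (simp add: insert_absorb)
    moreover have "card {j \<in> K. j < s} = card {j \<in> K - {t}. j < s} + (if t < s then 1 else 0)"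
      using card_less_insert[of "K - {t}" t s] fin st by (simp add: insert_absorb)
    moreover have "K - {s} - {t} = K - {t} - {s}" by auto
    moreover have "sym_deriv n s (sym_deriv n t u) = sym_deriv n t (sym_deriv n s u)" for u :: "'k mpoly"
      using st True by (intro sym_deriv_commute) auto
    ultimately show ?thesis using False by (cases "s < t") (simp_all add: F_def power_add mult.left_commute)
  qed (simp add: F_def)
  have "koszul_d n (koszul_d n w) K = (\<Sum>s\<in>K. \<Sum>t\<in>K - {s}. F s t)"
  proof -
    have "(- 1) ^ card {j \<in> K. j < s} * sym_deriv n s (koszul_d n w (K - {s})) = (\<Sum>t\<in>K - {s}. F s t)"
      if "s \<in> K" for s
    proof -
      have "K - {s} \<subseteq> {1..n}" using True by blast
      then have "koszul_d n w (K - {s}) = (\<Sum>t\<in>K - {s}. (- 1) ^ card {j \<in> K - {s}. j < t} * sym_deriv n t (w (K - {s} - {t})))"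
        by (simp only: koszul_d_def if_True)
      then show ?thesis
        by (auto simp: sym_deriv_sum sym_deriv_sign sum_distrib_left F_def intro!: sum.cong)
    qed
    then show ?thesis using True by (simp add: koszul_d_def[of n "koszul_d n w"])
  qed
  also have "\<dots> = (\<Sum>s\<in>K. \<Sum>t\<in>K. F s t)"
    using fin by (intro sum.cong sum.mono_neutral_left) (auto simp: F_def)
  finally have eq: "koszul_d n (koszul_d n w) K = (\<Sum>s\<in>K. \<Sum>t\<in>K. F s t)" .
  have "(\<Sum>s\<in>K. \<Sum>t\<in>K. F s t) = (\<Sum>t\<in>K. \<Sum>s\<in>K. F s t)" by (rule sum.swap)
  also have "\<dots> = (\<Sum>t\<in>K. \<Sum>s\<in>K. - F t s)" by (intro sum.cong refl anti)
  also have "\<dots> = - (\<Sum>s\<in>K. \<Sum>t\<in>K. F s t)" by (simp only: sum_negf)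
  finally show ?thesis unfolding eq by (rule mpoly_eq_uminus_zero)
qed (simp add: koszul_d_def)

definition euler_op :: "nat \<Rightarrow> 'k::field_char_0 mpoly \<Rightarrow> 'k mpoly" where
  "euler_op n v = (\<Sum>s = 1..n. sym_deriv n s (partial_deriv (n + s) v))"

text \<open>The terms \<open>B s t\<close>, in which \<open>s\<close> in \<open>J\<close> is
  replaced by \<open>t\<close> outside \<open>J\<close>, occur in both composites with opposite
  signs. The diagonal terms add up to the Euler operator, and the commutation relation contributes
  one copy of \<open>w J\<close> for each index outside \<open>J\<close>.\<close>

lemma koszul_homotopy:
  fixes w :: "nat set \<Rightarrow> 'k::field_char_0 mpoly"
  assumes J: "J \<subseteq> {1..n}"
  shows "koszul_d n (koszul_h n w) J + koszul_h n (koszul_d n w) J = euler_op n (w J) + of_nat (n - card J) * w J"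
proof -
  have fin: "finite J" using J by (rule finite_subset) simp
  let ?C = "{1..n} - J"
  let ?e = "\<lambda>s K. (- 1 :: 'k mpoly) ^ card {j \<in> K. j < (s::nat)}"
  let ?Y = "sym_deriv n" and ?A = "\<lambda>s. partial_deriv (n + s) :: 'k mpoly \<Rightarrow> 'k mpoly"
  define B where "B s t = ?e s J * (?e t (J - {s}) * ?Y s (?A t (w (insert t (J - {s})))))" for s t
  have sq: "x * (x * y) = y" if "x = (- 1) ^ k" for x y :: "'k mpoly" and k
    using that by (simp flip: mult.assoc power_mult_distrib)
  have 1: "koszul_d n (koszul_h n w) J = (\<Sum>s\<in>J. ?Y s (?A s (w J)) + (\<Sum>t\<in>?C. B s t))"
  proof -
    have "?e s J * ?Y s (koszul_h n w (J - {s})) = ?Y s (?A s (w J)) + (\<Sum>t\<in>?C. B s t)" if s: "s \<in> J" for s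
    proof -
      have J': "J - {s} \<subseteq> {1..n}" and C: "{1..n} - (J - {s}) = insert s ?C" using J s by auto
      have below: "{j \<in> J. j \<noteq> s \<and> j < s} = {j \<in> J. j < s}" by auto
      have "koszul_h n w (J - {s}) = ?e s J * ?A s (w J) +
          (\<Sum>t\<in>?C. ?e t (J - {s}) * ?A t (w (insert t (J - {s}))))"
        using s J' unfolding koszul_h_def C by (simp add: below insert_absorb)
      then have "?e s J * ?Y s (koszul_h n w (J - {s})) = ?e s J * (?e s J * ?Y s (?A s (w J))) +
          (\<Sum>t\<in>?C. B s t)"
        by (simp add: sym_deriv_add sym_deriv_sum sym_deriv_sign distrib_left sum_distrib_left B_def)
      then show ?thesis by (simp only: sq[OF refl])
    qed
    then show ?thesis using J by (simp add: koszul_d_def)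
  qed
  have 2: "koszul_h n (koszul_d n w) J = (\<Sum>t\<in>?C. (?Y t (?A t (w J)) + w J) - (\<Sum>s\<in>J. B s t))"
  proof -
    have "?e t J * ?A t (koszul_d n w (insert t J)) = (?Y t (?A t (w J)) + w J) - (\<Sum>s\<in>J. B s t)" if t: "t \<in> ?C" for t
    proof -
      have t': "t \<notin> J" "t \<in> {1..n}" and J': "insert t J \<subseteq> {1..n}" using J t by auto
      have below: "{j. (j = t \<or> j \<in> J) \<and> j < t} = {j \<in> J. j < t}" by auto
      have B: "?e t J * (?e s (insert t J) * ?A t (?Y s (w (insert t J - {s})))) = - B s t" if s: "s \<in> J" for s
      proof -
        have st: "s \<noteq> t" "s \<in> {1..n}" using s t' J by auto
        have "card {j \<in> J. j < t} = card {j \<in> J - {s}. j < t} + (if s < t then 1 else 0)"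
          using card_less_insert[of "J - {s}" s t] fin s by (simp add: insert_absorb)
        moreover have "card {j \<in> insert t J. j < s} = card {j \<in> J. j < s} + (if t < s then 1 else 0)"
          using card_less_insert[of J t s] fin t' by simp
        moreover have "insert t J - {s} = insert t (J - {s})" using st by auto
        ultimately show ?thesis
          using st xi_deriv_sym_deriv[OF st(2) t'(2)]
          by (cases "s < t") (simp_all add: B_def power_add mult.left_commute)
      qed
      have "insert t J - {t} = J" using t' by auto
      then have "koszul_d n w (insert t J) = ?e t J * ?Y t (w J) + (\<Sum>s\<in>J. ?e s (insert t J) * ?Y s (w (insert t J - {s})))"
        using fin t' J' by (simp add: koszul_d_def below)
      then have "?e t J * ?A t (koszul_d n w (insert t J)) = ?e t J * (?e t J * ?A t (?Y t (w J))) +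
          (\<Sum>s\<in>J. ?e t J * (?e s (insert t J) * ?A t (?Y s (w (insert t J - {s})))))"
        by (simp add: partial_deriv_add partial_deriv_sum partial_deriv_sign distrib_left sum_distrib_left)
      also have "\<dots> = (?Y t (?A t (w J)) + w J) + (\<Sum>s\<in>J. - B s t)"
        using B by (simp only: sq[OF refl] xi_deriv_sym_deriv[OF t'(2) t'(2)] refl if_True cong: sum.cong)
      finally show ?thesis by (simp add: sum_negf)
    qed
    then show ?thesis using J by (simp add: koszul_h_def)
  qed
  have "(\<Sum>s\<in>J. \<Sum>t\<in>?C. B s t) = (\<Sum>t\<in>?C. \<Sum>s\<in>J. B s t)" by (rule sum.swap)
  then have "koszul_d n (koszul_h n w) J + koszul_h n (koszul_d n w) J =
      (\<Sum>s\<in>J. ?Y s (?A s (w J))) + (\<Sum>t\<in>?C. ?Y t (?A t (w J))) + of_nat (card ?C) * w J"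
    unfolding 1 2 by (simp add: sum.distrib sum_subtractf)
  also have "(\<Sum>s\<in>J. ?Y s (?A s (w J))) + (\<Sum>t\<in>?C. ?Y t (?A t (w J))) = euler_op n (w J)"
    unfolding euler_op_def using J by (subst sum.subset_diff[of J]) (simp_all add: add.commute)
  also have "card ?C = n - card J" using J fin by (simp add: card_Diff_subset)
  finally show ?thesis .
qed

definition xi_deg :: "nat \<Rightarrow> (nat \<Rightarrow>\<^sub>0 nat) \<Rightarrow> nat" where
  "xi_deg n m = (\<Sum>s = 1..n. lookup m (n + s))"

text \<open>The highest part in \<open>\<xi>\<close> is an eigenvector of the Euler operator, its eigenvalue is the degree.\<close>

lemma euler_op_lowers:
  assumes v: "\<And>m. m \<in> keys v \<Longrightarrow> xi_deg n m < Suc N"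
    and m: "m \<in> keys (euler_op n v - of_nat N * v)"
  shows "xi_deg n m < N"
proof (rule ccontr)
  assume N: "\<not> xi_deg n m < N"
  have zero: "lookup v p = 0" if "xi_deg n p \<ge> Suc N" for p
    using v[of p] that by (auto simp: in_keys_iff)
  have "lookup (sym_deriv n s (partial_deriv (n + s) v)) m = of_nat (lookup m (n + s)) * lookup v m"
    if s: "s \<in> {1..n}" for s
  proof -
    have ne: "s \<noteq> n + s" using s by simp
    have 1: "lookup (var_poly (n + s) * partial_deriv (n + s) v) m = of_nat (lookup m (n + s)) * lookup v m"
    proof (cases "lookup m (n + s) = 0")
      case False
      then have "m - single (n + s) 1 + single (n + s) 1 = m" by (rule single_diff_add)
      moreover have "lookup (m - single (n + s) 1) (n + s) + 1 = lookup m (n + s)"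
        using False by (simp add: lookup_minus)
      ultimately show ?thesis using False by (simp only: lookup_var_poly_mult lookup_partial_deriv if_False)
    qed (simp add: lookup_var_poly_mult)
    \<comment> \<open>The summand \<open>partial_deriv s\<close> of \<open>sym_deriv\<close> takes
      its coefficient at \<open>m\<close> from a monomial of \<xi>-degree at least N + 1, and such a
      monomial does not occur in \<open>v\<close>.\<close>
    have "xi_deg n (m + single s 1 + single (n + s) 1) = xi_deg n m + 1"
      using s by (simp add: xi_deg_def lookup_add sum.distrib lookup_single when_def)
    then have "lookup v (m + single s 1 + single (n + s) 1) = 0" using N by (intro zero) simp
    then have "lookup (partial_deriv s (partial_deriv (n + s) v)) m = 0"
      by (simp only: lookup_partial_deriv) simp
    with 1 show ?thesis by (simp add: sym_deriv_def lookup_add)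
  qed
  then have "lookup (euler_op n v) m = of_nat (xi_deg n m) * lookup v m"
    by (simp add: euler_op_def lookup_sum xi_deg_def sum_distrib_right)
  moreover have "lookup (of_nat N * v) m = of_nat N * lookup v m"
  proof -
    have "(of_nat N :: 'a mpoly) = const_poly (of_nat N)" by (induction N) (simp_all add: const_poly_add)
    then show ?thesis by simp
  qed
  ultimately have "lookup (euler_op n v - of_nat N * v) m = (of_nat (xi_deg n m) - of_nat N) * lookup v m"
    by (simp add: lookup_minus left_diff_distrib)
  then have "lookup (euler_op n v - of_nat N * v) m = 0"
    using zero[of m] N by (cases "xi_deg n m = N") auto
  then show False using m by (simp add: in_keys_iff)
qed

lemma of_nat_mpoly: "(of_nat N :: 'k::field_char_0 mpoly) = const_poly (of_nat N)"
  by (induction N) (simp_all add: const_poly_add)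

lemma symbols_sign [simp]: "v \<in> symbols n r \<Longrightarrow> (- 1) ^ k * v \<in> symbols n r"
  using symbols_const[of v n r "(- 1) ^ k"] by (simp add: const_poly_minus_one_power)

lemma koszul_h_symbols:
  assumes "\<And>J. w J \<in> symbols n r"
  shows "koszul_h n w J \<in> symbols n r"
proof -
  have "partial_deriv (n + s) (w K) \<in> symbols n r" if "s \<in> {1..n}" for s K
    using assms that by (intro symbols_partial_deriv) auto
  then show ?thesis unfolding koszul_h_def by (auto intro!: symbols_sum symbols_sign)
qed

lemma euler_op_symbols: "v \<in> symbols n r \<Longrightarrow> euler_op n v \<in> symbols n r"
  unfolding euler_op_def by (auto intro!: symbols_sum symbols_sym_deriv symbols_partial_deriv)

text \<open>For a cocycle the homotopy formula reads d h w = Euler w + (n - i) w. Subtracting N w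
  from Euler w removes the part of \<xi>-degree N, so w' = d h w - (n - i + N) w is a cocycle of
  smaller \<xi>-degree and exact by induction. The constant n - i + N is nonzero because i <
  n.\<close>

lemma koszul_exact:
  fixes w :: "nat set \<Rightarrow> 'k::field_char_0 mpoly"
  assumes "i < n" "\<And>J. w J \<in> symbols n r" "\<And>J. w J \<noteq> 0 \<Longrightarrow> J \<subseteq> {1..n} \<and> card J = i"
    and "\<And>K. koszul_d n w K = 0" "\<And>J m. m \<in> keys (w J) \<Longrightarrow> xi_deg n m < N"
  shows "\<exists>u. (\<forall>J. u J \<in> symbols n r) \<and> (\<forall>J. u J \<noteq> 0 \<longrightarrow> J \<subseteq> {1..n} \<and> card J + 1 = i) \<and>
    (\<forall>K. koszul_d n u K = w K)"
  using assms(2-5)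
proof (induction N arbitrary: w)
  case 0
  then have "keys (w J) = {}" for J by blast
  then have "w J = 0" for J by simp
  then have "(\<forall>J. (0 :: 'k mpoly) \<in> symbols n r) \<and> (\<forall>J::nat set. (0 :: 'k mpoly) \<noteq> 0 \<longrightarrow> J \<subseteq> {1..n} \<and> card J + 1 = i) \<and>
      (\<forall>K. koszul_d n (\<lambda>J. 0) K = w K)" by (simp add: koszul_d_def)
  then show ?case by (intro exI[of _ "\<lambda>J. 0"])
next
  case (Suc N)
  define c :: 'k where "c = of_nat (n - i + N)"
  have c: "c \<noteq> 0" using assms(1) unfolding c_def of_nat_eq_0_iff by simp
  define w' where "w' J = euler_op n (w J) - of_nat N * w J" for J
  have h0: "koszul_h n (koszul_d n w) J = 0" for J
    using Suc.prems(3) by (simp add: koszul_h_def)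
  have w': "w' J = koszul_d n (koszul_h n w) J + const_poly (- c) * w J" for J
  proof (cases "J \<subseteq> {1..n}")
    case True
    have "of_nat (n - card J) * w J = of_nat (n - i) * w J"
      using Suc.prems(2)[of J] by (cases "w J = 0") auto
    then have "koszul_d n (koszul_h n w) J = euler_op n (w J) + of_nat (n - i) * w J"
      using koszul_homotopy[OF True, of w] by (simp add: h0)
    moreover have "const_poly (- c) = - (of_nat (n - i) + of_nat N)"
      by (simp only: c_def const_poly_uminus of_nat_mpoly of_nat_add const_poly_add)
    ultimately show ?thesis by (simp add: w'_def left_diff_distrib distrib_right)
  next
    case False
    then have "w J = 0" using Suc.prems(2)[of J] by blast
    then show ?thesis using False by (simp add: w'_def koszul_d_def euler_op_def)
  qed
  have "\<exists>u. (\<forall>J. u J \<in> symbols n r) \<and> (\<forall>J. u J \<noteq> 0 \<longrightarrow> J \<subseteq> {1..n} \<and> card J + 1 = i) \<and>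
    (\<forall>K. koszul_d n u K = w' K)"
  proof (rule Suc.IH)
    show "w' J \<in> symbols n r" for J
      using Suc.prems(1)[of J] unfolding w'_def of_nat_mpoly by (intro symbols_diff symbols_const euler_op_symbols)
    show "J \<subseteq> {1..n} \<and> card J = i" if "w' J \<noteq> 0" for J
      using that Suc.prems(2)[of J] by (cases "w J = 0") (auto simp: w'_def euler_op_def)
    have "koszul_d n w' K = koszul_d n (koszul_d n (koszul_h n w)) K + const_poly (- c) * koszul_d n w K" for K
      unfolding w' by (simp only: koszul_d_add koszul_d_const flip: koszul_d_def) 
    then show "koszul_d n w' K = 0" for K by (simp add: koszul_d_koszul_d Suc.prems(3))
    show "xi_deg n m < N" if "m \<in> keys (w' J)" for J m
      using euler_op_lowers[of "w J" n N m] Suc.prems(4)[of _ J] that unfolding w'_def by blast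
  qed
  then obtain u where u: "\<And>J. u J \<in> symbols n r" "\<And>J. u J \<noteq> 0 \<Longrightarrow> J \<subseteq> {1..n} \<and> card J + 1 = i"
    "\<And>K. koszul_d n u K = w' K" by blast
  \<comment> \<open>This solves \<open>w' = koszul_d n (koszul_h n w) - c * w\<close> for
    \<open>w\<close>, given \<open>koszul_d n u = w'\<close>.\<close>
  define u' where "u' J = const_poly (1 / c) * (koszul_h n w J + const_poly (- 1) * u J)" for J
  have "koszul_d n u' K = w K" for K
  proof -
    have "koszul_d n u' K = const_poly (1 / c) * (koszul_d n (koszul_h n w) K + const_poly (- 1) * w' K)"
      unfolding u'_def by (simp only: koszul_d_const koszul_d_add u(3))
    also have "koszul_d n (koszul_h n w) K + const_poly (- 1) * w' K = const_poly c * w K"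
      unfolding w' by (simp add: const_poly_def single_uminus algebra_simps)
    finally show ?thesis using c by (simp flip: mult.assoc const_poly_mult)
  qed
  moreover have "u' J \<in> symbols n r" for J
    unfolding u'_def using u(1) Suc.prems(1) by (intro symbols_const symbols_add koszul_h_symbols)
  moreover have "J \<subseteq> {1..n} \<and> card J + 1 = i" if "u' J \<noteq> 0" for J
  proof (cases "u J = 0")
    case True
    then have h: "koszul_h n w J \<noteq> 0" using that by (auto simp: u'_def)
    then have J: "J \<subseteq> {1..n}" unfolding koszul_h_def by metis
    have "\<exists>s \<in> {1..n} - J. w (insert s J) \<noteq> 0"
    proof (rule ccontr)
      assume "\<not> (\<exists>s \<in> {1..n} - J. w (insert s J) \<noteq> 0)"
      then show False using h J by (simp add: koszul_h_def)
    qed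
    then obtain s where "s \<notin> J" "w (insert s J) \<noteq> 0" by blast
    then show ?thesis using Suc.prems(2) J finite_subset[OF J] by fastforce
  qed (use u(2) in blast)
  ultimately show ?case by blast
qed

lemma finsum_free_module:
  assumes "finite A" "\<And>x. x \<in> A \<Longrightarrow> f x \<in> symbols n r"
  shows "(\<Oplus>\<^bsub>free_module n r\<^esub>x\<in>A. f x) = (\<Sum>x\<in>A. f x :: 'k::field_char_0 mpoly)"
proof -
  interpret left_module "diff_op_ring n :: 'k diff_op ring" "free_module n r" by (rule left_module_free_module)
  show ?thesis
    using assms by (induction A rule: finite_induct) (simp_all add: Pi_iff)
qed

section \<open>The de Rham complex of a module\<close>

lemma de_rham_forms_sel [simp]:
  "carrier (de_rham_forms n N b) = form_indices n b \<rightarrow>\<^sub>E carrier N"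
  "\<zero>\<^bsub>de_rham_forms n N b\<^esub> = (\<lambda>J \<in> form_indices n b. \<zero>\<^bsub>N\<^esub>)"
  "w \<oplus>\<^bsub>de_rham_forms n N b\<^esub> v = (\<lambda>J \<in> form_indices n b. w J \<oplus>\<^bsub>N\<^esub> v J)"
  "c \<odot>\<^bsub>de_rham_forms n N b\<^esub> w = (\<lambda>J \<in> form_indices n b. scalar_op n c \<odot>\<^bsub>N\<^esub> w J)"
  by (simp_all add: de_rham_forms_def)

lemma form_indices_remove:
  assumes "K \<in> form_indices n (b + 1)" "s \<in> K"
  shows "K - {s} \<in> form_indices n b" "s \<in> {1..n}" "finite K"
proof -
  have K: "K \<subseteq> {1..n}" "int (card K) = b + 1" using assms(1) by (auto simp: form_indices_def)
  show fin: "finite K" using K(1) by (rule finite_subset) simp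
  have "card K = Suc (card (K - {s}))" using card_Suc_Diff1[OF fin assms(2)] by (simp only: card_Suc_Diff1)
  then show "K - {s} \<in> form_indices n b" using K by (auto simp: form_indices_def)
  show "s \<in> {1..n}" using K assms(2) by blast
qed

lemma finite_form_index: "K \<in> form_indices n b \<Longrightarrow> finite K"
  using finite_subset[of K "{1..n}"] by (auto simp: form_indices_def)

lemma PiE_const_mem: "f \<in> A \<rightarrow>\<^sub>E B \<Longrightarrow> x \<in> A \<Longrightarrow> f x \<in> B"
  by (rule PiE_mem)

lemma PiE_eqI: "f \<in> A \<rightarrow>\<^sub>E B \<Longrightarrow> g \<in> A \<rightarrow>\<^sub>E B \<Longrightarrow> (\<And>x. x \<in> A \<Longrightarrow> f x = g x) \<Longrightarrow> f = g"
  by (rule PiE_ext)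

definition form_map :: "nat \<Rightarrow> int \<Rightarrow> ('x \<Rightarrow> 'y) \<Rightarrow> (nat set \<Rightarrow> 'x) \<Rightarrow> nat set \<Rightarrow> 'y" where
  "form_map n b h w = (\<lambda>J \<in> form_indices n b. h (w J))"

context
  fixes n :: nat and N :: "('k::field_char_0 diff_op, 'x) module"
  assumes N: "left_module (diff_op_ring n) N"
begin

interpretation N: left_module "diff_op_ring n :: 'k diff_op ring" N by (rule N)

abbreviation "forms b \<equiv> carrier (de_rham_forms n N b)"
abbreviation "dd b \<equiv> de_rham_diff n N b"

lemma left_module_de_rham_forms: "left_module base_field (de_rham_forms n N b)"
proof -
  have "abelian_group (de_rham_forms n N b)"
  proof (rule abelian_groupI)
    fix w assume w: "w \<in> forms b"
    let ?m = "\<lambda>J \<in> form_indices n b. \<ominus>\<^bsub>N\<^esub> w J"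
    have "?m \<in> forms b" using w by auto
    moreover have "?m \<oplus>\<^bsub>de_rham_forms n N b\<^esub> w = \<zero>\<^bsub>de_rham_forms n N b\<^esub>"
      using w by (auto intro!: restrict_ext simp: N.l_neg PiE_const_mem)
    ultimately show "\<exists>y \<in> forms b. y \<oplus>\<^bsub>de_rham_forms n N b\<^esub> w = \<zero>\<^bsub>de_rham_forms n N b\<^esub>" by blast
  qed (auto intro!: restrict_ext PiE_eqI[where A = "form_indices n b" and B = "carrier N"]
      simp: N.a_ac PiE_const_mem)
  moreover have "left_module_axioms (base_field :: 'k ring) (de_rham_forms n N b)"
  proof
    fix w v a c assume w: "w \<in> forms b"
    have sc: "scalar_op n x \<odot>\<^bsub>N\<^esub> w J \<in> carrier N" if "J \<in> form_indices n b" for J and x :: 'k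
      using w that by (intro N.smult_closed) auto
    show "c \<odot>\<^bsub>de_rham_forms n N b\<^esub> w \<in> forms b"
      using sc by auto
    show "\<one>\<^bsub>base_field\<^esub> \<odot>\<^bsub>de_rham_forms n N b\<^esub> w = w"
      using w by (intro PiE_eqI[of _ "form_indices n b" "carrier N"])
        (auto simp: ring_of_type_algebra_def scalar_op_one PiE_const_mem)
    show "c \<odot>\<^bsub>de_rham_forms n N b\<^esub> (w \<oplus>\<^bsub>de_rham_forms n N b\<^esub> v) =
        c \<odot>\<^bsub>de_rham_forms n N b\<^esub> w \<oplus>\<^bsub>de_rham_forms n N b\<^esub> c \<odot>\<^bsub>de_rham_forms n N b\<^esub> v" if "v \<in> forms b"
      using w that by (auto intro!: restrict_ext N.smult_r_distr simp: PiE_const_mem)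
    show "(a \<oplus>\<^bsub>base_field\<^esub> c) \<odot>\<^bsub>de_rham_forms n N b\<^esub> w =
        a \<odot>\<^bsub>de_rham_forms n N b\<^esub> w \<oplus>\<^bsub>de_rham_forms n N b\<^esub> c \<odot>\<^bsub>de_rham_forms n N b\<^esub> w"
      using w by (auto intro!: restrict_ext N.smult_l_distr simp: ring_of_type_algebra_def scalar_op_add PiE_const_mem)
    show "(a \<otimes>\<^bsub>base_field\<^esub> c) \<odot>\<^bsub>de_rham_forms n N b\<^esub> w =
        a \<odot>\<^bsub>de_rham_forms n N b\<^esub> (c \<odot>\<^bsub>de_rham_forms n N b\<^esub> w)"
      using w by (auto intro!: restrict_ext N.smult_assoc1 simp: ring_of_type_algebra_def scalar_op_mult PiE_const_mem)
  qed
  moreover have "ring (base_field :: 'k ring)" by (rule ring_from_type_algebra)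
  ultimately show ?thesis by (simp add: left_module_def)
qed

lemma dd_summand_closed:
  assumes "w \<in> forms b" "K \<in> form_indices n (b + 1)" "s \<in> K"
  shows "scalar_op n c \<odot>\<^bsub>N\<^esub> (partial_op n s \<odot>\<^bsub>N\<^esub> w (K - {s})) \<in> carrier N"
    "partial_op n s \<odot>\<^bsub>N\<^esub> w (K - {s}) \<in> carrier N" "w (K - {s}) \<in> carrier N"
proof -
  show w: "w (K - {s}) \<in> carrier N" using assms form_indices_remove[OF assms(2,3)] by auto
  show p: "partial_op n s \<odot>\<^bsub>N\<^esub> w (K - {s}) \<in> carrier N"
    using form_indices_remove[OF assms(2,3)] w by (intro N.smult_closed) auto
  show "scalar_op n c \<odot>\<^bsub>N\<^esub> (partial_op n s \<odot>\<^bsub>N\<^esub> w (K - {s})) \<in> carrier N"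
    using p by (rule N.smult_closed[OF scalar_op_in_diff_op])
qed

lemma dd_closed: "w \<in> forms b \<Longrightarrow> dd b w \<in> forms (b + 1)"
  using dd_summand_closed by (auto simp: de_rham_diff_def intro!: N.finsum_closed)

lemma dd_add:
  assumes w: "w \<in> forms b" and v: "v \<in> forms b"
  shows "dd b (w \<oplus>\<^bsub>de_rham_forms n N b\<^esub> v) = dd b w \<oplus>\<^bsub>de_rham_forms n N (b + 1)\<^esub> dd b v"
  unfolding de_rham_diff_def de_rham_forms_sel
proof (rule restrict_ext)
  fix K assume K: "K \<in> form_indices n (b + 1)"
  let ?c = "\<lambda>s. scalar_op n ((- 1) ^ card {j \<in> K. j < s}) :: 'k diff_op"
  have "(\<Oplus>\<^bsub>N\<^esub>s\<in>K. ?c s \<odot>\<^bsub>N\<^esub> (partial_op n s \<odot>\<^bsub>N\<^esub> (\<lambda>J \<in> form_indices n b. w J \<oplus>\<^bsub>N\<^esub> v J) (K - {s}))) =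
     (\<Oplus>\<^bsub>N\<^esub>s\<in>K. ?c s \<odot>\<^bsub>N\<^esub> (partial_op n s \<odot>\<^bsub>N\<^esub> w (K - {s})) \<oplus>\<^bsub>N\<^esub> ?c s \<odot>\<^bsub>N\<^esub> (partial_op n s \<odot>\<^bsub>N\<^esub> v (K - {s})))"
  proof (rule N.finsum_cong'[OF refl])
    fix s assume s: "s \<in> K"
    note r = form_indices_remove[OF K s] and cw = dd_summand_closed[OF w K s] and cv = dd_summand_closed[OF v K s]
    show "?c s \<odot>\<^bsub>N\<^esub> (partial_op n s \<odot>\<^bsub>N\<^esub> (\<lambda>J \<in> form_indices n b. w J \<oplus>\<^bsub>N\<^esub> v J) (K - {s})) =
       ?c s \<odot>\<^bsub>N\<^esub> (partial_op n s \<odot>\<^bsub>N\<^esub> w (K - {s})) \<oplus>\<^bsub>N\<^esub> ?c s \<odot>\<^bsub>N\<^esub> (partial_op n s \<odot>\<^bsub>N\<^esub> v (K - {s}))"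
      using r cw cv by (simp add: N.smult_r_distr del: atLeastAtMost_iff)
  qed (use dd_summand_closed[OF w K] dd_summand_closed[OF v K] in auto)
  also have "\<dots> = (\<Oplus>\<^bsub>N\<^esub>s\<in>K. ?c s \<odot>\<^bsub>N\<^esub> (partial_op n s \<odot>\<^bsub>N\<^esub> w (K - {s}))) \<oplus>\<^bsub>N\<^esub>
      (\<Oplus>\<^bsub>N\<^esub>s\<in>K. ?c s \<odot>\<^bsub>N\<^esub> (partial_op n s \<odot>\<^bsub>N\<^esub> v (K - {s})))"
    using dd_summand_closed[OF w K] dd_summand_closed[OF v K] by (intro N.finsum_addf) auto
  finally show "(\<Oplus>\<^bsub>N\<^esub>s\<in>K. ?c s \<odot>\<^bsub>N\<^esub> (partial_op n s \<odot>\<^bsub>N\<^esub> (\<lambda>J \<in> form_indices n b. w J \<oplus>\<^bsub>N\<^esub> v J) (K - {s}))) =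
    (\<lambda>K \<in> form_indices n (b + 1). \<Oplus>\<^bsub>N\<^esub>s\<in>K. scalar_op n ((- 1) ^ card {j \<in> K. j < s}) \<odot>\<^bsub>N\<^esub> (partial_op n s \<odot>\<^bsub>N\<^esub> w (K - {s}))) K \<oplus>\<^bsub>N\<^esub>
    (\<lambda>K \<in> form_indices n (b + 1). \<Oplus>\<^bsub>N\<^esub>s\<in>K. scalar_op n ((- 1) ^ card {j \<in> K. j < s}) \<odot>\<^bsub>N\<^esub> (partial_op n s \<odot>\<^bsub>N\<^esub> v (K - {s}))) K"
    using K by simp
qed

lemma dd_smult:
  assumes w: "w \<in> forms b"
  shows "dd b (c \<odot>\<^bsub>de_rham_forms n N b\<^esub> w) = c \<odot>\<^bsub>de_rham_forms n N (b + 1)\<^esub> dd b w"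
  unfolding de_rham_diff_def de_rham_forms_sel
proof (rule restrict_ext)
  fix K assume K: "K \<in> form_indices n (b + 1)"
  let ?c = "\<lambda>s. scalar_op n ((- 1) ^ card {j \<in> K. j < s}) :: 'k diff_op"
  have "scalar_op n c \<odot>\<^bsub>N\<^esub> (\<Oplus>\<^bsub>N\<^esub>s\<in>K. ?c s \<odot>\<^bsub>N\<^esub> (partial_op n s \<odot>\<^bsub>N\<^esub> w (K - {s}))) =
     (\<Oplus>\<^bsub>N\<^esub>s\<in>K. scalar_op n c \<odot>\<^bsub>N\<^esub> (?c s \<odot>\<^bsub>N\<^esub> (partial_op n s \<odot>\<^bsub>N\<^esub> w (K - {s}))))"
    using dd_summand_closed[OF w K] finite_form_index[OF K] by (intro N.smult_finsum) auto
  also have "\<dots> = (\<Oplus>\<^bsub>N\<^esub>s\<in>K. ?c s \<odot>\<^bsub>N\<^esub> (partial_op n s \<odot>\<^bsub>N\<^esub> (\<lambda>J \<in> form_indices n b. scalar_op n c \<odot>\<^bsub>N\<^esub> w J) (K - {s})))"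
  proof (rule N.finsum_cong'[OF refl])
    fix s assume s: "s \<in> K"
    note r = form_indices_remove[OF K s] and cw = dd_summand_closed[OF w K s]
    let ?D = "diff_op_ring n :: 'k diff_op ring"
    have "partial_op n s \<odot>\<^bsub>N\<^esub> (scalar_op n c \<odot>\<^bsub>N\<^esub> w (K - {s})) = (partial_op n s \<otimes>\<^bsub>?D\<^esub> scalar_op n c) \<odot>\<^bsub>N\<^esub> w (K - {s})"
      using r cw by (intro N.smult_assoc1[symmetric]) auto
    also have "\<dots> = scalar_op n c \<odot>\<^bsub>N\<^esub> (partial_op n s \<odot>\<^bsub>N\<^esub> w (K - {s}))"
      using r cw by (subst scalar_op_commute[symmetric]) (auto intro: N.smult_assoc1)
    finally have 1: "partial_op n s \<odot>\<^bsub>N\<^esub> (scalar_op n c \<odot>\<^bsub>N\<^esub> w (K - {s})) = scalar_op n c \<odot>\<^bsub>N\<^esub> (partial_op n s \<odot>\<^bsub>N\<^esub> w (K - {s}))" .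
    have "scalar_op n x \<odot>\<^bsub>N\<^esub> (scalar_op n y \<odot>\<^bsub>N\<^esub> z) = scalar_op n (x * y) \<odot>\<^bsub>N\<^esub> z" if "z \<in> carrier N" for x y z
      using that by (simp add: scalar_op_mult N.smult_assoc1)
    then have "scalar_op n c \<odot>\<^bsub>N\<^esub> (?c s \<odot>\<^bsub>N\<^esub> x) = ?c s \<odot>\<^bsub>N\<^esub> (scalar_op n c \<odot>\<^bsub>N\<^esub> x)" if "x \<in> carrier N" for x
      using that by (simp only: mult.commute[of c])
    then show "scalar_op n c \<odot>\<^bsub>N\<^esub> (?c s \<odot>\<^bsub>N\<^esub> (partial_op n s \<odot>\<^bsub>N\<^esub> w (K - {s}))) =
      ?c s \<odot>\<^bsub>N\<^esub> (partial_op n s \<odot>\<^bsub>N\<^esub> (\<lambda>J \<in> form_indices n b. scalar_op n c \<odot>\<^bsub>N\<^esub> w J) (K - {s}))"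
      using r cw 1 by (simp del: atLeastAtMost_iff)
  qed (use dd_summand_closed[OF w K] form_indices_remove[OF K] in \<open>auto intro!: N.smult_closed simp del: atLeastAtMost_iff\<close>)
  finally show "(\<Oplus>\<^bsub>N\<^esub>s\<in>K. ?c s \<odot>\<^bsub>N\<^esub> (partial_op n s \<odot>\<^bsub>N\<^esub> (\<lambda>J \<in> form_indices n b. scalar_op n c \<odot>\<^bsub>N\<^esub> w J) (K - {s}))) =
     scalar_op n c \<odot>\<^bsub>N\<^esub> (\<lambda>K \<in> form_indices n (b + 1). \<Oplus>\<^bsub>N\<^esub>s\<in>K. scalar_op n ((- 1) ^ card {j \<in> K. j < s}) \<odot>\<^bsub>N\<^esub> (partial_op n s \<odot>\<^bsub>N\<^esub> w (K - {s}))) K"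
    using K by simp
qed

end

lemma form_map_closed:
  "h \<in> lin_hom R N N' \<Longrightarrow> w \<in> carrier (de_rham_forms n N b) \<Longrightarrow> form_map n b h w \<in> carrier (de_rham_forms n N' b)"
  using lin_hom_closed[of h R N N'] by (auto simp: form_map_def)

lemma dd_form_map:
  fixes N :: "('k::field_char_0 diff_op, 'x) module" and N' :: "('k diff_op, 'y) module"
  assumes N: "left_module (diff_op_ring n) N" and N': "left_module (diff_op_ring n) N'"
    and h: "h \<in> lin_hom (diff_op_ring n) N N'" and w: "w \<in> carrier (de_rham_forms n N b)"
  shows "de_rham_diff n N' b (form_map n b h w) = form_map n (b + 1) h (de_rham_diff n N b w)"
  unfolding de_rham_diff_def form_map_def
proof (rule restrict_ext)
  fix K assume K: "K \<in> form_indices n (b + 1)"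
  interpret N': left_module "diff_op_ring n :: 'k diff_op ring" N' by (rule N')
  let ?c = "\<lambda>s. scalar_op n ((- 1) ^ card {j \<in> K. j < s}) :: 'k diff_op"
  have "h (\<Oplus>\<^bsub>N\<^esub>s\<in>K. ?c s \<odot>\<^bsub>N\<^esub> (partial_op n s \<odot>\<^bsub>N\<^esub> w (K - {s}))) =
     (\<Oplus>\<^bsub>N'\<^esub>s\<in>K. h (?c s \<odot>\<^bsub>N\<^esub> (partial_op n s \<odot>\<^bsub>N\<^esub> w (K - {s}))))"
    using dd_summand_closed[OF N w K] finite_form_index[OF K] by (intro lin_hom_finsum[OF N N' h]) auto
  also have "\<dots> = (\<Oplus>\<^bsub>N'\<^esub>s\<in>K. ?c s \<odot>\<^bsub>N'\<^esub> (partial_op n s \<odot>\<^bsub>N'\<^esub> (\<lambda>J \<in> form_indices n b. h (w J)) (K - {s})))"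
  proof -
    have eq: "h (?c s \<odot>\<^bsub>N\<^esub> (partial_op n s \<odot>\<^bsub>N\<^esub> w (K - {s}))) =
      ?c s \<odot>\<^bsub>N'\<^esub> (partial_op n s \<odot>\<^bsub>N'\<^esub> (\<lambda>J \<in> form_indices n b. h (w J)) (K - {s}))" if s: "s \<in> K" for s
      using form_indices_remove[OF K s] dd_summand_closed[OF N w K s]
      by (simp add: lin_hom_smult[OF h] del: atLeastAtMost_iff)
    have "?c s \<odot>\<^bsub>N'\<^esub> (partial_op n s \<odot>\<^bsub>N'\<^esub> (\<lambda>J \<in> form_indices n b. h (w J)) (K - {s})) \<in> carrier N'"
      if s: "s \<in> K" for s
      unfolding eq[OF s, symmetric] by (rule lin_hom_closed[OF h dd_summand_closed(1)[OF N w K s]])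
    then show ?thesis by (intro N'.finsum_cong'[OF refl] eq) blast+
  qed
  finally show "(\<Oplus>\<^bsub>N'\<^esub>s\<in>K. ?c s \<odot>\<^bsub>N'\<^esub> (partial_op n s \<odot>\<^bsub>N'\<^esub> (\<lambda>J \<in> form_indices n b. h (w J)) (K - {s}))) =
     h ((\<lambda>K \<in> form_indices n (b + 1). \<Oplus>\<^bsub>N\<^esub>s\<in>K. scalar_op n ((- 1) ^ card {j \<in> K. j < s}) \<odot>\<^bsub>N\<^esub> (partial_op n s \<odot>\<^bsub>N\<^esub> w (K - {s}))) K)"
    using K by simp
qed

section \<open>De Rham forms of a free module as Koszul cochains\<close>

definition form_ext :: "nat \<Rightarrow> int \<Rightarrow> (nat set \<Rightarrow> 'k::field_char_0 mpoly) \<Rightarrow> nat set \<Rightarrow> 'k mpoly" where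
  "form_ext n b w J = (if J \<in> form_indices n b then w J else 0)"

text \<open>In degree \<open>b + 1\<close> the two formulas agree term by term. Elsewhere both sides
  vanish, since removing an element of such a \<open>K\<close> does not lead to an index set of
  degree \<open>b\<close>.\<close>

lemma form_ext_koszul:
  fixes w :: "nat set \<Rightarrow> 'k::field_char_0 mpoly"
  assumes w: "w \<in> carrier (de_rham_forms n (free_module n r) b)"
  shows "form_ext n (b + 1) (de_rham_diff n (free_module n r) b w) = koszul_d n (form_ext n b w)"
proof
  fix K
  show "form_ext n (b + 1) (de_rham_diff n (free_module n r) b w) K = koszul_d n (form_ext n b w) K"
  proof (cases "K \<in> form_indices n (b + 1)")
    case True
    have s: "w (K - {s}) \<in> symbols n r" "s \<in> {1..n}" "K - {s} \<in> form_indices n b" if "s \<in> K" for s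
      using form_indices_remove[OF True that] w by auto
    have "de_rham_diff n (free_module n r) b w K =
      (\<Sum>s\<in>K. sym_action n r (scalar_op n ((- 1) ^ card {j \<in> K. j < s})) (sym_action n r (partial_op n s) (w (K - {s}))))"
      using True s finite_form_index[OF True]
      by (simp add: de_rham_diff_def finsum_free_module del: atLeastAtMost_iff)
    also have "\<dots> = (\<Sum>s\<in>K. (- 1) ^ card {j \<in> K. j < s} * sym_deriv n s (form_ext n b w (K - {s})))"
      using s by (intro sum.cong) (simp_all add: sym_action_gens const_poly_minus_one_power form_ext_def del: atLeastAtMost_iff)
    finally show ?thesis using True by (simp add: form_ext_def[of n "b + 1"] koszul_d_def form_indices_def)
  next
    case False
    have "form_ext n b w (K - {s}) = 0" if "s \<in> K" "K \<subseteq> {1..n}" for s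
    proof -
      have "finite K" using that(2) by (rule finite_subset) simp
      then have "card K = Suc (card (K - {s}))" using card_Suc_Diff1[OF _ that(1)] by simp
      then have "K - {s} \<notin> form_indices n b" using False that by (auto simp: form_indices_def)
      then show ?thesis by (simp add: form_ext_def)
    qed
    then show ?thesis using False by (simp add: form_ext_def[of n "b + 1"] koszul_d_def)
  qed
qed

lemma form_ext_eqI:
  "w \<in> form_indices n b \<rightarrow>\<^sub>E A \<Longrightarrow> v \<in> form_indices n b \<rightarrow>\<^sub>E A \<Longrightarrow> form_ext n b w = form_ext n b v \<Longrightarrow> w = v"
  by (rule PiE_ext) (auto simp: form_ext_def fun_eq_iff split: if_splits)

lemma de_rham_diff_diff_free:
  fixes w :: "nat set \<Rightarrow> 'k::field_char_0 mpoly"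
  assumes w: "w \<in> carrier (de_rham_forms n (free_module n r) b)"
  shows "de_rham_diff n (free_module n r) (b + 1) (de_rham_diff n (free_module n r) b w) =
    \<zero>\<^bsub>de_rham_forms n (free_module n r) (b + 1 + 1)\<^esub>"
proof (rule form_ext_eqI)
  let ?F = "free_module n r :: ('k diff_op, 'k mpoly) module"
  have d: "de_rham_diff n ?F b w \<in> carrier (de_rham_forms n ?F (b + 1))"
    using w by (rule dd_closed[OF left_module_free_module])
  then show "de_rham_diff n ?F (b + 1) (de_rham_diff n ?F b w) \<in> form_indices n (b + 1 + 1) \<rightarrow>\<^sub>E carrier ?F"
    using dd_closed[OF left_module_free_module] by fastforce
  show "form_ext n (b + 1 + 1) (de_rham_diff n ?F (b + 1) (de_rham_diff n ?F b w)) =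
      form_ext n (b + 1 + 1) \<zero>\<^bsub>de_rham_forms n ?F (b + 1 + 1)\<^esub>"
    unfolding form_ext_koszul[OF d] form_ext_koszul[OF w]
    by (auto simp: koszul_d_koszul_d form_ext_def)
qed auto

lemma de_rham_exact_free:
  fixes w :: "nat set \<Rightarrow> 'k::field_char_0 mpoly"
  assumes w: "w \<in> carrier (de_rham_forms n (free_module n r) (b + 1))" and b: "b + 1 < int n"
    and d: "de_rham_diff n (free_module n r) (b + 1) w = \<zero>\<^bsub>de_rham_forms n (free_module n r) (b + 1 + 1)\<^esub>"
  shows "\<exists>u \<in> carrier (de_rham_forms n (free_module n r) b). de_rham_diff n (free_module n r) b u = w"
proof -
  let ?F = "free_module n r :: ('k diff_op, 'k mpoly) module"
  let ?w = "form_ext n (b + 1) w"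
  have "\<exists>u. (\<forall>J. u J \<in> symbols n r) \<and> (\<forall>J. u J \<noteq> 0 \<longrightarrow> J \<in> form_indices n b) \<and> (\<forall>K. koszul_d n u K = ?w K)"
  proof (cases "b + 1 < 0")
    case True
    then have "?w K = 0" for K by (auto simp: form_ext_def form_indices_def)
    then have "(\<forall>J. (0 :: 'k mpoly) \<in> symbols n r) \<and> (\<forall>J::nat set. (0 :: 'k mpoly) \<noteq> 0 \<longrightarrow> J \<in> form_indices n b) \<and>
      (\<forall>K. koszul_d n (\<lambda>J. 0) K = ?w K)" by (simp add: koszul_d_def)
    then show ?thesis by (intro exI[of _ "\<lambda>J. 0"])
  next
    case False
    define i where "i = nat (b + 1)"
    have i: "int i = b + 1" "i < n" using False b by (auto simp: i_def)
    \<comment> \<open>Only finitely many monomials occur in the coefficients; a bound for their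
      \<xi>-degrees is the start of the induction in \<open>koszul_exact\<close>.\<close>
    have fin: "finite (\<Union>J \<in> form_indices n (b + 1). keys (w J))"
      by (rule finite_UN_I) (auto simp: form_indices_def intro: finite_subset[of _ "Pow {1..n}"])
    then obtain N where N: "\<And>m. m \<in> (\<Union>J \<in> form_indices n (b + 1). keys (w J)) \<Longrightarrow> xi_deg n m < N"
      using finite_nat_set_iff_bounded[of "xi_deg n ` (\<Union>J \<in> form_indices n (b + 1). keys (w J))"] by auto
    have "koszul_d n ?w K = 0" for K
      unfolding form_ext_koszul[OF w, symmetric] d by (simp add: form_ext_def)
    moreover have "?w J \<in> symbols n r" for J using w by (auto simp: form_ext_def)
    moreover have "J \<subseteq> {1..n} \<and> card J = i" if "?w J \<noteq> 0" for J
      using that i by (auto simp: form_ext_def form_indices_def split: if_splits)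
    moreover have "xi_deg n m < N" if "m \<in> keys (?w J)" for J m
      using that N by (auto simp: form_ext_def split: if_splits)
    ultimately obtain u where u: "\<forall>J. u J \<in> symbols n r" "\<forall>J. u J \<noteq> 0 \<longrightarrow> J \<subseteq> {1..n} \<and> card J + 1 = i"
      "\<forall>K. koszul_d n u K = ?w K" using koszul_exact[OF i(2), of ?w r N] by blast
    then have "J \<in> form_indices n b" if "u J \<noteq> 0" for J
      using that i by (force simp: form_indices_def)
    with u show ?thesis by blast
  qed
  then obtain u where u: "\<And>J. u J \<in> symbols n r" "\<And>J. u J \<noteq> 0 \<Longrightarrow> J \<in> form_indices n b"
    "\<And>K. koszul_d n u K = ?w K" by blast
  define u' where "u' = restrict u (form_indices n b)"
  have u': "u' \<in> carrier (de_rham_forms n ?F b)" using u(1) by (auto simp: u'_def)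
  have eq: "form_ext n b u' = u" 
  proof
    show "form_ext n b u' J = u J" for J using u(2)[of J] by (auto simp: u'_def form_ext_def)
  qed
  have "form_ext n (b + 1) (de_rham_diff n ?F b u') = ?w"
    unfolding form_ext_koszul[OF u'] eq by (rule ext) (rule u(3))
  then have "de_rham_diff n ?F b u' = w"
    using form_ext_eqI[of _ n "b + 1" "carrier ?F" w] dd_closed[OF left_module_free_module u'] w by simp
  then show ?thesis using u' by blast
qed

section \<open>Quotients of vector spaces\<close>

lemma base_field_sel [simp]:
  "carrier (base_field :: 'k::field ring) = UNIV" "x \<oplus>\<^bsub>base_field\<^esub> y = x + y" "x \<otimes>\<^bsub>base_field\<^esub> y = x * y"
  "\<one>\<^bsub>base_field\<^esub> = (1 :: 'k)" "\<zero>\<^bsub>base_field\<^esub> = (0 :: 'k)"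
  by (simp_all add: ring_of_type_algebra_def)

lemma base_field_uminus: "\<ominus>\<^bsub>base_field\<^esub> x = - (x :: 'k::field)"
proof -
  interpret ring "base_field :: 'k ring" by (rule ring_from_type_algebra)
  show ?thesis by (rule minus_equality) simp_all
qed

lemma submodule_set_uminus:
  assumes "left_module R N" "submodule_set R N K" "x \<in> K"
  shows "\<ominus>\<^bsub>N\<^esub> x \<in> K"
proof -
  interpret left_module R N by fact
  have "(\<ominus>\<^bsub>R\<^esub> \<one>\<^bsub>R\<^esub>) \<odot>\<^bsub>N\<^esub> x \<in> K" using assms(2,3) by (simp add: submodule_set_def)
  then show ?thesis using assms(2,3) by (simp add: smult_minus_one submodule_set_def subset_iff)
qed

lemma submodule_set_minus:
  assumes "left_module R N" "submodule_set R N K" "x \<in> K" "y \<in> K"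
  shows "x \<ominus>\<^bsub>N\<^esub> y \<in> K"
  using submodule_set_uminus[OF assms(1,2,4)] assms(2,3) by (simp add: a_minus_def submodule_set_def)

locale quotient_space =
  fixes V :: "('k::field, 'v) module" and B
  assumes V: "left_module base_field V" and B: "submodule_set base_field V B"
begin

sublocale left_module "base_field :: 'k ring" V by (rule V)

lemma abelian_subgroup_B: "abelian_subgroup B V"
proof (rule abelian_subgroupI3)
  show "abelian_group V" by (rule abelian_group_axioms)
  show "additive_subgroup B V"
  proof (intro additive_subgroup.intro add.subgroupI)
    show "B \<subseteq> carrier V" "B \<noteq> {}" "\<And>x y. x \<in> B \<Longrightarrow> y \<in> B \<Longrightarrow> x \<oplus>\<^bsub>V\<^esub> y \<in> B"
      using B by (auto simp: submodule_set_def)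
    show "\<ominus>\<^bsub>V\<^esub> x \<in> B" if "x \<in> B" for x by (rule submodule_set_uminus[OF V B that])
  qed
qed

sublocale S: abelian_subgroup B V by (rule abelian_subgroup_B)

abbreviation "Q \<equiv> quot_module V B"
abbreviation "cl x \<equiv> B +>\<^bsub>V\<^esub> x"

lemma carrier_quot: "carrier Q = cl ` carrier V"
  by (auto simp: quot_module_def A_RCOSETS_def')

lemma cl_closed: "x \<in> carrier V \<Longrightarrow> cl x \<in> carrier Q"
  by (simp add: carrier_quot)

lemma mem_cl: "x \<in> carrier V \<Longrightarrow> y \<in> cl x \<longleftrightarrow> y \<in> carrier V \<and> y \<ominus>\<^bsub>V\<^esub> x \<in> B"
  using S.a_rcos_module[of x y] S.a_elemrcos_carrier by (auto simp: a_minus_def)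

lemma cl_eq_iff:
  assumes "x \<in> carrier V" "y \<in> carrier V"
  shows "cl x = cl y \<longleftrightarrow> x \<ominus>\<^bsub>V\<^esub> y \<in> B"
proof
  show "x \<ominus>\<^bsub>V\<^esub> y \<in> B" if "cl x = cl y"
    using S.a_rcos_self[OF assms(1)] mem_cl[OF assms(2)] that by blast
  show "cl x = cl y" if "x \<ominus>\<^bsub>V\<^esub> y \<in> B"
    using S.a_repr_independence'[of x y] mem_cl[OF assms(2), of x] assms that by blast
qed

lemma one_smult: "x \<in> carrier V \<Longrightarrow> 1 \<odot>\<^bsub>V\<^esub> x = x"
  using smult_one[of x] by simp

lemma cl_add: "x \<in> carrier V \<Longrightarrow> y \<in> carrier V \<Longrightarrow> cl x \<oplus>\<^bsub>Q\<^esub> cl y = cl (x \<oplus>\<^bsub>V\<^esub> y)"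
  by (simp add: quot_module_def S.a_rcos_sum)

lemma cl_zero: "\<zero>\<^bsub>Q\<^esub> = cl \<zero>\<^bsub>V\<^esub>"
  by (simp add: quot_module_def S.a_subset)

lemma cl_smult:
  assumes x: "x \<in> carrier V"
  shows "c \<odot>\<^bsub>Q\<^esub> cl x = cl (c \<odot>\<^bsub>V\<^esub> x)"
proof -
  have eq: "cl (c \<odot>\<^bsub>V\<^esub> y) = cl (c \<odot>\<^bsub>V\<^esub> x)" if "y \<in> cl x" for y
  proof -
    have y: "y \<in> carrier V" "y \<ominus>\<^bsub>V\<^esub> x \<in> B" using mem_cl[OF x] that by auto
    then have "c \<odot>\<^bsub>V\<^esub> (y \<ominus>\<^bsub>V\<^esub> x) \<in> B" using B by (simp add: submodule_set_def)
    also have "c \<odot>\<^bsub>V\<^esub> (y \<ominus>\<^bsub>V\<^esub> x) = c \<odot>\<^bsub>V\<^esub> y \<ominus>\<^bsub>V\<^esub> c \<odot>\<^bsub>V\<^esub> x"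
      using x y by (simp add: a_minus_def smult_r_distr smult_minus_r)
    finally show ?thesis using x y by (simp add: cl_eq_iff)
  qed
  have "c \<odot>\<^bsub>Q\<^esub> cl x = (\<Union>y \<in> cl x. cl (c \<odot>\<^bsub>V\<^esub> y))" by (simp add: quot_module_def)
  also have "\<dots> = (\<Union>y \<in> cl x. cl (c \<odot>\<^bsub>V\<^esub> x))" by (rule SUP_cong[OF refl eq])
  also have "\<dots> = cl (c \<odot>\<^bsub>V\<^esub> x)" using S.a_rcos_self[OF x] by blast
  finally show ?thesis .
qed

lemma left_module_quot: "left_module base_field Q"
proof -
  have "abelian_group Q"
  proof (rule abelian_groupI)
    fix C assume "C \<in> carrier Q"
    then obtain x where x: "x \<in> carrier V" "C = cl x" unfolding carrier_quot by blast
    then have "cl (\<ominus>\<^bsub>V\<^esub> x) \<in> carrier Q" by (simp add: cl_closed)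
    moreover have "cl (\<ominus>\<^bsub>V\<^esub> x) \<oplus>\<^bsub>Q\<^esub> C = \<zero>\<^bsub>Q\<^esub>" using x by (simp only: cl_add cl_zero a_inv_closed l_neg)
    ultimately show "\<exists>D \<in> carrier Q. D \<oplus>\<^bsub>Q\<^esub> C = \<zero>\<^bsub>Q\<^esub>" by blast
  next
    fix C D E assume "C \<in> carrier Q" "D \<in> carrier Q" "E \<in> carrier Q"
    then obtain x y z where "x \<in> carrier V" "C = cl x" "y \<in> carrier V" "D = cl y" "z \<in> carrier V" "E = cl z"
      unfolding carrier_quot by blast
    then show "(C \<oplus>\<^bsub>Q\<^esub> D) \<oplus>\<^bsub>Q\<^esub> E = C \<oplus>\<^bsub>Q\<^esub> (D \<oplus>\<^bsub>Q\<^esub> E)" by (simp add: cl_add a_assoc)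
  next
    fix C D assume "C \<in> carrier Q" "D \<in> carrier Q"
    then obtain x y where xy: "x \<in> carrier V" "C = cl x" "y \<in> carrier V" "D = cl y"
      unfolding carrier_quot by blast
    then show "C \<oplus>\<^bsub>Q\<^esub> D \<in> carrier Q" by (simp add: cl_add cl_closed)
    show "C \<oplus>\<^bsub>Q\<^esub> D = D \<oplus>\<^bsub>Q\<^esub> C" using xy by (simp add: cl_add a_comm)
  next
    show "\<zero>\<^bsub>Q\<^esub> \<in> carrier Q" by (simp add: cl_zero cl_closed)
    fix C assume "C \<in> carrier Q"
    then obtain x where "x \<in> carrier V" "C = cl x" unfolding carrier_quot by blast
    then show "\<zero>\<^bsub>Q\<^esub> \<oplus>\<^bsub>Q\<^esub> C = C" by (simp only: cl_zero cl_add zero_closed l_zero)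
  qed
  moreover have "left_module_axioms (base_field :: 'k ring) Q"
  proof
    fix a c C D assume "C \<in> carrier Q"
    then obtain x where x: "x \<in> carrier V" "C = cl x" unfolding carrier_quot by blast
    show "a \<odot>\<^bsub>Q\<^esub> C \<in> carrier Q" using x by (simp add: cl_smult cl_closed)
    show "(a \<oplus>\<^bsub>base_field\<^esub> c) \<odot>\<^bsub>Q\<^esub> C = a \<odot>\<^bsub>Q\<^esub> C \<oplus>\<^bsub>Q\<^esub> c \<odot>\<^bsub>Q\<^esub> C"
      using x smult_l_distr[of a c x] by (simp add: cl_smult cl_add)
    show "(a \<otimes>\<^bsub>base_field\<^esub> c) \<odot>\<^bsub>Q\<^esub> C = a \<odot>\<^bsub>Q\<^esub> (c \<odot>\<^bsub>Q\<^esub> C)"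
      using x smult_assoc1[of a c x] by (simp add: cl_smult)
    show "\<one>\<^bsub>base_field\<^esub> \<odot>\<^bsub>Q\<^esub> C = C" using x by (simp add: cl_smult one_smult)
    assume "D \<in> carrier Q"
    then obtain y where "y \<in> carrier V" "D = cl y" unfolding carrier_quot by blast
    with x show "a \<odot>\<^bsub>Q\<^esub> (C \<oplus>\<^bsub>Q\<^esub> D) = a \<odot>\<^bsub>Q\<^esub> C \<oplus>\<^bsub>Q\<^esub> a \<odot>\<^bsub>Q\<^esub> D"
      by (simp add: cl_smult cl_add smult_r_distr)
  qed
  ultimately show ?thesis using ring_from_type_algebra by (simp add: left_module_def)
qed

text \<open>First isomorphism theorem for a map given on representatives. The condition on the
  kernel compares two elements, so independence of the representative and injectivity on classes are
  its two directions.\<close>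

theorem quotient_iso:
  assumes cl: "\<And>x. x \<in> carrier V \<Longrightarrow> f x \<in> carrier W"
    and add: "\<And>x y. x \<in> carrier V \<Longrightarrow> y \<in> carrier V \<Longrightarrow> f (x \<oplus>\<^bsub>V\<^esub> y) = f x \<oplus>\<^bsub>W\<^esub> f y"
    and smult: "\<And>c x. x \<in> carrier V \<Longrightarrow> f (c \<odot>\<^bsub>V\<^esub> x) = c \<odot>\<^bsub>W\<^esub> f x"
    and ker: "\<And>x y. x \<in> carrier V \<Longrightarrow> y \<in> carrier V \<Longrightarrow> f x = f y \<longleftrightarrow> x \<ominus>\<^bsub>V\<^esub> y \<in> B"
    and surj: "\<And>z. z \<in> carrier W \<Longrightarrow> \<exists>x \<in> carrier V. f x = z"
  shows "space_iso Q W"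
proof -
  define F where "F = (\<lambda>C \<in> carrier Q. f (SOME x. x \<in> C))"
  have F: "F (cl x) = f x" if x: "x \<in> carrier V" for x
  proof -
    have "(SOME y. y \<in> cl x) \<in> cl x" using S.a_rcos_self[OF x] by (rule someI)
    then have "(SOME y. y \<in> cl x) \<in> carrier V \<and> (SOME y. y \<in> cl x) \<ominus>\<^bsub>V\<^esub> x \<in> B"
      using mem_cl[OF x] by blast
    then show ?thesis using x ker by (simp add: F_def cl_closed)
  qed
  have "F \<in> lin_hom base_field Q W"
    unfolding lin_hom_def
  proof (intro CollectI conjI ballI)
    show "F \<in> carrier Q \<rightarrow>\<^sub>E carrier W"
    proof (rule PiE_I)
      show "F C \<in> carrier W" if "C \<in> carrier Q" for C using that cl F by (auto simp: carrier_quot)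
    qed (simp add: F_def)
    show "F (C \<oplus>\<^bsub>Q\<^esub> D) = F C \<oplus>\<^bsub>W\<^esub> F D" if "C \<in> carrier Q" "D \<in> carrier Q" for C D
      using that by (auto simp: carrier_quot cl_add F add)
    show "F (c \<odot>\<^bsub>Q\<^esub> C) = c \<odot>\<^bsub>W\<^esub> F C" if "C \<in> carrier Q" for c C
      using that by (auto simp: carrier_quot cl_smult F smult)
  qed
  moreover have "bij_betw F (carrier Q) (carrier W)"
  proof (rule bij_betw_imageI)
    show "inj_on F (carrier Q)"
    proof (rule inj_onI)
      fix C D assume "C \<in> carrier Q" "D \<in> carrier Q" and eq: "F C = F D"
      then obtain x y where xy: "x \<in> carrier V" "y \<in> carrier V" "C = cl x" "D = cl y"
        unfolding carrier_quot by blast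
      then show "C = D" using eq F ker cl_eq_iff by simp
    qed
    show "F ` carrier Q = carrier W"
      using cl surj F by (force simp: carrier_quot image_iff)
  qed
  ultimately show ?thesis by (auto simp: space_iso_def)
qed

end

lemma space_iso_trans:
  assumes V: "left_module base_field V" and "space_iso V W" "space_iso W U"
  shows "space_iso V U"
proof -
  obtain f g where f: "f \<in> lin_hom base_field V W" "bij_betw f (carrier V) (carrier W)"
    and g: "g \<in> lin_hom base_field W U" "bij_betw g (carrier W) (carrier U)"
    using assms(2,3) by (auto simp: space_iso_def)
  have "compose (carrier V) g f \<in> lin_hom base_field V U" using V f(1) g(1) by (rule lin_hom_compose)
  moreover have "bij_betw (compose (carrier V) g f) (carrier V) (carrier U)"
    using bij_betw_trans[OF f(2) g(2)] by (subst bij_betw_cong[where g = "g \<circ> f"]) (auto simp: compose_def)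
  ultimately show ?thesis by (auto simp: space_iso_def)
qed

lemma space_iso_sym:
  assumes V: "left_module base_field V" and "space_iso V W"
  shows "space_iso W V"
proof -
  interpret left_module base_field V by fact
  obtain f where f: "f \<in> lin_hom base_field V W" "bij_betw f (carrier V) (carrier W)"
    using assms(2) by (auto simp: space_iso_def)
  define g where "g = restrict (inv_into (carrier V) f) (carrier W)"
  have gf: "g (f x) = x" if "x \<in> carrier V" for x
    using f(2) that lin_hom_closed[OF f(1)] by (simp add: g_def bij_betw_def)
  have W: "carrier W = f ` carrier V" using f(2) by (simp add: bij_betw_def)
  have "g \<in> lin_hom base_field W V"
    unfolding lin_hom_def
  proof (intro CollectI conjI ballI)
    show "g \<in> carrier W \<rightarrow>\<^sub>E carrier V"
      by (rule PiE_I) (use gf in \<open>auto simp: W g_def\<close>)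
    show "g (x \<oplus>\<^bsub>W\<^esub> y) = g x \<oplus>\<^bsub>V\<^esub> g y" if "x \<in> carrier W" "y \<in> carrier W" for x y
      using that gf by (auto simp: W simp flip: lin_hom_add[OF f(1)])
    show "g (c \<odot>\<^bsub>W\<^esub> x) = c \<odot>\<^bsub>V\<^esub> g x" if "c \<in> carrier base_field" "x \<in> carrier W" for c x
      using that gf by (auto simp: W simp flip: lin_hom_smult[OF f(1)])
  qed
  moreover have "bij_betw g (carrier W) (carrier V)"
    by (rule bij_betwI'[where f = g]) (use gf in \<open>auto simp: W\<close>)
  ultimately show ?thesis by (auto simp: space_iso_def)
qed

section \<open>Projective modules\<close>

text \<open>Finitely supported families; as total functions they vanish outside the index set.\<close>

definition finsupp_module :: "('a, 'y) ring_scheme \<Rightarrow> 'p set \<Rightarrow> ('a, 'p \<Rightarrow> 'a) module" where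
  "finsupp_module R I = \<lparr> carrier = {c. (\<forall>p. c p \<in> carrier R) \<and> finite {p. c p \<noteq> \<zero>\<^bsub>R\<^esub>} \<and> {p. c p \<noteq> \<zero>\<^bsub>R\<^esub>} \<subseteq> I},
     monoid.mult = \<lambda>_ _. undefined, one = undefined,
     zero = (\<lambda>p. \<zero>\<^bsub>R\<^esub>), add = \<lambda>c d p. c p \<oplus>\<^bsub>R\<^esub> d p, module.smult = \<lambda>a c p. a \<otimes>\<^bsub>R\<^esub> c p \<rparr>"

context
  fixes R :: "('a, 'y) ring_scheme" and I :: "'p set"
  assumes R: "ring R"
begin

interpretation R: ring R by (rule R)

abbreviation "FS \<equiv> finsupp_module R I"

lemma finsupp_sel [simp]:
  "carrier FS = {c. (\<forall>p. c p \<in> carrier R) \<and> finite {p. c p \<noteq> \<zero>\<^bsub>R\<^esub>} \<and> {p. c p \<noteq> \<zero>\<^bsub>R\<^esub>} \<subseteq> I}"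
  "\<zero>\<^bsub>FS\<^esub> = (\<lambda>p. \<zero>\<^bsub>R\<^esub>)" "c \<oplus>\<^bsub>FS\<^esub> d = (\<lambda>p. c p \<oplus>\<^bsub>R\<^esub> d p)" "a \<odot>\<^bsub>FS\<^esub> c = (\<lambda>p. a \<otimes>\<^bsub>R\<^esub> c p)"
  by (simp_all add: finsupp_module_def)

lemma left_module_finsupp: "left_module R FS"
proof -
  have fin: "finite {p. c p \<oplus>\<^bsub>R\<^esub> d p \<noteq> \<zero>\<^bsub>R\<^esub>} \<and> {p. c p \<oplus>\<^bsub>R\<^esub> d p \<noteq> \<zero>\<^bsub>R\<^esub>} \<subseteq> I"
    if "c \<in> carrier FS" "d \<in> carrier FS" for c d
  proof -
    have "{p. c p \<oplus>\<^bsub>R\<^esub> d p \<noteq> \<zero>\<^bsub>R\<^esub>} \<subseteq> {p. c p \<noteq> \<zero>\<^bsub>R\<^esub>} \<union> {p. d p \<noteq> \<zero>\<^bsub>R\<^esub>}" by auto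
    then show ?thesis using that by (auto intro: finite_subset)
  qed
  have sm: "finite {p. a \<otimes>\<^bsub>R\<^esub> c p \<noteq> \<zero>\<^bsub>R\<^esub>} \<and> {p. a \<otimes>\<^bsub>R\<^esub> c p \<noteq> \<zero>\<^bsub>R\<^esub>} \<subseteq> I"
    if "c \<in> carrier FS" "a \<in> carrier R" for a c
  proof -
    have "{p. a \<otimes>\<^bsub>R\<^esub> c p \<noteq> \<zero>\<^bsub>R\<^esub>} \<subseteq> {p. c p \<noteq> \<zero>\<^bsub>R\<^esub>}" using that(2) by auto
    then show ?thesis using that by (auto intro: finite_subset)
  qed
  have "abelian_group FS"
  proof (rule abelian_groupI)
    fix c assume c: "c \<in> carrier FS"
    then have "(\<lambda>p. (\<ominus>\<^bsub>R\<^esub> \<one>\<^bsub>R\<^esub>) \<otimes>\<^bsub>R\<^esub> c p) \<in> carrier FS" using sm[OF c, of "\<ominus>\<^bsub>R\<^esub> \<one>\<^bsub>R\<^esub>"] by auto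
    moreover have "(\<lambda>p. (\<ominus>\<^bsub>R\<^esub> \<one>\<^bsub>R\<^esub>) \<otimes>\<^bsub>R\<^esub> c p) \<oplus>\<^bsub>FS\<^esub> c = \<zero>\<^bsub>FS\<^esub>"
      using c by (simp add: R.l_minus R.l_neg)
    ultimately show "\<exists>d \<in> carrier FS. d \<oplus>\<^bsub>FS\<^esub> c = \<zero>\<^bsub>FS\<^esub>" by blast
  next
    show "c \<oplus>\<^bsub>FS\<^esub> d \<in> carrier FS" if "c \<in> carrier FS" "d \<in> carrier FS" for c d
      using fin[OF that] that by simp
  qed (simp_all add: R.a_ac)
  moreover have "left_module_axioms R FS"
  proof
    show "a \<odot>\<^bsub>FS\<^esub> c \<in> carrier FS" if "a \<in> carrier R" "c \<in> carrier FS" for a c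
      using sm[OF that(2,1)] that by simp
  qed (simp_all add: R.l_distr R.r_distr R.m_assoc)
  ultimately show ?thesis using R by (simp add: left_module_def)
qed

definition finsupp_map :: "('a, 'x) module \<Rightarrow> ('p \<Rightarrow> 'x) \<Rightarrow> ('p \<Rightarrow> 'a) \<Rightarrow> 'x" where
  "finsupp_map N g = (\<lambda>c \<in> carrier FS. \<Oplus>\<^bsub>N\<^esub>p\<in>{p. c p \<noteq> \<zero>\<^bsub>R\<^esub>}. c p \<odot>\<^bsub>N\<^esub> g p)"

context
  fixes N :: "('a, 'x) module" and g :: "'p \<Rightarrow> 'x"
  assumes N: "left_module R N" and g: "\<And>p. p \<in> I \<Longrightarrow> g p \<in> carrier N"
begin

interpretation N: left_module R N by (rule N)

lemma finsupp_map_eq: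
  assumes c: "c \<in> carrier FS" and S: "finite S" "{p. c p \<noteq> \<zero>\<^bsub>R\<^esub>} \<subseteq> S" "S \<subseteq> I"
  shows "finsupp_map N g c = (\<Oplus>\<^bsub>N\<^esub>p\<in>S. c p \<odot>\<^bsub>N\<^esub> g p)"
proof -
  have "(\<Oplus>\<^bsub>N\<^esub>p\<in>{p. c p \<noteq> \<zero>\<^bsub>R\<^esub>}. c p \<odot>\<^bsub>N\<^esub> g p) = (\<Oplus>\<^bsub>N\<^esub>p\<in>S. c p \<odot>\<^bsub>N\<^esub> g p)"
    using c S g by (intro N.add.finprod_mono_neutral_cong_left) (auto simp: subset_iff)
  then show ?thesis using c by (simp add: finsupp_map_def)
qed

lemma finsupp_map_lin_hom: "finsupp_map N g \<in> lin_hom R FS N"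
proof -
  have mem: "(\<lambda>p. c p \<odot>\<^bsub>N\<^esub> g p) \<in> S \<rightarrow> carrier N" if "c \<in> carrier FS" "S \<subseteq> I" for c S
    using that g by auto
  interpret F: left_module R FS by (rule left_module_finsupp)
  have "restrict (finsupp_map N g) (carrier FS) \<in> lin_hom R FS N"
  proof (rule lin_hom_restrict[OF _ _ _ left_module_finsupp])
    fix c d a assume c: "c \<in> carrier FS"
    let ?S = "\<lambda>c. {p. c p \<noteq> \<zero>\<^bsub>R\<^esub>}"
    have Sc: "finite (?S c)" "?S c \<subseteq> I" using c by auto
    show "finsupp_map N g c \<in> carrier N"
      using finsupp_map_eq[OF c Sc(1) subset_refl Sc(2)] mem[OF c Sc(2)] by (simp add: N.finsum_closed)
    { assume d: "d \<in> carrier FS"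
      let ?U = "?S c \<union> ?S d"
      have U: "finite ?U" "?U \<subseteq> I" using c d by auto
      have cd: "c \<oplus>\<^bsub>FS\<^esub> d \<in> carrier FS" using c d by (rule F.a_closed)
      have "finsupp_map N g (c \<oplus>\<^bsub>FS\<^esub> d) = (\<Oplus>\<^bsub>N\<^esub>p\<in>?U. (c \<oplus>\<^bsub>FS\<^esub> d) p \<odot>\<^bsub>N\<^esub> g p)"
        using U by (intro finsupp_map_eq[OF cd]) auto
      also have "\<dots> = (\<Oplus>\<^bsub>N\<^esub>p\<in>?U. c p \<odot>\<^bsub>N\<^esub> g p \<oplus>\<^bsub>N\<^esub> d p \<odot>\<^bsub>N\<^esub> g p)"
        using U(2) c d g by (intro N.finsum_cong') (auto simp: N.smult_l_distr subset_iff)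
      also have "\<dots> = finsupp_map N g c \<oplus>\<^bsub>N\<^esub> finsupp_map N g d"
        using mem[OF c U(2)] mem[OF d U(2)]
        by (simp add: N.finsum_addf finsupp_map_eq[OF c U(1) _ U(2)] finsupp_map_eq[OF d U(1) _ U(2)])
      finally show "finsupp_map N g (c \<oplus>\<^bsub>FS\<^esub> d) = finsupp_map N g c \<oplus>\<^bsub>N\<^esub> finsupp_map N g d" . }
    { assume a: "a \<in> carrier R"
      have ac: "a \<odot>\<^bsub>FS\<^esub> c \<in> carrier FS" using a c by (rule F.smult_closed)
      have "finsupp_map N g (a \<odot>\<^bsub>FS\<^esub> c) = (\<Oplus>\<^bsub>N\<^esub>p\<in>?S c. (a \<odot>\<^bsub>FS\<^esub> c) p \<odot>\<^bsub>N\<^esub> g p)"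
        using Sc a by (intro finsupp_map_eq[OF ac]) auto
      also have "\<dots> = (\<Oplus>\<^bsub>N\<^esub>p\<in>?S c. a \<odot>\<^bsub>N\<^esub> (c p \<odot>\<^bsub>N\<^esub> g p))"
        using Sc(2) c a g by (intro N.finsum_cong') (auto simp: N.smult_assoc1 subset_iff)
      also have "\<dots> = a \<odot>\<^bsub>N\<^esub> finsupp_map N g c"
        using mem[OF c Sc(2)] a Sc(1)
        by (simp add: N.smult_finsum finsupp_map_eq[OF c Sc(1) subset_refl Sc(2)])
      finally show "finsupp_map N g (a \<odot>\<^bsub>FS\<^esub> c) = a \<odot>\<^bsub>N\<^esub> finsupp_map N g c" . }
  qed
  then show ?thesis by (simp add: finsupp_map_def)
qed

lemma finsupp_map_delta:
  assumes p: "p \<in> I"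
  shows "(\<lambda>q. if q = p then \<one>\<^bsub>R\<^esub> else \<zero>\<^bsub>R\<^esub>) \<in> carrier FS"
    "finsupp_map N g (\<lambda>q. if q = p then \<one>\<^bsub>R\<^esub> else \<zero>\<^bsub>R\<^esub>) = g p"
proof -
  let ?d = "\<lambda>q. if q = p then \<one>\<^bsub>R\<^esub> else \<zero>\<^bsub>R\<^esub>"
  have S: "{q. ?d q \<noteq> \<zero>\<^bsub>R\<^esub>} \<subseteq> {p}" by auto
  then have "finite {q. ?d q \<noteq> \<zero>\<^bsub>R\<^esub>}" by (rule finite_subset) simp
  then show d: "?d \<in> carrier FS" using S p by auto
  have "finsupp_map N g ?d = (\<Oplus>\<^bsub>N\<^esub>q\<in>{p}. ?d q \<odot>\<^bsub>N\<^esub> g q)"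
    using S p by (intro finsupp_map_eq[OF d]) auto
  also have "\<dots> = g p" using g[OF p] by simp
  finally show "finsupp_map N g ?d = g p" .
qed

end

end

text \<open>The condition is on the image of \<open>f\<close> and not on surjectivity of
  \<open>g\<close>: exactness of a resolution provides exactly this inclusion, since there
  \<open>g\<close> maps onto a kernel.\<close>

definition lifts :: "('a, 'y) ring_scheme \<Rightarrow> ('a, 'p) module \<Rightarrow> ('a, 'q) module \<Rightarrow> ('a, 'b) module \<Rightarrow> bool" where
  "lifts R P A B \<longleftrightarrow> (\<forall>g \<in> lin_hom R A B. \<forall>f \<in> lin_hom R P B. f ` carrier P \<subseteq> g ` carrier A \<longrightarrow>
     (\<exists>h \<in> lin_hom R P A. \<forall>x \<in> carrier P. g (h x) = f x))"

text \<open>A projective module is a retract of the module of finitely supported families on its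
  carrier, which lifts against modules of every type.\<close>

lemma projective_lifts:
  fixes P :: "('a, 'p) module"
  assumes P: "projective_module R P" and A: "left_module R A" and B: "left_module R B"
  shows "lifts R P A B"
  unfolding lifts_def
proof (intro ballI impI)
  fix g f assume g: "g \<in> lin_hom R A B" and f: "f \<in> lin_hom R P B" and im: "f ` carrier P \<subseteq> g ` carrier A"
  have PM: "left_module R P" using P by (simp add: projective_module_def)
  interpret P: left_module R P by (rule PM)
  have R: "ring R" by (rule P.R.ring_axioms)
  interpret B: left_module R B by fact
  let ?F = "finsupp_module R (carrier P)"
  let ?\<pi> = "finsupp_map R (carrier P) P (\<lambda>p. p)"
  have F: "left_module R ?F" by (rule left_module_finsupp[OF R])
  have \<pi>: "?\<pi> \<in> lin_hom R ?F P" by (rule finsupp_map_lin_hom[OF R PM])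
  have surj: "?\<pi> ` carrier ?F = carrier P"
  proof
    show "?\<pi> ` carrier ?F \<subseteq> carrier P" using lin_hom_closed[OF \<pi>] by blast
    show "carrier P \<subseteq> ?\<pi> ` carrier ?F"
    proof
      fix p assume p: "p \<in> carrier P"
      show "p \<in> ?\<pi> ` carrier ?F"
        using finsupp_map_delta[OF R PM _ p, of "\<lambda>p. p"] by (intro image_eqI) (rule sym, assumption, assumption)
    qed
  qed
  have id: "restrict (\<lambda>x. x) (carrier P) \<in> lin_hom R P P" by (rule lin_hom_restrict[OF _ _ _ PM]) auto
  obtain \<sigma> where \<sigma>: "\<sigma> \<in> lin_hom R P ?F" "\<And>x. x \<in> carrier P \<Longrightarrow> ?\<pi> (\<sigma> x) = x"
    using P[unfolded projective_module_def, THEN conjunct2, rule_format, OF F PM \<pi> surj id] by auto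
  \<comment> \<open>The module of families has one generator for each element of \<open>P\<close>,
    so any choice of preimages of the values \<open>f p\<close> extends to a linear map
    \<open>?k\<close>. Composing it with the section \<sigma> of the canonical surjection gives the
    lift.\<close>
  have "\<forall>p \<in> carrier P. \<exists>a \<in> carrier A. g a = f p" using im by force
  then obtain a where a: "\<And>p. p \<in> carrier P \<Longrightarrow> a p \<in> carrier A" "\<And>p. p \<in> carrier P \<Longrightarrow> g (a p) = f p" by metis
  let ?k = "finsupp_map R (carrier P) A a"
  have k: "?k \<in> lin_hom R ?F A" by (rule finsupp_map_lin_hom[OF R A]) (rule a)
  have gk: "g (?k c) = f (?\<pi> c)" if c: "c \<in> carrier ?F" for c
  proof -
    let ?S = "{p. c p \<noteq> \<zero>\<^bsub>R\<^esub>}"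
    have S: "finite ?S" "?S \<subseteq> carrier P" "\<And>p. c p \<in> carrier R" using c by (auto simp: finsupp_sel[OF R])
    have ek: "?k c = (\<Oplus>\<^bsub>A\<^esub>p\<in>?S. c p \<odot>\<^bsub>A\<^esub> a p)"
      using a(1) by (rule finsupp_map_eq[OF R A _ c S(1) subset_refl S(2)])
    have e\<pi>: "?\<pi> c = (\<Oplus>\<^bsub>P\<^esub>p\<in>?S. c p \<odot>\<^bsub>P\<^esub> p)"
      by (rule finsupp_map_eq[OF R PM _ c S(1) subset_refl S(2)])
    have "g (?k c) = (\<Oplus>\<^bsub>B\<^esub>p\<in>?S. g (c p \<odot>\<^bsub>A\<^esub> a p))"
      unfolding ek
      using S a(1) left_module.smult_closed[OF A] by (intro lin_hom_finsum[OF A B g]) auto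
    also have "\<dots> = (\<Oplus>\<^bsub>B\<^esub>p\<in>?S. f (c p \<odot>\<^bsub>P\<^esub> p))"
    proof (rule B.finsum_cong'[OF refl])
      show "(\<lambda>p. f (c p \<odot>\<^bsub>P\<^esub> p)) \<in> ?S \<rightarrow> carrier B" using S lin_hom_closed[OF f] by auto
      show "g (c p \<odot>\<^bsub>A\<^esub> a p) = f (c p \<odot>\<^bsub>P\<^esub> p)" if "p \<in> ?S" for p
        using that S a by (simp add: lin_hom_smult[OF g] lin_hom_smult[OF f] subset_iff)
    qed
    also have "\<dots> = f (?\<pi> c)"
      unfolding e\<pi>
      using S by (intro lin_hom_finsum[OF PM B f, symmetric]) auto
    finally show ?thesis .
  qed
  have "compose (carrier P) ?k \<sigma> \<in> lin_hom R P A" using PM \<sigma>(1) k by (rule lin_hom_compose)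
  moreover have "g (compose (carrier P) ?k \<sigma> x) = f x" if "x \<in> carrier P" for x
    using that gk[OF lin_hom_closed[OF \<sigma>(1)]] \<sigma>(2) by (simp add: compose_def)
  ultimately show "\<exists>h \<in> lin_hom R P A. \<forall>x \<in> carrier P. g (h x) = f x" by blast
qed

lemma free_module_lifts:
  fixes A :: "('k::field_char_0 diff_op, 'q) module" and B :: "('k diff_op, 'b) module"
  assumes A: "left_module (diff_op_ring n) A" and B: "left_module (diff_op_ring n) B"
  shows "lifts (diff_op_ring n) (free_module n r) A B"
  unfolding lifts_def
proof (intro ballI impI)
  let ?D = "diff_op_ring n :: 'k diff_op ring" and ?F = "free_module n r :: ('k diff_op, 'k mpoly) module"
  fix g f assume g: "g \<in> lin_hom ?D A B" and f: "f \<in> lin_hom ?D ?F B" and im: "f ` carrier ?F \<subseteq> g ` carrier A"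
  have "\<forall>s. s < r \<longrightarrow> (\<exists>a \<in> carrier A. g a = f (gen_symbol n s))"
  proof (intro allI impI)
    fix s assume "s < r"
    then have "f (gen_symbol n s) \<in> g ` carrier A" using im by (simp add: image_subset_iff)
    then show "\<exists>a \<in> carrier A. g a = f (gen_symbol n s)" by (metis imageE)
  qed
  then obtain a where a: "\<And>s. s < r \<Longrightarrow> a s \<in> carrier A" "\<And>s. s < r \<Longrightarrow> g (a s) = f (gen_symbol n s)" by metis
  have h: "free_map n r A a \<in> lin_hom ?D ?F A" by (rule free_map_lin_hom[OF A]) (rule a)
  have gh: "compose (carrier ?F) g (free_map n r A a) \<in> lin_hom ?D ?F B"
    by (rule lin_hom_compose[OF left_module_free_module h g])
  have "compose (carrier ?F) g (free_map n r A a) x = f x" if "x \<in> symbols n r" for x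
    using free_module_lin_hom_eq[OF B gh f _ that] by (simp add: compose_def free_map_gen[OF A a(1)] a(2))
  then have "\<forall>x \<in> carrier ?F. g (free_map n r A a x) = f x" by (simp add: compose_def)
  with h show "\<exists>h \<in> lin_hom ?D ?F A. \<forall>x \<in> carrier ?F. g (h x) = f x" by blast
qed

section \<open>Comparison of resolutions\<close>

text \<open>Exactness alone. The lifting property is supplied separately by \<open>lifts\<close>, so
  the notion serves projective resolutions, free resolutions and the rows of vector spaces in the
  double complex alike.\<close>

definition exact_resolution ::
  "('a, 'y) ring_scheme \<Rightarrow> (nat \<Rightarrow> ('a, 'p) module) \<Rightarrow> (nat \<Rightarrow> 'p \<Rightarrow> 'p) \<Rightarrow> ('p \<Rightarrow> 'm)
    \<Rightarrow> ('a, 'm) module \<Rightarrow> bool" where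
  "exact_resolution R P \<delta> \<epsilon> M \<longleftrightarrow> left_module R M \<and>
     (\<forall>i. left_module R (P i)) \<and>
     (\<forall>i. \<delta> i \<in> lin_hom R (P (Suc i)) (P i)) \<and>
     \<epsilon> \<in> lin_hom R (P 0) M \<and>
     \<epsilon> ` carrier (P 0) = carrier M \<and>
     \<delta> 0 ` carrier (P 1) = {x \<in> carrier (P 0). \<epsilon> x = \<zero>\<^bsub>M\<^esub>} \<and>
     (\<forall>i. \<delta> (Suc i) ` carrier (P (Suc (Suc i))) =
          {x \<in> carrier (P (Suc i)). \<delta> i x = \<zero>\<^bsub>P i\<^esub>})"

lemma projective_exact_resolution:
  "left_module R M \<Longrightarrow> projective_resolution R P \<delta> \<epsilon> M \<Longrightarrow> exact_resolution R P \<delta> \<epsilon> M"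
  by (simp add: projective_resolution_def exact_resolution_def projective_module_def)

lemma exact_resolutionD:
  assumes "exact_resolution R P \<delta> \<epsilon> M"
  shows "left_module R M" "left_module R (P i)" "\<delta> i \<in> lin_hom R (P (Suc i)) (P i)" "\<epsilon> \<in> lin_hom R (P 0) M"
    "y \<in> carrier M \<Longrightarrow> \<exists>x \<in> carrier (P 0). \<epsilon> x = y"
    "x \<in> carrier (P (Suc 0)) \<Longrightarrow> \<epsilon> (\<delta> 0 x) = \<zero>\<^bsub>M\<^esub>"
    "x \<in> carrier (P (Suc (Suc i))) \<Longrightarrow> \<delta> i (\<delta> (Suc i) x) = \<zero>\<^bsub>P i\<^esub>"
    "x \<in> carrier (P 0) \<Longrightarrow> \<epsilon> x = \<zero>\<^bsub>M\<^esub> \<Longrightarrow> \<exists>u \<in> carrier (P (Suc 0)). \<delta> 0 u = x"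
    "x \<in> carrier (P (Suc i)) \<Longrightarrow> \<delta> i x = \<zero>\<^bsub>P i\<^esub> \<Longrightarrow> \<exists>u \<in> carrier (P (Suc (Suc i))). \<delta> (Suc i) u = x"
proof -
  note r = assms[unfolded exact_resolution_def One_nat_def]
  show "left_module R M" "left_module R (P i)" "\<delta> i \<in> lin_hom R (P (Suc i)) (P i)" "\<epsilon> \<in> lin_hom R (P 0) M"
    using r by blast+
  have im: "\<epsilon> ` carrier (P 0) = carrier M" "\<delta> 0 ` carrier (P (Suc 0)) = {x \<in> carrier (P 0). \<epsilon> x = \<zero>\<^bsub>M\<^esub>}"
    "\<delta> (Suc i) ` carrier (P (Suc (Suc i))) = {x \<in> carrier (P (Suc i)). \<delta> i x = \<zero>\<^bsub>P i\<^esub>}"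
    using r by blast+
  show "y \<in> carrier M \<Longrightarrow> \<exists>x \<in> carrier (P 0). \<epsilon> x = y" using im(1) by (metis imageE)
  show "x \<in> carrier (P (Suc 0)) \<Longrightarrow> \<epsilon> (\<delta> 0 x) = \<zero>\<^bsub>M\<^esub>" using im(2) by blast
  show "x \<in> carrier (P (Suc (Suc i))) \<Longrightarrow> \<delta> i (\<delta> (Suc i) x) = \<zero>\<^bsub>P i\<^esub>" using im(3) by blast
  show "x \<in> carrier (P 0) \<Longrightarrow> \<epsilon> x = \<zero>\<^bsub>M\<^esub> \<Longrightarrow> \<exists>u \<in> carrier (P (Suc 0)). \<delta> 0 u = x"
    using im(2) by (metis (mono_tags, lifting) imageE mem_Collect_eq)
  show "x \<in> carrier (P (Suc i)) \<Longrightarrow> \<delta> i x = \<zero>\<^bsub>P i\<^esub> \<Longrightarrow> \<exists>u \<in> carrier (P (Suc (Suc i))). \<delta> (Suc i) u = x"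
    using im(3) by (metis (mono_tags, lifting) imageE mem_Collect_eq)
qed

definition chain_map where
  "chain_map R P \<delta> Q \<delta>' f \<longleftrightarrow> (\<forall>a. f a \<in> lin_hom R (P a) (Q a)) \<and>
     (\<forall>a. \<forall>x \<in> carrier (P (Suc a)). \<delta>' a (f (Suc a) x) = f a (\<delta> a x))"

lemma liftsD:
  assumes "lifts R P A B" "g \<in> lin_hom R A B" "f \<in> lin_hom R P B"
    "\<And>x. x \<in> carrier P \<Longrightarrow> \<exists>y \<in> carrier A. g y = f x"
  shows "\<exists>h \<in> lin_hom R P A. \<forall>x \<in> carrier P. g (h x) = f x"
proof -
  have "f ` carrier P \<subseteq> g ` carrier A" using assms(4) by (metis image_subsetI rev_image_eqI)
  then show ?thesis using assms(1-3) unfolding lifts_def by blast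
qed

lemma chain_map_exists:
  assumes P: "exact_resolution R P \<delta> \<epsilon> M" and Q: "exact_resolution R Q \<delta>' \<epsilon>' M"
    and L0: "lifts R (P 0) (Q 0) M" and LS: "\<And>a. lifts R (P (Suc a)) (Q (Suc a)) (Q a)"
  shows "\<exists>f. chain_map R P \<delta> Q \<delta>' f \<and> (\<forall>x \<in> carrier (P 0). \<epsilon>' (f 0 x) = \<epsilon> x)"
proof -
  note P' = exact_resolutionD[OF P] and Q' = exact_resolutionD[OF Q]
  \<comment> \<open>Besides linearity the invariant records that \<open>f\<close> after the
    differential takes values in the image of the differential of \<open>Q\<close>; this is what the
    lift in the next degree requires.\<close>
  define I where "I n f \<longleftrightarrow> f \<in> lin_hom R (P n) (Q n) \<and> (n = 0 \<longrightarrow> (\<forall>x \<in> carrier (P 0). \<epsilon>' (f x) = \<epsilon> x)) \<and>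
    (\<forall>x \<in> carrier (P (Suc n)). \<exists>u \<in> carrier (Q (Suc n)). \<delta>' n u = f (\<delta> n x))" for n f
  have "\<exists>f. \<forall>n. I n (f n) \<and> (\<forall>x \<in> carrier (P (Suc n)). \<delta>' n (f (Suc n) x) = f n (\<delta> n x))"
  proof (rule dependent_nat_choice)
    obtain f where f: "f \<in> lin_hom R (P 0) (Q 0)" "\<And>x. x \<in> carrier (P 0) \<Longrightarrow> \<epsilon>' (f x) = \<epsilon> x"
    proof -
      have "\<exists>y \<in> carrier (Q 0). \<epsilon>' y = \<epsilon> x" if "x \<in> carrier (P 0)" for x
        by (rule Q'(5)) (rule lin_hom_closed[OF P'(4) that])
      from liftsD[OF L0 Q'(4) P'(4) this] show thesis using that by blast
    qed
    have "\<exists>u \<in> carrier (Q (Suc 0)). \<delta>' 0 u = f (\<delta> 0 x)" if x: "x \<in> carrier (P (Suc 0))" for x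
    proof -
      have dx: "\<delta> 0 x \<in> carrier (P 0)" by (rule lin_hom_closed[OF P'(3) x])
      have "\<epsilon>' (f (\<delta> 0 x)) = \<zero>\<^bsub>M\<^esub>" using f(2)[OF dx] P'(6)[of x] x by simp
      then show ?thesis using Q'(8)[OF lin_hom_closed[OF f(1) dx]] by simp
    qed
    then show "\<exists>f. I 0 f" unfolding I_def using f by blast
  next
    fix f n assume f: "I n f"
    then have fl: "f \<in> lin_hom R (P n) (Q n)" by (simp add: I_def)
    have c: "compose (carrier (P (Suc n))) f (\<delta> n) \<in> lin_hom R (P (Suc n)) (Q n)"
      by (rule lin_hom_compose[OF P'(2) P'(3) fl])
    obtain h where h: "h \<in> lin_hom R (P (Suc n)) (Q (Suc n))"
      "\<And>x. x \<in> carrier (P (Suc n)) \<Longrightarrow> \<delta>' n (h x) = compose (carrier (P (Suc n))) f (\<delta> n) x"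
    proof -
      have "\<exists>y \<in> carrier (Q (Suc n)). \<delta>' n y = compose (carrier (P (Suc n))) f (\<delta> n) x" if "x \<in> carrier (P (Suc n))" for x
        using f that by (simp add: I_def compose_def)
      from liftsD[OF LS Q'(3) c this] show thesis using that by blast
    qed
    have h2: "\<delta>' n (h x) = f (\<delta> n x)" if "x \<in> carrier (P (Suc n))" for x
      using h(2)[OF that] that by (simp add: compose_def)
    have "\<exists>u \<in> carrier (Q (Suc (Suc n))). \<delta>' (Suc n) u = h (\<delta> (Suc n) x)" if x: "x \<in> carrier (P (Suc (Suc n)))" for x
    proof -
      have dx: "\<delta> (Suc n) x \<in> carrier (P (Suc n))" by (rule lin_hom_closed[OF P'(3) x])
      have "\<delta>' n (h (\<delta> (Suc n) x)) = \<zero>\<^bsub>Q n\<^esub>"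
        using h2[OF dx] P'(7)[OF x] lin_hom_zero[OF P'(2) Q'(2) fl] by simp
      then show ?thesis by (rule Q'(9)[OF lin_hom_closed[OF h(1) dx]])
    qed
    then have "I (Suc n) h" using h(1) by (simp add: I_def)
    then show "\<exists>h. I (Suc n) h \<and> (\<forall>x \<in> carrier (P (Suc n)). \<delta>' n (h x) = f (\<delta> n x))" using h2 by blast
  qed
  then obtain f where "\<forall>n. I n (f n) \<and> (\<forall>x \<in> carrier (P (Suc n)). \<delta>' n (f (Suc n) x) = f n (\<delta> n x))" by blast
  then show ?thesis unfolding chain_map_def I_def by blast
qed

lemma lin_hom_diff:
  assumes "left_module R A" "left_module R B" "f \<in> lin_hom R A B" "g \<in> lin_hom R A B"
  shows "(\<lambda>x \<in> carrier A. f x \<ominus>\<^bsub>B\<^esub> g x) \<in> lin_hom R A B"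
proof -
  interpret A: left_module R A by fact
  interpret B: left_module R B by fact
  show ?thesis
  proof (rule lin_hom_restrict[OF _ _ _ assms(1)])
    fix x y r assume x: "x \<in> carrier A"
    note fx = lin_hom_closed[OF assms(3) x] lin_hom_closed[OF assms(4) x]
    show "f x \<ominus>\<^bsub>B\<^esub> g x \<in> carrier B" using fx by simp
    { assume y: "y \<in> carrier A"
      note fy = lin_hom_closed[OF assms(3) y] lin_hom_closed[OF assms(4) y]
      show "f (x \<oplus>\<^bsub>A\<^esub> y) \<ominus>\<^bsub>B\<^esub> g (x \<oplus>\<^bsub>A\<^esub> y) = f x \<ominus>\<^bsub>B\<^esub> g x \<oplus>\<^bsub>B\<^esub> (f y \<ominus>\<^bsub>B\<^esub> g y)"
        using x y fx fy by (simp add: lin_hom_add[OF assms(3)] lin_hom_add[OF assms(4)] a_minus_def B.minus_add B.a_ac) }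
    { assume r: "r \<in> carrier R"
      show "f (r \<odot>\<^bsub>A\<^esub> x) \<ominus>\<^bsub>B\<^esub> g (r \<odot>\<^bsub>A\<^esub> x) = r \<odot>\<^bsub>B\<^esub> (f x \<ominus>\<^bsub>B\<^esub> g x)"
        using x r fx by (simp add: lin_hom_smult[OF assms(3)] lin_hom_smult[OF assms(4)] a_minus_def B.smult_r_distr B.smult_minus_r) }
  qed
qed

text \<open>The part \<open>r n s\<close> of \<open>f\<close> that the homotopy does not yet account
  for is annihilated by the differential, because the homotopy identity already holds one degree
  lower. By exactness it takes values in the image of the next differential, and its lift is the
  next component.\<close>

lemma homotopy_exists:
  assumes P: "exact_resolution R P \<delta> \<epsilon> M" and Q: "exact_resolution R Q \<delta>' \<epsilon>' M"
    and L: "\<And>a. lifts R (P a) (Q (Suc a)) (Q a)"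
    and f: "chain_map R P \<delta> Q \<delta>' f" and f0: "\<And>x. x \<in> carrier (P 0) \<Longrightarrow> \<epsilon>' (f 0 x) = \<zero>\<^bsub>M\<^esub>"
  shows "\<exists>s. (\<forall>a. s a \<in> lin_hom R (P a) (Q (Suc a))) \<and> (\<forall>x \<in> carrier (P 0). f 0 x = \<delta>' 0 (s 0 x)) \<and>
    (\<forall>a. \<forall>x \<in> carrier (P (Suc a)). f (Suc a) x = \<delta>' (Suc a) (s (Suc a) x) \<oplus>\<^bsub>Q (Suc a)\<^esub> s a (\<delta> a x))"
proof -
  note P' = exact_resolutionD[OF P] and Q' = exact_resolutionD[OF Q]
  have fl: "f a \<in> lin_hom R (P a) (Q a)" for a using f by (simp add: chain_map_def)
  have fc: "\<delta>' a (f (Suc a) x) = f a (\<delta> a x)" if "x \<in> carrier (P (Suc a))" for a x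
    using f that by (simp add: chain_map_def)
  define r where "r n s = (\<lambda>x \<in> carrier (P (Suc n)). f (Suc n) x \<ominus>\<^bsub>Q (Suc n)\<^esub> compose (carrier (P (Suc n))) s (\<delta> n) x)" for n s
  define I where "I n s \<longleftrightarrow> s \<in> lin_hom R (P n) (Q (Suc n)) \<and> (n = 0 \<longrightarrow> (\<forall>x \<in> carrier (P 0). f 0 x = \<delta>' 0 (s x))) \<and>
    (\<forall>x \<in> carrier (P (Suc n)). \<exists>u \<in> carrier (Q (Suc (Suc n))). \<delta>' (Suc n) u = r n s x)" for n s
  have r_eq: "r n s x = f (Suc n) x \<ominus>\<^bsub>Q (Suc n)\<^esub> s (\<delta> n x)" if "x \<in> carrier (P (Suc n))" for n s x
    using that by (simp add: r_def compose_def)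
  have r_hom: "r n s \<in> lin_hom R (P (Suc n)) (Q (Suc n))" if "s \<in> lin_hom R (P n) (Q (Suc n))" for n s
    unfolding r_def by (rule lin_hom_diff[OF P'(2) Q'(2) fl lin_hom_compose[OF P'(2) P'(3) that]])
  have "\<exists>s. \<forall>n. I n (s n) \<and> (\<forall>x \<in> carrier (P (Suc n)). r n (s n) x = \<delta>' (Suc n) (s (Suc n) x))"
  proof (rule dependent_nat_choice)
    obtain s where s: "s \<in> lin_hom R (P 0) (Q (Suc 0))" "\<And>x. x \<in> carrier (P 0) \<Longrightarrow> \<delta>' 0 (s x) = f 0 x"
    proof -
      have "\<exists>y \<in> carrier (Q (Suc 0)). \<delta>' 0 y = f 0 x" if "x \<in> carrier (P 0)" for x
        using Q'(8)[OF lin_hom_closed[OF fl that] f0[OF that]] by simp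
      from liftsD[OF L Q'(3) fl this] show thesis using that by blast
    qed
    have "\<exists>u \<in> carrier (Q (Suc (Suc 0))). \<delta>' (Suc 0) u = r 0 s x" if x: "x \<in> carrier (P (Suc 0))" for x
    proof (rule Q'(9))
      interpret Q0: left_module R "Q 0" by (rule Q'(2))
      have dx: "\<delta> 0 x \<in> carrier (P 0)" by (rule lin_hom_closed[OF P'(3) x])
      show "r 0 s x \<in> carrier (Q (Suc 0))" by (rule lin_hom_closed[OF r_hom[OF s(1)] x])
      have "\<delta>' 0 (r 0 s x) = \<delta>' 0 (f (Suc 0) x) \<ominus>\<^bsub>Q 0\<^esub> \<delta>' 0 (s (\<delta> 0 x))"
        unfolding r_eq[OF x]
        by (rule lin_hom_minus[OF Q'(2) Q'(2) Q'(3) lin_hom_closed[OF fl x] lin_hom_closed[OF s(1) dx]])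
      also have "\<dots> = \<zero>\<^bsub>Q 0\<^esub>"
        using lin_hom_closed[OF fl dx] by (simp add: fc[OF x] s(2)[OF dx] a_minus_def Q0.r_neg)
      finally show "\<delta>' 0 (r 0 s x) = \<zero>\<^bsub>Q 0\<^esub>" .
    qed
    then show "\<exists>s. I 0 s" unfolding I_def using s by metis
  next
    fix s n assume s: "I n s"
    then have sl: "s \<in> lin_hom R (P n) (Q (Suc n))" by (simp add: I_def)
    obtain h where h: "h \<in> lin_hom R (P (Suc n)) (Q (Suc (Suc n)))"
      "\<And>x. x \<in> carrier (P (Suc n)) \<Longrightarrow> \<delta>' (Suc n) (h x) = r n s x"
    proof -
      have "\<exists>y \<in> carrier (Q (Suc (Suc n))). \<delta>' (Suc n) y = r n s x" if "x \<in> carrier (P (Suc n))" for x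
        using s that by (simp add: I_def)
      from liftsD[OF L Q'(3) r_hom[OF sl] this] show thesis using that by blast
    qed
    have "\<exists>u \<in> carrier (Q (Suc (Suc (Suc n)))). \<delta>' (Suc (Suc n)) u = r (Suc n) h x"
      if x: "x \<in> carrier (P (Suc (Suc n)))" for x
    proof (rule Q'(9))
      interpret Q1: left_module R "Q (Suc n)" by (rule Q'(2))
      have dx: "\<delta> (Suc n) x \<in> carrier (P (Suc n))" by (rule lin_hom_closed[OF P'(3) x])
      note fdx = lin_hom_closed[OF fl dx]
      show "r (Suc n) h x \<in> carrier (Q (Suc (Suc n)))" by (rule lin_hom_closed[OF r_hom[OF h(1)] x])
      have "\<delta>' (Suc n) (r (Suc n) h x) = \<delta>' (Suc n) (f (Suc (Suc n)) x) \<ominus>\<^bsub>Q (Suc n)\<^esub> \<delta>' (Suc n) (h (\<delta> (Suc n) x))"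
        unfolding r_eq[OF x]
        by (rule lin_hom_minus[OF Q'(2) Q'(2) Q'(3) lin_hom_closed[OF fl x] lin_hom_closed[OF h(1) dx]])
      also have "\<delta>' (Suc n) (h (\<delta> (Suc n) x)) = f (Suc n) (\<delta> (Suc n) x)"
        using fdx P'(7)[OF x] lin_hom_zero[OF P'(2) Q'(2) sl] by (simp add: h(2)[OF dx] r_eq[OF dx] a_minus_def)
      finally show "\<delta>' (Suc n) (r (Suc n) h x) = \<zero>\<^bsub>Q (Suc n)\<^esub>"
        using fdx by (simp add: fc[OF x] a_minus_def Q1.r_neg)
    qed
    then have "I (Suc n) h" using h(1) by (simp add: I_def)
    then show "\<exists>h. I (Suc n) h \<and> (\<forall>x \<in> carrier (P (Suc n)). r n s x = \<delta>' (Suc n) (h x))" using h(2) by metis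
  qed
  then obtain s where s: "\<And>n. I n (s n)" "\<And>n x. x \<in> carrier (P (Suc n)) \<Longrightarrow> r n (s n) x = \<delta>' (Suc n) (s (Suc n) x)" by blast
  have sl: "s n \<in> lin_hom R (P n) (Q (Suc n))" for n using s(1)[of n] by (simp add: I_def)
  have "f (Suc n) x = \<delta>' (Suc n) (s (Suc n) x) \<oplus>\<^bsub>Q (Suc n)\<^esub> s n (\<delta> n x)" if x: "x \<in> carrier (P (Suc n))" for n x
  proof -
    interpret Q1: left_module R "Q (Suc n)" by (rule Q'(2))
    have "f (Suc n) x \<in> carrier (Q (Suc n))" "s n (\<delta> n x) \<in> carrier (Q (Suc n))"
      using lin_hom_closed[OF fl x] lin_hom_closed[OF sl lin_hom_closed[OF P'(3) x]] by auto
    then show ?thesis using s(2)[OF x] by (simp add: r_eq[OF x] a_minus_def Q1.a_assoc Q1.l_neg flip: s(2)[OF x])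
  qed
  moreover have "\<forall>x \<in> carrier (P 0). f 0 x = \<delta>' 0 (s 0 x)" using s(1)[of 0] by (simp add: I_def)
  ultimately show ?thesis using sl by blast
qed

text \<open>Both \<open>f\<close> and \<open>g\<close> cover the identity of \<open>M\<close>, so
  \<open>g\<close> after \<open>f\<close> minus the identity covers the zero map and
  \<open>homotopy_exists\<close> applies.\<close>

lemma chain_map_homotopic_id:
  assumes P: "exact_resolution R P \<delta> \<epsilon> M" and L: "\<And>a. lifts R (P a) (P (Suc a)) (P a)"
    and f: "chain_map R P \<delta> Q \<delta>' f" and g: "chain_map R Q \<delta>' P \<delta> g" and Q: "exact_resolution R Q \<delta>' \<epsilon>' M"
    and f0: "\<And>x. x \<in> carrier (P 0) \<Longrightarrow> \<epsilon>' (f 0 x) = \<epsilon> x" and g0: "\<And>x. x \<in> carrier (Q 0) \<Longrightarrow> \<epsilon> (g 0 x) = \<epsilon>' x"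
  shows "\<exists>s. (\<forall>a. s a \<in> lin_hom R (P a) (P (Suc a))) \<and>
    (\<forall>x \<in> carrier (P 0). g 0 (f 0 x) \<ominus>\<^bsub>P 0\<^esub> x = \<delta> 0 (s 0 x)) \<and>
    (\<forall>a. \<forall>x \<in> carrier (P (Suc a)). g (Suc a) (f (Suc a) x) \<ominus>\<^bsub>P (Suc a)\<^esub> x =
       \<delta> (Suc a) (s (Suc a) x) \<oplus>\<^bsub>P (Suc a)\<^esub> s a (\<delta> a x))"
proof -
  note P' = exact_resolutionD[OF P] and Q' = exact_resolutionD[OF Q]
  have fl: "f a \<in> lin_hom R (P a) (Q a)" and gl: "g a \<in> lin_hom R (Q a) (P a)" for a
    using f g by (simp_all add: chain_map_def)
  have fc: "\<delta>' a (f (Suc a) x) = f a (\<delta> a x)" if "x \<in> carrier (P (Suc a))" for a x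
    using f that by (simp add: chain_map_def)
  have gc: "\<delta> a (g (Suc a) x) = g a (\<delta>' a x)" if "x \<in> carrier (Q (Suc a))" for a x
    using g that by (simp add: chain_map_def)
  define h where "h a = (\<lambda>x \<in> carrier (P a). compose (carrier (P a)) (g a) (f a) x \<ominus>\<^bsub>P a\<^esub> (\<lambda>x \<in> carrier (P a). x) x)" for a
  have h_eq: "h a x = g a (f a x) \<ominus>\<^bsub>P a\<^esub> x" if "x \<in> carrier (P a)" for a x
    using that by (simp add: h_def compose_def)
  have id: "(\<lambda>x \<in> carrier (P a). x) \<in> lin_hom R (P a) (P a)" for a
    by (rule lin_hom_restrict[OF _ _ _ P'(2)]) auto
  have hl: "h a \<in> lin_hom R (P a) (P a)" for a
    unfolding h_def by (rule lin_hom_diff[OF P'(2) P'(2) lin_hom_compose[OF P'(2) fl gl] id])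
  have "chain_map R P \<delta> P \<delta> h"
    unfolding chain_map_def
  proof (intro conjI allI ballI hl)
    fix a x assume x: "x \<in> carrier (P (Suc a))"
    have dx: "\<delta> a x \<in> carrier (P a)" by (rule lin_hom_closed[OF P'(3) x])
    show "\<delta> a (h (Suc a) x) = h a (\<delta> a x)"
      using lin_hom_minus[OF P'(2) P'(2) P'(3) lin_hom_closed[OF gl lin_hom_closed[OF fl x]] x]
      by (simp add: h_eq[OF x] h_eq[OF dx] gc[OF lin_hom_closed[OF fl x]] fc[OF x])
  qed
  moreover have "\<epsilon> (h 0 x) = \<zero>\<^bsub>M\<^esub>" if x: "x \<in> carrier (P 0)" for x
  proof -
    interpret M: left_module R M by (rule P'(1))
    show ?thesis
      using lin_hom_minus[OF P'(2) P'(1) P'(4) lin_hom_closed[OF gl lin_hom_closed[OF fl x]] x] lin_hom_closed[OF P'(4) x]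
      by (simp add: h_eq[OF x] g0[OF lin_hom_closed[OF fl x]] f0[OF x] a_minus_def M.r_neg)
  qed
  ultimately obtain s where s: "\<forall>a. s a \<in> lin_hom R (P a) (P (Suc a))" "\<forall>x \<in> carrier (P 0). h 0 x = \<delta> 0 (s 0 x)"
    "\<forall>a. \<forall>x \<in> carrier (P (Suc a)). h (Suc a) x = \<delta> (Suc a) (s (Suc a) x) \<oplus>\<^bsub>P (Suc a)\<^esub> s a (\<delta> a x)"
    using homotopy_exists[OF P P L] by blast
  then show ?thesis using h_eq by (intro exI[of _ s]) simp
qed

section \<open>Independence of Ext from the resolution\<close>

lemma left_module_sub:
  assumes V: "left_module R V" and K: "submodule_set R V K"
  shows "left_module R (V\<lparr>carrier := K\<rparr>)"
proof -
  interpret left_module R V by (rule V)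
  have K': "\<And>x. x \<in> K \<Longrightarrow> x \<in> carrier V" "\<zero>\<^bsub>V\<^esub> \<in> K" "\<And>x y. x \<in> K \<Longrightarrow> y \<in> K \<Longrightarrow> x \<oplus>\<^bsub>V\<^esub> y \<in> K"
    "\<And>a x. a \<in> carrier R \<Longrightarrow> x \<in> K \<Longrightarrow> a \<odot>\<^bsub>V\<^esub> x \<in> K"
    using K by (auto simp: submodule_set_def)
  have "abelian_group (V\<lparr>carrier := K\<rparr>)"
  proof (rule abelian_groupI)
    fix x assume "x \<in> carrier (V\<lparr>carrier := K\<rparr>)"
    then have x: "x \<in> K" by simp
    then have "\<ominus>\<^bsub>V\<^esub> x \<in> K" by (rule submodule_set_uminus[OF V K])
    then show "\<exists>y \<in> carrier (V\<lparr>carrier := K\<rparr>). y \<oplus>\<^bsub>V\<lparr>carrier := K\<rparr>\<^esub> x = \<zero>\<^bsub>V\<lparr>carrier := K\<rparr>\<^esub>"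
      using K'(1)[OF x] by (auto intro!: bexI[of _ "\<ominus>\<^bsub>V\<^esub> x"] simp: M.l_neg)
  qed (use K' in \<open>simp_all add: M.a_ac\<close>)
  moreover have "left_module_axioms R (V\<lparr>carrier := K\<rparr>)"
    by unfold_locales (use K' in \<open>simp_all add: smult_l_distr smult_r_distr smult_assoc1\<close>)
  ultimately show ?thesis by (simp add: left_module_def R.ring_axioms)
qed

text \<open>The additive inverse is defined through the carrier, so its value in the subspace has to
  be identified by uniqueness of inverses.\<close>

lemma sub_minus:
  assumes V: "left_module R V" and K: "submodule_set R V K" and x: "x \<in> K" and y: "y \<in> K"
  shows "x \<ominus>\<^bsub>V\<lparr>carrier := K\<rparr>\<^esub> y = x \<ominus>\<^bsub>V\<^esub> y"
proof -
  interpret V: left_module R V by (rule V)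
  interpret K: left_module R "V\<lparr>carrier := K\<rparr>" by (rule left_module_sub[OF V K])
  have y': "y \<in> carrier V" "\<ominus>\<^bsub>V\<^esub> y \<in> K"
    using K y submodule_set_uminus[OF V K y] by (auto simp: submodule_set_def)
  then have "\<ominus>\<^bsub>V\<lparr>carrier := K\<rparr>\<^esub> y = \<ominus>\<^bsub>V\<^esub> y"
    using y by (intro K.minus_equality) (simp_all add: V.l_neg)
  then show ?thesis by (simp add: a_minus_def)
qed

lemma hom_space_sel [simp]:
  "carrier (hom_space A s M N) = lin_hom A M N"
  "\<zero>\<^bsub>hom_space A s M N\<^esub> = (\<lambda>x \<in> carrier M. \<zero>\<^bsub>N\<^esub>)"
  "f \<oplus>\<^bsub>hom_space A s M N\<^esub> g = (\<lambda>x \<in> carrier M. f x \<oplus>\<^bsub>N\<^esub> g x)"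
  "c \<odot>\<^bsub>hom_space A s M N\<^esub> f = (\<lambda>x \<in> carrier M. s c \<odot>\<^bsub>N\<^esub> f x)"
  by (simp_all add: hom_space_def)

context
  fixes n :: nat and A :: "('k::field_char_0 diff_op, 'x) module" and N :: "('k diff_op, 'y) module"
  assumes A: "left_module (diff_op_ring n) A" and N: "left_module (diff_op_ring n) N"
begin

interpretation A: left_module "diff_op_ring n :: 'k diff_op ring" A by (rule A)
interpretation N: left_module "diff_op_ring n :: 'k diff_op ring" N by (rule N)

lemma hom_zero: "(\<lambda>x \<in> carrier A. \<zero>\<^bsub>N\<^esub>) \<in> lin_hom (diff_op_ring n) A N"
  by (rule lin_hom_restrict[OF _ _ _ A]) auto

lemma hom_add:
  assumes f: "f \<in> lin_hom (diff_op_ring n) A N" and g: "g \<in> lin_hom (diff_op_ring n) A N"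
  shows "(\<lambda>x \<in> carrier A. f x \<oplus>\<^bsub>N\<^esub> g x) \<in> lin_hom (diff_op_ring n) A N"
proof (rule lin_hom_restrict[OF _ _ _ A])
  fix x y and r :: "'k diff_op" assume x: "x \<in> carrier A"
  note fx = lin_hom_closed[OF f x] lin_hom_closed[OF g x]
  show "f x \<oplus>\<^bsub>N\<^esub> g x \<in> carrier N" using fx by simp
  { assume y: "y \<in> carrier A"
    show "f (x \<oplus>\<^bsub>A\<^esub> y) \<oplus>\<^bsub>N\<^esub> g (x \<oplus>\<^bsub>A\<^esub> y) = f x \<oplus>\<^bsub>N\<^esub> g x \<oplus>\<^bsub>N\<^esub> (f y \<oplus>\<^bsub>N\<^esub> g y)"
      using x y fx lin_hom_closed[OF f y] lin_hom_closed[OF g y]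
      by (simp add: lin_hom_add[OF f] lin_hom_add[OF g] N.M.a_ac) }
  { assume r: "r \<in> carrier (diff_op_ring n)"
    show "f (r \<odot>\<^bsub>A\<^esub> x) \<oplus>\<^bsub>N\<^esub> g (r \<odot>\<^bsub>A\<^esub> x) = r \<odot>\<^bsub>N\<^esub> (f x \<oplus>\<^bsub>N\<^esub> g x)"
      using x r fx by (simp add: lin_hom_smult[OF f] lin_hom_smult[OF g] N.smult_r_distr) }
qed

lemma hom_scale:
  assumes f: "f \<in> lin_hom (diff_op_ring n) A N"
  shows "(\<lambda>x \<in> carrier A. scalar_op n c \<odot>\<^bsub>N\<^esub> f x) \<in> lin_hom (diff_op_ring n) A N"
proof (rule lin_hom_restrict[OF _ _ _ A])
  fix x y and r :: "'k diff_op" assume x: "x \<in> carrier A"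
  note fx = lin_hom_closed[OF f x]
  show "scalar_op n c \<odot>\<^bsub>N\<^esub> f x \<in> carrier N" using fx by simp
  { assume y: "y \<in> carrier A"
    show "scalar_op n c \<odot>\<^bsub>N\<^esub> f (x \<oplus>\<^bsub>A\<^esub> y) = scalar_op n c \<odot>\<^bsub>N\<^esub> f x \<oplus>\<^bsub>N\<^esub> scalar_op n c \<odot>\<^bsub>N\<^esub> f y"
      using x y fx lin_hom_closed[OF f y] by (simp add: lin_hom_add[OF f] N.smult_r_distr) }
  { assume r: "r \<in> carrier (diff_op_ring n)"
    have "scalar_op n c \<odot>\<^bsub>N\<^esub> (r \<odot>\<^bsub>N\<^esub> f x) = r \<odot>\<^bsub>N\<^esub> (scalar_op n c \<odot>\<^bsub>N\<^esub> f x)"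
      using N.smult_assoc1[OF scalar_op_in_diff_op r fx, of c] N.smult_assoc1[OF r scalar_op_in_diff_op fx, of c]
      by (simp add: scalar_op_commute[OF r])
    then show "scalar_op n c \<odot>\<^bsub>N\<^esub> f (r \<odot>\<^bsub>A\<^esub> x) = r \<odot>\<^bsub>N\<^esub> (scalar_op n c \<odot>\<^bsub>N\<^esub> f x)"
      using x r by (simp add: lin_hom_smult[OF f]) }
qed

lemma left_module_hom_space: "left_module base_field (hom_space (diff_op_ring n) (scalar_op n) A N)"
proof -
  let ?V = "hom_space (diff_op_ring n) (scalar_op n) A N"
  have eqI: "f = g" if "f \<in> lin_hom (diff_op_ring n) A N" "g \<in> lin_hom (diff_op_ring n) A N"
    "\<And>x. x \<in> carrier A \<Longrightarrow> f x = g x" for f g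
    using that by (rule lin_hom_eqI)
  have "abelian_group ?V"
  proof (rule abelian_groupI)
    fix f assume f: "f \<in> carrier ?V"
    let ?g = "\<lambda>x \<in> carrier A. scalar_op n (- 1) \<odot>\<^bsub>N\<^esub> f x"
    have f': "f \<in> lin_hom (diff_op_ring n) A N" using f by simp
    have "scalar_op n (- 1) \<odot>\<^bsub>N\<^esub> y \<oplus>\<^bsub>N\<^esub> y = \<zero>\<^bsub>N\<^esub>" if "y \<in> carrier N" for y
      using that N.smult_l_distr[of "scalar_op n (- 1)" "scalar_op n 1" y] scalar_op_add[of n "- 1 :: 'k" 1, symmetric]
      by (simp add: scalar_op_one scalar_op_zero)
    then have inv: "?g \<oplus>\<^bsub>?V\<^esub> f = \<zero>\<^bsub>?V\<^esub>"
      using lin_hom_closed[OF f'] by (auto intro!: restrict_ext)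
    have "?g \<in> carrier ?V" using hom_scale[OF f', of "- 1"] by simp
    with inv show "\<exists>g \<in> carrier ?V. g \<oplus>\<^bsub>?V\<^esub> f = \<zero>\<^bsub>?V\<^esub>" by blast
  next
    show "f \<oplus>\<^bsub>?V\<^esub> g \<in> carrier ?V" if "f \<in> carrier ?V" "g \<in> carrier ?V" for f g
      using that hom_add by simp
    show "\<zero>\<^bsub>?V\<^esub> \<in> carrier ?V" using hom_zero by simp
    show "f \<oplus>\<^bsub>?V\<^esub> g \<oplus>\<^bsub>?V\<^esub> h = f \<oplus>\<^bsub>?V\<^esub> (g \<oplus>\<^bsub>?V\<^esub> h)" if "f \<in> carrier ?V" "g \<in> carrier ?V" "h \<in> carrier ?V" for f g h
      using that lin_hom_closed[of f "diff_op_ring n" A N] lin_hom_closed[of g "diff_op_ring n" A N] lin_hom_closed[of h "diff_op_ring n" A N]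
      by (auto intro!: restrict_ext N.M.a_assoc)
    show "f \<oplus>\<^bsub>?V\<^esub> g = g \<oplus>\<^bsub>?V\<^esub> f" if "f \<in> carrier ?V" "g \<in> carrier ?V" for f g
      using that lin_hom_closed[of f "diff_op_ring n" A N] lin_hom_closed[of g "diff_op_ring n" A N]
      by (auto intro!: restrict_ext N.M.a_comm)
    show "\<zero>\<^bsub>?V\<^esub> \<oplus>\<^bsub>?V\<^esub> f = f" if f: "f \<in> carrier ?V" for f
    proof -
      have f': "f \<in> lin_hom (diff_op_ring n) A N" using f by simp
      show ?thesis using lin_hom_closed[OF f'] hom_add[OF hom_zero f'] by (intro eqI f') simp_all
    qed
  qed
  moreover have "left_module_axioms base_field ?V"
  proof
    fix f g a c assume f: "f \<in> carrier ?V"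
    then have f': "f \<in> lin_hom (diff_op_ring n) A N" by simp
    note fx = lin_hom_closed[OF f']
    show "c \<odot>\<^bsub>?V\<^esub> f \<in> carrier ?V" using hom_scale[OF f'] by simp
    show "c \<odot>\<^bsub>?V\<^esub> (f \<oplus>\<^bsub>?V\<^esub> g) = c \<odot>\<^bsub>?V\<^esub> f \<oplus>\<^bsub>?V\<^esub> c \<odot>\<^bsub>?V\<^esub> g" if "g \<in> carrier ?V"
      using fx that lin_hom_closed[of g "diff_op_ring n" A N] by (auto intro!: restrict_ext N.smult_r_distr)
    show "(a \<oplus>\<^bsub>base_field\<^esub> c) \<odot>\<^bsub>?V\<^esub> f = a \<odot>\<^bsub>?V\<^esub> f \<oplus>\<^bsub>?V\<^esub> c \<odot>\<^bsub>?V\<^esub> f"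
      using fx by (auto intro!: restrict_ext N.smult_l_distr simp: scalar_op_add)
    show "(a \<otimes>\<^bsub>base_field\<^esub> c) \<odot>\<^bsub>?V\<^esub> f = a \<odot>\<^bsub>?V\<^esub> (c \<odot>\<^bsub>?V\<^esub> f)"
      using fx by (auto intro!: restrict_ext N.smult_assoc1 simp: scalar_op_mult)
    show "\<one>\<^bsub>base_field\<^esub> \<odot>\<^bsub>?V\<^esub> f = f"
      using fx hom_scale[OF f', of 1] by (intro eqI f') (simp_all add: scalar_op_one)
  qed
  ultimately show ?thesis using ring_from_type_algebra by (simp add: left_module_def)
qed

lemma hom_space_minus:
  assumes f: "f \<in> lin_hom (diff_op_ring n) A N" and g: "g \<in> lin_hom (diff_op_ring n) A N" and x: "x \<in> carrier A"
  shows "(f \<ominus>\<^bsub>hom_space (diff_op_ring n) (scalar_op n) A N\<^esub> g) x = f x \<ominus>\<^bsub>N\<^esub> g x"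
proof -
  let ?V = "hom_space (diff_op_ring n) (scalar_op n) A N"
  interpret V: left_module base_field ?V by (rule left_module_hom_space)
  let ?d = "f \<ominus>\<^bsub>?V\<^esub> g"
  have fg: "f \<in> carrier ?V" "g \<in> carrier ?V" using f g by simp_all
  then have d: "?d \<in> lin_hom (diff_op_ring n) A N" using V.minus_closed[OF fg] by simp
  have "?d \<oplus>\<^bsub>?V\<^esub> g = f" using fg by (simp only: a_minus_def V.a_assoc V.a_inv_closed V.l_neg V.r_zero)
  then have "?d x \<oplus>\<^bsub>N\<^esub> g x = f x" using x by (auto dest: fun_cong[of _ _ x])
  moreover have "?d x \<oplus>\<^bsub>N\<^esub> g x \<ominus>\<^bsub>N\<^esub> g x = ?d x"
    using lin_hom_closed[OF d x] lin_hom_closed[OF g x] by (simp add: a_minus_def N.M.a_assoc N.M.r_neg)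
  ultimately show ?thesis by simp
qed

end

context
  fixes n :: nat and P :: "nat \<Rightarrow> ('k::field_char_0 diff_op, 'p) module" and \<delta> \<epsilon>
    and M :: "('k diff_op, 'm) module" and N :: "('k diff_op, 'e) module"
  assumes P: "exact_resolution (diff_op_ring n) P \<delta> \<epsilon> M" and N: "left_module (diff_op_ring n) N"
begin

private abbreviation "D \<equiv> diff_op_ring n :: 'k diff_op ring"

interpretation N: left_module D N by (rule N)

abbreviation "hom_cx i \<equiv> hom_space D (scalar_op n) (P i) N"
abbreviation "cocycle_space i \<equiv> (hom_cx i)\<lparr>carrier := ext_cocycles D P \<delta> N i\<rparr>"

lemma cocycles_submodule: "submodule_set base_field (hom_cx i) (ext_cocycles D P \<delta> N i)"
  unfolding submodule_set_def
proof (intro conjI ballI)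
  note P' = exact_resolutionD[OF P]
  have dx: "\<delta> i x \<in> carrier (P i)" if "x \<in> carrier (P (Suc i))" for x by (rule lin_hom_closed[OF P'(3) that])
  show "ext_cocycles D P \<delta> N i \<subseteq> carrier (hom_cx i)" by (auto simp: ext_cocycles_def)
  show "\<zero>\<^bsub>hom_cx i\<^esub> \<in> ext_cocycles D P \<delta> N i"
    using hom_zero[OF P'(2) N] dx by (simp add: ext_cocycles_def)
  show "f \<oplus>\<^bsub>hom_cx i\<^esub> g \<in> ext_cocycles D P \<delta> N i" if "f \<in> ext_cocycles D P \<delta> N i" "g \<in> ext_cocycles D P \<delta> N i" for f g
    using that hom_add[OF P'(2) N] dx by (simp add: ext_cocycles_def)
  show "c \<odot>\<^bsub>hom_cx i\<^esub> f \<in> ext_cocycles D P \<delta> N i" if "f \<in> ext_cocycles D P \<delta> N i" for c f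
    using that hom_scale[OF P'(2) N] dx by (simp add: ext_cocycles_def)
qed

lemma coboundaries_submodule: "submodule_set base_field (cocycle_space i) (ext_coboundaries D P \<delta> N i)"
proof -
  note P' = exact_resolutionD[OF P]
  show ?thesis
  proof (cases i)
    case 0
    have "\<zero>\<^bsub>hom_cx 0\<^esub> \<in> ext_cocycles D P \<delta> N 0"
      using cocycles_submodule[of 0] unfolding submodule_set_def by blast
    then show ?thesis by (auto simp: 0 submodule_set_def ext_coboundaries_def intro!: restrict_ext)
  next
    case (Suc j)
    have dx: "\<delta> a x \<in> carrier (P a)" if "x \<in> carrier (P (Suc a))" for x a by (rule lin_hom_closed[OF P'(3) that])
    have cob: "f \<in> ext_coboundaries D P \<delta> N i \<longleftrightarrow> (\<exists>\<chi> \<in> lin_hom D (P j) N. f = compose (carrier (P i)) \<chi> (\<delta> j))" for f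
      by (auto simp: Suc ext_coboundaries_def)
    show ?thesis
      unfolding submodule_set_def
    proof (intro conjI ballI subsetI)
      fix f assume "f \<in> ext_coboundaries D P \<delta> N i"
      then obtain \<chi> where \<chi>: "\<chi> \<in> lin_hom D (P j) N" "f = compose (carrier (P i)) \<chi> (\<delta> j)" using cob by blast
      have "f \<in> lin_hom D (P i) N" unfolding \<chi>(2) Suc by (rule lin_hom_compose[OF P'(2) P'(3) \<chi>(1)])
      moreover have "f (\<delta> i x) = \<zero>\<^bsub>N\<^esub>" if "x \<in> carrier (P (Suc i))" for x
        using that dx[of x i] P'(7)[of x j] lin_hom_zero[OF P'(2) N \<chi>(1)] by (simp add: \<chi>(2) Suc compose_def)
      ultimately show "f \<in> carrier (cocycle_space i)" by (simp add: ext_cocycles_def)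
      { fix g assume "g \<in> ext_coboundaries D P \<delta> N i"
        then obtain \<psi> where \<psi>: "\<psi> \<in> lin_hom D (P j) N" "g = compose (carrier (P i)) \<psi> (\<delta> j)" using cob by blast
        have "f \<oplus>\<^bsub>cocycle_space i\<^esub> g = compose (carrier (P i)) (\<lambda>x \<in> carrier (P j). \<chi> x \<oplus>\<^bsub>N\<^esub> \<psi> x) (\<delta> j)"
          using dx by (auto simp: \<chi>(2) \<psi>(2) compose_def Suc intro!: restrict_ext)
        then show "f \<oplus>\<^bsub>cocycle_space i\<^esub> g \<in> ext_coboundaries D P \<delta> N i"
          using cob hom_add[OF P'(2) N \<chi>(1) \<psi>(1)] by blast }
      fix c
      have "c \<odot>\<^bsub>cocycle_space i\<^esub> f = compose (carrier (P i)) (\<lambda>x \<in> carrier (P j). scalar_op n c \<odot>\<^bsub>N\<^esub> \<chi> x) (\<delta> j)"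
        using dx by (auto simp: \<chi>(2) compose_def Suc intro!: restrict_ext)
      then show "c \<odot>\<^bsub>cocycle_space i\<^esub> f \<in> ext_coboundaries D P \<delta> N i"
        using cob hom_scale[OF P'(2) N \<chi>(1)] by blast
    next
      have "\<zero>\<^bsub>cocycle_space i\<^esub> = compose (carrier (P i)) (\<lambda>x \<in> carrier (P j). \<zero>\<^bsub>N\<^esub>) (\<delta> j)"
        using dx by (auto simp: compose_def Suc intro!: restrict_ext)
      then show "\<zero>\<^bsub>cocycle_space i\<^esub> \<in> ext_coboundaries D P \<delta> N i"
        using cob hom_zero[OF P'(2) N] by blast
    qed
  qed
qed

lemma ext_quotient_space: "quotient_space (cocycle_space i) (ext_coboundaries D P \<delta> N i)"
  using left_module_sub[OF left_module_hom_space[OF exact_resolutionD(2)[OF P] N] cocycles_submodule]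
    coboundaries_submodule
  by (rule quotient_space.intro)

lemma ext_space_eq: "ext_space D (scalar_op n) P \<delta> N i = quot_module (cocycle_space i) (ext_coboundaries D P \<delta> N i)"
  by (simp add: ext_space_def)

lemma cocycle_minus:
  assumes "f \<in> ext_cocycles D P \<delta> N i" "g \<in> ext_cocycles D P \<delta> N i"
  shows "f \<ominus>\<^bsub>cocycle_space i\<^esub> g \<in> ext_cocycles D P \<delta> N i"
    "x \<in> carrier (P i) \<Longrightarrow> (f \<ominus>\<^bsub>cocycle_space i\<^esub> g) x = f x \<ominus>\<^bsub>N\<^esub> g x"
proof -
  note H = left_module_hom_space[OF exact_resolutionD(2)[OF P] N, of i]
  note m = sub_minus[OF H cocycles_submodule assms]
  show "f \<ominus>\<^bsub>cocycle_space i\<^esub> g \<in> ext_cocycles D P \<delta> N i"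
    unfolding m by (rule submodule_set_minus[OF H cocycles_submodule assms])
  show "(f \<ominus>\<^bsub>cocycle_space i\<^esub> g) x = f x \<ominus>\<^bsub>N\<^esub> g x" if "x \<in> carrier (P i)"
    unfolding m using assms that by (intro hom_space_minus[OF exact_resolutionD(2)[OF P] N]) (auto simp: ext_cocycles_def)
qed

text \<open>A cocycle annihilates boundaries, so of the two terms of the homotopy only the one
  through \<open>s j (\<delta> j x)\<close> remains. It factors through the differential, which
  makes the difference a coboundary; in degree 0 nothing remains.\<close>

lemma cocycle_homotopy:
  assumes \<phi>: "\<phi> \<in> ext_cocycles D P \<delta> N i" and s: "\<And>a. s a \<in> lin_hom D (P a) (P (Suc a))"
    and h0: "\<And>x. x \<in> carrier (P 0) \<Longrightarrow> h 0 x \<ominus>\<^bsub>P 0\<^esub> x = \<delta> 0 (s 0 x)"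
    and hS: "\<And>a x. x \<in> carrier (P (Suc a)) \<Longrightarrow> h (Suc a) x \<ominus>\<^bsub>P (Suc a)\<^esub> x =
       \<delta> (Suc a) (s (Suc a) x) \<oplus>\<^bsub>P (Suc a)\<^esub> s a (\<delta> a x)"
    and h: "\<And>a x. x \<in> carrier (P a) \<Longrightarrow> h a x \<in> carrier (P a)"
    and x: "x \<in> carrier (P i)"
  shows "\<phi> (h i x) \<ominus>\<^bsub>N\<^esub> \<phi> x = (case i of 0 \<Rightarrow> \<zero>\<^bsub>N\<^esub> | Suc j \<Rightarrow> \<phi> (s j (\<delta> j x)))"
proof -
  note P' = exact_resolutionD[OF P]
  have \<phi>': "\<phi> \<in> lin_hom D (P i) N" "\<And>x. x \<in> carrier (P (Suc i)) \<Longrightarrow> \<phi> (\<delta> i x) = \<zero>\<^bsub>N\<^esub>"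
    using \<phi> by (auto simp: ext_cocycles_def)
  have eq: "\<phi> (h i x) \<ominus>\<^bsub>N\<^esub> \<phi> x = \<phi> (h i x \<ominus>\<^bsub>P i\<^esub> x)"
    by (rule lin_hom_minus[OF P'(2) N \<phi>'(1) h[OF x] x, symmetric])
  show ?thesis
  proof (cases i)
    case 0
    then show ?thesis using eq h0 x \<phi>'(2) lin_hom_closed[OF s] by simp
  next
    case (Suc j)
    have sx: "s i x \<in> carrier (P (Suc i))" by (rule lin_hom_closed[OF s x])
    have "s j (\<delta> j x) \<in> carrier (P i)"
      using x unfolding Suc by (intro lin_hom_closed[OF s] lin_hom_closed[OF P'(3)])
    then have "\<phi> (\<delta> i (s i x) \<oplus>\<^bsub>P i\<^esub> s j (\<delta> j x)) = \<phi> (\<delta> i (s i x)) \<oplus>\<^bsub>N\<^esub> \<phi> (s j (\<delta> j x))"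
      by (rule lin_hom_add[OF \<phi>'(1) lin_hom_closed[OF P'(3) sx]])
    then show ?thesis
      using eq hS[of x j] x \<phi>'(2)[OF sx] lin_hom_closed[OF \<phi>'(1) \<open>s j (\<delta> j x) \<in> carrier (P i)\<close>] by (simp add: Suc)
  qed
qed

end

lemma compose_coboundary:
  fixes P :: "nat \<Rightarrow> ('k::field_char_0 diff_op, 'p) module" and Q :: "nat \<Rightarrow> ('k diff_op, 'q) module"
  assumes P: "exact_resolution (diff_op_ring n) P \<delta> \<epsilon> M" and Q: "exact_resolution (diff_op_ring n) Q \<delta>' \<epsilon>' M"
    and N: "left_module (diff_op_ring n) N" and g: "chain_map (diff_op_ring n) Q \<delta>' P \<delta> g"
    and \<theta>: "\<theta> \<in> ext_coboundaries (diff_op_ring n) P \<delta> N i"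
  shows "compose (carrier (Q i)) \<theta> (g i) \<in> ext_coboundaries (diff_op_ring n) Q \<delta>' N i"
proof -
  note P' = exact_resolutionD[OF P] and Q' = exact_resolutionD[OF Q]
  have gl: "g a \<in> lin_hom (diff_op_ring n) (Q a) (P a)" for a using g by (simp add: chain_map_def)
  have gc: "\<delta> a (g (Suc a) x) = g a (\<delta>' a x)" if "x \<in> carrier (Q (Suc a))" for a x
    using g that by (simp add: chain_map_def)
  note gx = lin_hom_closed[OF gl]
  show ?thesis
  proof (cases i)
    case 0
    then show ?thesis using \<theta> gx by (auto simp: ext_coboundaries_def compose_def intro!: restrict_ext)
  next
    case (Suc j)
    then obtain \<chi> where \<chi>: "\<chi> \<in> lin_hom (diff_op_ring n) (P j) N" "\<theta> = compose (carrier (P i)) \<chi> (\<delta> j)"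
      using \<theta> by (auto simp: ext_coboundaries_def)
    have "compose (carrier (Q i)) \<theta> (g i) = compose (carrier (Q i)) (compose (carrier (Q j)) \<chi> (g j)) (\<delta>' j)"
      using gx lin_hom_closed[OF Q'(3)] gc by (auto simp: \<chi>(2) Suc compose_def intro!: restrict_ext)
    moreover have "compose (carrier (Q j)) \<chi> (g j) \<in> lin_hom (diff_op_ring n) (Q j) N"
      by (rule lin_hom_compose[OF Q'(2) gl \<chi>(1)])
    ultimately show ?thesis by (auto simp: Suc ext_coboundaries_def)
  qed
qed

lemma compose_cocycle:
  fixes P :: "nat \<Rightarrow> ('k::field_char_0 diff_op, 'p) module" and Q :: "nat \<Rightarrow> ('k diff_op, 'q) module"
  assumes P: "exact_resolution (diff_op_ring n) P \<delta> \<epsilon> M" and Q: "exact_resolution (diff_op_ring n) Q \<delta>' \<epsilon>' M"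
    and g: "chain_map (diff_op_ring n) Q \<delta>' P \<delta> g"
    and \<phi>: "\<phi> \<in> ext_cocycles (diff_op_ring n) P \<delta> N i"
  shows "compose (carrier (Q i)) \<phi> (g i) \<in> ext_cocycles (diff_op_ring n) Q \<delta>' N i"
proof -
  note P' = exact_resolutionD[OF P] and Q' = exact_resolutionD[OF Q]
  have gl: "g a \<in> lin_hom (diff_op_ring n) (Q a) (P a)" for a using g by (simp add: chain_map_def)
  have "compose (carrier (Q i)) \<phi> (g i) \<in> lin_hom (diff_op_ring n) (Q i) N"
    using \<phi> by (intro lin_hom_compose[OF Q'(2) gl]) (simp add: ext_cocycles_def)
  moreover have "compose (carrier (Q i)) \<phi> (g i) (\<delta>' i x) = \<zero>\<^bsub>N\<^esub>" if x: "x \<in> carrier (Q (Suc i))" for x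
  proof -
    have "g i (\<delta>' i x) = \<delta> i (g (Suc i) x)" using g x by (simp add: chain_map_def)
    then show ?thesis using \<phi> lin_hom_closed[OF Q'(3) x] lin_hom_closed[OF gl x] by (simp add: compose_def ext_cocycles_def)
  qed
  ultimately show ?thesis by (simp add: ext_cocycles_def)
qed

lemma cocycle_homotopic:
  fixes P :: "nat \<Rightarrow> ('k::field_char_0 diff_op, 'p) module" and Q :: "nat \<Rightarrow> ('k diff_op, 'q) module"
  assumes P: "exact_resolution (diff_op_ring n) P \<delta> \<epsilon> M" and Q: "exact_resolution (diff_op_ring n) Q \<delta>' \<epsilon>' M"
    and N: "left_module (diff_op_ring n) N" and L: "\<And>a. lifts (diff_op_ring n) (P a) (P (Suc a)) (P a)"
    and f: "chain_map (diff_op_ring n) P \<delta> Q \<delta>' f" and g: "chain_map (diff_op_ring n) Q \<delta>' P \<delta> g"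
    and f0: "\<And>x. x \<in> carrier (P 0) \<Longrightarrow> \<epsilon>' (f 0 x) = \<epsilon> x" and g0: "\<And>x. x \<in> carrier (Q 0) \<Longrightarrow> \<epsilon> (g 0 x) = \<epsilon>' x"
    and \<phi>: "\<phi> \<in> ext_cocycles (diff_op_ring n) P \<delta> N i"
  shows "compose (carrier (P i)) (compose (carrier (Q i)) \<phi> (g i)) (f i)
    \<ominus>\<^bsub>(hom_space (diff_op_ring n) (scalar_op n) (P i) N)\<lparr>carrier := ext_cocycles (diff_op_ring n) P \<delta> N i\<rparr>\<^esub> \<phi>
    \<in> ext_coboundaries (diff_op_ring n) P \<delta> N i" (is "?\<theta> \<in> _")
proof -
  let ?D = "diff_op_ring n :: 'k diff_op ring"
  note P' = exact_resolutionD[OF P] and Q' = exact_resolutionD[OF Q]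
  have fl: "f a \<in> lin_hom ?D (P a) (Q a)" and gl: "g a \<in> lin_hom ?D (Q a) (P a)" for a
    using f g by (simp_all add: chain_map_def)
  obtain s where s: "\<And>a. s a \<in> lin_hom ?D (P a) (P (Suc a))"
    "\<And>x. x \<in> carrier (P 0) \<Longrightarrow> g 0 (f 0 x) \<ominus>\<^bsub>P 0\<^esub> x = \<delta> 0 (s 0 x)"
    "\<And>a x. x \<in> carrier (P (Suc a)) \<Longrightarrow> g (Suc a) (f (Suc a) x) \<ominus>\<^bsub>P (Suc a)\<^esub> x =
       \<delta> (Suc a) (s (Suc a) x) \<oplus>\<^bsub>P (Suc a)\<^esub> s a (\<delta> a x)"
    using chain_map_homotopic_id[OF P L f g Q f0 g0] by blast
  have \<phi>': "\<phi> \<in> lin_hom ?D (P i) N" using \<phi> by (simp add: ext_cocycles_def)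
  have c: "compose (carrier (P i)) (compose (carrier (Q i)) \<phi> (g i)) (f i) \<in> ext_cocycles ?D P \<delta> N i"
    by (rule compose_cocycle[OF Q P f compose_cocycle[OF P Q g \<phi>]])
  have \<theta>: "?\<theta> \<in> lin_hom ?D (P i) N"
    using cocycle_minus(1)[OF P N c \<phi>] by (simp add: ext_cocycles_def)
  have eq: "?\<theta> x = (case i of 0 \<Rightarrow> \<zero>\<^bsub>N\<^esub> | Suc j \<Rightarrow> \<phi> (s j (\<delta> j x)))" if x: "x \<in> carrier (P i)" for x
  proof -
    have "?\<theta> x = \<phi> (g i (f i x)) \<ominus>\<^bsub>N\<^esub> \<phi> x"
      using cocycle_minus(2)[OF P N c \<phi> x] x lin_hom_closed[OF fl x] by (simp add: compose_def)
    also have "\<dots> = (case i of 0 \<Rightarrow> \<zero>\<^bsub>N\<^esub> | Suc j \<Rightarrow> \<phi> (s j (\<delta> j x)))"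
      using s by (intro cocycle_homotopy[OF P N \<phi>, where h = "\<lambda>a x. g a (f a x)"] x)
        (auto intro: lin_hom_closed[OF gl] lin_hom_closed[OF fl])
    finally show ?thesis .
  qed
  show ?thesis
  proof (cases i)
    case 0
    have "?\<theta> = (\<lambda>x \<in> carrier (P i). \<zero>\<^bsub>N\<^esub>)"
      using eq 0 by (intro lin_hom_eqI[OF \<theta> hom_zero[OF P'(2) N]]) simp
    then show ?thesis using 0 by (simp add: ext_coboundaries_def)
  next
    case (Suc j)
    have \<phi>s: "compose (carrier (P j)) \<phi> (s j) \<in> lin_hom ?D (P j) N"
      using \<phi>' unfolding Suc by (rule lin_hom_compose[OF P'(2) s(1)])
    have "?\<theta> = compose (carrier (P i)) (compose (carrier (P j)) \<phi> (s j)) (\<delta> j)"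
    proof (rule lin_hom_eqI[OF \<theta>])
      show "compose (carrier (P i)) (compose (carrier (P j)) \<phi> (s j)) (\<delta> j) \<in> lin_hom ?D (P i) N"
        using \<phi>s unfolding Suc by (rule lin_hom_compose[OF P'(2) P'(3)])
      show "?\<theta> x = compose (carrier (P i)) (compose (carrier (P j)) \<phi> (s j)) (\<delta> j) x" if x: "x \<in> carrier (P i)" for x
        using eq[OF x] x lin_hom_closed[OF P'(3), of x j] by (simp add: Suc compose_def)
    qed
    then show ?thesis using \<phi>s Suc by (auto simp: ext_coboundaries_def)
  qed
qed

text \<open>Cocycles are pulled back along chain maps in both directions. The composites are
  homotopic to the identity, so the maps on classes are inverse to each other. With the lifting
  properties as hypotheses, one resolution may be projective and the other free, in different
  types.\<close>

lemma ext_space_unique: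
  fixes P :: "nat \<Rightarrow> ('k::field_char_0 diff_op, 'p) module" and Q :: "nat \<Rightarrow> ('k diff_op, 'q) module"
  assumes P: "exact_resolution (diff_op_ring n) P \<delta> \<epsilon> M" and Q: "exact_resolution (diff_op_ring n) Q \<delta>' \<epsilon>' M"
    and N: "left_module (diff_op_ring n) N"
    and LP: "\<And>a b. lifts (diff_op_ring n) (P a) (P (Suc a)) (P a)" "\<And>a. lifts (diff_op_ring n) (P (Suc a)) (Q (Suc a)) (Q a)"
      "lifts (diff_op_ring n) (P 0) (Q 0) M"
    and LQ: "\<And>a b. lifts (diff_op_ring n) (Q a) (Q (Suc a)) (Q a)" "\<And>a. lifts (diff_op_ring n) (Q (Suc a)) (P (Suc a)) (P a)"
      "lifts (diff_op_ring n) (Q 0) (P 0) M"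
  shows "space_iso (ext_space (diff_op_ring n) (scalar_op n) P \<delta> N i) (ext_space (diff_op_ring n) (scalar_op n) Q \<delta>' N i)"
proof -
  let ?D = "diff_op_ring n :: 'k diff_op ring"
  note P' = exact_resolutionD[OF P] and Q' = exact_resolutionD[OF Q]
  obtain f where f: "chain_map ?D P \<delta> Q \<delta>' f" "\<And>x. x \<in> carrier (P 0) \<Longrightarrow> \<epsilon>' (f 0 x) = \<epsilon> x"
    using chain_map_exists[OF P Q LP(3,2)] by blast
  obtain g where g: "chain_map ?D Q \<delta>' P \<delta> g" "\<And>x. x \<in> carrier (Q 0) \<Longrightarrow> \<epsilon> (g 0 x) = \<epsilon>' x"
    using chain_map_exists[OF Q P LQ(3,2)] by blast
  have gl: "g a \<in> lin_hom ?D (Q a) (P a)" for a using g(1) by (simp add: chain_map_def)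
  let ?ZP = "ext_cocycles ?D P \<delta> N i" and ?ZQ = "ext_cocycles ?D Q \<delta>' N i"
  let ?VP = "(hom_space ?D (scalar_op n) (P i) N)\<lparr>carrier := ?ZP\<rparr>"
  let ?VQ = "(hom_space ?D (scalar_op n) (Q i) N)\<lparr>carrier := ?ZQ\<rparr>"
  let ?BP = "ext_coboundaries ?D P \<delta> N i" and ?BQ = "ext_coboundaries ?D Q \<delta>' N i"
  interpret EP: quotient_space ?VP ?BP by (rule ext_quotient_space[OF P N])
  interpret EQ: quotient_space ?VQ ?BQ by (rule ext_quotient_space[OF Q N])
  interpret N: left_module ?D N by (rule N)
  let ?g = "\<lambda>\<phi>. compose (carrier (Q i)) \<phi> (g i)" and ?f = "\<lambda>\<psi>. compose (carrier (P i)) \<psi> (f i)"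
  have gZ: "?g \<phi> \<in> ?ZQ" if "\<phi> \<in> ?ZP" for \<phi> by (rule compose_cocycle[OF P Q g(1) that])
  have fZ: "?f \<psi> \<in> ?ZP" if "\<psi> \<in> ?ZQ" for \<psi> by (rule compose_cocycle[OF Q P f(1) that])
  have fg: "?f (?g \<phi>) \<ominus>\<^bsub>?VP\<^esub> \<phi> \<in> ?BP" if "\<phi> \<in> ?ZP" for \<phi>
    by (rule cocycle_homotopic[OF P Q N LP(1) f(1) g(1) f(2) g(2) that])
  have gf: "?g (?f \<psi>) \<ominus>\<^bsub>?VQ\<^esub> \<psi> \<in> ?BQ" if "\<psi> \<in> ?ZQ" for \<psi>
    by (rule cocycle_homotopic[OF Q P N LQ(1) g(1) f(1) g(2) f(2) that])
  have lin: "h \<in> lin_hom ?D (Q i) N" if "h \<in> ?ZQ" for h using that by (simp add: ext_cocycles_def)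
  have g_minus: "?g \<phi> \<ominus>\<^bsub>?VQ\<^esub> ?g \<psi> = ?g (\<phi> \<ominus>\<^bsub>?VP\<^esub> \<psi>)" if "\<phi> \<in> ?ZP" "\<psi> \<in> ?ZP" for \<phi> \<psi>
  proof (rule lin_hom_eqI[OF lin lin])
    note Z = gZ[OF that(1)] gZ[OF that(2)]
    show "?g \<phi> \<ominus>\<^bsub>?VQ\<^esub> ?g \<psi> \<in> ?ZQ" by (rule cocycle_minus(1)[OF Q N Z])
    show "?g (\<phi> \<ominus>\<^bsub>?VP\<^esub> \<psi>) \<in> ?ZQ" by (rule gZ[OF cocycle_minus(1)[OF P N that]])
    fix x assume x: "x \<in> carrier (Q i)"
    have "(?g \<phi> \<ominus>\<^bsub>?VQ\<^esub> ?g \<psi>) x = ?g \<phi> x \<ominus>\<^bsub>N\<^esub> ?g \<psi> x" by (rule cocycle_minus(2)[OF Q N Z x])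
    also have "\<dots> = ?g (\<phi> \<ominus>\<^bsub>?VP\<^esub> \<psi>) x"
      using x cocycle_minus(2)[OF P N that lin_hom_closed[OF gl x]] by (simp add: compose_def)
    finally show "(?g \<phi> \<ominus>\<^bsub>?VQ\<^esub> ?g \<psi>) x = ?g (\<phi> \<ominus>\<^bsub>?VP\<^esub> \<psi>) x" .
  qed
  have "space_iso EP.Q EQ.Q"
  proof (rule EP.quotient_iso[where f = "\<lambda>\<phi>. EQ.cl (?g \<phi>)"])
    show "EQ.cl (?g \<phi>) \<in> carrier EQ.Q" if "\<phi> \<in> carrier ?VP" for \<phi>
      using that gZ by (intro EQ.cl_closed) simp
    show "EQ.cl (?g (\<phi> \<oplus>\<^bsub>?VP\<^esub> \<psi>)) = EQ.cl (?g \<phi>) \<oplus>\<^bsub>EQ.Q\<^esub> EQ.cl (?g \<psi>)"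
      if "\<phi> \<in> carrier ?VP" "\<psi> \<in> carrier ?VP" for \<phi> \<psi>
    proof -
      have "?g (\<phi> \<oplus>\<^bsub>?VP\<^esub> \<psi>) = ?g \<phi> \<oplus>\<^bsub>?VQ\<^esub> ?g \<psi>"
        using lin_hom_closed[OF gl] by (auto simp: compose_def intro!: restrict_ext)
      then show ?thesis using that gZ by (simp only: EQ.cl_add partial_object.select_convs) (simp add: EQ.cl_add gZ)
    qed
    show "EQ.cl (?g (c \<odot>\<^bsub>?VP\<^esub> \<phi>)) = c \<odot>\<^bsub>EQ.Q\<^esub> EQ.cl (?g \<phi>)" if "\<phi> \<in> carrier ?VP" for c \<phi>
    proof -
      have "?g (c \<odot>\<^bsub>?VP\<^esub> \<phi>) = c \<odot>\<^bsub>?VQ\<^esub> ?g \<phi>"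
        using lin_hom_closed[OF gl] by (auto simp: compose_def intro!: restrict_ext)
      then show ?thesis using EQ.cl_smult[of "?g \<phi>" c] that gZ by simp
    qed
    show "EQ.cl (?g \<phi>) = EQ.cl (?g \<psi>) \<longleftrightarrow> \<phi> \<ominus>\<^bsub>?VP\<^esub> \<psi> \<in> ?BP"
      if "\<phi> \<in> carrier ?VP" "\<psi> \<in> carrier ?VP" for \<phi> \<psi>
    proof -
      have Z: "\<phi> \<in> ?ZP" "\<psi> \<in> ?ZP" using that by simp_all
      let ?\<theta> = "\<phi> \<ominus>\<^bsub>?VP\<^esub> \<psi>"
      have \<theta>: "?\<theta> \<in> ?ZP" by (rule cocycle_minus(1)[OF P N Z])
      have "EQ.cl (?g \<phi>) = EQ.cl (?g \<psi>) \<longleftrightarrow> ?g ?\<theta> \<in> ?BQ"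
        using EQ.cl_eq_iff[of "?g \<phi>" "?g \<psi>"] gZ Z g_minus[OF Z] by simp
      also have "\<dots> \<longleftrightarrow> ?\<theta> \<in> ?BP"
      proof
        assume "?\<theta> \<in> ?BP"
        then show "?g ?\<theta> \<in> ?BQ" by (rule compose_coboundary[OF P Q N g(1)])
      next
        assume "?g ?\<theta> \<in> ?BQ"
        then have 1: "?f (?g ?\<theta>) \<in> ?BP" by (rule compose_coboundary[OF Q P N f(1)])
        \<comment> \<open>The double pullback differs from \<theta> by a coboundary. As it is a
          coboundary itself, so is \<theta>.\<close>
        have "?f (?g ?\<theta>) \<ominus>\<^bsub>?VP\<^esub> (?f (?g ?\<theta>) \<ominus>\<^bsub>?VP\<^esub> ?\<theta>) \<in> ?BP"
          using 1 fg[OF \<theta>] by (rule submodule_set_minus[OF EP.V EP.B])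
        also have "?f (?g ?\<theta>) \<ominus>\<^bsub>?VP\<^esub> (?f (?g ?\<theta>) \<ominus>\<^bsub>?VP\<^esub> ?\<theta>) = ?\<theta>"
        proof -
          have "x \<ominus>\<^bsub>?VP\<^esub> (x \<ominus>\<^bsub>?VP\<^esub> y) = y" if "x \<in> carrier ?VP" "y \<in> carrier ?VP" for x y
            using that
            by (simp only: a_minus_def EP.minus_add EP.a_inv_closed EP.minus_minus EP.a_assoc[symmetric] EP.r_neg EP.l_zero)
          then show ?thesis using fZ[OF gZ[OF \<theta>]] \<theta> by simp
        qed
        finally show "?\<theta> \<in> ?BP" .
      qed
      finally show ?thesis .
    qed
    show "\<exists>\<phi> \<in> carrier ?VP. EQ.cl (?g \<phi>) = C" if "C \<in> carrier EQ.Q" for C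
    proof -
      obtain \<psi> where \<psi>: "\<psi> \<in> ?ZQ" "C = EQ.cl \<psi>" using \<open>C \<in> carrier EQ.Q\<close> unfolding EQ.carrier_quot by auto
      have "EQ.cl (?g (?f \<psi>)) = C"
        using EQ.cl_eq_iff[of "?g (?f \<psi>)" \<psi>] gf[OF \<psi>(1)] gZ[OF fZ[OF \<psi>(1)]] \<psi> by simp
      then show ?thesis using fZ[OF \<psi>(1)] by auto
    qed
  qed
  then show ?thesis by (simp only: ext_space_eq[OF P N] ext_space_eq[OF Q N])
qed

section \<open>Submodules of free modules are finitely generated\<close>

text \<open>On a finite basis \<open>B0\<close> for the other coordinates the coordinate
  \<open>j\<close> is bounded by some \<open>N\<close>, so \<open>B0\<close> serves every element
  whose coordinate \<open>j\<close> is at least \<open>N\<close>. Each of the finitely many slices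
  below \<open>N\<close> has a finite basis by induction.\<close>

lemma dickson:
  fixes L :: "'a set" and f :: "'a \<Rightarrow> 'b \<Rightarrow> nat"
  assumes "finite I"
  shows "\<exists>B. finite B \<and> B \<subseteq> L \<and> (\<forall>m \<in> L. \<exists>b \<in> B. \<forall>i \<in> I. f b i \<le> f m i)"
  using assms
proof (induction I arbitrary: L rule: finite_induct)
  case empty
  show ?case
  proof (cases "L = {}")
    case True
    then show ?thesis by (intro exI[of _ "{}"]) simp
  next
    case False
    then obtain m where m: "m \<in> L" by blast
    then show ?thesis by (intro exI[of _ "{m}"] conjI) simp_all
  qed
next
  case (insert j I)
  obtain B0 where B0: "finite B0" "B0 \<subseteq> L" "\<forall>m \<in> L. \<exists>b \<in> B0. \<forall>i \<in> I. f b i \<le> f m i"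
    using insert.IH[of L] by blast
  obtain N where N: "\<And>b. b \<in> B0 \<Longrightarrow> f b j \<le> N"
    using B0(1) finite_nat_set_iff_bounded_le[of "(\<lambda>b. f b j) ` B0"] by auto
  have "\<forall>t. \<exists>B. finite B \<and> B \<subseteq> {m \<in> L. f m j = t} \<and>
      (\<forall>m \<in> {m \<in> L. f m j = t}. \<exists>b \<in> B. \<forall>i \<in> I. f b i \<le> f m i)"
    by (intro allI insert.IH)
  from choice[OF this] obtain C where C': "\<forall>t. finite (C t) \<and> C t \<subseteq> {m \<in> L. f m j = t} \<and>
      (\<forall>m \<in> {m \<in> L. f m j = t}. \<exists>b \<in> C t. \<forall>i \<in> I. f b i \<le> f m i)" ..
  have C: "finite (C t)" "C t \<subseteq> {m \<in> L. f m j = t}"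
    "m \<in> {m \<in> L. f m j = t} \<Longrightarrow> \<exists>b \<in> C t. \<forall>i \<in> I. f b i \<le> f m i" for t m
    using C'[rule_format, of t] by blast+
  let ?B = "B0 \<union> (\<Union>t<N. C t)"
  have "\<exists>b \<in> ?B. \<forall>i \<in> insert j I. f b i \<le> f m i" if m: "m \<in> L" for m
  proof (cases "f m j < N")
    case True
    obtain b where "b \<in> C (f m j)" "\<forall>i \<in> I. f b i \<le> f m i" using C(3)[of m "f m j"] m by blast
    moreover have "f b j = f m j" using C(2) \<open>b \<in> C (f m j)\<close> by blast
    moreover have "b \<in> ?B" using True \<open>b \<in> C (f m j)\<close> by blast
    ultimately show ?thesis by (intro bexI[of _ b]) simp_all
  next
    case False
    obtain b where b: "b \<in> B0" "\<forall>i \<in> I. f b i \<le> f m i" using B0(3) m by blast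
    then have "f b j \<le> f m j" using N[of b] False by simp
    then show ?thesis using b by (intro bexI[of _ b]) simp_all
  qed
  moreover have "finite ?B" using B0(1) C(1) by simp
  moreover have "?B \<subseteq> L" using B0(2) C(2) by blast
  ultimately show ?case by blast
qed

text \<open>The total degree in x and \<xi> is compared first, so that the correction term of
  \<open>sym_deriv\<close>, which has smaller total degree than the leading term, never affects the
  leading exponent. Ties are broken by the additive linear order on exponents.\<close>

definition exp_less :: "nat \<Rightarrow> (nat \<Rightarrow>\<^sub>0 nat) \<Rightarrow> (nat \<Rightarrow>\<^sub>0 nat) \<Rightarrow> bool" where
  "exp_less n m m' \<longleftrightarrow> total_deg n m < total_deg n m' \<or> (total_deg n m = total_deg n m' \<and> m < m')"

lemma exp_less_trans: "exp_less n a b \<Longrightarrow> exp_less n b c \<Longrightarrow> exp_less n a c"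
  by (auto simp: exp_less_def)

lemma exp_less_irrefl: "\<not> exp_less n a a"
  by (simp add: exp_less_def)

lemma exp_less_add: "exp_less n a b \<Longrightarrow> exp_less n (a + c) (b + c)"
  by (auto simp: exp_less_def total_deg_add intro: add_strict_right_mono)

lemma exp_less_total_deg: "exp_less n a b \<Longrightarrow> total_deg n a \<le> total_deg n b"
  by (auto simp: exp_less_def)

lemma finite_symbol_exps_deg: "finite {m \<in> symbol_exps n r. total_deg n m \<le> d}"
proof (rule finite_subset)
  let ?I = "{1..2 * n + 1}"
  let ?g = "\<lambda>f. \<Sum>i \<in> ?I. single i (f i)"
  show "{m \<in> symbol_exps n r. total_deg n m \<le> d} \<subseteq> ?g ` (?I \<rightarrow>\<^sub>E {..d + r})"
  proof
    fix m assume m: "m \<in> {m \<in> symbol_exps n r. total_deg n m \<le> d}"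
    \<comment> \<open>The exponents of x and \<xi> are at most \<open>d\<close>, and the generator
      index is below \<open>r\<close>; the sum bounds both.\<close>
    have "lookup m i \<le> d + r" if i: "i \<in> ?I" for i
    proof (cases "i = 2 * n + 1")
      case True
      then show ?thesis using m by (simp add: symbol_exps_def gen_index_def)
    next
      case False
      then have "lookup m i \<le> total_deg n m"
        unfolding total_deg_def using i by (intro member_le_sum) auto
      then show ?thesis using m by simp
    qed
    moreover have "m = ?g (restrict (lookup m) ?I)"
    proof (rule poly_mapping_eqI)
      show "lookup m k = lookup (?g (restrict (lookup m) ?I)) k" for k
      proof (cases "k \<in> ?I")
        case False
        then have "k \<notin> keys m" using m unfolding symbol_exps_def by blast
        then show ?thesis using False by (simp add: lookup_sum lookup_single when_def in_keys_iff)
      qed (simp add: lookup_sum lookup_single when_def)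
    qed
    ultimately show "m \<in> ?g ` (?I \<rightarrow>\<^sub>E {..d + r})" by (intro image_eqI[where x = "restrict (lookup m) ?I"]) auto
  qed
qed (intro finite_imageI finite_PiE; simp)

section \<open>Leading exponents\<close>

definition leads :: "nat \<Rightarrow> 'k::field_char_0 mpoly \<Rightarrow> (nat \<Rightarrow>\<^sub>0 nat) \<Rightarrow> bool" where
  "leads n v m \<longleftrightarrow> m \<in> keys v \<and> (\<forall>p \<in> keys v. p \<noteq> m \<longrightarrow> exp_less n p m)"

lemma leads_exists:
  assumes "v \<noteq> 0"
  shows "\<exists>m. leads n v m"
proof -
  have ne: "keys v \<noteq> {}" using assms by simp
  define d where "d = Max (total_deg n ` keys v)"
  let ?T = "{m \<in> keys v. total_deg n m = d}"
  have "d \<in> total_deg n ` keys v" unfolding d_def using ne by (intro Max_in) auto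
  then have T: "?T \<noteq> {}" "finite ?T" by auto
  have d: "total_deg n p \<le> d" if "p \<in> keys v" for p unfolding d_def using that by (intro Max_ge) auto
  let ?m = "Max ?T"
  have m: "?m \<in> ?T" using T by (intro Max_in)
  have "exp_less n p ?m" if "p \<in> keys v" "p \<noteq> ?m" for p
  proof (cases "total_deg n p = d")
    case True
    then have "p \<le> ?m" using that T by (intro Max_ge) auto
    then have "p < ?m" using that(2) by (rule le_neq_trans)
    then show ?thesis using True m by (simp add: exp_less_def)
  next
    case False
    then show ?thesis using d[OF that(1)] m by (auto simp: exp_less_def)
  qed
  then show ?thesis using m by (auto simp: leads_def)
qed

lemma leads_var:
  assumes j: "j \<in> {1..n}" and v: "leads n v m"
  shows "leads n (var_poly j * v) (m + single j 1)"
  unfolding leads_def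
proof (intro conjI ballI impI)
  show "m + single j 1 \<in> keys (var_poly j * v)"
    using v by (simp add: leads_def in_keys_iff lookup_var_poly_mult lookup_add)
  fix p assume p: "p \<in> keys (var_poly j * v)" "p \<noteq> m + single j 1"
  then have l: "lookup p j \<noteq> 0" "p - single j 1 \<in> keys v"
    by (auto simp: in_keys_iff lookup_var_poly_mult split: if_splits)
  have e: "p - single j 1 + single j 1 = p" by (rule single_diff_add[OF l(1)])
  then have "p - single j 1 \<noteq> m" using p(2) by auto
  then have "exp_less n (p - single j 1) m" using v l(2) by (simp add: leads_def)
  then show "exp_less n p (m + single j 1)" using exp_less_add e by metis
qed

text \<open>Only the summand \<open>var_poly (n + j) * v\<close> matters: the monomials of the
  derivative by x_j have total degree below that of \<open>m\<close>, hence far below the new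
  leading exponent.\<close>

lemma leads_deriv:
  assumes j: "j \<in> {1..n}" and v: "leads n v m"
  shows "leads n (sym_deriv n j v) (m + single (n + j) 1)"
proof -
  have j2: "j \<in> {1..2 * n}" "n + j \<in> {1..2 * n}" using j by auto
  have lk: "lookup (sym_deriv n j v) q = (if lookup q (n + j) = 0 then 0 else lookup v (q - single (n + j) 1)) +
      of_nat (lookup q j + 1) * lookup v (q + single j 1)" for q
    by (simp only: sym_deriv_def lookup_add lookup_var_poly_mult lookup_partial_deriv)
  have deg: "total_deg n p \<le> total_deg n m" if "p \<in> keys v" for p
    using v that exp_less_total_deg by (cases "p = m") (auto simp: leads_def)
  show ?thesis
    unfolding leads_def
  proof (intro conjI ballI impI)
    have "m + single (n + j) 1 + single j 1 \<notin> keys v"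
      using deg[of "m + single (n + j) 1 + single j 1"] j2 by (auto simp: total_deg_add total_deg_single)
    then have "lookup (sym_deriv n j v) (m + single (n + j) 1) = lookup v m"
      unfolding lk by (simp add: in_keys_iff lookup_add)
    then show "m + single (n + j) 1 \<in> keys (sym_deriv n j v)" using v by (simp add: leads_def in_keys_iff)
    fix q assume q: "q \<in> keys (sym_deriv n j v)" "q \<noteq> m + single (n + j) 1"
    then consider "lookup q (n + j) \<noteq> 0" "q - single (n + j) 1 \<in> keys v" | "q + single j 1 \<in> keys v"
      unfolding in_keys_iff lk
      by (cases "lookup q (n + j) = 0"; cases "lookup v (q - single (n + j) 1) = 0") auto
    then show "exp_less n q (m + single (n + j) 1)"
    proof cases
      case 1
      have e: "q - single (n + j) 1 + single (n + j) 1 = q" by (rule single_diff_add[OF 1(1)])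
      then have "q - single (n + j) 1 \<noteq> m" using q(2) by auto
      then have "exp_less n (q - single (n + j) 1) m" using v 1(2) by (simp add: leads_def)
      then show ?thesis using exp_less_add e by metis
    next
      case 2
      show ?thesis using deg[OF 2] j2 by (simp add: exp_less_def total_deg_add total_deg_single)
    qed
  qed
qed

lemma submodule_symbolsD:
  fixes K :: "'k::field_char_0 mpoly set"
  assumes K: "submodule_set (diff_op_ring n) (free_module n r) K"
  shows "K \<subseteq> symbols n r" "0 \<in> K" "v \<in> K \<Longrightarrow> w \<in> K \<Longrightarrow> v + w \<in> K" "v \<in> K \<Longrightarrow> const_poly c * v \<in> K"
    "j \<in> {1..n} \<Longrightarrow> v \<in> K \<Longrightarrow> var_poly j * v \<in> K" "j \<in> {1..n} \<Longrightarrow> v \<in> K \<Longrightarrow> sym_deriv n j v \<in> K"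
    "v \<in> K \<Longrightarrow> w \<in> K \<Longrightarrow> v - w \<in> K"
proof -
  have act: "sym_action n r d v \<in> K" if "d \<in> carrier (diff_op_ring n)" "v \<in> K" for d v
    using K that by (simp add: submodule_set_def)
  show sub: "K \<subseteq> symbols n r" and "0 \<in> K" using K by (simp_all add: submodule_set_def)
  show add: "v + w \<in> K" if "v \<in> K" "w \<in> K" for v w using K that by (simp add: submodule_set_def)
  show c: "const_poly c * v \<in> K" if "v \<in> K" for v c
    using act[OF scalar_op_in_diff_op that] sub that by (simp add: sym_action_gens subset_iff)
  show "j \<in> {1..n} \<Longrightarrow> v \<in> K \<Longrightarrow> var_poly j * v \<in> K"
    using act[of "mult_op n (var_poly j)" v] sub by (simp add: sym_action_gens subset_iff)
  show "j \<in> {1..n} \<Longrightarrow> v \<in> K \<Longrightarrow> sym_deriv n j v \<in> K"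
    using act[of "partial_op n j" v] sub by (simp add: sym_action_gens subset_iff)
  show "v \<in> K \<Longrightarrow> w \<in> K \<Longrightarrow> v - w \<in> K"
    using add[of v "const_poly (- 1) * w"] c[of w "- 1"] by (simp add: const_poly_uminus)
qed

text \<open>Variables and derivatives raise one coordinate of the leading exponent by one and stay
  inside \<open>K\<close>, so every multiple of a leading exponent is again a leading exponent. This
  replaces the multiplication by a monomial of the commutative case.\<close>

lemma leads_shift:
  fixes K :: "'k::field_char_0 mpoly set"
  assumes K: "submodule_set (diff_op_ring n) (free_module n r) K"
    and m: "m \<in> symbol_exps n r"
    and g: "g \<in> K" "leads n g b" "gen_index n b = gen_index n m" "\<And>i. i \<in> {1..2 * n} \<Longrightarrow> lookup b i \<le> lookup m i"
  shows "\<exists>g' \<in> K. leads n g' m"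
  using g
proof (induction "total_deg n m - total_deg n b" arbitrary: g b rule: less_induct)
  case less
  have b: "b \<in> symbol_exps n r"
    using less.prems(1,2) submodule_symbolsD(1)[OF K] by (auto simp: leads_def symbols_def)
  show ?case
  proof (cases "\<forall>i \<in> {1..2 * n}. lookup b i = lookup m i")
    case True
    have "b = m"
    proof (rule symbol_exps_eqI[OF b m])
      show "xpart n b = xpart n m" "dpart n b = dpart n m"
        using True by (auto intro!: poly_mapping_eqI simp: lookup_xpart lookup_dpart)
    qed (rule less.prems(3))
    then show ?thesis using less.prems by blast
  next
    case False
    then obtain i where i: "i \<in> {1..2 * n}" "lookup b i < lookup m i"
      using less.prems(4) by (metis le_neq_implies_less)
    have step: "\<exists>g' \<in> K. leads n g' (b + single i 1)"
    proof (cases "i \<le> n")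
      case True
      then have "i \<in> {1..n}" using i by simp
      then show ?thesis using leads_var less.prems(1,2) submodule_symbolsD(5)[OF K] by blast
    next
      case False
      then have "i - n \<in> {1..n}" "n + (i - n) = i" using i by auto
      then show ?thesis using leads_deriv[of "i - n" n g b] less.prems(1,2) submodule_symbolsD(6)[OF K, of "i - n" g] by auto
    qed
    then obtain g1 where g1: "g1 \<in> K" "leads n g1 (b + single i 1)" by blast
    have le: "lookup (b + single i 1) k \<le> lookup m k" if "k \<in> {1..2 * n}" for k
      using less.prems(4)[OF that] i by (auto simp: lookup_add lookup_single when_def)
    have "total_deg n (b + single i 1) \<le> total_deg n m"
      unfolding total_deg_def by (rule sum_mono) (rule le)
    then have "total_deg n m - total_deg n (b + single i 1) < total_deg n m - total_deg n b"
      using i by (simp add: total_deg_add total_deg_single)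
    moreover have "gen_index n (b + single i 1) = gen_index n m"
      using less.prems(3) i by (simp add: gen_index_def lookup_add lookup_single when_def)
    ultimately show ?thesis using less.hyps[OF _ g1 _ le] by blast
  qed
qed

text \<open>Division with remainder by elements whose leading exponents generate all leading exponents
  shows that these elements generate.\<close>

lemma submodule_finitely_generated:
  fixes K :: "'k::field_char_0 mpoly set"
  assumes K: "submodule_set (diff_op_ring n) (free_module n r) K"
  shows "\<exists>T. finite T \<and> T \<subseteq> K \<and>
    (\<forall>K'. submodule_set (diff_op_ring n) (free_module n r) K' \<longrightarrow> T \<subseteq> K' \<longrightarrow> K \<subseteq> K')"
proof -
  \<comment> \<open>Divisibility compares only exponents that belong to the same generator, so
    \<open>dickson\<close> is applied once for each generator.\<close>
  define L where "L s = {m. (\<exists>v \<in> K. leads n v m) \<and> gen_index n m = s}" for s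
  have "\<forall>s. \<exists>B. finite B \<and> B \<subseteq> L s \<and> (\<forall>m \<in> L s. \<exists>b \<in> B. \<forall>i \<in> {1..2 * n}. lookup b i \<le> lookup m i)"
    by (intro allI dickson) simp
  then obtain B where B: "\<And>s. finite (B s)" "\<And>s. B s \<subseteq> L s"
    "\<And>s m. m \<in> L s \<Longrightarrow> \<exists>b \<in> B s. \<forall>i \<in> {1..2 * n}. lookup b i \<le> lookup m i" by metis
  have "\<forall>m \<in> (\<Union>s<r. B s). \<exists>v \<in> K. leads n v m" using B(2) unfolding L_def by blast
  then obtain g where g: "\<And>b. b \<in> (\<Union>s<r. B s) \<Longrightarrow> g b \<in> K \<and> leads n (g b) b" by metis
  let ?T = "g ` (\<Union>s<r. B s)"
  have "K \<subseteq> K'" if K': "submodule_set (diff_op_ring n) (free_module n r) K'" and T: "?T \<subseteq> K'" for K'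
  proof -
    \<comment> \<open>Finitely many exponents lie below a given one, since their total degree is
      bounded; counting them turns the monomial order into a measure for the induction.\<close>
    define rank where "rank m = card {p \<in> symbol_exps n r. exp_less n p m}" for m
    have rank: "rank p < rank m" if "exp_less n p m" "p \<in> symbol_exps n r" for p m
    proof -
      have "{q \<in> symbol_exps n r. exp_less n q m} \<subseteq> {q \<in> symbol_exps n r. total_deg n q \<le> total_deg n m}"
        using exp_less_total_deg by blast
      then have "finite {q \<in> symbol_exps n r. exp_less n q m}"
        using finite_symbol_exps_deg finite_subset by blast
      moreover have "{q \<in> symbol_exps n r. exp_less n q p} \<subset> {q \<in> symbol_exps n r. exp_less n q m}"
        using that exp_less_trans exp_less_irrefl by blast
      ultimately show ?thesis unfolding rank_def by (rule psubset_card_mono)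
    qed
    have "v \<in> K'" if "v \<in> K" "leads n v m" for v m
      using that
    proof (induction "rank m" arbitrary: v m rule: less_induct)
      case less
      have sub: "K \<subseteq> symbols n r" by (rule submodule_symbolsD(1)[OF K])
      have m: "m \<in> symbol_exps n r" using less.prems sub by (auto simp: leads_def symbols_def)
      then have s: "gen_index n m < r" by (simp add: symbol_exps_def)
      have "m \<in> L (gen_index n m)" using less.prems by (auto simp: L_def)
      then obtain b where b: "b \<in> B (gen_index n m)" "\<And>i. i \<in> {1..2 * n} \<Longrightarrow> lookup b i \<le> lookup m i"
        using B(3) by blast
      have "b \<in> (\<Union>s<r. B s)" using b s by blast
      then have gb: "g b \<in> K'" "g b \<in> K" "leads n (g b) b" using g T by auto
      have gi: "gen_index n b = gen_index n m" using b(1) B(2) by (auto simp: L_def)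
      \<comment> \<open>The shifted element has to lie in both submodules: in \<open>K\<close>, so
        that the remainder stays in \<open>K\<close>, and in \<open>K'\<close>, so that it may be
        added back at the end.\<close>
      have KK: "submodule_set (diff_op_ring n) (free_module n r) (K \<inter> K')"
        using K K' by (auto simp: submodule_set_def)
      obtain g' where g': "g' \<in> K" "g' \<in> K'" "leads n g' m"
        using leads_shift[OF KK m _ gb(3) gi b(2)] gb by blast
      define c where "c = lookup v m / lookup g' m"
      let ?u = "v - const_poly c * g'"
      have u: "?u \<in> K" using less.prems(1) g'(1) submodule_symbolsD(4,7)[OF K] by blast
      have nz: "lookup g' m \<noteq> 0" using g'(3) by (simp add: leads_def in_keys_iff)
      have "?u \<in> K'"
      proof (cases "?u = 0")
        case True
        then show ?thesis using submodule_symbolsD(2)[OF K'] by simp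
      next
        case False
        then obtain p where p: "leads n ?u p" using leads_exists by blast
        have "p \<noteq> m" "p \<in> keys v \<or> p \<in> keys g'"
          using p nz by (auto simp: leads_def in_keys_iff lookup_minus c_def)
        then have "exp_less n p m" using less.prems(2) g'(3) by (auto simp: leads_def)
        moreover have "p \<in> symbol_exps n r" using p u sub by (auto simp: leads_def symbols_def)
        ultimately show ?thesis using less.hyps[OF rank u p] by blast
      qed
      then have "?u + const_poly c * g' \<in> K'"
        using g'(2) submodule_symbolsD(3,4)[OF K'] by blast
      then show ?case by simp
    qed
    then show ?thesis using leads_exists submodule_symbolsD(2)[OF K'] by (metis subsetI)
  qed
  moreover have "finite ?T" "?T \<subseteq> K" using B(1) g by auto
  ultimately show ?thesis by blast
qed

section \<open>Graded free resolutions\<close>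

lift_definition restrict_keys :: "'a set \<Rightarrow> ('a \<Rightarrow>\<^sub>0 'b::zero) \<Rightarrow> 'a \<Rightarrow>\<^sub>0 'b" is
  "\<lambda>A f a. if a \<in> A then f a else 0"
  by (erule rev_finite_subset) auto

definition gdeg :: "nat \<Rightarrow> (nat \<Rightarrow> int) \<Rightarrow> (nat \<Rightarrow>\<^sub>0 nat) \<Rightarrow> int" where
  "gdeg n \<gamma> m = int (\<Sum>j = 1..n. lookup m j) - int (\<Sum>j = 1..n. lookup m (n + j)) + \<gamma> (gen_index n m)"

text \<open>For a single degree this is the projection to a homogeneous component; for the degrees
  below a bound it is the truncation that makes functionals admissible.\<close>

definition cut :: "nat \<Rightarrow> (nat \<Rightarrow> int) \<Rightarrow> int set \<Rightarrow> 'k::field_char_0 mpoly \<Rightarrow> 'k mpoly" where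
  "cut n \<gamma> I v = restrict_keys {m. gdeg n \<gamma> m \<in> I} v"

definition homog :: "nat \<Rightarrow> (nat \<Rightarrow> int) \<Rightarrow> int \<Rightarrow> 'k::field_char_0 mpoly \<Rightarrow> bool" where
  "homog n \<gamma> d v \<longleftrightarrow> keys v \<subseteq> {m. gdeg n \<gamma> m = d}"

lemma lookup_cut: "lookup (cut n \<gamma> I v) m = (if gdeg n \<gamma> m \<in> I then lookup v m else 0)"
  by (simp add: cut_def restrict_keys.rep_eq)

lemma cut_add: "cut n \<gamma> I (v + w) = cut n \<gamma> I v + cut n \<gamma> I w"
  by (rule poly_mapping_eqI) (simp add: lookup_cut lookup_add)

lemma cut_diff: "cut n \<gamma> I (v - w) = cut n \<gamma> I v - cut n \<gamma> I w"
  by (rule poly_mapping_eqI) (simp add: lookup_cut lookup_minus)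

lemma cut_const: "cut n \<gamma> I (const_poly c * v) = const_poly c * cut n \<gamma> I v"
  by (rule poly_mapping_eqI) (simp add: lookup_cut)

lemma cut_zero [simp]: "cut n \<gamma> I 0 = 0"
  by (rule poly_mapping_eqI) (simp add: lookup_cut)

lemma cut_single: "cut n \<gamma> I (single m c) = (if gdeg n \<gamma> m \<in> I then single m c else 0)"
  by (rule poly_mapping_eqI) (auto simp: lookup_cut lookup_single when_def)

lemma cut_symbols [simp]: "v \<in> symbols n r \<Longrightarrow> cut n \<gamma> I v \<in> symbols n r"
  by (simp add: symbols_iff_lookup lookup_cut)

lemma cut_compl: "cut n \<gamma> I v + cut n \<gamma> (- I) v = v"
  by (rule poly_mapping_eqI) (simp add: lookup_cut lookup_add)

lemma cut_homog: "homog n \<gamma> d v \<Longrightarrow> cut n \<gamma> I v = (if d \<in> I then v else 0)"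
  unfolding homog_def by (rule poly_mapping_eqI) (auto simp: lookup_cut in_keys_iff subset_iff)

lemma homog_cut: "homog n \<gamma> d (cut n \<gamma> {d} v)"
  by (auto simp: homog_def in_keys_iff lookup_cut split: if_splits)

lemma cut_sum: "cut n \<gamma> I v = (\<Sum>l \<in> gdeg n \<gamma> ` keys v \<inter> I. cut n \<gamma> {l} v)"
proof (rule poly_mapping_eqI)
  fix m
  have "lookup (\<Sum>l \<in> gdeg n \<gamma> ` keys v \<inter> I. cut n \<gamma> {l} v) m =
      (\<Sum>l \<in> gdeg n \<gamma> ` keys v \<inter> I. if l = gdeg n \<gamma> m then lookup v m else 0)"
    by (auto simp: lookup_sum lookup_cut intro!: sum.cong)
  also have "\<dots> = (if gdeg n \<gamma> m \<in> gdeg n \<gamma> ` keys v \<inter> I then lookup v m else 0)" by simp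
  also have "\<dots> = lookup (cut n \<gamma> I v) m" by (auto simp: lookup_cut in_keys_iff)
  finally show "lookup (cut n \<gamma> I v) m = lookup (\<Sum>l \<in> gdeg n \<gamma> ` keys v \<inter> I. cut n \<gamma> {l} v) m" by simp
qed

lemma sum_cut: "v = (\<Sum>l \<in> gdeg n \<gamma> ` keys v. cut n \<gamma> {l} v)"
proof -
  have "cut n \<gamma> UNIV v = v" by (rule poly_mapping_eqI) (simp add: lookup_cut)
  then show ?thesis using cut_sum[of n \<gamma> UNIV v] by simp
qed

lemma gdeg_add_single:
  assumes "j \<in> {1..n}"
  shows "gdeg n \<gamma> (m + single j k) = gdeg n \<gamma> m + int k" "gdeg n \<gamma> (m + single (n + j) k) = gdeg n \<gamma> m - int k"
  using assms by (simp_all add: gdeg_def gen_index_def lookup_add sum.distrib lookup_single when_def)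

lemma gdeg_gen: "gdeg n \<gamma> (single (2 * n + 1) s) = \<gamma> s"
  by (simp add: gdeg_def parts_gen lookup_single when_def)

lemma gdeg_diff_single:
  assumes "j \<in> {1..n}" "lookup m j \<noteq> 0"
  shows "gdeg n \<gamma> (m - single j 1) = gdeg n \<gamma> m - 1"
  using gdeg_add_single(1)[OF assms(1), of \<gamma> "m - single j 1" 1] single_diff_add[OF assms(2)] by simp

lemma cut_var:
  assumes "j \<in> {1..n}"
  shows "cut n \<gamma> I (var_poly j * v) = var_poly j * cut n \<gamma> {l. l + 1 \<in> I} v"
  by (rule additive_eqI[of "\<lambda>v. cut n \<gamma> I (var_poly j * v)" "\<lambda>v. var_poly j * cut n \<gamma> {l. l + 1 \<in> I} v"])
     (simp_all add: cut_add distrib_left cut_single gdeg_add_single[OF assms])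

lemma cut_deriv:
  assumes j: "j \<in> {1..n}"
  shows "cut n \<gamma> I (sym_deriv n j v) = sym_deriv n j (cut n \<gamma> {l. l - 1 \<in> I} v)"
proof (rule additive_eqI[of "\<lambda>v. cut n \<gamma> I (sym_deriv n j v)" "\<lambda>v. sym_deriv n j (cut n \<gamma> {l. l - 1 \<in> I} v)"])
  fix m
  show "cut n \<gamma> I (sym_deriv n j (single m c)) = sym_deriv n j (cut n \<gamma> {l. l - 1 \<in> I} (single m c))" for c
    by (cases "lookup m j = 0")
       (simp_all add: sym_deriv_def cut_add cut_single gdeg_add_single[OF j] gdeg_diff_single[OF j])
qed (simp_all add: cut_add sym_deriv_add)

lemma homog_add: "homog n \<gamma> d v \<Longrightarrow> homog n \<gamma> d w \<Longrightarrow> homog n \<gamma> d (v + w)"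
  using keys_add[of v w] unfolding homog_def by blast

lemma homog_const: "homog n \<gamma> d v \<Longrightarrow> homog n \<gamma> d (const_poly c * v)"
  by (auto simp: homog_def in_keys_iff subset_iff)

lemma homog_iff_cut: "homog n \<gamma> d v \<longleftrightarrow> cut n \<gamma> {d} v = v"
  using homog_cut[of n \<gamma> d v] cut_homog[of n \<gamma> d v "{d}"] by auto

lemma homog_var: "j \<in> {1..n} \<Longrightarrow> homog n \<gamma> d v \<Longrightarrow> homog n \<gamma> (d + 1) (var_poly j * v)"
  by (simp add: homog_iff_cut cut_var)

lemma homog_deriv:
  assumes "j \<in> {1..n}" "homog n \<gamma> d v"
  shows "homog n \<gamma> (d - 1) (sym_deriv n j v)"
proof -
  have "{l. l - 1 \<in> {d - 1}} = {d}" by auto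
  then show ?thesis using assms by (simp only: homog_iff_cut cut_deriv)
qed

lemma free_hom:
  fixes h :: "'k::field_char_0 mpoly \<Rightarrow> 'x"
  assumes N: "left_module (diff_op_ring n) N" and h: "h \<in> lin_hom (diff_op_ring n) (free_module n r) N"
  shows "v \<in> symbols n r \<Longrightarrow> w \<in> symbols n r \<Longrightarrow> h (v + w) = h v \<oplus>\<^bsub>N\<^esub> h w"
    "v \<in> symbols n r \<Longrightarrow> h (const_poly c * v) = scalar_op n c \<odot>\<^bsub>N\<^esub> h v"
    "j \<in> {1..n} \<Longrightarrow> v \<in> symbols n r \<Longrightarrow> h (var_poly j * v) = mult_op n (var_poly j) \<odot>\<^bsub>N\<^esub> h v"
    "j \<in> {1..n} \<Longrightarrow> v \<in> symbols n r \<Longrightarrow> h (sym_deriv n j v) = partial_op n j \<odot>\<^bsub>N\<^esub> h v"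
    "h 0 = \<zero>\<^bsub>N\<^esub>" "v \<in> symbols n r \<Longrightarrow> h v \<in> carrier N"
proof -
  show "v \<in> symbols n r \<Longrightarrow> w \<in> symbols n r \<Longrightarrow> h (v + w) = h v \<oplus>\<^bsub>N\<^esub> h w"
    using lin_hom_add[OF h, of v w] by simp
  show "v \<in> symbols n r \<Longrightarrow> h (const_poly c * v) = scalar_op n c \<odot>\<^bsub>N\<^esub> h v"
    using lin_hom_smult[OF h scalar_op_in_diff_op, of v c] by (simp add: sym_action_gens)
  show "j \<in> {1..n} \<Longrightarrow> v \<in> symbols n r \<Longrightarrow> h (var_poly j * v) = mult_op n (var_poly j) \<odot>\<^bsub>N\<^esub> h v"
    using lin_hom_smult[OF h, of "mult_op n (var_poly j)" v] by (simp add: sym_action_gens)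
  show "j \<in> {1..n} \<Longrightarrow> v \<in> symbols n r \<Longrightarrow> h (sym_deriv n j v) = partial_op n j \<odot>\<^bsub>N\<^esub> h v"
    using lin_hom_smult[OF h, of "partial_op n j" v] by (simp add: sym_action_gens)
  show "h 0 = \<zero>\<^bsub>N\<^esub>" using lin_hom_zero[OF left_module_free_module N h] by simp
  show "v \<in> symbols n r \<Longrightarrow> h v \<in> carrier N" using lin_hom_closed[OF h, of v] by simp
qed

lemma free_hom_free:
  fixes h :: "'k::field_char_0 mpoly \<Rightarrow> 'k mpoly"
  assumes h: "h \<in> lin_hom (diff_op_ring n) (free_module n r) (free_module n r')"
  shows "v \<in> symbols n r \<Longrightarrow> w \<in> symbols n r \<Longrightarrow> h (v + w) = h v + h w"
    "v \<in> symbols n r \<Longrightarrow> h (const_poly c * v) = const_poly c * h v"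
    "j \<in> {1..n} \<Longrightarrow> v \<in> symbols n r \<Longrightarrow> h (var_poly j * v) = var_poly j * h v"
    "j \<in> {1..n} \<Longrightarrow> v \<in> symbols n r \<Longrightarrow> h (sym_deriv n j v) = sym_deriv n j (h v)"
    "h 0 = 0" "v \<in> symbols n r \<Longrightarrow> h v \<in> symbols n r'"
  using free_hom[OF left_module_free_module h] by (simp_all add: sym_action_gens)

text \<open>Multiplication by \<open>\<xi>_j\<close> is not a module operation. It equals the action
  of \<open>\<partial>_j\<close> minus the derivative by x_j, and in this form inductions over
  monomials can compute \<open>h\<close>.\<close>

lemma free_hom_deriv_mono:
  fixes h :: "'k::field_char_0 mpoly \<Rightarrow> 'x"
  assumes N: "left_module (diff_op_ring n) N" and h: "h \<in> lin_hom (diff_op_ring n) (free_module n r) N"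
    and m: "m \<in> symbol_exps n r" and j: "j \<in> {1..n}"
  shows "h (single (m + single (n + j) 1) 1) = partial_op n j \<odot>\<^bsub>N\<^esub> h (single m 1) \<oplus>\<^bsub>N\<^esub>
    scalar_op n (- of_nat (lookup m j)) \<odot>\<^bsub>N\<^esub> h (single (m - single j 1) 1)"
proof -
  have j2: "j \<in> {1..2 * n}" using j by auto
  have s: "single m (1 :: 'k) \<in> symbols n r" "single (m - single j 1) (1 :: 'k) \<in> symbols n r"
    using m symbol_exps_diff_single[OF m j2] by (simp_all add: symbols_single)
  have eq: "single (m + single (n + j) 1) (1 :: 'k) =
      sym_deriv n j (single m 1) + const_poly (- of_nat (lookup m j)) * single (m - single j 1) 1"
    by (simp add: sym_deriv_def add.assoc flip: single_add)
  show ?thesis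
    unfolding eq
    by (simp only: free_hom(1)[OF N h symbols_sym_deriv[OF j s(1)] symbols_const[OF s(2)]]
        free_hom(4)[OF N h j s(1)] free_hom(2)[OF N h s(2)])
qed

text \<open>The values on the generators have the prescribed degrees, and the operations that build
  monomials shift the degree by 1 or -1 on both sides alike; hence components are mapped to
  components.\<close>

lemma free_map_homog:
  fixes g :: "nat \<Rightarrow> 'k::field_char_0 mpoly"
  assumes g: "\<And>s. s < r' \<Longrightarrow> g s \<in> symbols n r" "\<And>s. s < r' \<Longrightarrow> homog n \<gamma> (\<gamma>' s) (g s)"
    and v: "v \<in> symbols n r'"
  shows "free_map n r' (free_module n r) g (cut n \<gamma>' I v) = cut n \<gamma> I (free_map n r' (free_module n r) g v)"
proof -
  let ?h = "free_map n r' (free_module n r) g"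
  note F = left_module_free_module
  have h: "?h \<in> lin_hom (diff_op_ring n) (free_module n r') (free_module n r)"
    using g(1) by (intro free_map_lin_hom[OF F]) simp
  have gen: "?h (gen_symbol n s) = g s" if "s < r'" for s
    using g(1) that by (intro free_map_gen[OF F]) auto
  note hh = free_hom_free[OF h]
  have mono: "homog n \<gamma> (gdeg n \<gamma>' m) (?h (single m 1))" if "m \<in> symbol_exps n r'" for m
    using that
  proof (induction rule: symbol_mono_induct)
    case (gen s)
    then show ?case using assms(2) \<open>\<And>s. s < r' \<Longrightarrow> ?h (gen_symbol n s) = g s\<close> by (simp add: gdeg_gen gen_symbol_def)
  next
    case (var m j)
    then show ?case using hh(3)[of j "single m 1"] homog_var[of j n \<gamma> _ "?h (single m 1)"]
      by (simp add: symbols_single gdeg_add_single)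
  next
    case (deriv m j)
    have j2: "j \<in> {1..2 * n}" using deriv(2) by auto
    have s: "?h (single m 1) \<in> symbols n r" "?h (single (m - single j 1) 1) \<in> symbols n r"
      using deriv(1) symbol_exps_diff_single[OF deriv(1) j2] hh(6) by (auto simp: symbols_single)
    have eq: "?h (single (m + single (n + j) 1) 1) = sym_deriv n j (?h (single m 1)) +
        const_poly (- of_nat (lookup m j)) * ?h (single (m - single j 1) 1)"
      using free_hom_deriv_mono[OF F h deriv(1,2)] deriv(2) s by (simp add: sym_action_gens)
    have 1: "homog n \<gamma> (gdeg n \<gamma>' m - 1) (sym_deriv n j (?h (single m 1)))"
      by (rule homog_deriv[OF deriv(2,3)])
    have 2: "homog n \<gamma> (gdeg n \<gamma>' m - 1) (const_poly (- of_nat (lookup m j)) * ?h (single (m - single j 1) 1))"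
    proof (cases "lookup m j = 0")
      case False
      then show ?thesis using deriv(4) by (intro homog_const) (simp add: gdeg_diff_single[OF deriv(2)])
    qed (simp add: homog_def)
    show ?case unfolding eq using homog_add[OF 1 2] by (simp add: gdeg_add_single[OF deriv(2)])
  qed
  have v': "keys v \<subseteq> symbol_exps n r'" using v by (simp add: symbols_def)
  then show ?thesis
  proof (induction rule: poly_mapping_add_induct)
    case zero
    then show ?case by (simp add: hh(5))
  next
    case (single m c)
    have s: "single m (1 :: 'k) \<in> symbols n r'" using single by (rule symbols_single)
    have c: "single m c = const_poly c * single m 1" by simp
    show ?case
      unfolding c cut_const hh(2)[OF s] cut_homog[OF mono[OF single]]
      using hh(2)[OF s] by (simp add: cut_single hh(5) del: const_poly_mult_single)
  next
    case (add u w)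
    then have "u \<in> symbols n r'" "w \<in> symbols n r'" by (simp_all add: symbols_def)
    then show ?case using add by (simp add: cut_add hh(1))
  qed
qed

section \<open>Covering graded submodules by graded free modules\<close>

definition graded_submodule where
  "graded_submodule n r \<gamma> K \<longleftrightarrow> submodule_set (diff_op_ring n) (free_module n r) K \<and>
     (\<forall>l. \<forall>v \<in> K. cut n \<gamma> {l} v \<in> K)"

lemma submodule_symbols_sum:
  fixes K :: "'k::field_char_0 mpoly set"
  assumes K: "submodule_set (diff_op_ring n) (free_module n r) K" and "\<And>x. x \<in> A \<Longrightarrow> f x \<in> K"
  shows "(\<Sum>x \<in> A. f x) \<in> K"
  using assms(2) submodule_symbolsD(2,3)[OF K] by (induction A rule: infinite_finite_induct) auto

text \<open>Finitely many generators of \<open>K\<close> are replaced by their homogeneous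
  components: these lie in \<open>K\<close> because it is graded, and they sum up to the generators.
  A free module whose generators get the degrees of these components maps onto \<open>K\<close> and
  respects \<open>cut\<close>.\<close>

lemma graded_submodule_cover:
  fixes K :: "'k::field_char_0 mpoly set"
  assumes K: "graded_submodule n r \<gamma> K"
  shows "\<exists>r' \<gamma>' h. h \<in> lin_hom (diff_op_ring n) (free_module n r') (free_module n r) \<and> h ` symbols n r' = K \<and>
    (\<forall>I. \<forall>v \<in> symbols n r'. h (cut n \<gamma>' I v) = cut n \<gamma> I (h v))"
proof -
  note F = left_module_free_module
  have KS: "submodule_set (diff_op_ring n) (free_module n r) K" using K by (simp add: graded_submodule_def)
  obtain T where T: "finite T" "T \<subseteq> K"
    "\<And>K'. submodule_set (diff_op_ring n) (free_module n r) K' \<Longrightarrow> T \<subseteq> K' \<Longrightarrow> K \<subseteq> K'"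
    using submodule_finitely_generated[OF KS] by blast
  define T' where "T' = (\<Union>v \<in> T. (\<lambda>l. cut n \<gamma> {l} v) ` gdeg n \<gamma> ` keys v)"
  have fin: "finite T'" using T(1) by (simp add: T'_def)
  obtain r' and g :: "nat \<Rightarrow> 'k mpoly" where g: "T' = g ` {i. i < r'}"
    using finite_imp_nat_seg_image_inj_on[OF fin] by blast
  have "\<forall>s. \<exists>l. s < r' \<longrightarrow> g s \<in> K \<and> homog n \<gamma> l (g s)"
  proof
    fix s
    show "\<exists>l. s < r' \<longrightarrow> g s \<in> K \<and> homog n \<gamma> l (g s)"
    proof (cases "s < r'")
      case True
      then have "g s \<in> T'" using g by blast
      then obtain v l where "v \<in> T" "g s = cut n \<gamma> {l} v" by (auto simp: T'_def)
      then show ?thesis using K T(2) homog_cut by (metis graded_submodule_def subsetD)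
    qed simp
  qed
  from choice[OF this] obtain \<gamma>' where \<gamma>': "\<And>s. s < r' \<Longrightarrow> g s \<in> K" "\<And>s. s < r' \<Longrightarrow> homog n \<gamma> (\<gamma>' s) (g s)" by blast
  have gs: "g s \<in> symbols n r" if "s < r'" for s using \<gamma>'(1)[OF that] submodule_symbolsD(1)[OF KS] by blast
  let ?h = "free_map n r' (free_module n r) g"
  have h: "?h \<in> lin_hom (diff_op_ring n) (free_module n r') (free_module n r)"
    using gs by (intro free_map_lin_hom[OF F]) simp
  have im: "submodule_set (diff_op_ring n) (free_module n r) (?h ` symbols n r')"
    using submodule_set_image[OF F F h] by simp
  have "T \<subseteq> ?h ` symbols n r'"
  proof
    fix v assume v: "v \<in> T"
    have "cut n \<gamma> {l} v \<in> ?h ` symbols n r'" if "l \<in> gdeg n \<gamma> ` keys v" for l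
    proof -
      have "cut n \<gamma> {l} v \<in> T'" using v that unfolding T'_def by blast
      then obtain s where "s < r'" "cut n \<gamma> {l} v = g s" using g by blast
      then have "cut n \<gamma> {l} v = ?h (gen_symbol n s)" "gen_symbol n s \<in> (symbols n r' :: 'k mpoly set)"
        using gs by (simp_all add: free_map_gen[OF F])
      then show ?thesis by (rule image_eqI)
    qed
    then have "(\<Sum>l \<in> gdeg n \<gamma> ` keys v. cut n \<gamma> {l} v) \<in> ?h ` symbols n r'"
      by (rule submodule_symbols_sum[OF im])
    then show "v \<in> ?h ` symbols n r'" using sum_cut[of v n \<gamma>] by simp
  qed
  then have "K \<subseteq> ?h ` symbols n r'" by (rule T(3)[OF im])
  moreover have "?h ` symbols n r' \<subseteq> K" using \<gamma>'(1) by (rule free_map_image_subset[OF F KS])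
  ultimately have "?h ` symbols n r' = K" by blast
  moreover have "\<forall>I. \<forall>v \<in> symbols n r'. ?h (cut n \<gamma>' I v) = cut n \<gamma> I (?h v)"
    by (intro allI ballI free_map_homog) (use gs \<gamma>'(2) in auto)
  ultimately show ?thesis using h by blast
qed

lemma graded_kernel:
  fixes h :: "'k::field_char_0 mpoly \<Rightarrow> 'k mpoly"
  assumes h: "h \<in> lin_hom (diff_op_ring n) (free_module n r') (free_module n r)"
    and cut: "\<And>I v. v \<in> symbols n r' \<Longrightarrow> h (cut n \<gamma>' I v) = cut n \<gamma> I (h v)"
  shows "graded_submodule n r' \<gamma>' {v \<in> symbols n r'. h v = 0}"
  using submodule_set_kernel[OF left_module_free_module left_module_free_module h] cut
  by (simp add: graded_submodule_def)

section \<open>Graded modules and their resolutions\<close>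

context
  fixes n :: nat and M :: "('k::field_char_0 diff_op, 'm) module" and G :: "int \<Rightarrow> 'm set"
  assumes gr: "graded_diff_module n M G"
begin

lemma graded_moduleD:
  shows "left_module (diff_op_ring n) M" "additive_subgroup (G l) M"
    "m \<in> carrier M \<Longrightarrow> \<exists>!c. (\<forall>l. c l \<in> G l) \<and> finite {l. c l \<noteq> \<zero>\<^bsub>M\<^esub>} \<and> m = (\<Oplus>\<^bsub>M\<^esub>l\<in>{l. c l \<noteq> \<zero>\<^bsub>M\<^esub>}. c l)"
    "m \<in> G l \<Longrightarrow> scalar_op n c \<odot>\<^bsub>M\<^esub> m \<in> G l"
    "j \<in> {1..n} \<Longrightarrow> m \<in> G l \<Longrightarrow> mult_op n (var_poly j) \<odot>\<^bsub>M\<^esub> m \<in> G (l + 1)"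
    "j \<in> {1..n} \<Longrightarrow> m \<in> G l \<Longrightarrow> partial_op n j \<odot>\<^bsub>M\<^esub> m \<in> G (l - 1)"
proof -
  note g = gr[unfolded graded_diff_module_def]
  show "left_module (diff_op_ring n) M" "additive_subgroup (G l) M" using g by blast+
  show "m \<in> carrier M \<Longrightarrow> \<exists>!c. (\<forall>l. c l \<in> G l) \<and> finite {l. c l \<noteq> \<zero>\<^bsub>M\<^esub>} \<and> m = (\<Oplus>\<^bsub>M\<^esub>l\<in>{l. c l \<noteq> \<zero>\<^bsub>M\<^esub>}. c l)"
    using g by blast
  have mult: "mult_op n f \<odot>\<^bsub>M\<^esub> m \<in> G (l + int d)" if "f \<in> homog_polys n d" "m \<in> G l" for d l f m
    using g that by blast
  have "const_poly c \<in> homog_polys n 0" by (auto simp: homog_polys_def) (auto simp: const_poly_def split: if_splits)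
  then show "m \<in> G l \<Longrightarrow> scalar_op n c \<odot>\<^bsub>M\<^esub> m \<in> G l"
    using mult[of "const_poly c" 0 m l] by (simp add: scalar_op_def)
  have "var_poly j \<in> homog_polys n 1" if "j \<in> {1..n}"
    using that by (auto simp: homog_polys_def) (auto simp: var_poly_def lookup_single when_def)
  then show "j \<in> {1..n} \<Longrightarrow> m \<in> G l \<Longrightarrow> mult_op n (var_poly j) \<odot>\<^bsub>M\<^esub> m \<in> G (l + 1)"
    using mult[of "var_poly j" 1 m l] by simp
  show "j \<in> {1..n} \<Longrightarrow> m \<in> G l \<Longrightarrow> partial_op n j \<odot>\<^bsub>M\<^esub> m \<in> G (l - 1)" using g by blast
qed

lemma graded_component:
  "\<zero>\<^bsub>M\<^esub> \<in> G l" "x \<in> G l \<Longrightarrow> y \<in> G l \<Longrightarrow> x \<oplus>\<^bsub>M\<^esub> y \<in> G l" "x \<in> G l \<Longrightarrow> x \<in> carrier M"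
  using additive_subgroup.zero_closed[OF graded_moduleD(2)] additive_subgroup.a_closed[OF graded_moduleD(2)]
    additive_subgroup.a_Hcarr[OF graded_moduleD(2)] by blast+

lemma graded_hom_homog:
  fixes h :: "'k mpoly \<Rightarrow> 'm"
  assumes h: "h \<in> lin_hom (diff_op_ring n) (free_module n r) M"
    and gen: "\<And>s. s < r \<Longrightarrow> h (gen_symbol n s) \<in> G (\<gamma> s)"
    and v: "v \<in> symbols n r" "homog n \<gamma> d v"
  shows "h v \<in> G d"
proof -
  note hh = free_hom[OF graded_moduleD(1) h]
  have mono: "h (single m 1) \<in> G (gdeg n \<gamma> m)" if "m \<in> symbol_exps n r" for m
    using that
  proof (induction rule: symbol_mono_induct)
    case (gen s)
    then show ?case using assms(2)[of s] by (simp add: gdeg_gen gen_symbol_def)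
  next
    case (var m j)
    then show ?case using hh(3)[of j "single m 1"] graded_moduleD(5)[of j "h (single m 1)"]
      by (simp add: symbols_single gdeg_add_single)
  next
    case (deriv m j)
    have 1: "partial_op n j \<odot>\<^bsub>M\<^esub> h (single m 1) \<in> G (gdeg n \<gamma> m - 1)"
      by (rule graded_moduleD(6)[OF deriv(2,3)])
    have "scalar_op n (- of_nat (lookup m j)) \<odot>\<^bsub>M\<^esub> h (single (m - single j 1) 1) \<in> G (gdeg n \<gamma> m - 1)"
    proof (cases "lookup m j = 0")
      case True
      interpret M: left_module "diff_op_ring n :: 'k diff_op ring" M by (rule graded_moduleD(1))
      have "j \<in> {1..2 * n}" using deriv(2) by auto
      then have "h (single (m - single j 1) 1) \<in> carrier M"
        using symbol_exps_diff_single[OF deriv(1)] by (intro hh(6)) (simp add: symbols_single)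
      then show ?thesis using True graded_component(1) by (simp add: scalar_op_zero)
    next
      case False
      then show ?thesis
        using graded_moduleD(4)[OF deriv(4)] by (simp add: gdeg_diff_single[OF deriv(2)])
    qed
    then show ?case
      unfolding free_hom_deriv_mono[OF graded_moduleD(1) h deriv(1,2)]
      using graded_component(2)[OF 1] by (simp add: gdeg_add_single[OF deriv(2)])
  qed
  have "keys v \<subseteq> symbol_exps n r \<inter> {m. gdeg n \<gamma> m = d}" using v by (simp add: symbols_def homog_def)
  then show ?thesis
  proof (induction rule: poly_mapping_add_induct)
    case zero
    then show ?case using graded_component(1) by (simp add: hh(5))
  next
    case (single m c)
    then have s: "single m (1 :: 'k) \<in> symbols n r" by (simp add: symbols_single)
    have "h (const_poly c * single m 1) \<in> G (gdeg n \<gamma> m)"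
      unfolding hh(2)[OF s] using mono single by (intro graded_moduleD(4)) auto
    then show ?case using single by simp
  next
    case (add u w)
    then have "u \<in> symbols n r" "w \<in> symbols n r" by (auto simp: symbols_def)
    then show ?case using add graded_component(2) by (simp add: hh(1))
  qed
qed

text \<open>If \<open>h v\<close> is zero, the images of the components of \<open>v\<close>
  decompose zero into homogeneous elements. The decomposition is unique, so each of these images is
  zero.\<close>

lemma graded_hom_kernel:
  fixes h :: "'k mpoly \<Rightarrow> 'm"
  assumes h: "h \<in> lin_hom (diff_op_ring n) (free_module n r) M"
    and gen: "\<And>s. s < r \<Longrightarrow> h (gen_symbol n s) \<in> G (\<gamma> s)"
  shows "graded_submodule n r \<gamma> {v \<in> symbols n r. h v = \<zero>\<^bsub>M\<^esub>}"
proof -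
  note hh = free_hom[OF graded_moduleD(1) h]
  interpret M: left_module "diff_op_ring n :: 'k diff_op ring" M by (rule graded_moduleD(1))
  have "h (cut n \<gamma> {l} v) = \<zero>\<^bsub>M\<^esub>" if v: "v \<in> symbols n r" "h v = \<zero>\<^bsub>M\<^esub>" for v l
  proof -
    define c where "c l = h (cut n \<gamma> {l} v)" for l
    let ?L = "gdeg n \<gamma> ` keys v"
    have cG: "c l \<in> G l" for l unfolding c_def by (rule graded_hom_homog[OF h gen]) (use v homog_cut in auto)
    have c0: "c l = \<zero>\<^bsub>M\<^esub>" if "l \<notin> ?L" for l
    proof -
      have "cut n \<gamma> {l} v = 0" using cut_sum[of n \<gamma> "{l}" v] that by simp
      then show ?thesis by (simp add: c_def hh(5))
    qed
    have "\<zero>\<^bsub>M\<^esub> = h (\<Sum>l \<in> ?L. cut n \<gamma> {l} v)" using v sum_cut[of v n \<gamma>] by simp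
    also have "\<dots> = h (\<Oplus>\<^bsub>free_module n r\<^esub>l \<in> ?L. cut n \<gamma> {l} v)" using v by (subst finsum_free_module) simp_all
    also have "\<dots> = (\<Oplus>\<^bsub>M\<^esub>l \<in> ?L. c l)"
      unfolding c_def using v by (intro lin_hom_finsum[OF left_module_free_module graded_moduleD(1) h]) auto
    also have "\<dots> = (\<Oplus>\<^bsub>M\<^esub>l \<in> {l. c l \<noteq> \<zero>\<^bsub>M\<^esub>}. c l)"
      using c0 cG graded_component(3) by (intro M.add.finprod_mono_neutral_cong_right) auto
    finally have z: "\<zero>\<^bsub>M\<^esub> = (\<Oplus>\<^bsub>M\<^esub>l \<in> {l. c l \<noteq> \<zero>\<^bsub>M\<^esub>}. c l)" .
    have "finite {l. c l \<noteq> \<zero>\<^bsub>M\<^esub>}" by (rule finite_subset[of _ ?L]) (use c0 in auto)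
    with z have "(\<forall>l. c l \<in> G l) \<and> finite {l. c l \<noteq> \<zero>\<^bsub>M\<^esub>} \<and> \<zero>\<^bsub>M\<^esub> = (\<Oplus>\<^bsub>M\<^esub>l\<in>{l. c l \<noteq> \<zero>\<^bsub>M\<^esub>}. c l)"
      using cG by blast
    moreover define z where "z = (\<lambda>l::int. \<zero>\<^bsub>M\<^esub>)"
    then have "(\<forall>l. z l \<in> G l) \<and> finite {l. z l \<noteq> \<zero>\<^bsub>M\<^esub>} \<and> \<zero>\<^bsub>M\<^esub> = (\<Oplus>\<^bsub>M\<^esub>l\<in>{l. z l \<noteq> \<zero>\<^bsub>M\<^esub>}. z l)"
      using graded_component(1) by simp
    ultimately have "c = z" using graded_moduleD(3)[OF M.zero_closed] by blast
    then show ?thesis by (metis c_def z_def)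
  qed
  then show ?thesis
    using submodule_set_kernel[OF left_module_free_module graded_moduleD(1) h] by (simp add: graded_submodule_def)
qed

text \<open>The homogeneous components of finitely many generators of \<open>M\<close> are again
  finitely many generators, and each has a degree that can be given to a generator of the free
  module.\<close>

lemma graded_module_cover:
  assumes fg: "fin_gen (diff_op_ring n) M"
  shows "\<exists>r \<gamma> h. h \<in> lin_hom (diff_op_ring n) (free_module n r) M \<and> h ` symbols n r = carrier M \<and>
    (\<forall>s < r. h (gen_symbol n s) \<in> G (\<gamma> s))"
proof -
  let ?D = "diff_op_ring n :: 'k diff_op ring"
  note F = left_module_free_module and MM = graded_moduleD(1)
  interpret M: left_module ?D M by (rule MM)
  obtain S where S: "finite S" "S \<subseteq> carrier M"
    "\<And>m. m \<in> carrier M \<Longrightarrow> \<exists>c \<in> S \<rightarrow> carrier ?D. m = (\<Oplus>\<^bsub>M\<^esub>s\<in>S. c s \<odot>\<^bsub>M\<^esub> s)"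
    using fg unfolding fin_gen_def by blast
  have "\<forall>m \<in> S. \<exists>c. (\<forall>l. c l \<in> G l) \<and> finite {l. c l \<noteq> \<zero>\<^bsub>M\<^esub>} \<and> m = (\<Oplus>\<^bsub>M\<^esub>l\<in>{l. c l \<noteq> \<zero>\<^bsub>M\<^esub>}. c l)"
    using S(2) by (intro ballI ex1_implies_ex[OF graded_moduleD(3)]) blast
  from bchoice[OF this] obtain c where c: "\<And>m l. m \<in> S \<Longrightarrow> c m l \<in> G l" "\<And>m. m \<in> S \<Longrightarrow> finite {l. c m l \<noteq> \<zero>\<^bsub>M\<^esub>}"
    "\<And>m. m \<in> S \<Longrightarrow> m = (\<Oplus>\<^bsub>M\<^esub>l\<in>{l. c m l \<noteq> \<zero>\<^bsub>M\<^esub>}. c m l)" by blast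
  define T where "T = (\<Union>m \<in> S. c m ` {l. c m l \<noteq> \<zero>\<^bsub>M\<^esub>})"
  have fin: "finite T" using S(1) c(2) by (simp add: T_def)
  obtain r and g :: "nat \<Rightarrow> 'm" where g: "T = g ` {i. i < r}"
    using finite_imp_nat_seg_image_inj_on[OF fin] by blast
  have "\<forall>s. \<exists>l. s < r \<longrightarrow> g s \<in> G l"
  proof
    fix s
    show "\<exists>l. s < r \<longrightarrow> g s \<in> G l"
    proof (cases "s < r")
      case True
      then have "g s \<in> T" using g by blast
      then obtain m l where "m \<in> S" "g s = c m l" by (auto simp: T_def)
      then show ?thesis using c(1) by metis
    qed simp
  qed
  from choice[OF this] obtain \<gamma> where \<gamma>: "\<And>s. s < r \<Longrightarrow> g s \<in> G (\<gamma> s)" by blast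
  have gM: "g s \<in> carrier M" if "s < r" for s using graded_component(3)[OF \<gamma>[OF that]] .
  let ?h = "free_map n r M g"
  have h: "?h \<in> lin_hom ?D (free_module n r) M" using gM by (rule free_map_lin_hom[OF MM])
  have gen: "?h (gen_symbol n s) = g s" if "s < r" for s using gM that by (rule free_map_gen[OF MM])
  let ?K = "?h ` symbols n r"
  have K: "submodule_set ?D M ?K" using submodule_set_image[OF F MM h] by simp
  have TK: "T \<subseteq> ?K"
  proof
    fix x assume "x \<in> T"
    then obtain s where "s < r" "x = g s" using g by blast
    then have "x = ?h (gen_symbol n s)" "gen_symbol n s \<in> (symbols n r :: 'k mpoly set)" by (simp_all add: gen)
    then show "x \<in> ?K" by (rule image_eqI)
  qed
  have K': "?K \<subseteq> carrier M" "\<zero>\<^bsub>M\<^esub> \<in> ?K" "\<And>x y. x \<in> ?K \<Longrightarrow> y \<in> ?K \<Longrightarrow> x \<oplus>\<^bsub>M\<^esub> y \<in> ?K"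
    "\<And>a x. a \<in> carrier ?D \<Longrightarrow> x \<in> ?K \<Longrightarrow> a \<odot>\<^bsub>M\<^esub> x \<in> ?K"
    using K unfolding submodule_set_def by blast+
  have SK: "m \<in> ?K" if m: "m \<in> S" for m
  proof -
    have cK: "c m \<in> {l. c m l \<noteq> \<zero>\<^bsub>M\<^esub>} \<rightarrow> ?K" using TK m unfolding T_def by blast
    have "(\<Oplus>\<^bsub>M\<^esub>l\<in>{l. c m l \<noteq> \<zero>\<^bsub>M\<^esub>}. c m l) \<in> ?K"
      by (rule M.finsum_closed_sub[OF K'(1,2) _ c(2)[OF m] cK]) (rule K'(3))
    then show ?thesis by (subst c(3)[OF m])
  qed
  have "m \<in> ?K" if m: "m \<in> carrier M" for m
  proof -
    obtain a where a: "a \<in> S \<rightarrow> carrier ?D" "m = (\<Oplus>\<^bsub>M\<^esub>s\<in>S. a s \<odot>\<^bsub>M\<^esub> s)" using S(3)[OF m] by blast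
    have aK: "(\<lambda>s. a s \<odot>\<^bsub>M\<^esub> s) \<in> S \<rightarrow> ?K" using a(1) SK K'(4) by blast
    show ?thesis unfolding a(2) by (rule M.finsum_closed_sub[OF K'(1,2) _ S(1) aK]) (rule K'(3))
  qed
  then have "?K = carrier M" using K'(1) by blast
  moreover have "\<forall>s < r. ?h (gen_symbol n s) \<in> G (\<gamma> s)" using gen \<gamma> by simp
  ultimately show ?thesis using h by blast
qed

theorem graded_free_resolution:
  assumes fg: "fin_gen (diff_op_ring n) M"
  shows "\<exists>r \<gamma> \<delta> \<epsilon>. exact_resolution (diff_op_ring n) (\<lambda>a. free_module n (r a)) \<delta> \<epsilon> M \<and>
    (\<forall>a I. \<forall>v \<in> symbols n (r (Suc a)). \<delta> a (cut n (\<gamma> (Suc a)) I v) = cut n (\<gamma> a) I (\<delta> a v))"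
proof -
  let ?D = "diff_op_ring n :: 'k diff_op ring"
  obtain r0 \<gamma>0 \<epsilon> where \<epsilon>: "\<epsilon> \<in> lin_hom ?D (free_module n r0) M" "\<epsilon> ` symbols n r0 = carrier M"
    "\<forall>s < r0. \<epsilon> (gen_symbol n s) \<in> G (\<gamma>0 s)" using graded_module_cover[OF fg] by blast
  define K0 where "K0 = {v \<in> symbols n r0. \<epsilon> v = \<zero>\<^bsub>M\<^esub>}"
  \<comment> \<open>Dependent choice runs over triples of rank, degrees of the generators and the
    graded submodule still to be covered. The condition at \<open>a = 0\<close> ties the sequence to
    the kernel of the cover of \<open>M\<close>.\<close>
  define I where "I a Z \<longleftrightarrow> (case Z of (r, \<gamma>, K) \<Rightarrow> graded_submodule n r \<gamma> K \<and> (a = 0 \<longrightarrow> Z = (r0, \<gamma>0, K0)))"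
    for a :: nat and Z :: "nat \<times> (nat \<Rightarrow> int) \<times> 'k mpoly set"
  define S where "S Z Y \<longleftrightarrow> (case Z of (r, \<gamma>, K) \<Rightarrow> case Y of (r', \<gamma>', K') \<Rightarrow>
     \<exists>h \<in> lin_hom ?D (free_module n r') (free_module n r). h ` symbols n r' = K \<and> K' = {v \<in> symbols n r'. h v = 0} \<and>
       (\<forall>I. \<forall>v \<in> symbols n r'. h (cut n \<gamma>' I v) = cut n \<gamma> I (h v)))" for Z Y
  have "\<exists>Z. \<forall>a. I a (Z a) \<and> S (Z a) (Z (Suc a))"
  proof (rule dependent_nat_choice)
    have "graded_submodule n r0 \<gamma>0 K0" unfolding K0_def using \<epsilon>(1,3) by (intro graded_hom_kernel) auto
    then show "\<exists>Z. I 0 Z" by (auto simp: I_def)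
    fix Z a assume "I a Z"
    then obtain r \<gamma> K where Z: "Z = (r, \<gamma>, K)" "graded_submodule n r \<gamma> K" by (auto simp: I_def split: prod.splits)
    obtain r' \<gamma>' h where h: "h \<in> lin_hom ?D (free_module n r') (free_module n r)" "h ` symbols n r' = K"
      "\<forall>I. \<forall>v \<in> symbols n r'. h (cut n \<gamma>' I v) = cut n \<gamma> I (h v)" using graded_submodule_cover[OF Z(2)] by blast
    let ?K' = "{v \<in> symbols n r'. h v = 0}"
    have "graded_submodule n r' \<gamma>' ?K'" using h by (intro graded_kernel) auto
    then have "I (Suc a) (r', \<gamma>', ?K')" "S Z (r', \<gamma>', ?K')" using h by (auto simp: I_def S_def Z(1))
    then show "\<exists>Y. I (Suc a) Y \<and> S Z Y" by blast
  qed
  then obtain Z where Z: "\<And>a. I a (Z a)" "\<And>a. S (Z a) (Z (Suc a))" by blast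
  define r where "r a = fst (Z a)" for a
  define \<gamma> where "\<gamma> a = fst (snd (Z a))" for a
  define K where "K a = snd (snd (Z a))" for a
  have Zeq: "Z a = (r a, \<gamma> a, K a)" for a by (simp add: r_def \<gamma>_def K_def)
  have Z0: "r 0 = r0" "\<gamma> 0 = \<gamma>0" "K 0 = K0" using Z(1)[of 0] by (simp_all add: I_def Zeq)
  have "\<forall>a. \<exists>h. h \<in> lin_hom ?D (free_module n (r (Suc a))) (free_module n (r a)) \<and> h ` symbols n (r (Suc a)) = K a \<and>
      K (Suc a) = {v \<in> symbols n (r (Suc a)). h v = 0} \<and>
      (\<forall>I. \<forall>v \<in> symbols n (r (Suc a)). h (cut n (\<gamma> (Suc a)) I v) = cut n (\<gamma> a) I (h v))"
  proof
    fix a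
    show "\<exists>h. h \<in> lin_hom ?D (free_module n (r (Suc a))) (free_module n (r a)) \<and> h ` symbols n (r (Suc a)) = K a \<and>
      K (Suc a) = {v \<in> symbols n (r (Suc a)). h v = 0} \<and>
      (\<forall>I. \<forall>v \<in> symbols n (r (Suc a)). h (cut n (\<gamma> (Suc a)) I v) = cut n (\<gamma> a) I (h v))"
      using Z(2)[of a] unfolding S_def Zeq prod.case by blast
  qed
  from choice[OF this] obtain \<delta> where \<delta>: "\<And>a. \<delta> a \<in> lin_hom ?D (free_module n (r (Suc a))) (free_module n (r a))"
    "\<And>a. \<delta> a ` symbols n (r (Suc a)) = K a" "\<And>a. K (Suc a) = {v \<in> symbols n (r (Suc a)). \<delta> a v = 0}"
    "\<And>a I v. v \<in> symbols n (r (Suc a)) \<Longrightarrow> \<delta> a (cut n (\<gamma> (Suc a)) I v) = cut n (\<gamma> a) I (\<delta> a v)" by blast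
  have "exact_resolution ?D (\<lambda>a. free_module n (r a)) \<delta> \<epsilon> M"
    unfolding exact_resolution_def
    using \<delta>(1) \<delta>(2)[of 0] \<delta>(2)[of "Suc _"] \<delta>(3) \<epsilon>(1,2) graded_moduleD(1)
    by (simp add: Z0 K0_def One_nat_def left_module_free_module)
  then show ?thesis using \<delta>(4) by blast
qed

end

section \<open>Homomorphisms into the module of inverse polynomials\<close>

lemma exp_induct [consumes 1, case_names zero add]:
  assumes "keys p \<subseteq> {1..n::nat}" "P 0"
    and "\<And>p j. keys p \<subseteq> {1..n} \<Longrightarrow> j \<in> {1..n} \<Longrightarrow> P p \<Longrightarrow> P (p + single j (1::nat))"
  shows "P p"
  using assms(1)
proof (induction "\<Sum>j = 1..n. lookup p j" arbitrary: p rule: less_induct)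
  case less
  show ?case
  proof (cases "p = 0")
    case False
    then obtain j where j: "j \<in> keys p" by (metis keys_eq_empty equals0I)
    then have jn: "j \<in> {1..n}" "lookup p j \<noteq> 0" using less.prems by (blast, simp add: in_keys_iff)
    let ?p = "p - single j 1"
    have p: "?p + single j 1 = p" by (rule single_diff_add[OF jn(2)])
    have k: "keys ?p \<subseteq> {1..n}"
    proof
      fix i assume "i \<in> keys ?p"
      then have "i \<in> keys p" by (auto simp: in_keys_iff lookup_minus)
      then show "i \<in> {1..n}" using less.prems by blast
    qed
    have "lookup p i = lookup ?p i + lookup (single j 1) i" for i
      using arg_cong[OF p, of "\<lambda>q. lookup q i"] by (simp add: lookup_add)
    then have "(\<Sum>i = 1..n. lookup p i) = (\<Sum>i = 1..n. lookup ?p i) + (\<Sum>i = 1..n. lookup (single j 1) i)"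
      by (simp only: sum.distrib)
    also have "(\<Sum>i = 1..n. lookup (single j (1::nat)) i) = 1" using jn(1) by (simp add: lookup_single when_def)
    finally have "P ?p" by (intro less.hyps k) simp
    then have "P (?p + single j 1)" by (rule assms(3)[OF k jn(1)])
    then show ?thesis by (simp only: p)
  qed (simp add: assms(2))
qed

lemma mono_add_mult: "single (p + single j 1) 1 * v = var_poly j * (single p (1 :: 'k::field_char_0) * v)"
  by (simp flip: mult.assoc)

lemma mono_mult_symbols: "keys p \<subseteq> {1..n} \<Longrightarrow> v \<in> symbols n r \<Longrightarrow> single p 1 * v \<in> symbols n r"
proof (induction rule: exp_induct)
  case (add p j)
  then show ?case unfolding mono_add_mult by (intro symbols_var) auto
qed simp

lemma cut_mono_mult:
  fixes v :: "'k::field_char_0 mpoly"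
  assumes "keys p \<subseteq> {1..n}"
  shows "cut n \<gamma> I (single p 1 * v) = single p 1 * cut n \<gamma> {l. l + int (\<Sum>j = 1..n. lookup p j) \<in> I} v"
  using assms
proof (induction arbitrary: I rule: exp_induct)
  case (add p j)
  have "int (\<Sum>i = 1..n. lookup (p + single j 1) i) = int (\<Sum>i = 1..n. lookup p i) + 1"
    using add(2) by (simp add: lookup_add sum.distrib lookup_single when_def)
  then show ?case unfolding mono_add_mult using add by (simp add: cut_var add.assoc)
qed simp

lemma lin_hom_gensI:
  fixes A :: "('k::field_char_0 diff_op, 'x) module" and N :: "('k diff_op, 'y) module"
  assumes A: "left_module (diff_op_ring n) A" and N: "left_module (diff_op_ring n) N"
    and cl: "\<And>x. x \<in> carrier A \<Longrightarrow> f x \<in> carrier N"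
    and add: "\<And>x y. x \<in> carrier A \<Longrightarrow> y \<in> carrier A \<Longrightarrow> f (x \<oplus>\<^bsub>A\<^esub> y) = f x \<oplus>\<^bsub>N\<^esub> f y"
    and sc: "\<And>c x. x \<in> carrier A \<Longrightarrow> f (scalar_op n c \<odot>\<^bsub>A\<^esub> x) = scalar_op n c \<odot>\<^bsub>N\<^esub> f x"
    and var: "\<And>j x. j \<in> {1..n} \<Longrightarrow> x \<in> carrier A \<Longrightarrow> f (mult_op n (var_poly j) \<odot>\<^bsub>A\<^esub> x) = mult_op n (var_poly j) \<odot>\<^bsub>N\<^esub> f x"
    and deriv: "\<And>j x. j \<in> {1..n} \<Longrightarrow> x \<in> carrier A \<Longrightarrow> f (partial_op n j \<odot>\<^bsub>A\<^esub> x) = partial_op n j \<odot>\<^bsub>N\<^esub> f x"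
  shows "restrict f (carrier A) \<in> lin_hom (diff_op_ring n) A N"
proof (rule lin_hom_restrict[OF cl add _ A])
  interpret A: left_module "diff_op_ring n :: 'k diff_op ring" A by (rule A)
  interpret N: left_module "diff_op_ring n :: 'k diff_op ring" N by (rule N)
  fix d :: "'k diff_op" and x assume d: "d \<in> carrier (diff_op_ring n)" and x: "x \<in> carrier A"
  from d x show "f (d \<odot>\<^bsub>A\<^esub> x) = d \<odot>\<^bsub>N\<^esub> f x"
  proof (induction arbitrary: x rule: diff_op_induct)
    case (add d e)
    then show ?case using cl assms(4) by (simp add: A.smult_l_distr N.smult_l_distr)
  next
    case (mult d e)
    then show ?case using cl by (simp add: A.smult_assoc1 N.smult_assoc1)
  qed (use sc var deriv in auto)
qed

context
  fixes n :: nat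
begin

abbreviation "EE \<equiv> inverse_poly_module n :: ('k::field_char_0 diff_op, 'k laurent) module"

lemma inverse_module_sel:
  "left_module (diff_op_ring n) EE" "carrier EE = {e. keys e \<subseteq> inverse_exponents n}"
  "\<zero>\<^bsub>EE\<^esub> = 0" "e \<oplus>\<^bsub>EE\<^esub> e' = e + e'"
  using inverse_poly_module[of n] by (auto simp: is_inverse_poly_module_def)

interpretation E: left_module "diff_op_ring n :: 'k::field_char_0 diff_op ring" EE by (rule inverse_module_sel)

lemma inverse_exponents_shift:
  assumes "b \<in> inverse_exponents n" "j \<in> {1..n}"
  shows "b - single j 1 \<in> inverse_exponents n"
    "lookup b j \<noteq> - 1 \<Longrightarrow> b + single j 1 \<in> inverse_exponents n"
proof -
  have k: "i \<in> {1..n}" if "i \<in> keys b" for i using assms(1) that by (auto simp: inverse_exponents_def)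
  have l: "lookup b i \<le> - 1" if "i \<in> {1..n}" for i using assms(1) that by (auto simp: inverse_exponents_def)
  have "i \<in> {1..n}" if "i \<in> keys (b - single j 1)" for i
    using k[of i] assms(2) that by (cases "i = j") (auto simp: in_keys_iff lookup_minus lookup_single)
  moreover have "lookup (b - single j 1) i \<le> - 1" if "i \<in> {1..n}" for i
    using l[OF that] by (auto simp: lookup_minus lookup_single when_def)
  ultimately show "b - single j 1 \<in> inverse_exponents n" by (auto simp: inverse_exponents_def)
  assume ne: "lookup b j \<noteq> - 1"
  have "i \<in> {1..n}" if "i \<in> keys (b + single j 1)" for i
    using k[of i] assms(2) that by (cases "i = j") (auto simp: in_keys_iff lookup_add lookup_single)
  moreover have "lookup (b + single j 1) i \<le> - 1" if "i \<in> {1..n}" for i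
    using l[OF that] l[OF assms(2)] ne by (auto simp: lookup_add lookup_single when_def)
  ultimately show "b + single j 1 \<in> inverse_exponents n" by (auto simp: inverse_exponents_def)
qed

lemma inverse_action_single:
  assumes "a \<in> inverse_exponents n"
  shows "scalar_op n c \<odot>\<^bsub>EE\<^esub> single a d = single a (c * d)"
    "j \<in> {1..n} \<Longrightarrow> mult_op n (var_poly j) \<odot>\<^bsub>EE\<^esub> single a d = (if lookup a j = - 1 then 0 else single (a + single j 1) d)"
    "j \<in> {1..n} \<Longrightarrow> partial_op n j \<odot>\<^bsub>EE\<^esub> single a d = single (a - single j 1) (of_int (lookup a j) * d)"
  using inverse_poly_module[of n] assms unfolding is_inverse_poly_module_def by blast+

text \<open>Both sides are additive, so it suffices to compare them on inverse monomials. Where the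
  exponent of x_j is -1, the factor in the last formula is 0: a derivative has no term there, and in
  particular no residue.\<close>

lemma lookup_inverse_action:
  fixes e :: "'k::field_char_0 laurent"
  assumes e: "e \<in> carrier EE" and b: "b \<in> inverse_exponents n"
  shows "lookup (scalar_op n c \<odot>\<^bsub>EE\<^esub> e) b = c * lookup e b"
    "j \<in> {1..n} \<Longrightarrow> lookup (mult_op n (var_poly j) \<odot>\<^bsub>EE\<^esub> e) b = lookup e (b - single j 1)"
    "j \<in> {1..n} \<Longrightarrow> lookup (partial_op n j \<odot>\<^bsub>EE\<^esub> e) b = of_int (lookup b j + 1) * lookup e (b + single j 1)"
proof -
  have k: "keys e \<subseteq> inverse_exponents n" using e by (simp add: inverse_module_sel)
  have ext: "lookup (d \<odot>\<^bsub>EE\<^esub> e) b = F e"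
    if d: "d \<in> carrier (diff_op_ring n)" and F: "\<And>u w. F (u + w) = F u + F w"
      and s: "\<And>a c. a \<in> inverse_exponents n \<Longrightarrow> lookup (d \<odot>\<^bsub>EE\<^esub> single a c) b = F (single a c)"
    for d :: "'k diff_op" and F :: "'k laurent \<Rightarrow> 'k"
    using k
  proof (induction rule: poly_mapping_add_induct)
    case zero
    have "d \<odot>\<^bsub>EE\<^esub> 0 = 0" using E.smult_zero_r[OF d] by (simp add: inverse_module_sel)
    moreover have "F 0 = 0" using F[of 0 0] by simp
    ultimately show ?case by simp
  next
    case (single m c)
    then show ?case by (rule s)
  next
    case (add u w)
    then show ?case using E.smult_r_distr[OF d, of u w] by (simp add: inverse_module_sel lookup_add F)
  qed
  show "lookup (scalar_op n c \<odot>\<^bsub>EE\<^esub> e) b = c * lookup e b"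
    by (rule ext) (auto simp: lookup_add distrib_left inverse_action_single lookup_single when_def)
  { assume j: "j \<in> {1..n}"
    have l: "lookup b j \<le> - 1" using b j by (auto simp: inverse_exponents_def)
    show "lookup (mult_op n (var_poly j) \<odot>\<^bsub>EE\<^esub> e) b = lookup e (b - single j 1)"
    proof (rule ext)
      fix a :: "nat \<Rightarrow>\<^sub>0 int" and c :: 'k assume a: "a \<in> inverse_exponents n"
      have eq: "a + single j 1 = b \<longleftrightarrow> a = b - single j 1" by (auto simp: algebra_simps)
      have "a \<noteq> b - single j 1" if "lookup a j = - 1"
        using that l by (auto simp: lookup_minus lookup_single)
      then show "lookup (mult_op n (var_poly j) \<odot>\<^bsub>EE\<^esub> single a c) b = lookup (single a c) (b - single j 1)"
        unfolding inverse_action_single(2)[OF a j] using eq by (auto simp: lookup_single when_def)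
    qed (use j in \<open>auto simp: lookup_add\<close>)
    show "lookup (partial_op n j \<odot>\<^bsub>EE\<^esub> e) b = of_int (lookup b j + 1) * lookup e (b + single j 1)"
    proof (rule ext)
      fix a :: "nat \<Rightarrow>\<^sub>0 int" and c :: 'k assume a: "a \<in> inverse_exponents n"
      have eq: "a - single j 1 = b \<longleftrightarrow> a = b + single j 1" by (auto simp: algebra_simps)
      show "lookup (partial_op n j \<odot>\<^bsub>EE\<^esub> single a c) b = of_int (lookup b j + 1) * lookup (single a c) (b + single j 1)"
        unfolding inverse_action_single(3)[OF a j] using eq by (auto simp: lookup_single when_def lookup_add)
    qed (use j in \<open>auto simp: lookup_add distrib_left\<close>) }
qed

lemma inverse_eqI:
  assumes "e \<in> carrier EE" "e' \<in> carrier EE" "\<And>b. b \<in> inverse_exponents n \<Longrightarrow> lookup e b = lookup e' b"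
  shows "e = e'"
proof (rule poly_mapping_eqI)
  fix b
  show "lookup e b = lookup e' b"
  proof (cases "b \<in> inverse_exponents n")
    case False
    then have "b \<notin> keys e" "b \<notin> keys e'" using assms(1,2) by (auto simp: inverse_module_sel)
    then show ?thesis by (simp add: in_keys_iff)
  qed (rule assms(3))
qed

section \<open>Residues\<close>

definition top_exp :: "nat \<Rightarrow>\<^sub>0 int" where
  "top_exp = (\<Sum>j = 1..n. single j (- 1))"

definition residue :: "'k::field_char_0 laurent \<Rightarrow> 'k" where
  "residue e = lookup e top_exp"

text \<open>For an inverse exponent \<open>b\<close> this is the exponent p of the monomial
  \<open>x^p\<close> that moves the inverse monomial at \<open>b\<close> to the one with all
  exponents -1.\<close>

definition dual_exp :: "(nat \<Rightarrow>\<^sub>0 int) \<Rightarrow> (nat \<Rightarrow>\<^sub>0 nat)" where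
  "dual_exp b = (\<Sum>j = 1..n. single j (nat (- lookup b j - 1)))"

lemma lookup_top_exp: "lookup top_exp j = (if j \<in> {1..n} then - 1 else 0)"
  by (simp add: top_exp_def lookup_sum lookup_single when_def)

lemma lookup_dual_exp: "lookup (dual_exp b) j = (if j \<in> {1..n} then nat (- lookup b j - 1) else 0)"
  by (simp add: dual_exp_def lookup_sum lookup_single when_def)

lemma keys_dual_exp: "keys (dual_exp b) \<subseteq> {1..n}"
  by (rule subsetI) (simp add: in_keys_iff lookup_dual_exp split: if_splits)

lemma top_exp_inverse: "top_exp \<in> inverse_exponents n"
proof -
  have "keys top_exp \<subseteq> {1..n}" by (rule subsetI) (simp add: in_keys_iff lookup_top_exp split: if_splits)
  then show ?thesis by (simp add: inverse_exponents_def lookup_top_exp)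
qed

lemma top_exp_minus_dual_exp: "b \<in> inverse_exponents n \<Longrightarrow> top_exp - int_exp (dual_exp b) = b"
proof (rule poly_mapping_eqI)
  fix j assume b: "b \<in> inverse_exponents n"
  show "lookup (top_exp - int_exp (dual_exp b)) j = lookup b j"
  proof (cases "j \<in> {1..n}")
    case True
    then have "lookup b j \<le> - 1" using b by (auto simp: inverse_exponents_def)
    then show ?thesis using True by (simp add: lookup_minus lookup_top_exp lookup_dual_exp)
  next
    case False
    then have "j \<notin> keys b" using b by (auto simp: inverse_exponents_def)
    then show ?thesis using False by (simp add: lookup_minus lookup_top_exp lookup_dual_exp in_keys_iff)
  qed
qed

lemma residue_mono:
  fixes \<phi> :: "'k::field_char_0 mpoly \<Rightarrow> 'k laurent"
  assumes \<phi>: "\<phi> \<in> lin_hom (diff_op_ring n) (free_module n r) EE" and v: "v \<in> symbols n r"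
    and p: "keys p \<subseteq> {1..n}" and b: "b \<in> inverse_exponents n"
  shows "lookup (\<phi> (single p 1 * v)) b = lookup (\<phi> v) (b - int_exp p)"
  using p b
proof (induction arbitrary: b rule: exp_induct)
  case zero
  have "int_exp 0 = 0" by (rule poly_mapping_eqI) simp
  then show ?case by simp
next
  case (add p j)
  note h = free_hom[OF inverse_module_sel(1) \<phi>]
  have s: "single p 1 * v \<in> symbols n r" by (rule mono_mult_symbols[OF add(1) v])
  have "lookup (\<phi> (single (p + single j 1) 1 * v)) b = lookup (\<phi> (single p 1 * v)) (b - single j 1)"
    unfolding mono_add_mult h(3)[OF add(2) s] using add by (intro lookup_inverse_action h(6) s)
  also have "\<dots> = lookup (\<phi> v) (b - single j 1 - int_exp p)"
    using add.IH inverse_exponents_shift(1)[OF add.prems add(2)] by simp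
  also have "b - single j 1 - int_exp p = b - int_exp (p + single j 1)"
    by (rule poly_mapping_eqI) (simp add: lookup_minus lookup_add lookup_single when_def)
  finally show ?case .
qed

text \<open>Multiplication by a monomial moves any coefficient to the residue position, and \<phi>
  is linear over polynomials. So the residues of \<phi> determine all its coefficients.\<close>

lemma lookup_hom_residue:
  fixes \<phi> :: "'k::field_char_0 mpoly \<Rightarrow> 'k laurent"
  assumes \<phi>: "\<phi> \<in> lin_hom (diff_op_ring n) (free_module n r) EE" and v: "v \<in> symbols n r"
    and b: "b \<in> inverse_exponents n"
  shows "lookup (\<phi> v) b = residue (\<phi> (single (dual_exp b) 1 * v))"
  using residue_mono[OF \<phi> v keys_dual_exp top_exp_inverse, of b] top_exp_minus_dual_exp[OF b]
  by (simp add: residue_def)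

lemma hom_eq_residue:
  fixes \<phi> :: "'k::field_char_0 mpoly \<Rightarrow> 'k laurent"
  assumes \<phi>: "\<phi> \<in> lin_hom (diff_op_ring n) (free_module n r) EE" and \<psi>: "\<psi> \<in> lin_hom (diff_op_ring n) (free_module n r) EE"
    and eq: "\<And>v. v \<in> symbols n r \<Longrightarrow> residue (\<phi> v) = residue (\<psi> v)"
  shows "\<phi> = \<psi>"
proof (rule lin_hom_eqI[OF \<phi> \<psi>])
  fix v assume "v \<in> carrier (free_module n r :: ('k diff_op, 'k mpoly) module)"
  then have v: "v \<in> symbols n r" by simp
  show "\<phi> v = \<psi> v"
    using free_hom(6)[OF inverse_module_sel(1) \<phi> v] free_hom(6)[OF inverse_module_sel(1) \<psi> v]
    by (rule inverse_eqI)
       (simp add: lookup_hom_residue[OF \<phi> v] lookup_hom_residue[OF \<psi> v] eq mono_mult_symbols[OF keys_dual_exp v])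
qed

text \<open>The functionals \<open>residue \<circ> \<phi>\<close> for \<open>\<phi>\<close> in \<open>Hom\<^sub>D(Q, E)\<close>, with \<open>Q\<close> free on homogeneous generators
  of degrees \<open>\<gamma>\<close>: those that vanish on derivatives and in large degrees.\<close>

definition admissible :: "nat \<Rightarrow> (nat \<Rightarrow> int) \<Rightarrow> ('k::field_char_0 mpoly \<Rightarrow> 'k) \<Rightarrow> bool" where
  "admissible r \<gamma> \<mu> \<longleftrightarrow>
     (\<forall>v \<in> symbols n r. \<forall>w \<in> symbols n r. \<mu> (v + w) = \<mu> v + \<mu> w) \<and>
     (\<forall>c. \<forall>v \<in> symbols n r. \<mu> (const_poly c * v) = c * \<mu> v) \<and>
     (\<forall>j \<in> {1..n}. \<forall>v \<in> symbols n r. \<mu> (sym_deriv n j v) = 0) \<and>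
     (\<exists>N. \<forall>v \<in> symbols n r. \<mu> v = \<mu> (cut n \<gamma> {..<N} v))"

lemma residue_add: "residue (e + e') = residue e + residue e'"
  by (simp add: residue_def lookup_add)

lemma residue_scalar: "e \<in> carrier EE \<Longrightarrow> residue (scalar_op n c \<odot>\<^bsub>EE\<^esub> e) = c * residue e"
  by (simp add: residue_def lookup_inverse_action(1) top_exp_inverse)

text \<open>On the finitely many generators the values of \<phi> have finitely many terms, so \<phi>
  lowers degrees there by at most some \<open>C\<close>. Variables and derivatives shift the degree
  in source and target by the same amount, so the bound persists on all monomials.\<close>

lemma hom_degree_bound:
  fixes \<phi> :: "'k::field_char_0 mpoly \<Rightarrow> 'k laurent"
  assumes \<phi>: "\<phi> \<in> lin_hom (diff_op_ring n) (free_module n r) EE"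
  shows "\<exists>C. \<forall>m \<in> symbol_exps n r. \<forall>b \<in> keys (\<phi> (single m 1)). gdeg n \<gamma> m - C \<le> (\<Sum>j = 1..n. lookup b j)"
proof -
  note h = free_hom[OF inverse_module_sel(1) \<phi>]
  let ?s = "\<lambda>b. (\<Sum>j = 1..n. lookup b j) :: int"
  let ?T = "\<Union>s \<in> {..<r}. (\<lambda>b. \<gamma> s - ?s b) ` keys (\<phi> (gen_symbol n s))"
  have "finite ?T" by simp
  then obtain C where C: "\<And>x. x \<in> ?T \<Longrightarrow> x \<le> C" using bdd_above_finite[of ?T] by (auto simp: bdd_above_def)
  have in_E: "\<phi> (single m 1) \<in> carrier EE" if "m \<in> symbol_exps n r" for m
    using that by (intro h(6)) (simp add: symbols_single)
  have inv: "b \<in> inverse_exponents n" if "e \<in> carrier EE" "b \<in> keys e" for b and e :: "'k laurent"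
    using that by (auto simp: inverse_module_sel)
  have add_j: "?s (b + single j 1) = ?s b + 1" "?s (b - single j 1) = ?s b - 1" if "j \<in> {1..n}" for b j
    using that by (simp_all add: lookup_add lookup_minus sum.distrib sum_subtractf lookup_single when_def)
  have "\<forall>b \<in> keys (\<phi> (single m 1)). gdeg n \<gamma> m - C \<le> ?s b" if "m \<in> symbol_exps n r" for m
    using that
  proof (induction rule: symbol_mono_induct)
    case (gen s)
    show ?case
    proof
      fix b assume "b \<in> keys (\<phi> (single (single (2 * n + 1) s) 1))"
      then have "\<gamma> s - ?s b \<in> ?T" using gen by (auto simp: gen_symbol_def)
      then have "\<gamma> s - ?s b \<le> C" by (rule C)
      then show "gdeg n \<gamma> (single (2 * n + 1) s) - C \<le> ?s b" by (simp add: gdeg_gen)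
    qed
  next
    case (var m j)
    have s: "single m (1 :: 'k) \<in> symbols n r" using var(1) by (rule symbols_single)
    have eq: "\<phi> (single (m + single j 1) 1) = mult_op n (var_poly j) \<odot>\<^bsub>EE\<^esub> \<phi> (single m 1)"
      using h(3)[OF var(2) s] by simp
    show ?case
    proof
      fix b assume b: "b \<in> keys (\<phi> (single (m + single j 1) 1))"
      have "\<phi> (single (m + single j 1) 1) \<in> carrier EE"
        unfolding eq using var(2) in_E[OF var(1)] by (intro E.smult_closed) auto
      then have bi: "b \<in> inverse_exponents n" using b by (rule inv)
      have "b - single j 1 \<in> keys (\<phi> (single m 1))"
        using b lookup_inverse_action(2)[OF in_E[OF var(1)] bi var(2)] by (simp add: eq in_keys_iff)
      then have "gdeg n \<gamma> m - C \<le> ?s (b - single j 1)" using var(3) by blast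
      then show "gdeg n \<gamma> (m + single j 1) - C \<le> ?s b"
        using var(2) by (simp add: add_j gdeg_add_single)
    qed
  next
    case (deriv m j)
    have j2: "j \<in> {1..2 * n}" using deriv(2) by auto
    note eq = free_hom_deriv_mono[OF inverse_module_sel(1) \<phi> deriv(1,2)]
    let ?e1 = "\<phi> (single m 1)" and ?e2 = "\<phi> (single (m - single j 1) 1)"
    have e: "?e1 \<in> carrier EE" "?e2 \<in> carrier EE"
      using in_E deriv(1) symbol_exps_diff_single[OF deriv(1) j2] by auto
    show ?case
    proof
      fix b assume b: "b \<in> keys (\<phi> (single (m + single (n + j) 1) 1))"
      have "\<phi> (single (m + single (n + j) 1) 1) \<in> carrier EE"
        unfolding eq using deriv(2) e by (intro E.a_closed E.smult_closed) auto
      then have bi: "b \<in> inverse_exponents n" using b by (rule inv)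
      have "lookup (\<phi> (single (m + single (n + j) 1) 1)) b =
          of_int (lookup b j + 1) * lookup ?e1 (b + single j 1) - of_nat (lookup m j) * lookup ?e2 b"
        unfolding eq inverse_module_sel(4)
        by (simp only: lookup_add lookup_inverse_action(1)[OF e(2) bi] lookup_inverse_action(3)[OF e(1) bi deriv(2)]) simp
      then have "b + single j 1 \<in> keys ?e1 \<or> (lookup m j \<noteq> 0 \<and> b \<in> keys ?e2)"
        using b by (auto simp: in_keys_iff)
      then show "gdeg n \<gamma> (m + single (n + j) 1) - C \<le> ?s b"
      proof
        assume "b + single j 1 \<in> keys ?e1"
        then have "gdeg n \<gamma> m - C \<le> ?s (b + single j 1)" using deriv(3) by blast
        then show ?thesis using deriv(2) by (simp add: add_j gdeg_add_single)
      next
        assume a: "lookup m j \<noteq> 0 \<and> b \<in> keys ?e2"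
        then have "gdeg n \<gamma> (m - single j 1) - C \<le> ?s b" using deriv(4) by blast
        then show ?thesis using deriv(2) a by (simp add: gdeg_diff_single gdeg_add_single)
      qed
    qed
  qed
  then show ?thesis by blast
qed

lemma residue_admissible:
  fixes \<phi> :: "'k::field_char_0 mpoly \<Rightarrow> 'k laurent"
  assumes \<phi>: "\<phi> \<in> lin_hom (diff_op_ring n) (free_module n r) EE"
  shows "admissible r \<gamma> (\<lambda>v. residue (\<phi> v))"
proof -
  note h = free_hom[OF inverse_module_sel(1) \<phi>]
  obtain C where C: "\<And>m b. m \<in> symbol_exps n r \<Longrightarrow> b \<in> keys (\<phi> (single m 1)) \<Longrightarrow> gdeg n \<gamma> m - C \<le> (\<Sum>j = 1..n. lookup b j)"
    using hom_degree_bound[OF \<phi>] by blast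
  \<comment> \<open>The residue sits in degree -n, so by the bound it can be nonzero only on
    monomials of degree at most \<open>C - n\<close>.\<close>
  define N where "N = C - int n + 1"
  have add: "residue (\<phi> (v + w)) = residue (\<phi> v) + residue (\<phi> w)" if "v \<in> symbols n r" "w \<in> symbols n r" for v w
    using that h(1) by (simp add: inverse_module_sel residue_add)
  have sc: "residue (\<phi> (const_poly c * v)) = c * residue (\<phi> v)" if "v \<in> symbols n r" for v c
    using that h(2,6) by (simp add: residue_scalar)
  have zero: "residue (\<phi> 0) = 0" using h(5) by (simp add: inverse_module_sel residue_def)
  have "residue (\<phi> (sym_deriv n j v)) = 0" if "j \<in> {1..n}" "v \<in> symbols n r" for j v
    using that h(4,6) lookup_inverse_action(3)[OF _ top_exp_inverse that(1), of "\<phi> v"]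
    by (simp add: residue_def lookup_top_exp)
  moreover have "residue (\<phi> v) = residue (\<phi> (cut n \<gamma> {..<N} v))" if "v \<in> symbols n r" for v
  proof -
    have "keys v \<subseteq> symbol_exps n r" using that by (simp add: symbols_def)
    then show ?thesis
    proof (induction rule: poly_mapping_add_induct)
      case (single m c)
      show ?case
      proof (cases "gdeg n \<gamma> m < N")
        case False
        have s: "single m (1 :: 'k) \<in> symbols n r" using single by (rule symbols_single)
        have "top_exp \<notin> keys (\<phi> (single m 1))"
        proof
          assume "top_exp \<in> keys (\<phi> (single m 1))"
          then have "gdeg n \<gamma> m - C \<le> (\<Sum>j = 1..n. lookup top_exp j)" by (rule C[OF single])
          then show False using False by (simp add: lookup_top_exp N_def)
        qed
        then have "residue (\<phi> (single m 1)) = 0" by (simp add: residue_def in_keys_iff)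
        then have "residue (\<phi> (single m c)) = 0" using sc[OF s, of c] by simp
        then show ?thesis using False zero by (simp add: cut_single)
      qed (simp add: cut_single)
    next
      case (add u w)
      then have "u \<in> symbols n r" "w \<in> symbols n r" by (simp_all add: symbols_def)
      then show ?case using add \<open>\<And>v w. v \<in> symbols n r \<Longrightarrow> w \<in> symbols n r \<Longrightarrow> residue (\<phi> (v + w)) = residue (\<phi> v) + residue (\<phi> w)\<close>
        by (simp add: cut_add)
    qed (simp)
  qed
  ultimately show ?thesis unfolding admissible_def using add sc by blast
qed

lemma finite_dual_exp_bounded: "finite {b \<in> inverse_exponents n. int (\<Sum>j = 1..n. lookup (dual_exp b) j) < B}"
proof (rule finite_subset)
  let ?g = "\<lambda>f. \<Sum>j = 1..n. single j (- int (f j) - 1)"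
  show "{b \<in> inverse_exponents n. int (\<Sum>j = 1..n. lookup (dual_exp b) j) < B} \<subseteq> ?g ` ({1..n} \<rightarrow>\<^sub>E {..nat B})"
  proof
    fix b assume "b \<in> {b \<in> inverse_exponents n. int (\<Sum>j = 1..n. lookup (dual_exp b) j) < B}"
    then have b: "b \<in> inverse_exponents n" "int (\<Sum>j = 1..n. lookup (dual_exp b) j) < B" by auto
    have "lookup (dual_exp b) j \<le> nat B" if "j \<in> {1..n}" for j
    proof -
      have "lookup (dual_exp b) j \<le> (\<Sum>j = 1..n. lookup (dual_exp b) j)" using that by (intro member_le_sum) auto
      then show ?thesis using b(2) by linarith
    qed
    moreover have "b = ?g (restrict (lookup (dual_exp b)) {1..n})"
    proof (rule poly_mapping_eqI)
      fix i
      show "lookup b i = lookup (?g (restrict (lookup (dual_exp b)) {1..n})) i"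
      proof (cases "i \<in> {1..n}")
        case True
        then have "lookup b i \<le> - 1" using b(1) by (auto simp: inverse_exponents_def)
        then show ?thesis using True by (simp add: lookup_sum lookup_single when_def lookup_dual_exp)
      next
        case False
        then have "i \<notin> keys b" using b(1) by (auto simp: inverse_exponents_def)
        then show ?thesis using False by (simp add: lookup_sum lookup_single when_def in_keys_iff)
      qed
    qed
    ultimately show "b \<in> ?g ` ({1..n} \<rightarrow>\<^sub>E {..nat B})"
      by (intro image_eqI[where x = "restrict (lookup (dual_exp b)) {1..n}"]) auto
  qed
qed (intro finite_imageI finite_PiE; simp)

lemma dual_exp_shift:
  assumes "b \<in> inverse_exponents n" "j \<in> {1..n}"
  shows "dual_exp (b - single j 1) = dual_exp b + single j 1"
proof (rule poly_mapping_eqI)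
  fix i
  have "lookup b j \<le> - 1" using assms by (auto simp: inverse_exponents_def)
  then show "lookup (dual_exp (b - single j 1)) i = lookup (dual_exp b + single j 1) i"
    using assms(2) by (auto simp: lookup_dual_exp lookup_add lookup_minus lookup_single when_def)
qed

lemma mono_sym_deriv:
  fixes v :: "'k::field_char_0 mpoly"
  assumes p: "keys p \<subseteq> {1..n}" and j: "j \<in> {1..n}"
  shows "single p 1 * sym_deriv n j v =
    sym_deriv n j (single p 1 * v) - const_poly (of_nat (lookup p j)) * (single (p - single j 1) 1 * v)"
proof -
  have e: "partial_deriv j (single p (1 :: 'k)) = const_poly (of_nat (lookup p j)) * single (p - single j 1) 1"
    by simp
  show ?thesis
    unfolding sym_deriv_def partial_deriv_mult e
    by (simp only: distrib_left mult.assoc mult.left_commute[of "single p 1" "var_poly (n + j)"]) simp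
qed

text \<open>The coefficient of \<phi>(v) at \<open>b\<close> must be the value of \<mu> on
  \<open>x^p v\<close> for the dual exponent p, by \<open>lookup_hom_residue\<close>. Vanishing of
  \<mu> in large degrees makes this a finite sum, and vanishing on derivatives makes \<phi> commute
  with the derivatives.\<close>

lemma admissible_hom:
  fixes \<mu> :: "'k::field_char_0 mpoly \<Rightarrow> 'k"
  assumes adm: "admissible r \<gamma> \<mu>"
  shows "\<exists>\<phi> \<in> lin_hom (diff_op_ring n) (free_module n r) EE. \<forall>v \<in> symbols n r. residue (\<phi> v) = \<mu> v"
proof -
  have add: "\<mu> (v + w) = \<mu> v + \<mu> w" if "v \<in> symbols n r" "w \<in> symbols n r" for v w
    using adm that unfolding admissible_def by blast
  have sc: "\<mu> (const_poly c * v) = c * \<mu> v" if "v \<in> symbols n r" for v c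
    using adm that unfolding admissible_def by blast
  have der: "\<mu> (sym_deriv n j v) = 0" if "j \<in> {1..n}" "v \<in> symbols n r" for v j
    using adm that unfolding admissible_def by blast
  obtain N where N: "\<And>v. v \<in> symbols n r \<Longrightarrow> \<mu> v = \<mu> (cut n \<gamma> {..<N} v)"
    using adm unfolding admissible_def by blast
  have zero: "\<mu> 0 = 0" using add[of 0 0] by simp
  let ?c = "\<lambda>v b. if b \<in> inverse_exponents n then \<mu> (single (dual_exp b) 1 * v) else 0"
  define \<phi> where "\<phi> v = Abs_poly_mapping (?c v)" for v
  have fin: "finite {b. ?c v b \<noteq> 0}" if v: "v \<in> symbols n r" for v
  proof -
    have "finite (gdeg n \<gamma> ` keys v)" by simp
    then obtain d where d: "\<And>m. m \<in> keys v \<Longrightarrow> d \<le> gdeg n \<gamma> m"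
      using bdd_below_finite[of "gdeg n \<gamma> ` keys v"] by (auto simp: bdd_below_def)
    \<comment> \<open>All degrees in \<open>v\<close> are at least \<open>d\<close>, so
      multiplication by a monomial of degree \<open>N - d\<close> or more leaves nothing below
      \<open>N\<close>, where \<mu> is supported.\<close>
    have "int (\<Sum>j = 1..n. lookup (dual_exp b) j) < N - d" if b: "?c v b \<noteq> 0" for b
    proof (rule ccontr)
      let ?l = "int (\<Sum>j = 1..n. lookup (dual_exp b) j)"
      assume l: "\<not> ?l < N - d"
      have "cut n \<gamma> {l. l + ?l \<in> {..<N}} v = 0"
        by (rule poly_mapping_eqI) (use d l in \<open>force simp: lookup_cut in_keys_iff\<close>)
      then have "cut n \<gamma> {..<N} (single (dual_exp b) 1 * v) = 0"
        by (simp only: cut_mono_mult[OF keys_dual_exp]) simp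
      then have "\<mu> (single (dual_exp b) 1 * v) = 0"
        using N[OF mono_mult_symbols[OF keys_dual_exp v]] zero by simp
      then have "?c v b = 0" by (simp only: if_cancel)
      then show False using b by contradiction
    qed
    then have "{b. ?c v b \<noteq> 0} \<subseteq> {b \<in> inverse_exponents n. int (\<Sum>j = 1..n. lookup (dual_exp b) j) < N - d}"
      by (auto split: if_splits)
    then show ?thesis using finite_dual_exp_bounded by (rule finite_subset)
  qed
  have lk: "lookup (\<phi> v) b = ?c v b" if "v \<in> symbols n r" for v b
    unfolding \<phi>_def using fin[OF that] by (subst Abs_poly_mapping_inverse) auto
  have cl: "\<phi> v \<in> carrier EE" if "v \<in> symbols n r" for v
    using lk[OF that] by (auto simp: inverse_module_sel in_keys_iff split: if_splits)
  note xs = mono_mult_symbols[OF keys_dual_exp]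
  have "restrict \<phi> (carrier (free_module n r)) \<in> lin_hom (diff_op_ring n) (free_module n r) EE"
  proof (rule lin_hom_gensI[OF left_module_free_module inverse_module_sel(1)])
    fix v w :: "'k mpoly" assume v': "v \<in> carrier (free_module n r)"
    then have v: "v \<in> symbols n r" by simp
    show "\<phi> v \<in> carrier EE" by (rule cl[OF v])
    show "\<phi> (v \<oplus>\<^bsub>free_module n r\<^esub> w) = \<phi> v \<oplus>\<^bsub>EE\<^esub> \<phi> w" if "w \<in> carrier (free_module n r)"
      using v that add[OF xs xs]
      by (intro poly_mapping_eqI) (simp add: inverse_module_sel lookup_add lk distrib_left)
    show "\<phi> (scalar_op n c \<odot>\<^bsub>free_module n r\<^esub> v) = scalar_op n c \<odot>\<^bsub>EE\<^esub> \<phi> v" for c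
    proof (rule inverse_eqI)
      show "\<phi> (scalar_op n c \<odot>\<^bsub>free_module n r\<^esub> v) \<in> carrier EE" using v by (simp add: sym_action_gens cl)
      show "scalar_op n c \<odot>\<^bsub>EE\<^esub> \<phi> v \<in> carrier EE" using cl[OF v] by simp
      fix b assume b: "b \<in> inverse_exponents n"
      have "\<mu> (single (dual_exp b) 1 * (const_poly c * v)) = c * \<mu> (single (dual_exp b) 1 * v)"
        using sc[OF xs[OF v]] by (simp only: mult.left_commute)
      then show "lookup (\<phi> (scalar_op n c \<odot>\<^bsub>free_module n r\<^esub> v)) b = lookup (scalar_op n c \<odot>\<^bsub>EE\<^esub> \<phi> v) b"
        using v b by (simp add: sym_action_gens lk lookup_inverse_action(1)[OF cl[OF v] b])
    qed
    fix j assume j: "j \<in> {1..n}"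
    show "\<phi> (mult_op n (var_poly j) \<odot>\<^bsub>free_module n r\<^esub> v) = mult_op n (var_poly j) \<odot>\<^bsub>EE\<^esub> \<phi> v"
    proof (rule inverse_eqI)
      show "\<phi> (mult_op n (var_poly j) \<odot>\<^bsub>free_module n r\<^esub> v) \<in> carrier EE"
        unfolding free_module_sel sym_action_gens(2)[OF v j] by (rule cl[OF symbols_var[OF j v]])
      show "mult_op n (var_poly j) \<odot>\<^bsub>EE\<^esub> \<phi> v \<in> carrier EE" using cl[OF v] j by (intro E.smult_closed) auto
      fix b assume b: "b \<in> inverse_exponents n"
      have shift: "single (dual_exp b) 1 * (var_poly j * v) = single (dual_exp (b - single j 1)) 1 * v"
        unfolding dual_exp_shift[OF b j] mono_add_mult by (simp only: mult.left_commute)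
      show "lookup (\<phi> (mult_op n (var_poly j) \<odot>\<^bsub>free_module n r\<^esub> v)) b = lookup (mult_op n (var_poly j) \<odot>\<^bsub>EE\<^esub> \<phi> v) b"
        unfolding free_module_sel sym_action_gens(2)[OF v j] lookup_inverse_action(2)[OF cl[OF v] b j]
        by (simp only: lk[OF symbols_var[OF j v]] lk[OF v] if_P[OF b] if_P[OF inverse_exponents_shift(1)[OF b j]] shift)
    qed
    show "\<phi> (partial_op n j \<odot>\<^bsub>free_module n r\<^esub> v) = partial_op n j \<odot>\<^bsub>EE\<^esub> \<phi> v"
    proof (rule inverse_eqI)
      show "\<phi> (partial_op n j \<odot>\<^bsub>free_module n r\<^esub> v) \<in> carrier EE"
        unfolding free_module_sel sym_action_gens(3)[OF v j] by (rule cl[OF symbols_sym_deriv[OF j v]])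
      show "partial_op n j \<odot>\<^bsub>EE\<^esub> \<phi> v \<in> carrier EE" using cl[OF v] j by (intro E.smult_closed) auto
      fix b assume b: "b \<in> inverse_exponents n"
      have bj: "lookup b j \<le> - 1" using b j by (auto simp: inverse_exponents_def)
      let ?p = "dual_exp b"
      have kp: "keys (?p - single j 1) \<subseteq> {1..n}"
        using keys_dual_exp[of b] by (auto simp: in_keys_iff lookup_minus subset_iff)
      have u: "single (?p - single j 1) 1 * v \<in> symbols n r" by (rule mono_mult_symbols[OF kp v])
      \<comment> \<open>Integration by parts: commuting \<open>x^p\<close> past the derivative
        leaves a derivative, on which \<mu> vanishes, and -p_j times a term with lower exponent.
        Here -p_j is \<open>lookup b j + 1\<close>, the factor in the action on
        \<open>E\<close>.\<close>
      have "\<mu> (single ?p 1 * sym_deriv n j v) =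
          \<mu> (sym_deriv n j (single ?p 1 * v) + const_poly (- of_nat (lookup ?p j)) * (single (?p - single j 1) 1 * v))"
        unfolding mono_sym_deriv[OF keys_dual_exp j] by (simp add: const_poly_uminus)
      also have "\<dots> = - of_nat (lookup ?p j) * \<mu> (single (?p - single j 1) 1 * v)"
        by (simp only: add[OF symbols_sym_deriv[OF j xs[OF v]] symbols_const[OF u]] der[OF j xs[OF v]] sc[OF u]) simp
      also have "- of_nat (lookup ?p j) = (of_int (lookup b j + 1) :: 'k)"
      proof -
        have "int (lookup ?p j) = - (lookup b j + 1)" using bj j by (simp add: lookup_dual_exp)
        then have "(of_int (int (lookup ?p j)) :: 'k) = of_int (- (lookup b j + 1))" by simp
        then show ?thesis by (simp only: of_int_of_nat_eq of_int_minus minus_minus)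
      qed
      finally have 1: "lookup (\<phi> (sym_deriv n j v)) b = of_int (lookup b j + 1) * \<mu> (single (?p - single j 1) 1 * v)"
        using b by (simp only: lk[OF symbols_sym_deriv[OF j v]] if_True)
      show "lookup (\<phi> (partial_op n j \<odot>\<^bsub>free_module n r\<^esub> v)) b = lookup (partial_op n j \<odot>\<^bsub>EE\<^esub> \<phi> v) b"
        unfolding free_module_sel sym_action_gens(3)[OF v j] lookup_inverse_action(3)[OF cl[OF v] b j] 1
      \<comment> \<open>At exponent -1 the factor is 0 on both sides; otherwise
        \<open>b + single j 1\<close> is still an inverse exponent, whose dual exponent is
        \<open>?p\<close> lowered by one at \<open>j\<close>.\<close>
      proof (cases "lookup b j = - 1")
        case False
        have bi: "b + single j 1 \<in> inverse_exponents n" by (rule inverse_exponents_shift(2)[OF b j False])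
        have "?p = dual_exp (b + single j 1) + single j 1" using dual_exp_shift[OF bi j] by simp
        then have "?p - single j 1 = dual_exp (b + single j 1)" by simp
        then show "of_int (lookup b j + 1) * \<mu> (single (?p - single j 1) 1 * v) = of_int (lookup b j + 1) * lookup (\<phi> v) (b + single j 1)"
          using bi by (simp add: lk[OF v])
      qed simp
    qed
  qed
  moreover have "residue (restrict \<phi> (carrier (free_module n r)) v) = \<mu> v" if "v \<in> symbols n r" for v
  proof -
    have "dual_exp top_exp = 0" by (rule poly_mapping_eqI) (simp add: lookup_dual_exp lookup_top_exp)
    then show ?thesis using that by (simp add: residue_def lk top_exp_inverse)
  qed
  ultimately show ?thesis by blast
qed

end

section \<open>The zigzag between a module and its resolution\<close>

lemma left_module_minus:
  assumes "left_module R N" "x \<in> carrier N" "y \<in> carrier N"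
  shows "x \<ominus>\<^bsub>N\<^esub> y = \<zero>\<^bsub>N\<^esub> \<longleftrightarrow> x = y" "x = y \<oplus>\<^bsub>N\<^esub> (x \<ominus>\<^bsub>N\<^esub> y)" "x \<oplus>\<^bsub>N\<^esub> y \<ominus>\<^bsub>N\<^esub> y = x"
proof -
  interpret N: left_module R N by fact
  show 2: "x = y \<oplus>\<^bsub>N\<^esub> (x \<ominus>\<^bsub>N\<^esub> y)"
    using assms(2,3) by (simp add: a_minus_def N.a_lcomm N.r_neg)
  show "x \<ominus>\<^bsub>N\<^esub> y = \<zero>\<^bsub>N\<^esub> \<longleftrightarrow> x = y"
  proof
    assume "x \<ominus>\<^bsub>N\<^esub> y = \<zero>\<^bsub>N\<^esub>"
    then show "x = y" using 2 assms(3) by simp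
  qed (use assms in \<open>simp add: a_minus_def N.r_neg\<close>)
  show "x \<oplus>\<^bsub>N\<^esub> y \<ominus>\<^bsub>N\<^esub> y = x" using assms(2,3) by (simp add: a_minus_def N.a_assoc N.r_neg)
qed

text \<open>In the application \<open>a\<close> is the position in the resolution and
  \<open>b\<close> the form degree: rows resolve the forms of \<open>M\<close>, columns are de Rham
  complexes of free modules. The squares commute without signs, because the total complex is never
  formed.\<close>

locale double_complex =
  fixes R :: "('r, 'z) ring_scheme" and C :: "nat \<Rightarrow> int \<Rightarrow> ('r, 'x) module" and Y :: "int \<Rightarrow> ('r, 'y) module"
    and f :: "nat \<Rightarrow> int \<Rightarrow> 'x \<Rightarrow> 'x" and e :: "int \<Rightarrow> 'x \<Rightarrow> 'y"
    and d :: "nat \<Rightarrow> int \<Rightarrow> 'x \<Rightarrow> 'x" and dY :: "int \<Rightarrow> 'y \<Rightarrow> 'y" and top_deg :: int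
  assumes rows: "exact_resolution R (\<lambda>a. C a b) (\<lambda>a. f a b) (e b) (Y b)"
    and d: "d a b \<in> lin_hom R (C a b) (C a (b + 1))" and dY: "dY b \<in> lin_hom R (Y b) (Y (b + 1))"
    and d_f: "x \<in> carrier (C (Suc a) b) \<Longrightarrow> d a b (f a b x) = f a (b + 1) (d (Suc a) b x)"
    and dY_e: "x \<in> carrier (C 0 b) \<Longrightarrow> dY b (e b x) = e (b + 1) (d 0 b x)"
    and d_d: "x \<in> carrier (C a b) \<Longrightarrow> d a (b + 1) (d a b x) = \<zero>\<^bsub>C a (b + 1 + 1)\<^esub>"
    and d_exact: "b + 1 < top_deg \<Longrightarrow> x \<in> carrier (C a (b + 1)) \<Longrightarrow> d a (b + 1) x = \<zero>\<^bsub>C a (b + 1 + 1)\<^esub> \<Longrightarrow>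
      \<exists>y \<in> carrier (C a b). d a b y = x"
begin

lemma C_mod: "left_module R (C a b)" and Y_mod: "left_module R (Y b)"
  using exact_resolutionD(2,1)[OF rows] by blast+

lemma f_hom: "f a b \<in> lin_hom R (C (Suc a) b) (C a b)" and e_hom: "e b \<in> lin_hom R (C 0 b) (Y b)"
  using exact_resolutionD(3,4)[OF rows] by blast+

lemmas fc = lin_hom_closed[OF f_hom] and ec = lin_hom_closed[OF e_hom] and dc = lin_hom_closed[OF d] and dYc = lin_hom_closed[OF dY]
lemmas e_f = exact_resolutionD(6)[OF rows, unfolded One_nat_def] and f_f = exact_resolutionD(7)[OF rows]
lemmas row_lift0 = exact_resolutionD(8)[OF rows] and row_lift = exact_resolutionD(9)[OF rows]
lemmas e_surj = exact_resolutionD(5)[OF rows]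

lemma f_zero: "f a b \<zero>\<^bsub>C (Suc a) b\<^esub> = \<zero>\<^bsub>C a b\<^esub>" and d_zero: "d a b \<zero>\<^bsub>C a b\<^esub> = \<zero>\<^bsub>C a (b + 1)\<^esub>"
  and e_zero: "e b \<zero>\<^bsub>C 0 b\<^esub> = \<zero>\<^bsub>Y b\<^esub>"
  by (rule lin_hom_zero[OF C_mod C_mod f_hom] lin_hom_zero[OF C_mod C_mod d] lin_hom_zero[OF C_mod Y_mod e_hom])+

lemmas f_add = lin_hom_add[OF f_hom] and d_add = lin_hom_add[OF d] and e_add = lin_hom_add[OF e_hom]
lemmas f_minus = lin_hom_minus[OF C_mod C_mod f_hom] and d_minus = lin_hom_minus[OF C_mod C_mod d]
  and e_minus = lin_hom_minus[OF C_mod Y_mod e_hom]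

lemma dY_dY:
  assumes "v \<in> carrier (Y b)"
  shows "dY (b + 1) (dY b v) = \<zero>\<^bsub>Y (b + 1 + 1)\<^esub>"
proof -
  obtain u where "u \<in> carrier (C 0 b)" "e b u = v" using e_surj[OF assms] by blast
  then show ?thesis using dY_e[OF dc] dY_e d_d by (metis e_zero)
qed

text \<open>There are elements u_0, ..., u_a = \<open>u\<close> with e u_0 = \<open>w\<close>, each
  u_k being sent by \<open>d\<close> to the image of u_{k+1} under \<open>f\<close>. This is a
  relation and not a map, because every step chooses a preimage.\<close>

primrec zigzag :: "int \<Rightarrow> nat \<Rightarrow> 'y \<Rightarrow> 'x \<Rightarrow> bool" where
  "zigzag j 0 w u \<longleftrightarrow> u \<in> carrier (C 0 j) \<and> e j u = w"
| "zigzag j (Suc a) w u \<longleftrightarrow> u \<in> carrier (C (Suc a) (j + int a + 1)) \<and>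
     (\<exists>u'. zigzag j a w u' \<and> d a (j + int a) u' = f a (j + int a + 1) u)"

lemma index_Suc: "j + int (Suc a) = j + int a + 1"
  by simp

lemma zigzag_closed: "zigzag j a w u \<Longrightarrow> u \<in> carrier (C a (j + int a)) \<and> w \<in> carrier (Y j)"
proof (induction a arbitrary: u)
  case 0
  then show ?case using ec by auto
next
  case (Suc a)
  then show ?case unfolding index_Suc by auto
qed

lemma zigzag_exists:
  assumes w: "w \<in> carrier (Y j)" "dY j w = \<zero>\<^bsub>Y (j + 1)\<^esub>"
  shows "\<exists>u. zigzag j a w u"
proof -
  \<comment> \<open>The claim is strengthened by the preimage needed for the next step, which exists
    because the row is exact and \<open>d\<close> composed with itself vanishes.\<close>
  have "\<exists>u. zigzag j a w u \<and> (\<exists>q \<in> carrier (C (Suc a) (j + int a + 1)). f a (j + int a + 1) q = d a (j + int a) u)"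
  proof (induction a)
    case 0
    obtain u where u: "u \<in> carrier (C 0 j)" "e j u = w" using e_surj[OF w(1)] by blast
    have "e (j + 1) (d 0 j u) = \<zero>\<^bsub>Y (j + 1)\<^esub>" using dY_e[OF u(1)] u(2) w(2) by simp
    then have "\<exists>q \<in> carrier (C (Suc 0) (j + 1)). f 0 (j + 1) q = d 0 j u" by (rule row_lift0[OF dc[OF u(1)]])
    then show ?case using u by auto
  next
    case (Suc a)
    then obtain u q where u: "zigzag j a w u" "q \<in> carrier (C (Suc a) (j + int a + 1))" "f a (j + int a + 1) q = d a (j + int a) u"
      by blast
    have uc: "u \<in> carrier (C a (j + int a))" using zigzag_closed[OF u(1)] by blast
    have z: "zigzag j (Suc a) w q" using u by auto
    have "f a (j + int a + 1 + 1) (d (Suc a) (j + int a + 1) q) = d a (j + int a + 1) (d a (j + int a) u)"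
      using d_f[OF u(2)] u(3) by simp
    then have "f a (j + int a + 1 + 1) (d (Suc a) (j + int a + 1) q) = \<zero>\<^bsub>C a (j + int a + 1 + 1)\<^esub>"
      using d_d[OF uc] by simp
    then have "\<exists>q' \<in> carrier (C (Suc (Suc a)) (j + int a + 1 + 1)). f (Suc a) (j + int a + 1 + 1) q' = d (Suc a) (j + int a + 1) q"
      by (rule row_lift[OF dc[OF u(2)]])
    then show ?case using z unfolding index_Suc by blast
  qed
  then show ?thesis by blast
qed

definition boundary :: "nat \<Rightarrow> int \<Rightarrow> 'x \<Rightarrow> bool" where
  "boundary a b u \<longleftrightarrow> (\<exists>p \<in> carrier (C a (b - 1)). \<exists>q \<in> carrier (C (Suc a) b). u = d a (b - 1) p \<oplus>\<^bsub>C a b\<^esub> f a b q)"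

lemma d_pred: "p \<in> carrier (C a (b - 1)) \<Longrightarrow> d a (b - 1) p \<in> carrier (C a b)"
  using dc[of p a "b - 1"] by simp

text \<open>The boundary representation of u_a is passed to u_{a+1}: applying \<open>d\<close>
  removes the \<open>d\<close> part and turns f q into f (d q), so u_{a+1} - d q is annihilated by
  \<open>f\<close> and lifts through the row.\<close>

lemma zigzag_boundary:
  assumes "zigzag j a w u" "v \<in> carrier (Y (j - 1))" "w = dY (j - 1) v"
  shows "boundary a (j + int a) u"
  using assms(1)
proof (induction a arbitrary: u)
  case 0
  then have u: "u \<in> carrier (C 0 j)" "e j u = w" by auto
  obtain p where p: "p \<in> carrier (C 0 (j - 1))" "e (j - 1) p = v" using e_surj[OF assms(2)] by blast
  note dp = d_pred[OF p(1)]
  have "e j (d 0 (j - 1) p) = w" using dY_e[OF p(1)] p(2) assms(3) by simp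
  then have "e j (u \<ominus>\<^bsub>C 0 j\<^esub> d 0 (j - 1) p) = \<zero>\<^bsub>Y j\<^esub>"
    using u e_minus[OF u(1) dp] left_module_minus(1)[OF Y_mod ec ec, OF u(1) dp] by simp
  moreover have "u \<ominus>\<^bsub>C 0 j\<^esub> d 0 (j - 1) p \<in> carrier (C 0 j)"
  proof -
    interpret left_module R "C 0 j" by (rule C_mod)
    show ?thesis using u dp by simp
  qed
  ultimately obtain q where q: "q \<in> carrier (C (Suc 0) j)" "f 0 j q = u \<ominus>\<^bsub>C 0 j\<^esub> d 0 (j - 1) p"
    using row_lift0 by blast
  have "u = d 0 (j - 1) p \<oplus>\<^bsub>C 0 j\<^esub> f 0 j q" unfolding q(2) by (rule left_module_minus(2)[OF C_mod u(1) dp])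
  then show ?case using p(1) q(1) unfolding boundary_def of_nat_0 add_0_right by blast
next
  case (Suc a)
  let ?b = "j + int a"
  obtain u' where u': "zigzag j a w u'" "d a ?b u' = f a (?b + 1) u" and u: "u \<in> carrier (C (Suc a) (?b + 1))"
    using Suc.prems by auto
  obtain p q where pq: "p \<in> carrier (C a (?b - 1))" "q \<in> carrier (C (Suc a) ?b)" "u' = d a (?b - 1) p \<oplus>\<^bsub>C a ?b\<^esub> f a ?b q"
    using Suc.IH[OF u'(1)] by (auto simp: boundary_def)
  interpret C1: left_module R "C a (?b + 1)" by (rule C_mod)
  interpret C2: left_module R "C (Suc a) (?b + 1)" by (rule C_mod)
  have "d a ?b (d a (?b - 1) p) = \<zero>\<^bsub>C a (?b + 1)\<^esub>" using d_d[OF pq(1)] by simp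
  then have "d a ?b u' = f a (?b + 1) (d (Suc a) ?b q)"
    using fc[OF dc[OF pq(2)]] by (simp add: pq(3) d_add[OF d_pred[OF pq(1)] fc[OF pq(2)]] d_f[OF pq(2)])
  then have "f a (?b + 1) (u \<ominus>\<^bsub>C (Suc a) (?b + 1)\<^esub> d (Suc a) ?b q) = \<zero>\<^bsub>C a (?b + 1)\<^esub>"
    using u'(2) f_minus[OF u dc[OF pq(2)]] fc[OF u] by (simp add: a_minus_def C1.r_neg)
  moreover have "u \<ominus>\<^bsub>C (Suc a) (?b + 1)\<^esub> d (Suc a) ?b q \<in> carrier (C (Suc a) (?b + 1))" using u dc[OF pq(2)] by simp
  ultimately obtain q' where q': "q' \<in> carrier (C (Suc (Suc a)) (?b + 1))"
    "f (Suc a) (?b + 1) q' = u \<ominus>\<^bsub>C (Suc a) (?b + 1)\<^esub> d (Suc a) ?b q" using row_lift by blast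
  have "u = d (Suc a) ?b q \<oplus>\<^bsub>C (Suc a) (?b + 1)\<^esub> f (Suc a) (?b + 1) q'"
    unfolding q'(2) by (rule left_module_minus(2)[OF C_mod u dc[OF pq(2)]])
  then have "\<exists>p \<in> carrier (C (Suc a) (?b + 1 - 1)). \<exists>q \<in> carrier (C (Suc (Suc a)) (?b + 1)).
      u = d (Suc a) (?b + 1 - 1) p \<oplus>\<^bsub>C (Suc a) (?b + 1)\<^esub> f (Suc a) (?b + 1) q"
    using pq(2) q'(1) by (intro bexI[of _ q] bexI[of _ q']) simp_all
  then show ?case unfolding boundary_def index_Suc .
qed

text \<open>In top degree the class of \<open>u\<close> modulo the image of \<open>d\<close> is a
  cycle of the complex of these quotients; at the start of the resolution there is no
  condition.\<close>

definition cycle :: "nat \<Rightarrow> int \<Rightarrow> 'x \<Rightarrow> bool" where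
  "cycle a b u \<longleftrightarrow> u \<in> carrier (C a b) \<and>
     (case a of 0 \<Rightarrow> True | Suc a' \<Rightarrow> \<exists>p \<in> carrier (C a' (b - 1)). d a' (b - 1) p = f a' b u)"

lemma zigzag_cycle: "zigzag j a w u \<Longrightarrow> cycle a (j + int a) u"
proof (cases a)
  case (Suc a')
  assume z: "zigzag j a w u"
  then obtain u' where u': "zigzag j a' w u'" "d a' (j + int a') u' = f a' (j + int a' + 1) u"
    "u \<in> carrier (C (Suc a') (j + int a' + 1))" by (auto simp: Suc)
  have "u' \<in> carrier (C a' (j + int a' + 1 - 1))" using zigzag_closed[OF u'(1)] by simp
  moreover have "d a' (j + int a' + 1 - 1) u' = f a' (j + int a' + 1) u" using u'(2) by simp
  ultimately show ?thesis using u'(3) unfolding cycle_def Suc index_Suc by auto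
qed (simp add: cycle_def)

text \<open>The zigzag is followed back towards \<open>M\<close>. This uses exactness of columns at
  \<open>j + a'\<close> for a' < \<open>a\<close>, positions that lie strictly below
  \<open>top_deg\<close>.\<close>

lemma cycle_zigzag:
  assumes "cycle a (j + int a) u" "j + int a \<le> top_deg"
  shows "\<exists>w. zigzag j a w u"
  using assms
proof (induction a arbitrary: u)
  case 0
  then show ?case by (simp add: cycle_def)
next
  case (Suc a)
  let ?b = "j + int a"
  have u: "u \<in> carrier (C (Suc a) (?b + 1))" and "\<exists>p \<in> carrier (C a (?b + 1 - 1)). d a (?b + 1 - 1) p = f a (?b + 1) u"
    using Suc.prems(1) unfolding cycle_def index_Suc by auto
  then obtain p where p: "p \<in> carrier (C a ?b)" "d a ?b p = f a (?b + 1) u" by auto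
  have "cycle a ?b p"
  proof (cases a)
    case 0
    then show ?thesis using p by (simp add: cycle_def)
  next
    case (Suc a')
    have p': "p \<in> carrier (C (Suc a') ?b)" using p(1) Suc by simp
    have "d a' ?b (f a' ?b p) = f a' (?b + 1) (f (Suc a') (?b + 1) u)" using d_f[OF p'] p(2) Suc by simp
    also have "\<dots> = \<zero>\<^bsub>C a' (?b + 1)\<^esub>" using u Suc by (intro f_f) simp
    finally have "\<exists>y \<in> carrier (C a' (?b - 1)). d a' (?b - 1) y = f a' ?b p"
      using d_exact[of "?b - 1" "f a' ?b p" a'] fc[OF p'] Suc.prems(2) by simp
    then show ?thesis using p(1) unfolding cycle_def Suc by simp
  qed
  then obtain w where "zigzag j a w p" using Suc.IH Suc.prems(2) by auto
  then show ?case using p u by auto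
qed

text \<open>For positive length closedness of \<open>w\<close> follows from \<open>e\<close>
  composed with \<open>f\<close> being zero. At length 0 there is no such step, and closedness of
  \<open>u\<close> is required instead.\<close>

lemma zigzag_dY:
  assumes "zigzag j a w u" "a = 0 \<Longrightarrow> d 0 j u = \<zero>\<^bsub>C 0 (j + 1)\<^esub>"
  shows "dY j w = \<zero>\<^bsub>Y (j + 1)\<^esub>"
  using assms
proof (induction a arbitrary: u)
  case 0
  then show ?case using dY_e e_zero by auto
next
  case (Suc a)
  then obtain u' where u': "zigzag j a w u'" "d a (j + int a) u' = f a (j + int a + 1) u"
    "u \<in> carrier (C (Suc a) (j + int a + 1))" by auto
  show ?case
  proof (cases a)
    case 0
    then have "u' \<in> carrier (C 0 j)" "e j u' = w" "d 0 j u' = f 0 (j + 1) u" "u \<in> carrier (C (Suc 0) (j + 1))" using u' by auto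
    then show ?thesis using dY_e e_f by metis
  next
    case (Suc b)
    then show ?thesis using Suc.IH[OF u'(1)] by simp
  qed
qed

text \<open>If u = d p + f q, then u' - f p is annihilated by \<open>d\<close>, where u' precedes
  \<open>u\<close> in the zigzag. Exactness of the column makes u' a boundary as well, down to
  length 0, where \<open>e\<close> yields the primitive of \<open>w\<close>.\<close>

lemma boundary_zigzag:
  assumes "zigzag j a w u" "boundary a (j + int a) u" "j + int a \<le> top_deg"
  shows "\<exists>v \<in> carrier (Y (j - 1)). w = dY (j - 1) v"
  using assms
proof (induction a arbitrary: u)
  case 0
  then obtain p q where pq: "p \<in> carrier (C 0 (j - 1))" "q \<in> carrier (C (Suc 0) j)" "u = d 0 (j - 1) p \<oplus>\<^bsub>C 0 j\<^esub> f 0 j q"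
    by (auto simp: boundary_def)
  interpret Y0: left_module R "Y j" by (rule Y_mod)
  have "w = e j u" using 0 by simp
  also have "\<dots> = e j (d 0 (j - 1) p)" unfolding pq(3) using e_add[OF d_pred[OF pq(1)] fc[OF pq(2)]] e_f[OF pq(2)] ec[OF d_pred[OF pq(1)]] by simp
  also have "\<dots> = dY (j - 1) (e (j - 1) p)" using dY_e[OF pq(1)] by simp
  finally show ?case using ec[OF pq(1)] by blast
next
  case (Suc a)
  let ?b = "j + int a"
  obtain u' where u': "zigzag j a w u'" "d a ?b u' = f a (?b + 1) u" and u: "u \<in> carrier (C (Suc a) (?b + 1))"
    using Suc.prems by auto
  have u'c: "u' \<in> carrier (C a ?b)" using zigzag_closed[OF u'(1)] by blast
  have "boundary (Suc a) (?b + 1) u" using Suc.prems(2) unfolding index_Suc .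
  then obtain p q where pq: "p \<in> carrier (C (Suc a) ?b)" "q \<in> carrier (C (Suc (Suc a)) (?b + 1))"
    "u = d (Suc a) ?b p \<oplus>\<^bsub>C (Suc a) (?b + 1)\<^esub> f (Suc a) (?b + 1) q" by (auto simp: boundary_def)
  interpret C1: left_module R "C a (?b + 1)" by (rule C_mod)
  interpret C0: left_module R "C a ?b" by (rule C_mod)
  have fp: "f a ?b p \<in> carrier (C a ?b)" by (rule fc[OF pq(1)])
  have "d a ?b u' = d a ?b (f a ?b p)"
    unfolding u'(2) pq(3) f_add[OF dc[OF pq(1)] fc[OF pq(2)]] f_f[OF pq(2)] d_f[OF pq(1)]
    using fc[OF dc[OF pq(1)]] by simp
  then have "d a ?b (u' \<ominus>\<^bsub>C a ?b\<^esub> f a ?b p) = \<zero>\<^bsub>C a (?b + 1)\<^esub>"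
    using d_minus[OF u'c fp] dc[OF fp] by (simp add: a_minus_def C1.r_neg)
  then have "\<exists>y \<in> carrier (C a (?b - 1)). d a (?b - 1) y = u' \<ominus>\<^bsub>C a ?b\<^esub> f a ?b p"
    using d_exact[of "?b - 1" "u' \<ominus>\<^bsub>C a ?b\<^esub> f a ?b p" a] u'c fp Suc.prems(3) by simp
  then obtain p' where p': "p' \<in> carrier (C a (?b - 1))" "d a (?b - 1) p' = u' \<ominus>\<^bsub>C a ?b\<^esub> f a ?b p" by blast
  have "u' = d a (?b - 1) p' \<oplus>\<^bsub>C a ?b\<^esub> f a ?b p"
    unfolding p'(2) using left_module_minus(2)[OF C_mod u'c fp] u'c fp by (simp add: C0.a_comm)
  then have "boundary a ?b u'" using p'(1) pq(1) unfolding boundary_def by blast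
  then show ?case using Suc.IH[OF u'(1)] Suc.prems(3) by simp
qed

lemma zigzag_add:
  "zigzag j a w u \<Longrightarrow> zigzag j a w' u' \<Longrightarrow> zigzag j a (w \<oplus>\<^bsub>Y j\<^esub> w') (u \<oplus>\<^bsub>C a (j + int a)\<^esub> u')"
proof (induction a arbitrary: u u')
  case 0
  interpret C0: left_module R "C 0 j" by (rule C_mod)
  show ?case using 0 e_add by auto
next
  case (Suc a)
  let ?b = "j + int a"
  obtain v where v: "zigzag j a w v" "d a ?b v = f a (?b + 1) u" and u: "u \<in> carrier (C (Suc a) (?b + 1))"
    using Suc.prems(1) by auto
  obtain v' where v': "zigzag j a w' v'" "d a ?b v' = f a (?b + 1) u'" and u': "u' \<in> carrier (C (Suc a) (?b + 1))"
    using Suc.prems(2) by auto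
  interpret C1: left_module R "C (Suc a) (?b + 1)" by (rule C_mod)
  have "d a ?b (v \<oplus>\<^bsub>C a ?b\<^esub> v') = f a (?b + 1) (u \<oplus>\<^bsub>C (Suc a) (?b + 1)\<^esub> u')"
    using zigzag_closed[OF v(1)] zigzag_closed[OF v'(1)] by (simp add: d_add f_add[OF u u'] v(2) v'(2))
  moreover have "u \<oplus>\<^bsub>C (Suc a) (?b + 1)\<^esub> u' \<in> carrier (C (Suc a) (?b + 1))" using u u' by simp
  ultimately show ?case using Suc.IH[OF v(1) v'(1)] unfolding index_Suc zigzag.simps by blast
qed

lemma zigzag_smult:
  assumes c: "c \<in> carrier R"
  shows "zigzag j a w u \<Longrightarrow> zigzag j a (c \<odot>\<^bsub>Y j\<^esub> w) (c \<odot>\<^bsub>C a (j + int a)\<^esub> u)"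
proof (induction a arbitrary: u)
  case 0
  interpret C0: left_module R "C 0 j" by (rule C_mod)
  show ?case using 0 c lin_hom_smult[OF e_hom c] by auto
next
  case (Suc a)
  let ?b = "j + int a"
  obtain v where v: "zigzag j a w v" "d a ?b v = f a (?b + 1) u" and u: "u \<in> carrier (C (Suc a) (?b + 1))"
    using Suc.prems(1) by auto
  interpret C1: left_module R "C (Suc a) (?b + 1)" by (rule C_mod)
  have "d a ?b (c \<odot>\<^bsub>C a ?b\<^esub> v) = f a (?b + 1) (c \<odot>\<^bsub>C (Suc a) (?b + 1)\<^esub> u)"
    using zigzag_closed[OF v(1)] by (simp add: lin_hom_smult[OF d c] lin_hom_smult[OF f_hom c u] v(2))
  moreover have "c \<odot>\<^bsub>C (Suc a) (?b + 1)\<^esub> u \<in> carrier (C (Suc a) (?b + 1))" using u c by simp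
  ultimately show ?case using Suc.IH[OF v(1)] unfolding index_Suc zigzag.simps by blast
qed

end

section \<open>Top-degree forms\<close>

text \<open>The subspace \<open>Z\<close> has a linear projection \<open>g\<close> onto it, and
  \<nu> after \<open>g\<close> extends \<nu>. Extensions to all polynomials are needed because the
  truncation of an element may leave \<open>Z\<close>.\<close>

lemma functional_extension:
  fixes \<nu> :: "'k::field_char_0 mpoly \<Rightarrow> 'k"
  assumes Z: "0 \<in> Z" "\<And>x y. x \<in> Z \<Longrightarrow> y \<in> Z \<Longrightarrow> x + y \<in> Z" "\<And>c x. x \<in> Z \<Longrightarrow> const_poly c * x \<in> Z"
    and \<nu>: "\<And>x y. x \<in> Z \<Longrightarrow> y \<in> Z \<Longrightarrow> \<nu> (x + y) = \<nu> x + \<nu> y" "\<And>c x. x \<in> Z \<Longrightarrow> \<nu> (const_poly c * x) = c * \<nu> x"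
  shows "\<exists>\<mu>. (\<forall>x y. \<mu> (x + y) = \<mu> x + \<mu> y) \<and> (\<forall>c x. \<mu> (const_poly c * x) = c * \<mu> x) \<and> (\<forall>x \<in> Z. \<mu> x = \<nu> x)"
proof -
  let ?s = "\<lambda>(c :: 'k) (v :: 'k mpoly). const_poly c * v"
  interpret V: vector_space ?s
    by unfold_locales (simp_all add: const_poly_add const_poly_mult algebra_simps)
  interpret VV: vector_space_pair ?s ?s ..
  have "V.subspace Z" using Z by (simp add: V.subspace_def)
  then obtain g where g: "g ` UNIV \<subseteq> Z" "Vector_Spaces.linear ?s ?s g" "\<forall>v \<in> Z. g v = v"
    using VV.linear_exists_left_inverse_on[OF V.linear_ident, of Z] by auto
  interpret g: Vector_Spaces.linear ?s ?s g by (rule g(2))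
  have gZ: "g x \<in> Z" for x using g(1) by blast
  show ?thesis
    using g(3) by (intro exI[of _ "\<lambda>x. \<nu> (g x)"]) (simp add: g.add g.scale \<nu> gZ)
qed

text \<open>Exactness is inherited coefficient by coefficient: for a map applied to every
  coefficient, image and kernel are again products over the index sets.\<close>

lemma form_map_resolution:
  fixes Q :: "nat \<Rightarrow> ('k::field_char_0 diff_op, 'q) module" and M :: "('k diff_op, 'm) module"
  assumes res: "exact_resolution (diff_op_ring n) Q \<delta> \<epsilon> M"
  shows "exact_resolution base_field (\<lambda>a. de_rham_forms n (Q a) b)
    (\<lambda>a. restrict (form_map n b (\<delta> a)) (carrier (de_rham_forms n (Q (Suc a)) b)))
    (restrict (form_map n b \<epsilon>) (carrier (de_rham_forms n (Q 0) b))) (de_rham_forms n M b)"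
proof -
  note r = exact_resolutionD[OF res]
  let ?I = "form_indices n b"
  have hom: "restrict (form_map n b h) (carrier (de_rham_forms n A b)) \<in> lin_hom base_field (de_rham_forms n A b) (de_rham_forms n B b)"
    if A: "left_module (diff_op_ring n) A" and h: "h \<in> lin_hom (diff_op_ring n) A B"
    for A :: "('k diff_op, 'x) module" and B :: "('k diff_op, 'y) module" and h
  proof (rule lin_hom_restrict[OF _ _ _ left_module_de_rham_forms[OF A]])
    fix w v c assume w: "w \<in> carrier (de_rham_forms n A b)"
    show "form_map n b h w \<in> carrier (de_rham_forms n B b)" by (rule form_map_closed[OF h w])
    show "form_map n b h (w \<oplus>\<^bsub>de_rham_forms n A b\<^esub> v) = form_map n b h w \<oplus>\<^bsub>de_rham_forms n B b\<^esub> form_map n b h v"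
      if "v \<in> carrier (de_rham_forms n A b)"
      using w that by (auto simp: form_map_def PiE_const_mem lin_hom_add[OF h] intro!: restrict_ext)
    show "form_map n b h (c \<odot>\<^bsub>de_rham_forms n A b\<^esub> w) = c \<odot>\<^bsub>de_rham_forms n B b\<^esub> form_map n b h w"
      using w by (auto simp: form_map_def PiE_const_mem lin_hom_smult[OF h] intro!: restrict_ext)
  qed
  have image: "form_map n b h ` (?I \<rightarrow>\<^sub>E A) = ?I \<rightarrow>\<^sub>E h ` A" for h :: "'x \<Rightarrow> 'y" and A
  proof
    show "form_map n b h ` (?I \<rightarrow>\<^sub>E A) \<subseteq> ?I \<rightarrow>\<^sub>E h ` A"
      by (auto simp: form_map_def PiE_const_mem)
    show "?I \<rightarrow>\<^sub>E h ` A \<subseteq> form_map n b h ` (?I \<rightarrow>\<^sub>E A)"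
    proof
      fix w assume w: "w \<in> ?I \<rightarrow>\<^sub>E h ` A"
      then have "\<forall>J \<in> ?I. \<exists>x. x \<in> A \<and> h x = w J" by (metis PiE_const_mem imageE)
      from bchoice[OF this] obtain u where u: "\<forall>J \<in> ?I. u J \<in> A \<and> h (u J) = w J" ..
      have "form_map n b h (restrict u ?I) \<in> ?I \<rightarrow>\<^sub>E h ` A" using u by (auto simp: form_map_def)
      then have "w = form_map n b h (restrict u ?I)"
        by (rule PiE_eqI[OF w]) (simp add: form_map_def u)
      moreover have "restrict u ?I \<in> ?I \<rightarrow>\<^sub>E A" using u by auto
      ultimately show "w \<in> form_map n b h ` (?I \<rightarrow>\<^sub>E A)" by (rule image_eqI)
    qed
  qed
  have kernel: "{w \<in> ?I \<rightarrow>\<^sub>E A. form_map n b h w = (\<lambda>J \<in> ?I. z)} = ?I \<rightarrow>\<^sub>E {x \<in> A. h x = z}" for h :: "'x \<Rightarrow> 'y" and A z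
  proof (intro equalityI subsetI)
    fix w assume "w \<in> {w \<in> ?I \<rightarrow>\<^sub>E A. form_map n b h w = (\<lambda>J \<in> ?I. z)}"
    then have w: "w \<in> ?I \<rightarrow>\<^sub>E A" "form_map n b h w = (\<lambda>J \<in> ?I. z)" by auto
    have "h (w J) = z" if "J \<in> ?I" for J using fun_cong[OF w(2), of J] that by (simp add: form_map_def)
    then show "w \<in> ?I \<rightarrow>\<^sub>E {x \<in> A. h x = z}" using w(1) by (auto simp: PiE_iff)
  next
    fix w assume "w \<in> ?I \<rightarrow>\<^sub>E {x \<in> A. h x = z}"
    then show "w \<in> {w \<in> ?I \<rightarrow>\<^sub>E A. form_map n b h w = (\<lambda>J \<in> ?I. z)}"
      by (auto simp: PiE_iff form_map_def intro!: restrict_ext)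
  qed
  have sub: "carrier (de_rham_forms n (Q a) b) = ?I \<rightarrow>\<^sub>E carrier (Q a)" for a by simp
  show ?thesis
    unfolding exact_resolution_def
  proof (intro conjI allI)
    show "left_module base_field (de_rham_forms n M b)" "left_module base_field (de_rham_forms n (Q a) b)" for a
      by (rule left_module_de_rham_forms[OF r(1)] left_module_de_rham_forms[OF r(2)])+
    show "restrict (form_map n b (\<delta> a)) (carrier (de_rham_forms n (Q (Suc a)) b)) \<in>
        lin_hom base_field (de_rham_forms n (Q (Suc a)) b) (de_rham_forms n (Q a) b)" for a
      by (rule hom[OF r(2) r(3)])
    show "restrict (form_map n b \<epsilon>) (carrier (de_rham_forms n (Q 0) b)) \<in>
        lin_hom base_field (de_rham_forms n (Q 0) b) (de_rham_forms n M b)"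
      by (rule hom[OF r(2) r(4)])
    note x = res[unfolded exact_resolution_def]
    show "restrict (form_map n b \<epsilon>) (carrier (de_rham_forms n (Q 0) b)) ` carrier (de_rham_forms n (Q 0) b) = carrier (de_rham_forms n M b)"
      using x by (simp add: image)
    show "restrict (form_map n b (\<delta> 0)) (carrier (de_rham_forms n (Q (Suc 0)) b)) ` carrier (de_rham_forms n (Q 1) b) =
        {x \<in> carrier (de_rham_forms n (Q 0) b). restrict (form_map n b \<epsilon>) (carrier (de_rham_forms n (Q 0) b)) x = \<zero>\<^bsub>de_rham_forms n M b\<^esub>}"
    proof -
      have "{x \<in> carrier (de_rham_forms n (Q 0) b). restrict (form_map n b \<epsilon>) (carrier (de_rham_forms n (Q 0) b)) x = \<zero>\<^bsub>de_rham_forms n M b\<^esub>} =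
        {w \<in> ?I \<rightarrow>\<^sub>E carrier (Q 0). form_map n b \<epsilon> w = (\<lambda>J \<in> ?I. \<zero>\<^bsub>M\<^esub>)}" by auto
      also have "\<dots> = ?I \<rightarrow>\<^sub>E \<delta> 0 ` carrier (Q (Suc 0))" unfolding kernel using x by (simp add: One_nat_def)
      finally show ?thesis by (simp add: image One_nat_def)
    qed
    show "restrict (form_map n b (\<delta> (Suc a))) (carrier (de_rham_forms n (Q (Suc (Suc a))) b)) ` carrier (de_rham_forms n (Q (Suc (Suc a))) b) =
        {x \<in> carrier (de_rham_forms n (Q (Suc a)) b).
           restrict (form_map n b (\<delta> a)) (carrier (de_rham_forms n (Q (Suc a)) b)) x = \<zero>\<^bsub>de_rham_forms n (Q a) b\<^esub>}" for a
    proof -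
      have "{x \<in> carrier (de_rham_forms n (Q (Suc a)) b).
           restrict (form_map n b (\<delta> a)) (carrier (de_rham_forms n (Q (Suc a)) b)) x = \<zero>\<^bsub>de_rham_forms n (Q a) b\<^esub>} =
        {w \<in> ?I \<rightarrow>\<^sub>E carrier (Q (Suc a)). form_map n b (\<delta> a) w = (\<lambda>J \<in> ?I. \<zero>\<^bsub>Q a\<^esub>)}" by auto
      also have "\<dots> = ?I \<rightarrow>\<^sub>E \<delta> (Suc a) ` carrier (Q (Suc (Suc a)))" unfolding kernel using x by simp
      finally show ?thesis by (simp add: image)
    qed
  qed
qed

lemma form_indices_top: "form_indices n (int n) = {{1..n}}"
proof
  show "form_indices n (int n) \<subseteq> {{1..n}}"
  proof
    fix J assume "J \<in> form_indices n (int n)"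
    then have "J \<subseteq> {1..n}" "card J = card {1..n}" by (auto simp: form_indices_def)
    then show "J \<in> {{1..n}}" using card_subset_eq[of "{1..n}" J] by simp
  qed
qed (simp add: form_indices_def)

lemma form_indices_above_top: "form_indices n (int n + 1) = {}"
proof -
  have "int (card J) \<noteq> int n + 1" if "J \<subseteq> {1..n}" for J
    using card_mono[OF finite_atLeastAtMost that] by simp
  then show ?thesis unfolding form_indices_def by blast
qed

section \<open>Forms of top degree and the span of the derivatives\<close>

definition top_form :: "nat \<Rightarrow> 'x \<Rightarrow> nat set \<Rightarrow> 'x" where
  "top_form n t = (\<lambda>J \<in> form_indices n (int n). t)"

definition deriv_span :: "nat \<Rightarrow> nat \<Rightarrow> 'k::field_char_0 mpoly set" where
  "deriv_span n r = {\<Sum>s = 1..n. sym_deriv n s (x s) |x. \<forall>s. x s \<in> symbols n r}"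

lemma top_form_in: "top_form n t \<in> form_indices n (int n) \<rightarrow>\<^sub>E A \<longleftrightarrow> t \<in> A"
  by (auto simp: top_form_def form_indices_top)

lemma top_form_all: "u \<in> form_indices n (int n) \<rightarrow>\<^sub>E A \<Longrightarrow> \<exists>t \<in> A. u = top_form n t"
  by (rule bexI[of _ "u {1..n}"], rule PiE_eqI, assumption)
     (auto simp: top_form_def form_indices_top)

lemma top_form_inj: "top_form n t = top_form n t' \<longleftrightarrow> t = t'"
proof
  assume "top_form n t = top_form n t'"
  then have "top_form n t {1..n} = top_form n t' {1..n}" by simp
  then show "t = t'" by (simp add: top_form_def form_indices_top)
qed simp

lemma top_form_d:
  fixes t :: "'k::field_char_0 mpoly"
  shows "(\<exists>p \<in> carrier (de_rham_forms n (free_module n r) (int n - 1)).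
      de_rham_diff n (free_module n r) (int n - 1) p = top_form n t) \<longleftrightarrow> t \<in> deriv_span n r"
proof -
  let ?F = "free_module n r :: ('k diff_op, 'k mpoly) module"
  have top: "{1..n} \<in> form_indices n (int n)" by (simp add: form_indices_top)
  have diff: "de_rham_diff n ?F (int n - 1) p {1..n} =
      (\<Sum>s = 1..n. (- 1) ^ card {j \<in> {1..n}. j < s} * sym_deriv n s (p ({1..n} - {s})))"
    if p: "p \<in> carrier (de_rham_forms n ?F (int n - 1))" for p
  proof -
    have "de_rham_diff n ?F (int n - 1) p {1..n} = koszul_d n (form_ext n (int n - 1) p) {1..n}"
      using fun_cong[OF form_ext_koszul[OF p], of "{1..n}"] top by (simp add: form_ext_def[of n "int n"])
    also have "\<dots> = (\<Sum>s = 1..n. (- 1) ^ card {j \<in> {1..n}. j < s} * sym_deriv n s (p ({1..n} - {s})))"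
      unfolding koszul_d_def
    proof (simp only: subset_refl if_True, rule sum.cong[OF refl])
      fix s assume "s \<in> {1..n}"
      then have "{1..n} - {s} \<in> form_indices n (int n - 1)"
        using form_indices_remove(1)[of "{1..n}" n "int n - 1" s] top by simp
      then show "(- 1) ^ card {j \<in> {1..n}. j < s} * sym_deriv n s (form_ext n (int n - 1) p ({1..n} - {s})) =
        (- 1) ^ card {j \<in> {1..n}. j < s} * sym_deriv n s (p ({1..n} - {s}))" by (simp only: form_ext_def if_True)
    qed
    finally show ?thesis .
  qed
  show ?thesis
  proof
    assume "\<exists>p \<in> carrier (de_rham_forms n ?F (int n - 1)). de_rham_diff n ?F (int n - 1) p = top_form n t"
    then obtain p where p: "p \<in> carrier (de_rham_forms n ?F (int n - 1))" "de_rham_diff n ?F (int n - 1) p = top_form n t" by blast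
    \<comment> \<open>The sign of each summand moves into the coefficient. The value 0 at the other
      indices is chosen because \<open>deriv_span\<close> asks for a symbol at every index.\<close>
    define x where "x s = (if s \<in> {1..n} then (- 1) ^ card {j \<in> {1..n}. j < s} * p ({1..n} - {s}) else 0)" for s
    have "t = de_rham_diff n ?F (int n - 1) p {1..n}" using p(2) top by (simp add: top_form_def)
    also have "\<dots> = (\<Sum>s = 1..n. sym_deriv n s (x s))"
      unfolding diff[OF p(1)] by (rule sum.cong) (auto simp: x_def sym_deriv_sign)
    finally have "t = (\<Sum>s = 1..n. sym_deriv n s (x s))" .
    moreover have "x s \<in> symbols n r" for s
    proof (cases "s \<in> {1..n}")
      case True
      then have "{1..n} - {s} \<in> form_indices n (int n - 1)"
        using form_indices_remove(1)[of "{1..n}" n "int n - 1" s] top by simp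
      then have "p ({1..n} - {s}) \<in> symbols n r" using p(1) by auto
      then show ?thesis using True by (simp add: x_def)
    next
      case False
      then show ?thesis unfolding x_def by (simp only: if_False symbols_zero)
    qed
    ultimately show "t \<in> deriv_span n r" by (auto simp: deriv_span_def)
  next
    assume "t \<in> deriv_span n r"
    then obtain x where x: "t = (\<Sum>s = 1..n. sym_deriv n s (x s))" "\<And>s. x s \<in> symbols n r" by (auto simp: deriv_span_def)
    \<comment> \<open>An index set \<open>J\<close> of this degree misses exactly one element, so
      the sum has a single term: \<open>x s\<close> with the sign that cancels the one of the
      differential.\<close>
    define p where "p = (\<lambda>J \<in> form_indices n (int n - 1). \<Sum>s \<in> {1..n} - J. (- 1) ^ card {j \<in> {1..n}. j < s} * x s)"
    have p: "p \<in> carrier (de_rham_forms n ?F (int n - 1))" using x(2) by (auto simp: p_def intro!: symbols_sum)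
    have ps: "p ({1..n} - {s}) = (- 1) ^ card {j \<in> {1..n}. j < s} * x s" if s: "s \<in> {1..n}" for s
    proof -
      have "{1..n} - {s} \<in> form_indices n (int n - 1)"
        using form_indices_remove(1)[of "{1..n}" n "int n - 1" s] top s by simp
      moreover have "{1..n} - ({1..n} - {s}) = {s}" using s by auto
      ultimately show ?thesis by (simp add: p_def)
    qed
    have "de_rham_diff n ?F (int n - 1) p {1..n} = (\<Sum>s = 1..n. sym_deriv n s (x s))"
      unfolding diff[OF p]
    proof (rule sum.cong[OF refl])
      fix s assume "s \<in> {1..n}"
      then show "(- 1) ^ card {j \<in> {1..n}. j < s} * sym_deriv n s (p ({1..n} - {s})) = sym_deriv n s (x s)"
        by (simp only: ps sym_deriv_sign) (simp flip: mult.assoc power_mult_distrib)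
    qed
    then have "de_rham_diff n ?F (int n - 1) p {1..n} = t" using x(1) by simp
    moreover have "de_rham_diff n ?F (int n - 1) p \<in> form_indices n (int n) \<rightarrow>\<^sub>E symbols n r"
      using dd_closed[OF left_module_free_module p] by simp
    then obtain t' where "de_rham_diff n ?F (int n - 1) p = top_form n t'" using top_form_all by blast
    ultimately have "de_rham_diff n ?F (int n - 1) p = top_form n t" using top by (simp add: top_form_def)
    then show "\<exists>p \<in> carrier (de_rham_forms n ?F (int n - 1)). de_rham_diff n ?F (int n - 1) p = top_form n t" using p by blast
  qed
qed

lemma deriv_span_cut:
  assumes "t \<in> deriv_span n r"
  shows "cut n \<gamma> I t \<in> deriv_span n r"
proof -
  obtain x where x: "t = (\<Sum>s = 1..n. sym_deriv n s (x s))" "\<And>s. x s \<in> symbols n r"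
    using assms by (auto simp: deriv_span_def)
  have sum: "cut n \<gamma> I (\<Sum>s \<in> A. g s) = (\<Sum>s \<in> A. cut n \<gamma> I (g s))" if "finite A" for g :: "nat \<Rightarrow> 'a mpoly" and A
    using that by (induction A rule: finite_induct) (simp_all add: cut_add)
  have "cut n \<gamma> I t = (\<Sum>s = 1..n. sym_deriv n s (cut n \<gamma> {l. l - 1 \<in> I} (x s)))"
    unfolding x(1) sum[OF finite_atLeastAtMost] by (rule sum.cong) (auto simp: cut_deriv)
  then show ?thesis using x(2) unfolding deriv_span_def by (intro CollectI exI[of _ "\<lambda>s. cut n \<gamma> {l. l - 1 \<in> I} (x s)"]) simp
qed

lemma admissible_deriv_span:
  assumes adm: "admissible n r \<gamma> \<mu>" and t: "t \<in> deriv_span n r"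
  shows "\<mu> t = 0"
proof -
  obtain x where x: "t = (\<Sum>s = 1..n. sym_deriv n s (x s))" "\<And>s. x s \<in> symbols n r"
    using t by (auto simp: deriv_span_def)
  have add: "\<mu> (v + w) = \<mu> v + \<mu> w" if "v \<in> symbols n r" "w \<in> symbols n r" for v w
    using adm that unfolding admissible_def by blast
  have der: "\<mu> (sym_deriv n s v) = 0" if "s \<in> {1..n}" "v \<in> symbols n r" for v s
    using adm that unfolding admissible_def by blast
  have "\<mu> (\<Sum>s \<in> A. sym_deriv n s (x s)) = 0" if "finite A" "A \<subseteq> {1..n}" for A
    using that
  proof (induction A rule: finite_induct)
    case empty
    then show ?case using add[of 0 0] by simp
  next
    case (insert s A)
    have "(\<Sum>s \<in> A. sym_deriv n s (x s)) \<in> symbols n r"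
      using insert x(2) by (intro symbols_sum symbols_sym_deriv) auto
    then show ?case using insert x(2) by (simp add: add der subset_iff)
  qed
  then show ?thesis unfolding x(1) by blast
qed

lemma sym_deriv_in_deriv_span:
  assumes "s \<in> {1..n}" "v \<in> symbols n r"
  shows "sym_deriv n s v \<in> deriv_span n r"
proof -
  have "(\<Sum>i = 1..n. sym_deriv n i (if i = s then v else 0)) = (\<Sum>i = 1..n. if i = s then sym_deriv n s v else 0)"
    by (rule sum.cong) auto
  then have "sym_deriv n s v = (\<Sum>i = 1..n. sym_deriv n i (if i = s then v else 0))" using assms(1) by simp
  then show ?thesis using assms(2) unfolding deriv_span_def by (intro CollectI exI[of _ "\<lambda>i. if i = s then v else 0"]) simp
qed

lemma deriv_span_symbols: "deriv_span n r \<subseteq> symbols n r"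
  unfolding deriv_span_def by (auto intro!: symbols_sum symbols_sym_deriv)

lemma deriv_span_zero: "0 \<in> deriv_span n r"
  unfolding deriv_span_def by (intro CollectI exI[of _ "\<lambda>_. 0"]) simp

lemma deriv_span_const:
  assumes "t \<in> deriv_span n r"
  shows "const_poly c * t \<in> deriv_span n r"
proof -
  obtain x where x: "t = (\<Sum>s = 1..n. sym_deriv n s (x s))" "\<And>s. x s \<in> symbols n r"
    using assms by (auto simp: deriv_span_def)
  have "const_poly c * t = (\<Sum>s = 1..n. sym_deriv n s (const_poly c * x s))"
    unfolding x(1) by (simp add: sum_distrib_left sym_deriv_const)
  then show ?thesis using x(2) unfolding deriv_span_def by (intro CollectI exI[of _ "\<lambda>s. const_poly c * x s"]) simp
qed

lemma deriv_span_add: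
  assumes "t \<in> deriv_span n r" "t' \<in> deriv_span n r"
  shows "t + t' \<in> deriv_span n r"
proof -
  obtain x where x: "t = (\<Sum>s = 1..n. sym_deriv n s (x s))" "\<And>s. x s \<in> symbols n r"
    using assms(1) by (auto simp: deriv_span_def)
  obtain y where y: "t' = (\<Sum>s = 1..n. sym_deriv n s (y s))" "\<And>s. y s \<in> symbols n r"
    using assms(2) by (auto simp: deriv_span_def)
  have "t + t' = (\<Sum>s = 1..n. sym_deriv n s (x s + y s))"
    unfolding x(1) y(1) by (simp add: sum.distrib sym_deriv_add)
  then show ?thesis using x(2) y(2) unfolding deriv_span_def by (intro CollectI exI[of _ "\<lambda>s. x s + y s"]) simp
qed

text \<open>Representatives, in the free modules themselves, of the cycles of the complex of
  quotients by \<open>deriv_span\<close>; \<open>top_boundaries\<close> likewise represents its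
  boundaries.\<close>

definition top_cycles :: "nat \<Rightarrow> (nat \<Rightarrow> nat) \<Rightarrow> (nat \<Rightarrow> 'k::field_char_0 mpoly \<Rightarrow> 'k mpoly) \<Rightarrow> nat \<Rightarrow> 'k mpoly set" where
  "top_cycles n r \<delta> i = {t \<in> symbols n (r i). case i of 0 \<Rightarrow> True | Suc a \<Rightarrow> \<delta> a t \<in> deriv_span n (r a)}"

definition top_boundaries :: "nat \<Rightarrow> (nat \<Rightarrow> nat) \<Rightarrow> (nat \<Rightarrow> 'k::field_char_0 mpoly \<Rightarrow> 'k mpoly) \<Rightarrow> nat \<Rightarrow> 'k mpoly set" where
  "top_boundaries n r \<delta> i = {y + \<delta> i q |y q. y \<in> deriv_span n (r i) \<and> q \<in> symbols n (r (Suc i))}"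

lemma form_map_top: "form_map n (int n) h (top_form n t) = top_form n (h t)"
  by (auto simp: form_map_def top_form_def intro!: restrict_ext)

lemma top_form_add: "top_form n t \<oplus>\<^bsub>de_rham_forms n N (int n)\<^esub> top_form n t' = top_form n (t \<oplus>\<^bsub>N\<^esub> t')"
  by (auto simp: top_form_def intro!: restrict_ext)

lemma top_form_smult: "c \<odot>\<^bsub>de_rham_forms n N (int n)\<^esub> top_form n t = top_form n (scalar_op n c \<odot>\<^bsub>N\<^esub> t)"
  by (auto simp: top_form_def intro!: restrict_ext)

lemma de_rham_diff_hom:
  fixes N :: "('k::field_char_0 diff_op, 'x) module"
  assumes N: "left_module (diff_op_ring n) N"
  shows "restrict (de_rham_diff n N b) (carrier (de_rham_forms n N b)) \<in>
    lin_hom base_field (de_rham_forms n N b) (de_rham_forms n N (b + 1))"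
  by (rule lin_hom_restrict[OF dd_closed[OF N] dd_add[OF N] dd_smult[OF N] left_module_de_rham_forms[OF N]])

section \<open>The double complex of a free resolution\<close>

locale free_resolution =
  fixes n :: nat and r :: "nat \<Rightarrow> nat" and \<delta> :: "nat \<Rightarrow> 'k::field_char_0 mpoly \<Rightarrow> 'k mpoly" and \<epsilon> :: "'k mpoly \<Rightarrow> 'm"
    and M :: "('k diff_op, 'm) module"
  assumes res: "exact_resolution (diff_op_ring n) (\<lambda>a. free_module n (r a)) \<delta> \<epsilon> M"
begin

abbreviation "F a \<equiv> free_module n (r a) :: ('k diff_op, 'k mpoly) module"

lemmas res_M = exact_resolutionD(1)[OF res] and delta_hom = exact_resolutionD(3)[OF res] and eps_hom = exact_resolutionD(4)[OF res]

sublocale dc: double_complex base_field "\<lambda>a b. de_rham_forms n (F a) b" "\<lambda>b. de_rham_forms n M b"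
  "\<lambda>a b. restrict (form_map n b (\<delta> a)) (carrier (de_rham_forms n (F (Suc a)) b))"
  "\<lambda>b. restrict (form_map n b \<epsilon>) (carrier (de_rham_forms n (F 0) b))"
  "\<lambda>a b. restrict (de_rham_diff n (F a) b) (carrier (de_rham_forms n (F a) b))"
  "\<lambda>b. restrict (de_rham_diff n M b) (carrier (de_rham_forms n M b))" "int n"
proof (rule double_complex.intro)
  fix a b and x :: "nat set \<Rightarrow> 'k mpoly"
  note F = left_module_free_module[of n "r a"] left_module_free_module[of n "r (Suc a)"]
  show "exact_resolution base_field (\<lambda>a. de_rham_forms n (F a) b)
      (\<lambda>a. restrict (form_map n b (\<delta> a)) (carrier (de_rham_forms n (F (Suc a)) b)))
      (restrict (form_map n b \<epsilon>) (carrier (de_rham_forms n (F 0) b))) (de_rham_forms n M b)"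
    by (rule form_map_resolution[OF res])
  show "restrict (de_rham_diff n (F a) b) (carrier (de_rham_forms n (F a) b)) \<in> lin_hom base_field (de_rham_forms n (F a) b) (de_rham_forms n (F a) (b + 1))"
    by (rule de_rham_diff_hom[OF F(1)])
  show "restrict (de_rham_diff n M b) (carrier (de_rham_forms n M b)) \<in> lin_hom base_field (de_rham_forms n M b) (de_rham_forms n M (b + 1))"
    by (rule de_rham_diff_hom[OF res_M])
  { assume x: "x \<in> carrier (de_rham_forms n (F (Suc a)) b)"
    show "restrict (de_rham_diff n (F a) b) (carrier (de_rham_forms n (F a) b))
        (restrict (form_map n b (\<delta> a)) (carrier (de_rham_forms n (F (Suc a)) b)) x) =
      restrict (form_map n (b + 1) (\<delta> a)) (carrier (de_rham_forms n (F (Suc a)) (b + 1)))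
        (restrict (de_rham_diff n (F (Suc a)) b) (carrier (de_rham_forms n (F (Suc a)) b)) x)"
      using dd_form_map[OF F(2,1) delta_hom x] form_map_closed[OF delta_hom x] dd_closed[OF F(2) x] x
      by (simp only: restrict_apply' ) }
  { assume x: "x \<in> carrier (de_rham_forms n (F 0) b)"
    note F0 = left_module_free_module[of n "r 0"]
    show "restrict (de_rham_diff n M b) (carrier (de_rham_forms n M b))
        (restrict (form_map n b \<epsilon>) (carrier (de_rham_forms n (F 0) b)) x) =
      restrict (form_map n (b + 1) \<epsilon>) (carrier (de_rham_forms n (F 0) (b + 1)))
        (restrict (de_rham_diff n (F 0) b) (carrier (de_rham_forms n (F 0) b)) x)"
      using dd_form_map[OF F0 res_M eps_hom x] form_map_closed[OF eps_hom x] dd_closed[OF F0 x] x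
      by (simp only: restrict_apply') }
  { assume x: "x \<in> carrier (de_rham_forms n (F a) b)"
    show "restrict (de_rham_diff n (F a) (b + 1)) (carrier (de_rham_forms n (F a) (b + 1)))
        (restrict (de_rham_diff n (F a) b) (carrier (de_rham_forms n (F a) b)) x) = \<zero>\<^bsub>de_rham_forms n (F a) (b + 1 + 1)\<^esub>"
      using de_rham_diff_diff_free[OF x] dd_closed[OF F(1) x] x by (simp only: restrict_apply') }
  { assume b: "b + 1 < int n" and x: "x \<in> carrier (de_rham_forms n (F a) (b + 1))"
      and "restrict (de_rham_diff n (F a) (b + 1)) (carrier (de_rham_forms n (F a) (b + 1))) x = \<zero>\<^bsub>de_rham_forms n (F a) (b + 1 + 1)\<^esub>"
    then have "de_rham_diff n (F a) (b + 1) x = \<zero>\<^bsub>de_rham_forms n (F a) (b + 1 + 1)\<^esub>" by (simp only: restrict_apply')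
    from de_rham_exact_free[OF x b this]
    obtain y where y: "y \<in> carrier (de_rham_forms n (F a) b)" "de_rham_diff n (F a) b y = x" by blast
    show "\<exists>y \<in> carrier (de_rham_forms n (F a) b). restrict (de_rham_diff n (F a) b) (carrier (de_rham_forms n (F a) b)) y = x"
      by (rule bexI[OF _ y(1)]) (simp only: restrict_apply'[OF y(1)] y(2)) }
qed

lemma delta_closed: "t \<in> symbols n (r (Suc a)) \<Longrightarrow> \<delta> a t \<in> symbols n (r a)"
  using lin_hom_closed[OF delta_hom] by simp

lemma top_form_closed: "top_form n t \<in> carrier (de_rham_forms n (F a) (int n)) \<longleftrightarrow> t \<in> symbols n (r a)"
  by (simp only: de_rham_forms_sel top_form_in free_module_sel)

lemma top_form_ex: "u \<in> carrier (de_rham_forms n (F a) (int n)) \<Longrightarrow> \<exists>t \<in> symbols n (r a). u = top_form n t"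
  using top_form_all[of u n "symbols n (r a)"] by simp

lemma cycle_iff: "dc.cycle i (int n) (top_form n t) \<longleftrightarrow> t \<in> top_cycles n r \<delta> i"
proof (cases i)
  case 0
  then show ?thesis unfolding dc.cycle_def top_cycles_def top_form_closed by simp
next
  case (Suc a)
  show ?thesis
  proof (cases "t \<in> symbols n (r (Suc a))")
    case True
    then have "restrict (form_map n (int n) (\<delta> a)) (carrier (de_rham_forms n (F (Suc a)) (int n))) (top_form n t) = top_form n (\<delta> a t)"
      by (simp only: restrict_apply' top_form_closed form_map_top)
    then show ?thesis using True top_form_d[of n "r a" "\<delta> a t"]
      unfolding dc.cycle_def top_cycles_def Suc top_form_closed by simp
  qed (simp add: dc.cycle_def top_cycles_def Suc top_form_closed del: de_rham_forms_sel)
qed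

lemma boundary_iff:
  assumes "t \<in> symbols n (r i)"
  shows "dc.boundary i (int n) (top_form n t) \<longleftrightarrow> t \<in> top_boundaries n r \<delta> i"
proof
  assume "dc.boundary i (int n) (top_form n t)"
  then obtain p q where p: "p \<in> carrier (de_rham_forms n (F i) (int n - 1))" and q: "q \<in> carrier (de_rham_forms n (F (Suc i)) (int n))"
    and eq: "top_form n t = restrict (de_rham_diff n (F i) (int n - 1)) (carrier (de_rham_forms n (F i) (int n - 1))) p
      \<oplus>\<^bsub>de_rham_forms n (F i) (int n)\<^esub> restrict (form_map n (int n) (\<delta> i)) (carrier (de_rham_forms n (F (Suc i)) (int n))) q"
    unfolding dc.boundary_def by blast
  obtain q' where q': "q' \<in> symbols n (r (Suc i))" "q = top_form n q'" using top_form_ex[OF q] by blast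
  have "de_rham_diff n (F i) (int n - 1) p \<in> carrier (de_rham_forms n (F i) (int n))"
    using dd_closed[OF left_module_free_module p] by simp
  then obtain y where y: "y \<in> symbols n (r i)" "de_rham_diff n (F i) (int n - 1) p = top_form n y" using top_form_ex by blast
  then have "y \<in> deriv_span n (r i)" using p top_form_d[of n "r i" y] by blast
  moreover have "top_form n t = top_form n (y + \<delta> i q')"
    using eq p q unfolding y(2) q'(2) by (simp only: restrict_apply' y(2) form_map_top top_form_add free_module_sel)
  ultimately show "t \<in> top_boundaries n r \<delta> i" using q'(1) unfolding top_boundaries_def top_form_inj by blast
next
  assume "t \<in> top_boundaries n r \<delta> i"
  then obtain y q where y: "y \<in> deriv_span n (r i)" and q: "q \<in> symbols n (r (Suc i))" and t: "t = y + \<delta> i q"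
    unfolding top_boundaries_def by blast
  obtain p where p: "p \<in> carrier (de_rham_forms n (F i) (int n - 1))" "de_rham_diff n (F i) (int n - 1) p = top_form n y"
    using y top_form_d[of n "r i" y] by blast
  have q': "top_form n q \<in> carrier (de_rham_forms n (F (Suc i)) (int n))" using q by (simp only: top_form_closed)
  have "top_form n t = restrict (de_rham_diff n (F i) (int n - 1)) (carrier (de_rham_forms n (F i) (int n - 1))) p
      \<oplus>\<^bsub>de_rham_forms n (F i) (int n)\<^esub> restrict (form_map n (int n) (\<delta> i)) (carrier (de_rham_forms n (F (Suc i)) (int n))) (top_form n q)"
    using p q' by (simp only: restrict_apply' t form_map_top top_form_add free_module_sel)
  then show "dc.boundary i (int n) (top_form n t)" unfolding dc.boundary_def using p(1) q' by blast
qed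

section \<open>Cohomology of \<open>M\<close> through cycles of top degree\<close>

abbreviation "closed_forms b \<equiv> (de_rham_forms n M b)\<lparr>carrier :=
  {w \<in> carrier (de_rham_forms n M b). de_rham_diff n M b w = \<zero>\<^bsub>de_rham_forms n M (b + 1)\<^esub>}\<rparr>"
abbreviation "exact_forms b \<equiv> de_rham_diff n M (b - 1) ` carrier (de_rham_forms n M (b - 1))"

lemma closed_forms_submodule:
  "submodule_set base_field (de_rham_forms n M b) {w \<in> carrier (de_rham_forms n M b). de_rham_diff n M b w = \<zero>\<^bsub>de_rham_forms n M (b + 1)\<^esub>}"
proof -
  have "{w \<in> carrier (de_rham_forms n M b). de_rham_diff n M b w = \<zero>\<^bsub>de_rham_forms n M (b + 1)\<^esub>} =
     {w \<in> carrier (de_rham_forms n M b). restrict (de_rham_diff n M b) (carrier (de_rham_forms n M b)) w = \<zero>\<^bsub>de_rham_forms n M (b + 1)\<^esub>}"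
    by (auto simp only: restrict_apply')
  then show ?thesis
    using submodule_set_kernel[OF left_module_de_rham_forms[OF res_M] left_module_de_rham_forms[OF res_M] de_rham_diff_hom[OF res_M]] by simp
qed

lemma cohomology_quotient_space: "quotient_space (closed_forms b) (exact_forms b)"
proof (rule quotient_space.intro[OF left_module_sub[OF left_module_de_rham_forms[OF res_M] closed_forms_submodule]])
  have "exact_forms b = restrict (de_rham_diff n M (b - 1)) (carrier (de_rham_forms n M (b - 1))) ` carrier (de_rham_forms n M (b - 1))"
    by (rule image_cong[OF refl]) (simp only: restrict_apply')
  then have "submodule_set base_field (de_rham_forms n M (b - 1 + 1)) (exact_forms b)"
    using submodule_set_image[OF left_module_de_rham_forms[OF res_M] left_module_de_rham_forms[OF res_M] de_rham_diff_hom[OF res_M], of "b - 1"] by simp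
  moreover have "de_rham_diff n M b (de_rham_diff n M (b - 1) v) = \<zero>\<^bsub>de_rham_forms n M (b + 1)\<^esub>"
    if v: "v \<in> carrier (de_rham_forms n M (b - 1))" for v
    using dc.dY_dY[OF v] dd_closed[OF res_M v] v by (simp add: restrict_apply' del: de_rham_forms_sel)
  ultimately show "submodule_set base_field (closed_forms b) (exact_forms b)"
    by (auto simp add: submodule_set_def simp del: de_rham_forms_sel)
qed

text \<open>The zigzag relation is additive and matches exact forms with boundaries, so the class of
  \<open>w\<close> depends only on \<open>t\<close>. The result is a surjection from cycles with the
  boundaries as kernel, because the duality evaluates functionals at representatives.\<close>

theorem homology_zigzag:
  fixes i :: nat
  defines "H \<equiv> de_rham_cohomology n M (int n - int i)"
  shows "left_module base_field H" "\<exists>h. (\<forall>t \<in> top_cycles n r \<delta> i. h t \<in> carrier H) \<and>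
    (\<forall>t \<in> top_cycles n r \<delta> i. \<forall>t' \<in> top_cycles n r \<delta> i. h (t + t') = h t \<oplus>\<^bsub>H\<^esub> h t') \<and>
    (\<forall>c. \<forall>t \<in> top_cycles n r \<delta> i. h (const_poly c * t) = c \<odot>\<^bsub>H\<^esub> h t) \<and>
    (\<forall>C \<in> carrier H. \<exists>t \<in> top_cycles n r \<delta> i. h t = C) \<and>
    (\<forall>t \<in> top_cycles n r \<delta> i. h t = \<zero>\<^bsub>H\<^esub> \<longleftrightarrow> t \<in> top_boundaries n r \<delta> i)"
proof -
  define j where "j = int n - int i"
  have ji: "j + int i = int n" by (simp add: j_def)
  interpret S: quotient_space "closed_forms j" "exact_forms j" by (rule cohomology_quotient_space)
  let ?V = "closed_forms j" and ?cyc = "top_cycles n r \<delta> i"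
  have H: "H = S.Q" by (simp add: H_def de_rham_cohomology_def j_def)
  show "left_module base_field H" unfolding H by (rule S.left_module_quot)
  define rel where "rel w t \<longleftrightarrow> dc.zigzag j i w (top_form n t)" for w t
  have rel: "w \<in> carrier ?V" "t \<in> ?cyc" "t \<in> symbols n (r i)" if "rel w t" for w t
  proof -
    note z = that[unfolded rel_def]
    show cyc: "t \<in> ?cyc" using dc.zigzag_cycle[OF z] unfolding ji cycle_iff .
    then show t: "t \<in> symbols n (r i)" by (simp add: top_cycles_def)
    have w: "w \<in> carrier (de_rham_forms n M j)" using dc.zigzag_closed[OF z] by blast
    have "restrict (de_rham_diff n M j) (carrier (de_rham_forms n M j)) w = \<zero>\<^bsub>de_rham_forms n M (j + 1)\<^esub>"
    proof (rule dc.zigzag_dY[OF z])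
      \<comment> \<open>Here the form has degree \<open>n\<close>, and it is closed because there
        are no forms of degree \<open>n + 1\<close>.\<close>
      assume i: "i = 0"
      then have j: "j = int n" using ji by simp
      have tt: "top_form n t \<in> carrier (de_rham_forms n (F 0) j)" unfolding j top_form_closed using t i by simp
      have "de_rham_diff n (F 0) j (top_form n t) \<in> carrier (de_rham_forms n (F 0) (j + 1))"
        by (rule dd_closed[OF left_module_free_module tt])
      then have "de_rham_diff n (F 0) j (top_form n t) = \<zero>\<^bsub>de_rham_forms n (F 0) (j + 1)\<^esub>"
        by (simp add: j form_indices_above_top restrict_def)
      then show "restrict (de_rham_diff n (F 0) j) (carrier (de_rham_forms n (F 0) j)) (top_form n t) = \<zero>\<^bsub>de_rham_forms n (F 0) (j + 1)\<^esub>"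
        by (simp only: restrict_apply'[OF tt])
    qed
    then have "de_rham_diff n M j w = \<zero>\<^bsub>de_rham_forms n M (j + 1)\<^esub>" by (simp only: restrict_apply'[OF w])
    then show "w \<in> carrier ?V" using w by (simp del: de_rham_forms_sel)
  qed
  have add: "rel (w \<oplus>\<^bsub>?V\<^esub> w') (t + t')" if "rel w t" "rel w' t'" for w w' t t'
    using dc.zigzag_add[OF that[unfolded rel_def]] unfolding rel_def ji top_form_add by simp
  have smult: "rel (c \<odot>\<^bsub>?V\<^esub> w) (const_poly c * t)" if "rel w t" for c w t
    using dc.zigzag_smult[OF _ that[unfolded rel_def], of c] sym_action_gens(1)[OF rel(3)[OF that], of c]
    unfolding rel_def ji top_form_smult by simp
  have exact: "w \<in> exact_forms j \<longleftrightarrow> t \<in> top_boundaries n r \<delta> i" if R: "rel w t" for w t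
  proof -
    note z = R[unfolded rel_def]
    have "w \<in> exact_forms j \<longleftrightarrow> (\<exists>v \<in> carrier (de_rham_forms n M (j - 1)).
        w = restrict (de_rham_diff n M (j - 1)) (carrier (de_rham_forms n M (j - 1))) v)"
      by (auto simp del: de_rham_forms_sel)
    also have "\<dots> \<longleftrightarrow> dc.boundary i (int n) (top_form n t)"
      using dc.zigzag_boundary[OF z] dc.boundary_zigzag[OF z] unfolding ji by blast
    finally show ?thesis unfolding boundary_iff[OF rel(3)[OF R]] .
  qed
  have minus: "rel (w \<ominus>\<^bsub>?V\<^esub> w') (t - t')" if R: "rel w t" "rel w' t'" for w w' t t'
  proof -
    have "(- 1) \<odot>\<^bsub>?V\<^esub> w' = \<ominus>\<^bsub>?V\<^esub> w'"
      using S.smult_minus_one[OF rel(1)[OF R(2)]] by (simp only: base_field_uminus base_field_sel)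
    moreover have "const_poly (- 1) * t' = - t'" by (rule poly_mapping_eqI) simp
    ultimately show ?thesis using add[OF R(1) smult[OF R(2), of "- 1"]] by (simp add: a_minus_def)
  qed
  have ex_t: "\<exists>t. rel w t" if w: "w \<in> carrier ?V" for w
  proof -
    have w': "w \<in> carrier (de_rham_forms n M j)" "de_rham_diff n M j w = \<zero>\<^bsub>de_rham_forms n M (j + 1)\<^esub>"
      using w by (simp_all del: de_rham_forms_sel)
    then have "restrict (de_rham_diff n M j) (carrier (de_rham_forms n M j)) w = \<zero>\<^bsub>de_rham_forms n M (j + 1)\<^esub>"
      by (simp only: restrict_apply')
    from dc.zigzag_exists[OF w'(1) this] obtain u where u: "dc.zigzag j i w u" by blast
    then have "u \<in> carrier (de_rham_forms n (F i) (int n))" using dc.zigzag_closed[OF u] unfolding ji by blast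
    then show ?thesis using u top_form_ex unfolding rel_def by blast
  qed
  have ex_w: "\<exists>w. rel w t" if "t \<in> ?cyc" for t
    using dc.cycle_zigzag[of i j "top_form n t"] that unfolding ji cycle_iff rel_def by simp
  define h where "h t = S.cl (SOME w. rel w t)" for t
  have h: "h t = S.cl w" if R: "rel w t" for w t
  proof -
    have R': "rel (SOME w. rel w t) t" by (rule someI[of "\<lambda>w. rel w t", OF R])
    have "0 \<in> top_boundaries n r \<delta> i"
      using lin_hom_zero[OF left_module_free_module left_module_free_module delta_hom] deriv_span_zero
      unfolding top_boundaries_def by (intro CollectI exI[of _ 0]) simp
    then show ?thesis unfolding h_def S.cl_eq_iff[OF rel(1)[OF R'] rel(1)[OF R]] using exact[OF minus[OF R' R]] by simp
  qed
  have zero: "S.cl w = \<zero>\<^bsub>S.Q\<^esub> \<longleftrightarrow> w \<in> exact_forms j" if w: "w \<in> carrier ?V" for w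
    using left_module_minus(3)[OF S.V w S.zero_closed]
    unfolding S.cl_zero S.cl_eq_iff[OF w S.zero_closed] by (simp only: S.r_zero[OF w])
  show "\<exists>h. (\<forall>t \<in> ?cyc. h t \<in> carrier H) \<and>
    (\<forall>t \<in> ?cyc. \<forall>t' \<in> ?cyc. h (t + t') = h t \<oplus>\<^bsub>H\<^esub> h t') \<and>
    (\<forall>c. \<forall>t \<in> ?cyc. h (const_poly c * t) = c \<odot>\<^bsub>H\<^esub> h t) \<and>
    (\<forall>C \<in> carrier H. \<exists>t \<in> ?cyc. h t = C) \<and>
    (\<forall>t \<in> ?cyc. h t = \<zero>\<^bsub>H\<^esub> \<longleftrightarrow> t \<in> top_boundaries n r \<delta> i)"
    unfolding H
  proof (intro exI[of _ h] conjI ballI allI)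
    fix t assume "t \<in> ?cyc"
    then obtain w where w: "rel w t" using ex_w by blast
    show "h t \<in> carrier S.Q" using S.cl_closed[OF rel(1)[OF w]] unfolding h[OF w] .
    show "h (const_poly c * t) = c \<odot>\<^bsub>S.Q\<^esub> h t" for c
      using S.cl_smult[OF rel(1)[OF w], of c] unfolding h[OF w] h[OF smult[OF w]] by (rule sym)
    show "h t = \<zero>\<^bsub>S.Q\<^esub> \<longleftrightarrow> t \<in> top_boundaries n r \<delta> i"
      unfolding h[OF w] zero[OF rel(1)[OF w]] by (rule exact[OF w])
    fix t' assume "t' \<in> ?cyc"
    then obtain w' where w': "rel w' t'" using ex_w by blast
    show "h (t + t') = h t \<oplus>\<^bsub>S.Q\<^esub> h t'"
      using S.cl_add[OF rel(1)[OF w] rel(1)[OF w']] unfolding h[OF w] h[OF w'] h[OF add[OF w w']] by (rule sym)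
  next
    fix C assume "C \<in> carrier S.Q"
    then obtain w where w: "w \<in> carrier ?V" "C = S.cl w" unfolding S.carrier_quot by blast
    obtain t where "rel w t" using ex_t[OF w(1)] by blast
    then show "\<exists>t \<in> ?cyc. h t = C" using rel(2) h w(2) by blast
  qed
qed

end

section \<open>Duality\<close>

lemma cut_sym_deriv_span: "s \<in> {1..n} \<Longrightarrow> v \<in> symbols n r \<Longrightarrow> cut n \<gamma> I (sym_deriv n s v) \<in> deriv_span n r"
  by (intro deriv_span_cut sym_deriv_in_deriv_span)

lemma cut_cut: "cut n \<gamma> I (cut n \<gamma> J v) = cut n \<gamma> (I \<inter> J) v"
  by (rule poly_mapping_eqI) (simp add: lookup_cut)

lemma cut_bounded: "\<exists>N. cut n \<gamma> {..<N} v = v"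
proof -
  have "bdd_above (gdeg n \<gamma> ` keys v)" by (intro bdd_above_finite finite_imageI finite_keys)
  then obtain N where N: "\<And>m. m \<in> keys v \<Longrightarrow> gdeg n \<gamma> m \<le> N" by (auto simp: bdd_above_def)
  have "cut n \<gamma> {..<N + 1} v = v"
    by (rule poly_mapping_eqI) (use N in \<open>force simp: lookup_cut in_keys_iff\<close>)
  then show ?thesis ..
qed

text \<open>Truncation commutes with the derivatives up to a shift of the bound, so it maps
  \<open>deriv_span\<close> into itself, where \<mu> vanishes; in large degrees the functional
  vanishes by construction.\<close>

lemma truncation_admissible:
  fixes \<mu> :: "'k::field_char_0 mpoly \<Rightarrow> 'k"
  assumes \<mu>: "\<And>x y. \<mu> (x + y) = \<mu> x + \<mu> y" "\<And>c x. \<mu> (const_poly c * x) = c * \<mu> x"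
    and der: "\<And>y. y \<in> deriv_span n r \<Longrightarrow> \<mu> y = 0"
  shows "admissible n r \<gamma> (\<lambda>v. \<mu> (cut n \<gamma> {..<N} v))"
  unfolding admissible_def
proof (intro conjI ballI allI exI[of _ N])
  show "\<mu> (cut n \<gamma> {..<N} (sym_deriv n j v)) = 0" if "j \<in> {1..n}" "v \<in> symbols n r" for j v
    using that by (intro der cut_sym_deriv_span)
qed (simp_all add: cut_add cut_const cut_cut \<mu>)

section \<open>Pairing of cocycles with cycles of top degree\<close>

locale graded_free_resolution_complex = free_resolution n r \<delta> \<epsilon> M
  for n :: nat and r and \<delta> :: "nat \<Rightarrow> 'k::field_char_0 mpoly \<Rightarrow> 'k mpoly" and \<epsilon> and M :: "('k diff_op, 'm) module" +
  fixes \<gamma> :: "nat \<Rightarrow> nat \<Rightarrow> int"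
  assumes delta_cut: "v \<in> symbols n (r (Suc a)) \<Longrightarrow> \<delta> a (cut n (\<gamma> (Suc a)) I v) = cut n (\<gamma> a) I (\<delta> a v)"
begin

abbreviation "D \<equiv> diff_op_ring n :: 'k diff_op ring"
abbreviation "E \<equiv> inverse_poly_module n :: ('k diff_op, 'k laurent) module"
abbreviation "cyc i \<equiv> top_cycles n r \<delta> i"
abbreviation "bnd i \<equiv> top_boundaries n r \<delta> i"
abbreviation "cocyc i \<equiv> ext_cocycles D F \<delta> E i"
abbreviation "res \<equiv> residue n"

lemmas delta_free = free_hom_free[OF delta_hom]
lemmas E_mod = inverse_module_sel(1)[of n]

lemma delta_delta: "q \<in> symbols n (r (Suc (Suc a))) \<Longrightarrow> \<delta> a (\<delta> (Suc a) q) = 0"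
  using exact_resolutionD(7)[OF free_resolution.res[OF free_resolution_axioms]] by simp

lemma delta_deriv_span:
  assumes "y \<in> deriv_span n (r (Suc a))"
  shows "\<delta> a y \<in> deriv_span n (r a)"
proof -
  obtain x where x: "y = (\<Sum>s = 1..n. sym_deriv n s (x s))" "\<And>s. x s \<in> symbols n (r (Suc a))"
    using assms by (auto simp: deriv_span_def)
  have "\<delta> a (\<Sum>s \<in> A. sym_deriv n s (x s)) = (\<Sum>s \<in> A. sym_deriv n s (\<delta> a (x s)))" if "finite A" "A \<subseteq> {1..n}" for A
    using that
  proof (induction A rule: finite_induct)
    case empty
    then show ?case by (simp add: delta_free(5))
  next
    case (insert s A)
    have "(\<Sum>s \<in> A. sym_deriv n s (x s)) \<in> symbols n (r (Suc a))"
      using insert x(2) by (intro symbols_sum symbols_sym_deriv) auto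
    then show ?case using insert x(2) by (simp add: delta_free(1,4) subset_iff)
  qed
  then have "\<delta> a y = (\<Sum>s = 1..n. sym_deriv n s (\<delta> a (x s)))" unfolding x(1) by blast
  then show ?thesis unfolding deriv_span_def using x(2) delta_closed by (intro CollectI exI[of _ "\<lambda>s. \<delta> a (x s)"]) blast
qed

lemma cyc_symbols: "t \<in> cyc i \<Longrightarrow> t \<in> symbols n (r i)"
  by (simp add: top_cycles_def)

lemma cyc_add: "t \<in> cyc i \<Longrightarrow> t' \<in> cyc i \<Longrightarrow> t + t' \<in> cyc i"
  by (cases i) (auto simp: top_cycles_def delta_free(1) deriv_span_add)

lemma cyc_const: "t \<in> cyc i \<Longrightarrow> const_poly c * t \<in> cyc i"
  by (cases i) (auto simp: top_cycles_def delta_free(2) deriv_span_const)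

lemma cyc_diff:
  assumes "t \<in> cyc i" "t' \<in> cyc i"
  shows "t - t' \<in> cyc i"
proof -
  have "const_poly (- 1) * t' = - t'" by (rule poly_mapping_eqI) simp
  then show ?thesis using cyc_add[OF assms(1) cyc_const[OF assms(2), of "- 1"]] by simp
qed

lemma cyc_cut: "t \<in> cyc i \<Longrightarrow> cut n (\<gamma> i) I t \<in> cyc i"
  by (cases i) (auto simp: top_cycles_def delta_cut deriv_span_cut)

lemma deriv_span_bnd: "y \<in> deriv_span n (r i) \<Longrightarrow> y \<in> bnd i"
  unfolding top_boundaries_def by (intro CollectI exI[of _ y] exI[of _ 0]) (simp add: delta_free(5))

lemma delta_bnd: "q \<in> symbols n (r (Suc i)) \<Longrightarrow> \<delta> i q \<in> bnd i"
  unfolding top_boundaries_def by (intro CollectI exI[of _ 0] exI[of _ q]) (simp add: deriv_span_zero)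

lemma zero_bnd: "0 \<in> bnd i"
  by (rule deriv_span_bnd[OF deriv_span_zero])

lemma bnd_cyc:
  assumes "t \<in> bnd i"
  shows "t \<in> cyc i"
proof -
  obtain y q where t: "t = y + \<delta> i q" "y \<in> deriv_span n (r i)" "q \<in> symbols n (r (Suc i))"
    using assms by (auto simp: top_boundaries_def)
  have "y \<in> symbols n (r i)" using t(2) deriv_span_symbols by blast
  then have "y \<in> cyc i" using t(2) by (cases i) (auto simp: top_cycles_def delta_deriv_span)
  moreover have "\<delta> i q \<in> cyc i"
    using t(3) by (cases i) (auto simp: top_cycles_def delta_closed delta_delta deriv_span_zero)
  ultimately show ?thesis unfolding t(1) by (rule cyc_add)
qed

lemma bnd_cut:
  assumes "t \<in> bnd i"
  shows "cut n (\<gamma> i) I t \<in> bnd i"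
proof -
  obtain y q where t: "t = y + \<delta> i q" "y \<in> deriv_span n (r i)" "q \<in> symbols n (r (Suc i))"
    using assms by (auto simp: top_boundaries_def)
  have "cut n (\<gamma> i) I t = cut n (\<gamma> i) I y + \<delta> i (cut n (\<gamma> (Suc i)) I q)"
    using t(3) by (simp add: t(1) cut_add delta_cut)
  moreover have "cut n (\<gamma> (Suc i)) I q \<in> symbols n (r (Suc i))" using t(3) by simp
  ultimately show ?thesis using deriv_span_cut[OF t(2), of "\<gamma> i" I] unfolding top_boundaries_def by blast
qed

lemma cocyc_hom: "\<theta> \<in> cocyc i \<Longrightarrow> \<theta> \<in> lin_hom D (F i) E"
  by (simp add: ext_cocycles_def)

lemma res_zero: "res 0 = 0"
  using residue_add[of n 0 0] by simp

lemma res_hom: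
  assumes "\<theta> \<in> lin_hom D (F i) E" "v \<in> symbols n (r i)"
  shows "w \<in> symbols n (r i) \<Longrightarrow> res (\<theta> (v + w)) = res (\<theta> v) + res (\<theta> w)" "res (\<theta> (const_poly c * v)) = c * res (\<theta> v)"
  using residue_admissible[OF assms(1)] assms(2) unfolding admissible_def by blast+

lemma cocyc_bnd:
  assumes "\<theta> \<in> cocyc i" "t \<in> bnd i"
  shows "res (\<theta> t) = 0"
proof -
  note \<theta> = cocyc_hom[OF assms(1)]
  obtain y q where t: "t = y + \<delta> i q" "y \<in> deriv_span n (r i)" "q \<in> symbols n (r (Suc i))"
    using assms by (auto simp: top_boundaries_def)
  have "y \<in> symbols n (r i)" using t(2) deriv_span_symbols by blast
  then have "res (\<theta> t) = res (\<theta> y) + res (\<theta> (\<delta> i q))" unfolding t(1) using res_hom(1)[OF \<theta>] t(3) delta_closed by blast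
  moreover have "res (\<theta> y) = 0" by (rule admissible_deriv_span[OF residue_admissible[OF \<theta>] t(2)])
  moreover have "\<theta> (\<delta> i q) = 0" using assms(1) t(3) by (simp add: ext_cocycles_def inverse_module_sel(3))
  ultimately show ?thesis by (simp add: res_zero)
qed

text \<open>A homomorphism into \<open>E\<close> is determined by its residues, so the cocycle
  condition may be tested on residues.\<close>

lemma cocycI:
  assumes \<theta>: "\<theta> \<in> lin_hom D (F i) E" and "\<And>q. q \<in> symbols n (r (Suc i)) \<Longrightarrow> res (\<theta> (\<delta> i q)) = 0"
  shows "\<theta> \<in> cocyc i"
proof -
  have "compose (carrier (F (Suc i))) \<theta> (\<delta> i) = (\<lambda>x \<in> carrier (F (Suc i)). \<zero>\<^bsub>E\<^esub>)"
    by (rule hom_eq_residue[OF lin_hom_compose[OF left_module_free_module delta_hom \<theta>] hom_zero[OF left_module_free_module E_mod]])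
       (simp add: compose_def assms(2) inverse_module_sel(3) res_zero)
  then have "\<theta> (\<delta> i q) = \<zero>\<^bsub>E\<^esub>" if "q \<in> symbols n (r (Suc i))" for q
    using that by (auto simp: compose_def dest!: fun_cong[of _ _ q])
  then show ?thesis using \<theta> by (simp add: ext_cocycles_def)
qed

lemma coboundary_residue:
  assumes \<theta>: "\<theta> \<in> ext_coboundaries D F \<delta> E i" and t: "t \<in> cyc i"
  shows "res (\<theta> t) = 0"
proof (cases i)
  case 0
  then show ?thesis using \<theta> cyc_symbols[OF t] by (simp add: ext_coboundaries_def inverse_module_sel(3) res_zero)
next
  case (Suc a)
  then obtain \<chi> where \<chi>: "\<chi> \<in> lin_hom D (F a) E" "\<theta> = compose (carrier (F (Suc a))) \<chi> (\<delta> a)"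
    using \<theta> by (auto simp: ext_coboundaries_def)
  have "\<delta> a t \<in> deriv_span n (r a)" using t by (simp add: top_cycles_def Suc)
  then have "res (\<chi> (\<delta> a t)) = 0" by (rule admissible_deriv_span[OF residue_admissible[OF \<chi>(1)]])
  then show ?thesis using cyc_symbols[OF t] by (simp add: \<chi>(2) compose_def Suc)
qed

text \<open>The factor of the residue of \<theta> through \<delta> has no reason to vanish in large
  degrees. It may be truncated at the bound \<open>N\<close> of \<theta> itself: \<delta> respects
  degrees, and the residue of \<theta> does not change under truncation at \<open>N\<close>.\<close>

lemma residue_coboundary:
  assumes \<theta>: "\<theta> \<in> cocyc i" and t: "\<And>t. t \<in> cyc i \<Longrightarrow> res (\<theta> t) = 0"
  shows "\<theta> \<in> ext_coboundaries D F \<delta> E i"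
proof (cases i)
  case 0
  have "\<theta> = (\<lambda>x \<in> carrier (F i). \<zero>\<^bsub>E\<^esub>)"
    by (rule hom_eq_residue[OF cocyc_hom[OF \<theta>] hom_zero[OF left_module_free_module E_mod]])
       (simp add: t 0 top_cycles_def inverse_module_sel(3) res_zero)
  then show ?thesis by (simp add: ext_coboundaries_def 0)
next
  case (Suc a)
  note \<theta>' = cocyc_hom[OF \<theta>, unfolded Suc]
  let ?S = "symbols n (r (Suc a))" and ?B = "deriv_span n (r a)"
  txt \<open>On \<open>\<delta> Q\<^sub>i + \<partial>Q\<^sub>a\<close> the residue of \<open>\<theta>\<close> factors through \<open>\<delta>\<close>; a truncated extension of the factor is
    the residue of a preimage \<open>\<chi>\<close>.\<close>
  define Z where "Z = {\<delta> a t + y |t y. t \<in> ?S \<and> y \<in> ?B}"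
  define \<nu> where "\<nu> z = res (\<theta> (SOME t. t \<in> ?S \<and> z - \<delta> a t \<in> ?B))" for z
  \<comment> \<open>The chosen preimage is immaterial: two choices differ by a cycle, on which
    \<theta> has residue 0.\<close>
  have \<nu>: "\<nu> (\<delta> a t + y) = res (\<theta> t)" if ty: "t \<in> ?S" "y \<in> ?B" for t y
  proof -
    define t' where "t' = (SOME t'. t' \<in> ?S \<and> \<delta> a t + y - \<delta> a t' \<in> ?B)"
    have "t \<in> ?S \<and> \<delta> a t + y - \<delta> a t \<in> ?B" using ty by simp
    then have t': "t' \<in> ?S" "\<delta> a t + y - \<delta> a t' \<in> ?B"
      using someI[of "\<lambda>t'. t' \<in> ?S \<and> \<delta> a t + y - \<delta> a t' \<in> ?B" t] unfolding t'_def by blast+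
    have "const_poly (- 1) * y = - y" by (rule poly_mapping_eqI) simp
    then have "- y \<in> ?B" using deriv_span_const[OF ty(2), of "- 1"] by simp
    from deriv_span_add[OF t'(2) this] have d: "\<delta> a t - \<delta> a t' \<in> ?B" by simp
    have "\<delta> a (t - t' + t') = \<delta> a (t - t') + \<delta> a t'" by (rule delta_free(1)) (use ty t' in simp_all)
    then have "t - t' \<in> cyc i" using d ty(1) t'(1) by (simp add: top_cycles_def Suc)
    then have "res (\<theta> (t - t')) = 0" by (rule t)
    moreover have "res (\<theta> (t - t' + t')) = res (\<theta> (t - t')) + res (\<theta> t')" by (rule res_hom(1)[OF \<theta>']) (use ty t' in simp_all)
    ultimately show ?thesis by (simp add: \<nu>_def t'_def)
  qed
  obtain \<mu> :: "'k mpoly \<Rightarrow> 'k" where \<mu>: "\<And>x y. \<mu> (x + y) = \<mu> x + \<mu> y" "\<And>c x. \<mu> (const_poly c * x) = c * \<mu> x" "\<And>x. x \<in> Z \<Longrightarrow> \<mu> x = \<nu> x"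
  proof -
    have eq: "(\<delta> a t + y) + (\<delta> a t' + y') = \<delta> a (t + t') + (y + y')" "const_poly c * (\<delta> a t + y) = \<delta> a (const_poly c * t) + const_poly c * y"
      if "t \<in> ?S" "t' \<in> ?S" for t t' y y' c
      using that by (simp_all add: delta_free(1,2) distrib_left)
    have "\<exists>\<mu>. (\<forall>x y. \<mu> (x + y) = \<mu> x + \<mu> y) \<and> (\<forall>c x. \<mu> (const_poly c * x) = c * \<mu> x) \<and> (\<forall>x \<in> Z. \<mu> x = \<nu> x)"
    proof (rule functional_extension)
      show "0 \<in> Z" unfolding Z_def by (intro CollectI exI[of _ 0]) (simp add: delta_free(5) deriv_span_zero)
    next
      fix x x' assume "x \<in> Z" "x' \<in> Z"
      then obtain t y t' y' where x: "t \<in> ?S" "y \<in> ?B" "x = \<delta> a t + y" and x': "t' \<in> ?S" "y' \<in> ?B" "x' = \<delta> a t' + y'"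
        unfolding Z_def by blast
      have e: "x + x' = \<delta> a (t + t') + (y + y')" unfolding x(3) x'(3) by (rule eq(1)[OF x(1) x'(1)])
      have m: "t + t' \<in> ?S" "y + y' \<in> ?B" using x x' by (simp_all add: deriv_span_add)
      show "x + x' \<in> Z" unfolding e Z_def using m by blast
      show "\<nu> (x + x') = \<nu> x + \<nu> x'"
        unfolding e \<nu>[OF m] unfolding x(3) x'(3) \<nu>[OF x(1,2)] \<nu>[OF x'(1,2)] by (rule res_hom(1)[OF \<theta>' x(1) x'(1)])
    next
      fix c x assume "x \<in> Z"
      then obtain t y where x: "t \<in> ?S" "y \<in> ?B" "x = \<delta> a t + y" unfolding Z_def by blast
      have e: "const_poly c * x = \<delta> a (const_poly c * t) + const_poly c * y" unfolding x(3) by (rule eq(2)[OF x(1) x(1)])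
      have m: "const_poly c * t \<in> ?S" "const_poly c * y \<in> ?B" using x by (simp_all add: deriv_span_const)
      show "const_poly c * x \<in> Z" unfolding e Z_def using m by blast
      show "\<nu> (const_poly c * x) = c * \<nu> x"
        unfolding e \<nu>[OF m] unfolding x(3) \<nu>[OF x(1,2)] by (rule res_hom(2)[OF \<theta>' x(1)])
    qed
    then show ?thesis using that by blast
  qed
  have \<mu>Z: "\<mu> (\<delta> a t + y) = res (\<theta> t)" if "t \<in> ?S" "y \<in> ?B" for t y
    using \<mu>(3)[of "\<delta> a t + y"] \<nu>[OF that] that unfolding Z_def by auto
  obtain N where N: "\<And>v. v \<in> ?S \<Longrightarrow> res (\<theta> v) = res (\<theta> (cut n (\<gamma> (Suc a)) {..<N} v))"
    using residue_admissible[OF \<theta>', of "\<gamma> (Suc a)"] unfolding admissible_def by blast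
  have "\<mu> y = 0" if "y \<in> ?B" for y
  proof -
    have "\<theta> 0 = 0" using free_hom(5)[OF E_mod \<theta>'] by (simp add: inverse_module_sel(3))
    then show ?thesis using \<mu>Z[OF symbols_zero that] by (simp add: delta_free(5) res_zero)
  qed
  then have "admissible n (r a) (\<gamma> a) (\<lambda>v. \<mu> (cut n (\<gamma> a) {..<N} v))"
    by (rule truncation_admissible[OF \<mu>(1,2)])
  from admissible_hom[OF this] obtain \<chi> where \<chi>: "\<chi> \<in> lin_hom D (F a) E"
    "\<And>v. v \<in> symbols n (r a) \<Longrightarrow> res (\<chi> v) = \<mu> (cut n (\<gamma> a) {..<N} v)" by blast
  have "\<theta> = compose (carrier (F (Suc a))) \<chi> (\<delta> a)"
  proof (rule hom_eq_residue[OF \<theta>' lin_hom_compose[OF left_module_free_module delta_hom \<chi>(1)]])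
    fix v :: "'k mpoly" assume v: "v \<in> ?S"
    \<comment> \<open>Truncating the image of \<open>v\<close> is the same as taking the image of
      the truncated \<open>v\<close>, and there \<mu> gives the residue of \<theta>.\<close>
    have "res (\<chi> (\<delta> a v)) = \<mu> (\<delta> a (cut n (\<gamma> (Suc a)) {..<N} v) + 0)"
      using \<chi>(2)[OF delta_closed[OF v]] delta_cut[OF v] by simp
    also have "\<dots> = res (\<theta> (cut n (\<gamma> (Suc a)) {..<N} v))" by (rule \<mu>Z[OF cut_symbols[OF v] deriv_span_zero])
    finally show "res (\<theta> v) = res (compose (carrier (F (Suc a))) \<chi> (\<delta> a) v)"
      using v by (simp add: compose_def N[OF v])
  qed
  then show ?thesis using \<chi>(1) by (auto simp: ext_coboundaries_def Suc)
qed

text \<open>A cocycle \<theta> goes to the functional with value \<open>res (\<theta> t)\<close> at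
  the class of \<open>t\<close>. It is well defined because this residue vanishes on boundaries, and
  its kernel consists of the coboundaries by \<open>residue_coboundary\<close>. Finite dimension
  enters in surjectivity, where a functional has to be truncated without changing it on
  classes.\<close>

theorem ext_space_dual:
  fixes i :: nat
  defines "H \<equiv> de_rham_cohomology n M (int n - int i)"
  assumes fd: "finite_dimensional H"
  shows "space_iso (ext_space D (scalar_op n) F \<delta> E i) (dual_space H)"
proof -
  interpret H: left_module "base_field :: 'k ring" H unfolding H_def by (rule homology_zigzag(1))
  obtain h where h_all: "(\<forall>t \<in> cyc i. h t \<in> carrier H) \<and> (\<forall>t \<in> cyc i. \<forall>t' \<in> cyc i. h (t + t') = h t \<oplus>\<^bsub>H\<^esub> h t') \<and>
    (\<forall>c. \<forall>t \<in> cyc i. h (const_poly c * t) = c \<odot>\<^bsub>H\<^esub> h t) \<and> (\<forall>C \<in> carrier H. \<exists>t \<in> cyc i. h t = C) \<and>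
    (\<forall>t \<in> cyc i. h t = \<zero>\<^bsub>H\<^esub> \<longleftrightarrow> t \<in> bnd i)"
    using homology_zigzag(2)[of i] unfolding H_def by (rule exE)
  have h: "h t \<in> carrier H" "t' \<in> cyc i \<Longrightarrow> h (t + t') = h t \<oplus>\<^bsub>H\<^esub> h t'"
    "h (const_poly c * t) = c \<odot>\<^bsub>H\<^esub> h t" "h t = \<zero>\<^bsub>H\<^esub> \<longleftrightarrow> t \<in> bnd i" if "t \<in> cyc i" for t t' c
  proof -
    note hs = h_all[THEN conjunct1] h_all[THEN conjunct2, THEN conjunct1]
      h_all[THEN conjunct2, THEN conjunct2, THEN conjunct1] h_all[THEN conjunct2, THEN conjunct2, THEN conjunct2, THEN conjunct2]
    show "h t \<in> carrier H" by (rule bspec[OF hs(1) that])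
    show "t' \<in> cyc i \<Longrightarrow> h (t + t') = h t \<oplus>\<^bsub>H\<^esub> h t'" by (rule bspec[OF bspec[OF hs(2) that]])
    show "h (const_poly c * t) = c \<odot>\<^bsub>H\<^esub> h t" by (rule bspec[OF spec[OF hs(3)] that])
    show "h t = \<zero>\<^bsub>H\<^esub> \<longleftrightarrow> t \<in> bnd i" by (rule bspec[OF hs(4) that])
  qed
  have h_surj: "\<exists>t \<in> cyc i. h t = C" if "C \<in> carrier H" for C
    by (rule bspec[OF h_all[THEN conjunct2, THEN conjunct2, THEN conjunct2, THEN conjunct1] that])
  have h_eq: "t - t' \<in> bnd i" if t: "t \<in> cyc i" "t' \<in> cyc i" and eq: "h t = h t'" for t t'
  proof -
    have "h (t - t' + t') = h (t - t') \<oplus>\<^bsub>H\<^esub> h t'" by (rule h(2)[OF cyc_diff[OF t] t(2)])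
    then have "h (t - t') \<oplus>\<^bsub>H\<^esub> h t' = h t'" using eq by simp
    then have "h (t - t') = \<zero>\<^bsub>H\<^esub>"
      using left_module_minus(3)[OF H.left_module_axioms h(1)[OF cyc_diff[OF t]] h(1)[OF t(2)]]
        left_module_minus(1)[OF H.left_module_axioms h(1)[OF t(2)] h(1)[OF t(2)]] by simp
    then show ?thesis using h(4)[OF cyc_diff[OF t]] by simp
  qed
  define s where "s C = (SOME t. t \<in> cyc i \<and> h t = C)" for C
  have s: "s C \<in> cyc i" "h (s C) = C" if "C \<in> carrier H" for C
    using someI_ex[of "\<lambda>t. t \<in> cyc i \<and> h t = C"] h_surj[OF that] unfolding s_def by blast+
  define \<Phi> where "\<Phi> \<theta> = (\<lambda>C \<in> carrier H. res (\<theta> (s C)))" for \<theta> :: "'k mpoly \<Rightarrow> 'k laurent"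
  have \<Phi>: "\<Phi> \<theta> (h t) = res (\<theta> t)" if \<theta>: "\<theta> \<in> cocyc i" and t: "t \<in> cyc i" for \<theta> t
  proof -
    note st = s[OF h(1)[OF t]]
    have "res (\<theta> (s (h t) - t)) = 0" by (rule cocyc_bnd[OF \<theta> h_eq[OF st(1) t st(2)]])
    moreover have "res (\<theta> (s (h t) - t + t)) = res (\<theta> (s (h t) - t)) + res (\<theta> t)"
      by (rule res_hom(1)[OF cocyc_hom[OF \<theta>]]) (use st(1) t cyc_symbols in auto)
    ultimately show ?thesis using h(1)[OF t] by (simp add: \<Phi>_def)
  qed
  have dual [simp]: "carrier (dual_space H) = lin_hom base_field H base_field_space"
    "f \<oplus>\<^bsub>dual_space H\<^esub> g = (\<lambda>C \<in> carrier H. f C + g C)" "c \<odot>\<^bsub>dual_space H\<^esub> f = (\<lambda>C \<in> carrier H. c * f C)" for f g c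
    by (simp_all add: dual_space_def base_field_space_def)
  interpret EQ: quotient_space "cocycle_space n F \<delta> E i" "ext_coboundaries D F \<delta> E i"
    by (rule ext_quotient_space[OF free_resolution.res[OF free_resolution_axioms] E_mod])
  note cminus = cocycle_minus[OF free_resolution.res[OF free_resolution_axioms] E_mod]
  show ?thesis
    unfolding ext_space_eq[OF free_resolution.res[OF free_resolution_axioms] E_mod]
  proof (rule EQ.quotient_iso[where f = \<Phi>])
    fix \<theta> assume "\<theta> \<in> carrier (cocycle_space n F \<delta> E i)"
    then have \<theta>: "\<theta> \<in> cocyc i" by simp
    note hom = cocyc_hom[OF \<theta>]
    have val: "\<theta> (s C) \<in> carrier E" if "C \<in> carrier H" for C
      using lin_hom_closed[OF hom] cyc_symbols[OF s(1)[OF that]] by simp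
    show "\<Phi> \<theta> \<in> carrier (dual_space H)"
    proof -
      have "restrict (\<Phi> \<theta>) (carrier H) \<in> lin_hom base_field H base_field_space"
      proof (rule lin_hom_restrict[OF _ _ _ H.left_module_axioms])
        fix C assume "C \<in> carrier H"
        then obtain t where t: "t \<in> cyc i" "C = h t" using h_surj by blast
        show "\<Phi> \<theta> C \<in> carrier base_field_space" by (simp add: base_field_space_def)
        show "\<Phi> \<theta> (c \<odot>\<^bsub>H\<^esub> C) = c \<odot>\<^bsub>base_field_space\<^esub> \<Phi> \<theta> C" for c
          using \<Phi>[OF \<theta> cyc_const[OF t(1)], of c] \<Phi>[OF \<theta> t(1)] res_hom(2)[OF hom cyc_symbols[OF t(1)]]
          by (simp add: base_field_space_def t(2) h(3)[OF t(1)])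
        fix C' assume "C' \<in> carrier H"
        then obtain t' where t': "t' \<in> cyc i" "C' = h t'" using h_surj by blast
        show "\<Phi> \<theta> (C \<oplus>\<^bsub>H\<^esub> C') = \<Phi> \<theta> C \<oplus>\<^bsub>base_field_space\<^esub> \<Phi> \<theta> C'"
          using \<Phi>[OF \<theta> cyc_add[OF t(1) t'(1)]] \<Phi>[OF \<theta> t(1)] \<Phi>[OF \<theta> t'(1)] res_hom(1)[OF hom cyc_symbols[OF t(1)] cyc_symbols[OF t'(1)]]
          by (simp add: base_field_space_def t(2) t'(2) h(2)[OF t(1) t'(1)])
      qed
      then show ?thesis by (simp add: \<Phi>_def)
    qed
    show "\<Phi> (c \<odot>\<^bsub>cocycle_space n F \<delta> E i\<^esub> \<theta>) = c \<odot>\<^bsub>dual_space H\<^esub> \<Phi> \<theta>" for c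
      using residue_scalar[OF val] cyc_symbols[OF s(1)] by (auto simp: \<Phi>_def intro!: restrict_ext)
    fix \<theta>' assume "\<theta>' \<in> carrier (cocycle_space n F \<delta> E i)"
    then have \<theta>': "\<theta>' \<in> cocyc i" by simp
    show "\<Phi> (\<theta> \<oplus>\<^bsub>cocycle_space n F \<delta> E i\<^esub> \<theta>') = \<Phi> \<theta> \<oplus>\<^bsub>dual_space H\<^esub> \<Phi> \<theta>'"
      using cyc_symbols[OF s(1)] by (auto simp: \<Phi>_def inverse_module_sel(4) residue_add intro!: restrict_ext)
    let ?d = "\<theta> \<ominus>\<^bsub>cocycle_space n F \<delta> E i\<^esub> \<theta>'"
    have d: "?d \<in> cocyc i" by (rule cminus(1)[OF \<theta> \<theta>'])
    have diff: "res (\<theta> t) = res (\<theta>' t) + res (?d t)" if t: "t \<in> cyc i" for t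
    proof -
      have t': "t \<in> carrier (F i)" using cyc_symbols[OF t] by simp
      have "\<theta> t = \<theta>' t \<oplus>\<^bsub>E\<^esub> ?d t"
        unfolding cminus(2)[OF \<theta> \<theta>' t']
        by (rule left_module_minus(2)[OF E_mod lin_hom_closed[OF hom t'] lin_hom_closed[OF cocyc_hom[OF \<theta>'] t']])
      then show ?thesis by (simp only: inverse_module_sel(4) residue_add)
    qed
    show "\<Phi> \<theta> = \<Phi> \<theta>' \<longleftrightarrow> ?d \<in> ext_coboundaries D F \<delta> E i"
    proof
      assume eq: "\<Phi> \<theta> = \<Phi> \<theta>'"
      show "?d \<in> ext_coboundaries D F \<delta> E i"
      proof (rule residue_coboundary[OF d])
        fix t assume t: "t \<in> cyc i"
        then show "res (?d t) = 0" using diff[OF t] \<Phi>[OF \<theta> t] \<Phi>[OF \<theta>' t] eq by simp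
      qed
    next
      assume "?d \<in> ext_coboundaries D F \<delta> E i"
      then have "res (\<theta> t) = res (\<theta>' t)" if "t \<in> cyc i" for t
        using diff[OF that] coboundary_residue[OF _ that] by simp
      then show "\<Phi> \<theta> = \<Phi> \<theta>'" using s(1) by (auto simp: \<Phi>_def intro!: restrict_ext)
    qed
  next
    fix \<nu> assume "\<nu> \<in> carrier (dual_space H)"
    then have \<nu>: "\<nu> \<in> lin_hom base_field H base_field_space" by simp
    have \<nu>_add: "\<nu> (C \<oplus>\<^bsub>H\<^esub> C') = \<nu> C + \<nu> C'" if "C \<in> carrier H" "C' \<in> carrier H" for C C'
      using lin_hom_add[OF \<nu> that] by (simp add: base_field_space_def)
    have \<nu>_scale: "\<nu> (c \<odot>\<^bsub>H\<^esub> C) = c * \<nu> C" if "C \<in> carrier H" for C c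
      using lin_hom_smult[OF \<nu> _ that, of c] by (simp add: base_field_space_def)
    have \<nu>_zero: "\<nu> \<zero>\<^bsub>H\<^esub> = 0" using \<nu>_add[of "\<zero>\<^bsub>H\<^esub>" "\<zero>\<^bsub>H\<^esub>"] by simp
    obtain G where G: "finite G" "G \<subseteq> carrier H"
      "\<And>C. C \<in> carrier H \<Longrightarrow> \<exists>c \<in> G \<rightarrow> carrier base_field. C = (\<Oplus>\<^bsub>H\<^esub>g\<in>G. c g \<odot>\<^bsub>H\<^esub> g)"
      using fd unfolding finite_dimensional_def fin_gen_def by blast
    have "\<forall>C. \<exists>N. cut n (\<gamma> i) {..<N} (s C) = s C" by (simp add: cut_bounded)
    from choice[OF this] obtain b where b: "\<forall>C. cut n (\<gamma> i) {..<b C} (s C) = s C" ..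
    obtain N where N: "\<And>C. C \<in> G \<Longrightarrow> b C \<le> N"
      using bdd_above_finite[OF finite_imageI[OF G(1)], of b] by (auto simp: bdd_above_def)
    txt \<open>By finite dimension all classes have representatives of degree below some \<open>N\<close>.\<close>
    define K where "K = {C. \<exists>t \<in> cyc i. C = h t \<and> cut n (\<gamma> i) {..<N} t = t}"
    have K: "C \<in> K" if C: "C \<in> carrier H" for C
    proof -
      obtain c where c: "C = (\<Oplus>\<^bsub>H\<^esub>g\<in>G. c g \<odot>\<^bsub>H\<^esub> g)" using G(3)[OF C] by blast
      show ?thesis
        unfolding c
      proof (rule H.finsum_closed_sub[OF _ _ _ G(1)])
        show "K \<subseteq> carrier H" using h(1) by (auto simp: K_def)
        show "\<zero>\<^bsub>H\<^esub> \<in> K" using h(4)[OF bnd_cyc[OF zero_bnd]] bnd_cyc[OF zero_bnd] zero_bnd unfolding K_def by (intro CollectI bexI[of _ 0]) auto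
        fix x y assume "x \<in> K" "y \<in> K"
        then obtain t t' where "t \<in> cyc i" "x = h t" "cut n (\<gamma> i) {..<N} t = t" "t' \<in> cyc i" "y = h t'" "cut n (\<gamma> i) {..<N} t' = t'"
          unfolding K_def by blast
        then show "x \<oplus>\<^bsub>H\<^esub> y \<in> K" unfolding K_def by (intro CollectI bexI[of _ "t + t'"]) (simp_all add: h(2) cut_add cyc_add)
      next
        show "(\<lambda>g. c g \<odot>\<^bsub>H\<^esub> g) \<in> G \<rightarrow> K"
        proof
          fix g assume g: "g \<in> G"
          then have gs: "s g \<in> cyc i" "h (s g) = g" using s G(2) by blast+
          have "cut n (\<gamma> i) {..<N} (s g) = cut n (\<gamma> i) {..<N} (cut n (\<gamma> i) {..<b g} (s g))" by (simp only: b)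
          also have "\<dots> = s g"
          proof -
            have "{..<N} \<inter> {..<b g} = {..<b g}" using N[OF g] by auto
            then show ?thesis using cut_cut[of n "\<gamma> i" "{..<N}" "{..<b g}" "s g"] by (simp only: b)
          qed
          finally have "cut n (\<gamma> i) {..<N} (s g) = s g" .
          then show "c g \<odot>\<^bsub>H\<^esub> g \<in> K"
            using gs unfolding K_def
            by (intro CollectI bexI[of _ "const_poly (c g) * s g"]) (simp_all add: h(3) cut_const cyc_const)
        qed
      qed
    qed
    let ?cut = "cut n (\<gamma> i) {..<N} :: 'k mpoly \<Rightarrow> 'k mpoly" and ?cut' = "cut n (\<gamma> i) (- {..<N}) :: 'k mpoly \<Rightarrow> 'k mpoly"
    \<comment> \<open>The part of a cycle in degrees at least \<open>N\<close> is a cycle, so it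
      differs by a boundary from a cycle \<open>t3\<close> of degree below \<open>N\<close>. Cutting
      this boundary to degrees at least \<open>N\<close> removes \<open>t3\<close> and shows that
      the high part is itself a boundary.\<close>
    have h_cut: "h (?cut t) = h t" if t: "t \<in> cyc i" for t
    proof -
      have t2: "?cut' t \<in> cyc i" by (rule cyc_cut[OF t])
      obtain t3 where t3: "t3 \<in> cyc i" "h (?cut' t) = h t3" "?cut t3 = t3" using K[OF h(1)[OF t2]] unfolding K_def by blast
      have "?cut' t3 = ?cut' (?cut t3)" by (simp only: t3(3))
      then have "?cut' t3 = cut n (\<gamma> i) {} t3" by (simp only: cut_cut Compl_disjoint2)
      then have c3: "?cut' t3 = 0" by (simp add: poly_mapping_eq_iff lookup_cut fun_eq_iff)
      have "?cut' (?cut' t - t3) \<in> bnd i" by (rule bnd_cut[OF h_eq[OF t2 t3(1,2)]])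
      then have "?cut' t \<in> bnd i" by (simp only: cut_diff c3 cut_cut Int_absorb diff_zero)
      then have z: "h (?cut' t) = \<zero>\<^bsub>H\<^esub>" using h(4)[OF t2] by simp
      have "h (?cut t + ?cut' t) = h (?cut t) \<oplus>\<^bsub>H\<^esub> h (?cut' t)" by (rule h(2)[OF cyc_cut[OF t] t2])
      then show ?thesis by (simp only: cut_compl z H.r_zero[OF h(1)[OF cyc_cut[OF t]]])
    qed
    have "\<exists>\<mu>. (\<forall>x y. \<mu> (x + y) = \<mu> x + \<mu> y) \<and> (\<forall>c x. \<mu> (const_poly c * x) = c * \<mu> x) \<and> (\<forall>x \<in> cyc i. \<mu> x = \<nu> (h x))"
      by (rule functional_extension)
         (simp_all add: bnd_cyc[OF zero_bnd] cyc_add cyc_const h \<nu>_add \<nu>_scale)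
    then obtain \<mu> :: "'k mpoly \<Rightarrow> 'k" where \<mu>: "\<And>x y. \<mu> (x + y) = \<mu> x + \<mu> y" "\<And>c x. \<mu> (const_poly c * x) = c * \<mu> x" "\<And>x. x \<in> cyc i \<Longrightarrow> \<mu> x = \<nu> (h x)"
      by blast
    have \<mu>_bnd: "\<mu> y = 0" if "y \<in> bnd i" for y
      using \<mu>(3)[OF bnd_cyc[OF that]] h(4)[OF bnd_cyc[OF that]] that \<nu>_zero by simp
    \<comment> \<open>The truncated extension of \<nu> is the residue of a homomorphism \<phi>, and
      by \<open>h_cut\<close> it still takes the values of \<nu> on cycles.\<close>
    have "admissible n (r i) (\<gamma> i) (\<lambda>v. \<mu> (?cut v))"
      by (rule truncation_admissible[OF \<mu>(1,2) \<mu>_bnd[OF deriv_span_bnd]])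
    from admissible_hom[OF this] obtain \<phi> where \<phi>: "\<phi> \<in> lin_hom D (F i) E"
      "\<And>v. v \<in> symbols n (r i) \<Longrightarrow> res (\<phi> v) = \<mu> (?cut v)" by blast
    have \<phi>c: "\<phi> \<in> cocyc i"
    proof (rule cocycI[OF \<phi>(1)])
      fix q :: "'k mpoly" assume q: "q \<in> symbols n (r (Suc i))"
      show "res (\<phi> (\<delta> i q)) = 0" using \<phi>(2)[OF delta_closed[OF q]] \<mu>_bnd[OF bnd_cut[OF delta_bnd[OF q]]] by simp
    qed
    have "\<Phi> \<phi> C = \<nu> C" if C: "C \<in> carrier H" for C
    proof -
      obtain t where t: "t \<in> cyc i" "C = h t" using h_surj[OF C] by blast
      have "\<Phi> \<phi> C = \<mu> (?cut t)" using \<Phi>[OF \<phi>c t(1)] \<phi>(2)[OF cyc_symbols[OF t(1)]] t(2) by simp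
      then show ?thesis using \<mu>(3)[OF cyc_cut[OF t(1)]] h_cut[OF t(1)] t(2) by simp
    qed
    moreover have "\<nu> \<in> carrier H \<rightarrow>\<^sub>E UNIV" using \<nu> by (auto simp: lin_hom_def base_field_space_def)
    ultimately have "\<Phi> \<phi> = \<nu>"
      by (intro PiE_eqI[of "\<Phi> \<phi>" "carrier H" UNIV \<nu>]) (simp_all add: \<Phi>_def)
    then show "\<exists>\<phi> \<in> carrier (cocycle_space n F \<delta> E i). \<Phi> \<phi> = \<nu>" using \<phi>c by auto
  qed
qed

end

theorem theorem3:
  fixes n i :: nat
    and M :: "('k::field_char_0 diff_op, 'm) module"
    and G :: "int \<Rightarrow> 'm set"
    and P :: "nat \<Rightarrow> ('k diff_op, 'p) module"
    and \<delta> :: "nat \<Rightarrow> 'p \<Rightarrow> 'p"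
    and \<epsilon> :: "'p \<Rightarrow> 'm"
  assumes "graded_diff_module n M G"
    and "fin_gen (diff_op_ring n) M"
    and "projective_resolution (diff_op_ring n) P \<delta> \<epsilon> M"
    and "finite_dimensional (de_rham_cohomology n M (int n - int i))"
  shows "space_iso (dual_space (de_rham_cohomology n M (int n - int i)))
           (ext_space (diff_op_ring n) (scalar_op n) P \<delta> (inverse_poly_module n) i)"
proof -
  let ?D = "diff_op_ring n :: 'k diff_op ring" and ?E = "inverse_poly_module n :: ('k diff_op, 'k laurent) module"
  note M = graded_moduleD(1)[OF assms(1)]
  note P = projective_exact_resolution[OF M assms(3)]
  obtain r \<gamma> \<delta>' \<epsilon>' where Q: "exact_resolution ?D (\<lambda>a. free_module n (r a)) \<delta>' \<epsilon>' M"
    and cut: "\<And>a I v. v \<in> symbols n (r (Suc a)) \<Longrightarrow> \<delta>' a (cut n (\<gamma> (Suc a)) I v) = cut n (\<gamma> a) I (\<delta>' a v)"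
    using graded_free_resolution[OF assms(1,2)] by blast
  interpret graded_free_resolution_complex n r \<delta>' \<epsilon>' M \<gamma>
    by unfold_locales (rule Q, rule cut)
  note EE = inverse_module_sel(1)[of n]
  have proj: "projective_module ?D (P a)" for a using assms(3) by (simp add: projective_resolution_def)
  note mods = exact_resolutionD(2)[OF P] exact_resolutionD(2)[OF Q] M
  \<comment> \<open>Ext is moved from the given projective resolution to the graded free one; all
    lifting hypotheses come from \<open>projective_lifts\<close> and
    \<open>free_module_lifts\<close>.\<close>
  have "space_iso (ext_space ?D (scalar_op n) P \<delta> ?E i) (ext_space ?D (scalar_op n) (\<lambda>a. free_module n (r a)) \<delta>' ?E i)"
    by (rule ext_space_unique[OF P Q EE]) (rule projective_lifts[OF proj] free_module_lifts, (rule mods)+)+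
  moreover have "left_module base_field (ext_space ?D (scalar_op n) P \<delta> ?E i)"
    unfolding ext_space_eq[OF P EE] by (rule quotient_space.left_module_quot[OF ext_quotient_space[OF P EE]])
  ultimately show ?thesis
    using space_iso_trans[OF _ _ ext_space_dual[OF assms(4)]] space_iso_sym by blast
qed

end
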